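(* Let $(\xi,\eta)$ be a pair of random variables, and let $\{(\xi_i,\eta_i)\}_{i\ge 1}$ be independent copies of $(\xi,\eta)$. For $n\ge 1$ define $$W_n=\frac{\xi_1+\xi_2+\cdots+\xi_n}{\sqrt n},\qquad \boldsymbol{\eta}_n=(\eta_1,\ldots,\eta_n).$$ Assume that $$\sigma^2:=\mathbb{E}\,\operatorname{Var}(\xi\mid\eta)<\infty$$ and that, for $P_\eta$-almost every value of $\eta$, the conditional law of $\xi$ given $\eta$ is absolutely continuous with respect to Lebesgue measure on $\mathbb{R}$. Define $$h_n=\mathbb{E}\,h(W_n\mid\boldsymbol{\eta}_n).$$ Then the convergence $$\lim_{n\to\infty}h_n=\frac12\log(2\pi e\sigma^2)$$ holds if and only if there exists $n_0\ge 1$ such that $$h_{n_0}=\mathbb{E}\,h(W_{n_0}\mid\boldsymbol{\eta}_{n_0})>-\infty.$$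
   Context: Random variables $\xi$ are real-valued, and $\log$ is the natural logarithm. $P_\eta$ denotes the law of $\eta$. For a real random variable $X$ with density $f$, the differential entropy is $h(X)=-\int_{\mathbb{R}} f(x)\log f(x)\,dx$; for finite variance it takes values in $[-\infty,\infty)$. For a pair $(X,Y)$ such that the conditional law of $X$ given $Y=y$ has a density for almost every $y$, $h(X\mid Y=y)$ denotes the differential entropy of that conditional law, $h(X\mid Y)$ is the random variable obtained by evaluating $y\mapsto h(X\mid Y=y)$ at $Y$, and $\mathbb{E}\,h(X\mid Y)$ is its expectation, which may equal $-\infty$. Likewise $\operatorname{Var}(X\mid Y)$ is the variance of the (regular) conditional law of $X$ given $Y$. *)

theory Defs
  imports "HOL-Probability.Probability"
begin

(* Integral of an extended-real function with values in [-infinity, infinity]: e2ennreal maps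
   negative arguments to 0, so the two terms are the integrals of the positive and the negative
   part. Pitfall: in ereal, infinity - infinity = infinity. This case is excluded for the
   integrals below whenever the (conditional) variances are integrable. *)
definition ereal_integral :: "'a measure \<Rightarrow> ('a \<Rightarrow> ereal) \<Rightarrow> ereal" where
  "ereal_integral M f =
     enn2ereal (\<integral>\<^sup>+ x. e2ennreal (f x) \<partial>M) - enn2ereal (\<integral>\<^sup>+ x. e2ennreal (- f x) \<partial>M)"

(* For a law mu with a Lebesgue density, RN_deriv lborel mu is that density; the value is
   meaningful only for such mu. ln 0 = 0 gives the convention 0 log 0 = 0. The entropy of the
   Information theory is real-valued and cannot take the value -infinity. *)
definition differential_entropy :: "real measure \<Rightarrow> ereal" where
  "differential_entropy \<mu> =
     (let f = (\<lambda>x. enn2real (RN_deriv lborel \<mu> x))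
      in ereal_integral lborel (\<lambda>x. ereal (- (f x * ln (f x)))))"

(* If mu has no mean, the Bochner integral is 0 and the value is infinity, as it should be. *)
definition law_variance :: "real measure \<Rightarrow> ennreal" where
  "law_variance \<mu> = (\<integral>\<^sup>+ x. ennreal ((x - (\<integral>z. z \<partial>\<mu>))\<^sup>2) \<partial>\<mu>)"

definition is_regular_cond_law ::
    "'a measure \<Rightarrow> 'b measure \<Rightarrow> ('a \<Rightarrow> real) \<Rightarrow> ('a \<Rightarrow> 'b) \<Rightarrow> ('b \<Rightarrow> real measure) \<Rightarrow> bool" where
  "is_regular_cond_law M N X Y \<kappa> \<longleftrightarrow>
     \<kappa> \<in> N \<rightarrow>\<^sub>M prob_algebra borel \<and>
     (\<forall>A\<in>sets borel. \<forall>B\<in>sets N.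
        emeasure M {\<omega> \<in> space M. X \<omega> \<in> A \<and> Y \<omega> \<in> B} =
        (\<integral>\<^sup>+ y\<in>B. emeasure (\<kappa> y) A \<partial>distr M N Y))"

(* For real-valued X a regular conditional law given Y exists, and any two versions agree for
   almost every y; the notions below do not depend on the version chosen. *)
definition cond_law ::
    "'a measure \<Rightarrow> 'b measure \<Rightarrow> ('a \<Rightarrow> real) \<Rightarrow> ('a \<Rightarrow> 'b) \<Rightarrow> 'b \<Rightarrow> real measure" where
  "cond_law M N X Y = (SOME \<kappa>. is_regular_cond_law M N X Y \<kappa>)"

definition cond_variance ::
    "'a measure \<Rightarrow> 'b measure \<Rightarrow> ('a \<Rightarrow> real) \<Rightarrow> ('a \<Rightarrow> 'b) \<Rightarrow> 'a \<Rightarrow> ennreal" where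
  "cond_variance M N X Y \<omega> = law_variance (cond_law M N X Y (Y \<omega>))"

definition cond_entropy ::
    "'a measure \<Rightarrow> 'b measure \<Rightarrow> ('a \<Rightarrow> real) \<Rightarrow> ('a \<Rightarrow> 'b) \<Rightarrow> 'a \<Rightarrow> ereal" where
  "cond_entropy M N X Y \<omega> = differential_entropy (cond_law M N X Y (Y \<omega>))"

definition normalized_sum :: "(nat \<Rightarrow> 'a \<Rightarrow> real) \<Rightarrow> nat \<Rightarrow> 'a \<Rightarrow> real" where
  "normalized_sum \<xi> n \<omega> = (\<Sum>i=1..n. \<xi> i \<omega>) / sqrt (real n)"

definition initial_block :: "(nat \<Rightarrow> 'a \<Rightarrow> 'b) \<Rightarrow> nat \<Rightarrow> 'a \<Rightarrow> nat \<Rightarrow> 'b" where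
  "initial_block \<eta> n \<omega> = (\<lambda>i\<in>{1..n}. \<eta> i \<omega>)"

definition mean_cond_entropy ::
    "'a measure \<Rightarrow> 'b measure \<Rightarrow> (nat \<Rightarrow> 'a \<Rightarrow> real) \<Rightarrow> (nat \<Rightarrow> 'a \<Rightarrow> 'b) \<Rightarrow> nat \<Rightarrow> ereal" where
  "mean_cond_entropy M N \<xi> \<eta> n =
     ereal_integral M
       (cond_entropy M (PiM {1..n} (\<lambda>_. N)) (normalized_sum \<xi> n) (initial_block \<eta> n))"

definition indep_copies ::
    "'a measure \<Rightarrow> 'b measure \<Rightarrow> ('a \<Rightarrow> real) \<Rightarrow> ('a \<Rightarrow> 'b) \<Rightarrow>
       (nat \<Rightarrow> 'a \<Rightarrow> real) \<Rightarrow> (nat \<Rightarrow> 'a \<Rightarrow> 'b) \<Rightarrow> bool" where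
  "indep_copies M N \<xi> \<eta> \<xi>s \<eta>s \<longleftrightarrow>
     prob_space.indep_vars M (\<lambda>_. borel \<Otimes>\<^sub>M N) (\<lambda>i \<omega>. (\<xi>s i \<omega>, \<eta>s i \<omega>)) {1..} \<and>
     (\<forall>i\<ge>1. distr M (borel \<Otimes>\<^sub>M N) (\<lambda>\<omega>. (\<xi>s i \<omega>, \<eta>s i \<omega>)) =
             distr M (borel \<Otimes>\<^sub>M N) (\<lambda>\<omega>. (\<xi> \<omega>, \<eta> \<omega>)))"

end

(*
After removing the conditional mean, \<xi> has a conditional density f(y, _), jointly measurable in y,
and the conditional density p of W_n is a rescaled convolution of f(\<eta>_1, _), ..., f(\<eta>_n, _).

Upper bound: Gibbs' inequality against the density \<phi> of N(0, \<sigma>^2).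

Lower bound: cut the conditional density of \<xi>_1 + ... + \<xi>_n0 at height n and convolve the two parts
with the remaining summands, p = A + B.  Since E h_n0 > -infinity, the mass of B is o(1 / log n), so by
Jensen's inequality B contributes nothing to the entropy in the limit.  For the bounded part,
E \<integral> A^2 is controlled through Plancherel by the powers of q(t) = E |E(exp(i t \<xi>) | \<eta>)|^2, which satisfies
q(t) = 1 - \<sigma>^2 t^2 + o(t^2) near 0 and is bounded away from 1 elsewhere (Riemann-Lebesgue).  This gives
limsup E \<integral> A^2 <= \<integral> \<phi>^2.  With the classical central limit theorem for the averaged laws, it means that
A -> \<phi> in L^2 on the product space, and that is enough to pass to the limit in E \<integral> A log A.
*)

theory Submission
  imports Defs
begin

text \<open>The obstacle is that finite entropy bounds nothing: the conditional density of W_n may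
  stay unbounded and outside L^2 for every n, so neither Fourier inversion nor a local limit theorem
  applies to it. The cut is made only once, in the first n0 summands; convolution is linear and
  carries both parts through the others. Normalising by sqrt n adds (ln n)/2 to the logarithm of the
  density, so a mass o(1) above the cut would not do; o(1 / ln n) comes from t ln t being at least t
  ln n above height n. Nothing is claimed for a fixed sequence of labels. Only averages over the
  labels occur: by independence the averaged squared transforms factor into powers of one function,
  and no Lindeberg condition on individual label sequences arises. The constant: after t = u / sqrt
  n the powers tend to exp (- \<sigma>^2 u^2), with integral sqrt pi / \<sigma>. Division by the 2
  pi of Plancherel gives 1 / (2 \<sigma> sqrt pi), exactly the integral of \<phi>^2. Since the limit
  theorem fixes the cross term of A and \<phi>, this equality leaves no room for an L^2
  distance.\<close>

section \<open>Fourier transforms on the real line\<close>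

text \<open>Half-open intervals are an intersection-stable generator of the Borel sets, so a Dynkin
  argument carries \<open>P\<close> from them to indicators, and approximation by simple functions
  carries it to all of L^1. The Riemann-Lebesgue lemma and the continuity of translations are
  thereby reduced to a single interval.\<close>

lemma lborel_L1_induct [consumes 1, case_names ivl add scale lim]:
  fixes u :: "real \<Rightarrow> real"
  assumes u: "integrable lborel u"
    and ivl: "\<And>a b. a \<le> b \<Longrightarrow> P (indicator {a<..b})"
    and add: "\<And>u v. integrable lborel u \<Longrightarrow> P u \<Longrightarrow> integrable lborel v \<Longrightarrow> P v \<Longrightarrow> P (\<lambda>x. u x + v x)"
    and scale: "\<And>u c. integrable lborel u \<Longrightarrow> P u \<Longrightarrow> P (\<lambda>x. u x * c)"
    and lim: "\<And>u s. (\<And>i::nat. integrable lborel (s i)) \<Longrightarrow> (\<And>i. P (s i)) \<Longrightarrow> integrable lborel u \<Longrightarrow>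
        (\<lambda>i. LINT x|lborel. \<bar>s i x - u x\<bar>) \<longlonglongrightarrow> 0 \<Longrightarrow> P u"
  shows "P u"
proof -
  \<comment> \<open>Dominated convergence turns closure under L^1 limits into closure under
    dominated almost-everywhere limits, the form in which all limits of this proof arrive.\<close>
  have dom: "P v" if si: "\<And>i::nat. integrable lborel (s i)" "\<And>i. P (s i)"
      and sv: "AE x in lborel. (\<lambda>i. s i x) \<longlonglongrightarrow> v x" and v: "v \<in> borel_measurable borel"
      and w: "integrable lborel w" "\<And>i x. \<bar>s i x\<bar> \<le> w x" for s v and w :: "real \<Rightarrow> real"
  proof -
    note [measurable] = borel_measurable_integrable[OF si(1)] v borel_measurable_integrable[OF w(1)]
    have bv: "AE x in lborel. \<bar>v x\<bar> \<le> w x"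
      using sv
    proof eventually_elim
      case (elim x)
      have "(\<lambda>i. \<bar>s i x\<bar>) \<longlonglongrightarrow> \<bar>v x\<bar>" using elim by (rule tendsto_rabs)
      then show ?case by (rule LIMSEQ_le_const2) (use w in auto)
    qed
    have iv: "integrable lborel v"
      by (rule Bochner_Integration.integrable_bound[OF w(1)]) (use bv in \<open>auto elim!: eventually_mono\<close>)
    have "(\<lambda>i. LINT x|lborel. \<bar>s i x - v x\<bar>) \<longlonglongrightarrow> (LINT x|(lborel::real measure). 0)"
    proof (rule integral_dominated_convergence)
      show "integrable lborel (\<lambda>x. 2 * w x)" using w by auto
      show "AE x in lborel. (\<lambda>i. \<bar>s i x - v x\<bar>) \<longlonglongrightarrow> 0"
        using sv by eventually_elim (auto intro!: tendsto_eq_intros)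
      show "AE x in lborel. norm \<bar>s i x - v x\<bar> \<le> 2 * w x" for i
        using bv by eventually_elim (use w(2)[of i] in \<open>smt (verit) real_norm_def\<close>)
    qed auto
    with lim[OF si iv] show ?thesis by simp
  qed
  have ivl': "P (indicator {a<..b})" for a b
    using ivl[of a b] ivl[of a a] by (cases "a \<le> b") auto
  have fin_ivl: "integrable lborel (indicator (A \<inter> {- real R<..real R}) :: real \<Rightarrow> real)"
    if "A \<in> sets borel" for A :: "real set" and R
  proof -
    have "emeasure lborel (A \<inter> {- real R<..real R}) \<le> emeasure lborel {- real R<..real R}"
      by (rule emeasure_mono) auto
    also have "\<dots> < \<infinity>" by simp
    finally show ?thesis using that by (auto simp: integrable_indicator_iff)
  qed
  \<comment> \<open>The window \<open>{- real R<..real R}\<close> keeps complements and countable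
    unions at finite measure, so that every set met in the Dynkin induction has an integrable
    indicator.\<close>
  have step1: "P (indicator (A \<inter> {- real R<..real R}))" if "A \<in> sets borel" for A R
  proof -
    have A: "A \<in> sigma_sets UNIV (range (\<lambda>(a, b). {a <.. b::real}))"
      using that by (simp add: borel_sigma_sets_Ioc)
    have "Int_stable (range (\<lambda>(a, b). {a <.. b::real}))"
    proof (rule Int_stableI)
      fix A B assume "A \<in> range (\<lambda>(a, b). {a <.. b::real})" "B \<in> range (\<lambda>(a, b). {a <.. b::real})"
      then obtain a b c d where "A = {a<..b}" "B = {c<..d}" by auto
      then have "A \<inter> B = {max a c<..min b d}" by simp
      then show "A \<inter> B \<in> range (\<lambda>(a, b). {a <.. b::real})" by auto
    qed
    from this _ A show ?thesis
    proof (rule sigma_sets_induct_disjoint)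
      fix A assume "A \<in> range (\<lambda>(a, b). {a <.. b::real})"
      then obtain a b where A: "A = {a<..b}" by auto
      have "A \<inter> {- real R<..real R} = {max a (-R) <.. min b R}" unfolding A by auto
      then show "P (indicator (A \<inter> {- real R<..real R}))" using ivl' by simp
    next
      have "{} \<inter> {- real R<..real R} = {0::real<..0}" by auto
      then show "P (indicator ({} \<inter> {- real R<..real R}))" using ivl' by metis
    next
      fix A assume A: "A \<in> sigma_sets UNIV (range (\<lambda>(a, b). {a <.. b::real}))"
        and PA: "P (indicator (A \<inter> {- real R<..real R}))"
      have A': "A \<in> sets borel" using A by (simp add: borel_sigma_sets_Ioc)
      have "P (\<lambda>x. indicator {- real R<..real R} x + indicator (A \<inter> {- real R<..real R}) x * (-1))"
        using fin_ivl[of UNIV] fin_ivl[OF A'] ivl' PA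
        by (intro add scale) auto
      also have "(\<lambda>x. indicator {- real R<..real R} x + indicator (A \<inter> {- real R<..real R}) x * (-1))
          = (indicator ((UNIV - A) \<inter> {- real R<..real R}) :: real \<Rightarrow> real)"
        by (auto simp: indicator_def fun_eq_iff)
      finally show "P (indicator ((UNIV - A) \<inter> {- real R<..real R}))" .
    next
      fix A :: "nat \<Rightarrow> real set"
      assume disj: "disjoint_family A"
        and A: "range A \<subseteq> sigma_sets UNIV (range (\<lambda>(a, b). {a <.. b::real}))"
        and PA: "\<And>i. P (indicator (A i \<inter> {- real R<..real R}))"
      have A' [measurable]: "A i \<in> sets borel" for i using A by (auto simp: borel_sigma_sets_Ioc)
      show "P (indicator ((\<Union>i. A i) \<inter> {- real R<..real R}))"
      proof (rule dom)
        fix n :: nat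
        have eq: "(indicator ((\<Union>i<n. A i) \<inter> {- real R<..real R}) :: real \<Rightarrow> real) =
            (\<lambda>x. \<Sum>i<n. indicator (A i \<inter> {- real R<..real R}) x)"
        proof -
          have *: "((\<Union>i<n. A i) \<inter> {- real R<..real R}) = (\<Union>i<n. A i \<inter> {- real R<..real R})" by auto
          have "disjoint_family_on (\<lambda>i. A i \<inter> {- real R<..real R}) {..<n}"
            using disj by (auto simp: disjoint_family_on_def)
          then show ?thesis unfolding * by (intro ext indicator_UN_disjoint) auto
        qed
        show "P (indicator ((\<Union>i<n. A i) \<inter> {- real R<..real R}))"
          unfolding eq
        proof (induct n)
          case 0
          have "(indicator {0::real<..0} :: real \<Rightarrow> real) = (\<lambda>x. 0)" by auto
          then show ?case using ivl'[of 0 0] by simp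
        next
          case (Suc n)
          then show ?case by (simp, intro add) (auto intro!: fin_ivl PA)
        qed
        show "integrable lborel (indicator ((\<Union>i<n. A i) \<inter> {- real R<..real R}) :: real \<Rightarrow> real)"
          by (rule fin_ivl) auto
        show "\<bar>indicator ((\<Union>i<n. A i) \<inter> {- real R<..real R}) x :: real\<bar> \<le> indicator {- real R<..real R} x" for x
          by (auto simp: indicator_def)
      next
        show "integrable lborel (indicator {- real R<..real R} :: real \<Rightarrow> real)"
          using fin_ivl[of UNIV] by simp
        show "AE x in lborel. (\<lambda>n. indicator ((\<Union>i<n. A i) \<inter> {- real R<..real R}) x :: real)
            \<longlonglongrightarrow> indicator ((\<Union>i. A i) \<inter> {- real R<..real R}) x"
        proof (rule AE_I2)
          fix x :: real
          show "(\<lambda>n. indicator ((\<Union>i<n. A i) \<inter> {- real R<..real R}) x :: real)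
            \<longlonglongrightarrow> indicator ((\<Union>i. A i) \<inter> {- real R<..real R}) x"
          proof (cases "x \<in> (\<Union>i. A i)")
            case True
            then obtain i where "x \<in> A i" by auto
            then have "\<forall>\<^sub>F n in sequentially. indicator ((\<Union>i. A i) \<inter> {- real R<..real R}) x =
               (indicator ((\<Union>i<n. A i) \<inter> {- real R<..real R}) x :: real)"
              by (intro eventually_sequentiallyI[of "Suc i"]) (auto simp: indicator_def Suc_le_eq)
            then show ?thesis by (rule Lim_transform_eventually[OF tendsto_const])
          qed (auto simp: indicator_def)
        qed
      qed auto
    qed auto
  qed
  show ?thesis
    using u
  proof (induct rule: integrable_induct)
    case (base A c)
    have [measurable]: "A \<in> sets borel" using base by simp
    have "P (indicator A)"
    proof (rule dom)
      show "integrable lborel (indicator (A \<inter> {- real R<..real R}) :: real \<Rightarrow> real)" for R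
        by (rule fin_ivl) simp
      show "P (indicator (A \<inter> {- real R<..real R}))" for R by (rule step1) simp
      show "integrable lborel (indicator A :: real \<Rightarrow> real)" using base by auto
      show "\<bar>indicator (A \<inter> {- real i<..real i}) x\<bar> \<le> (indicator A x :: real)" for i x
        by (auto simp: indicator_def)
      show "AE x in lborel. (\<lambda>R. indicator (A \<inter> {- real R<..real R}) x :: real) \<longlonglongrightarrow> indicator A x"
      proof (rule AE_I2)
        fix x :: real
        obtain n :: nat where n: "\<bar>x\<bar> < n" using reals_Archimedean2 by blast
        have "\<forall>\<^sub>F R in sequentially. indicator A x = (indicator (A \<inter> {- real R<..real R}) x :: real)"
          by (intro eventually_sequentiallyI[of n]) (use n in \<open>auto simp: indicator_def\<close>)
        then show "(\<lambda>R. indicator (A \<inter> {- real R<..real R}) x :: real) \<longlonglongrightarrow> indicator A x"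
          by (rule Lim_transform_eventually[OF tendsto_const])
      qed
    qed auto
    moreover have "integrable lborel (indicator A :: real \<Rightarrow> real)" using base by auto
    ultimately show ?case using scale[of "indicator A" c] by simp
  next
    case (add f g) then show ?case using assms(3) by blast
  next
    case (lim f s)
    \<comment> \<open>The approximations supplied by \<open>integrable_induct\<close> are bounded by
      twice the modulus of their limit; this is the dominating function.\<close>
    show ?case
      by (rule dom[of s f "\<lambda>x. 2 * \<bar>f x\<bar>"]) (use lim borel_measurable_integrable[OF lim(5)] in auto)
  qed
qed

text \<open>The sign \<open>+ t * x\<close> and the missing normalisation make \<open>FT\<close> of
  a probability density its characteristic function; in return Plancherel carries the factor 2
  pi.\<close>

definition FT :: "(real \<Rightarrow> real) \<Rightarrow> real \<Rightarrow> complex" where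
  "FT u t = (LINT x|lborel. complex_of_real (u x) * iexp (t * x))"

lemma norm_mult_iexp [simp]: "norm (complex_of_real a * iexp b) = \<bar>a\<bar>"
  by (simp add: norm_mult)

lemma integrable_FT:
  assumes "integrable lborel u"
  shows "integrable lborel (\<lambda>x. complex_of_real (u x) * iexp (t * x))"
proof -
  note [measurable] = borel_measurable_integrable[OF assms]
  show ?thesis
    by (rule Bochner_Integration.integrable_bound[OF assms]) (auto simp del: of_real_mult)
qed

lemma norm_FT_le:
  "norm (FT u t) \<le> (LINT x|lborel. \<bar>u x\<bar>)"
proof -
  have "norm (FT u t) \<le> (LINT x|lborel. norm (complex_of_real (u x) * iexp (t * x)))"
    unfolding FT_def by (rule integral_norm_bound)
  also have "\<dots> = (LINT x|lborel. \<bar>u x\<bar>)" by (simp del: of_real_mult)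
  finally show ?thesis .
qed

lemma isCont_FT:
  assumes u: "integrable lborel u"
  shows "isCont (FT u) t"
  unfolding continuous_at_sequentially
proof safe
  note [measurable] = borel_measurable_integrable[OF u]
  fix X assume X: "X \<longlonglongrightarrow> t"
  show "(FT u \<circ> X) \<longlonglongrightarrow> FT u t"
    unfolding comp_def FT_def
    by (rule integral_dominated_convergence[where w="\<lambda>x. \<bar>u x\<bar>"])
       (use u in \<open>auto intro!: tendsto_intros X simp del: of_real_mult\<close>)
qed

lemma measurable_FT [measurable]:
  assumes [measurable]: "u \<in> borel_measurable borel"
  shows "FT u \<in> borel_measurable borel"
  unfolding FT_def[abs_def] by measurable

lemma FT_diff:
  assumes "integrable lborel u" "integrable lborel v"
  shows "FT (\<lambda>x. u x - v x) t = FT u t - FT v t"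
  unfolding FT_def using assms integrable_FT
  by (subst Bochner_Integration.integral_diff[symmetric]) (auto simp: ring_distribs)

lemma FT_add:
  assumes "integrable lborel u" "integrable lborel v"
  shows "FT (\<lambda>x. u x + v x) t = FT u t + FT v t"
  unfolding FT_def using assms integrable_FT
  by (subst Bochner_Integration.integral_add[symmetric]) (auto simp: ring_distribs)

lemma FT_mult_right:
  shows "FT (\<lambda>x. u x * c) t = FT u t * of_real c"
  unfolding FT_def by (subst integral_mult_left_zero[symmetric]) (auto simp: algebra_simps)

lemma norm_FT_indicator_le:
  assumes ab: "a \<le> b" and t: "t \<noteq> 0"
  shows "norm (FT (indicator {a<..b}) t) \<le> 2 / \<bar>t\<bar>"
proof -
  define F where "F x = iexp (t * x) / (\<i> * t)" for x
  have "FT (indicator {a<..b}) t = (LINT x|lborel. indicator {a..b} x *\<^sub>R iexp (t * x))"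
    unfolding FT_def
  proof (rule integral_cong_AE)
    show "AE x in lborel. complex_of_real (indicator {a<..b} x) * iexp (t * x) =
        indicator {a..b} x *\<^sub>R iexp (t * x)"
      using AE_lborel_singleton[of a] by eventually_elim (auto simp: indicator_def)
  qed auto
  also have "\<dots> = F b - F a"
  proof (rule integral_FTC_Icc[OF ab])
    fix x assume "a \<le> x" "x \<le> b"
    show "(F has_vector_derivative iexp (t * x)) (at x within {a..b})"
      unfolding F_def[abs_def] using t
      by (auto intro!: derivative_eq_intros has_vector_derivative_real_field simp: field_simps)
  qed (auto intro!: continuous_intros)
  finally have "FT (indicator {a<..b}) t = F b - F a" .
  then have "norm (FT (indicator {a<..b}) t) \<le> norm (F b) + norm (F a)"
    by (simp add: norm_triangle_ineq4)
  also have "\<dots> = 2 / \<bar>t\<bar>" by (simp add: F_def norm_divide norm_mult del: of_real_mult)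
  finally show ?thesis .
qed

text \<open>For an interval the transform is at most 2 / |t|. Since \<open>FT\<close> is 1-Lipschitz
  from L^1 to the supremum norm, the decay survives L^1 limits.\<close>

lemma Riemann_Lebesgue:
  assumes "integrable lborel u"
  shows "(FT u \<longlongrightarrow> 0) at_infinity"
  using assms
proof (induct u rule: lborel_L1_induct)
  case (ivl a b)
  have "((\<lambda>t::real. 2 / \<bar>t\<bar>) \<longlongrightarrow> 0) at_infinity"
  proof (intro tendsto_divide_0[OF tendsto_const] filterlim_at_top_imp_at_infinity)
    have "filterlim (\<lambda>t::real. norm t) at_top at_infinity" by (rule filterlim_norm_at_top)
    then show "filterlim (\<lambda>t::real. \<bar>t\<bar>) at_top at_infinity" by simp
  qed
  moreover have "\<forall>\<^sub>F t in at_infinity. norm (FT (indicator {a<..b}) t) \<le> 2 / \<bar>t\<bar>"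
    unfolding eventually_at_infinity using norm_FT_indicator_le[OF ivl] by (intro exI[of _ 1]) auto
  ultimately show ?case by (rule Lim_null_comparison[rotated])
next
  case (add u v)
  then show ?case using tendsto_add[OF add(2,4)] by (simp add: FT_add[OF add(1,3)])
next
  case (scale u c)
  then show ?case using tendsto_mult_left_zero[OF scale(2)] by (simp add: FT_mult_right)
next
  case (lim u s)
  show ?case
  proof (rule tendstoI)
    fix e :: real assume e: "e > 0"
    have "\<forall>\<^sub>F i in sequentially. dist (LINT x|lborel. \<bar>s i x - u x\<bar>) 0 < e / 2"
      using lim(4) e by (intro tendstoD) auto
    then obtain i where i: "dist (LINT x|lborel. \<bar>s i x - u x\<bar>) 0 < e / 2"
      using eventually_happens'[OF sequentially_bot] by blast
    have "\<forall>\<^sub>F t in at_infinity. dist (FT (s i) t) 0 < e / 2" using lim(2) e by (intro tendstoD) auto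
    then show "\<forall>\<^sub>F t in at_infinity. dist (FT u t) 0 < e"
    proof eventually_elim
      case (elim t)
      have "FT u t = FT (s i) t - FT (\<lambda>x. s i x - u x) t" using FT_diff[OF lim(1)[of i] lim(3)] by simp
      then have "norm (FT u t) \<le> norm (FT (s i) t) + norm (FT (\<lambda>x. s i x - u x) t)"
        by (simp add: norm_triangle_ineq4)
      with norm_FT_le[of "\<lambda>x. s i x - u x" t] i elim show ?case by auto
    qed
  qed
qed

text \<open>For an interval the translated indicator converges off the two endpoints, with |w| as
  dominating function. The bound L makes the pairing with w Lipschitz in u, uniformly over all
  translations, and so extends the limit to L^1. The case u = w is the continuity at 0 of an
  autocorrelation.\<close>

lemma tendsto_translate_weak:
  fixes u w :: "real \<Rightarrow> real"
  assumes u: "integrable lborel u" and w: "integrable lborel w" and wL: "\<And>x. \<bar>w x\<bar> \<le> L"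
    and h: "h \<longlonglongrightarrow> (0::real)"
  shows "(\<lambda>k. LINT y|lborel. u (y + h k) * w y) \<longlonglongrightarrow> (LINT y|lborel. u y * w y)"
proof -
  note [measurable] = borel_measurable_integrable[OF w]
  have L: "L \<ge> 0" using wL[of 0] by linarith
  have sh: "integrable lborel (\<lambda>y. v (y + c))" if "integrable lborel v" for v :: "real \<Rightarrow> real" and c
    using lborel_integrable_real_affine[OF that, of 1 c] by (simp add: add.commute)
  have iw: "integrable lborel (\<lambda>y. v (y + c) * w y)" if v: "integrable lborel v" for v :: "real \<Rightarrow> real" and c
  proof (rule Bochner_Integration.integrable_bound)
    note [measurable] = borel_measurable_integrable[OF v]
    show "integrable lborel (\<lambda>y. v (y + c) * L)" using sh[OF v, of c] by simp
    show "AE y in lborel. norm (v (y + c) * w y) \<le> norm (v (y + c) * L)"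
      using wL L by (auto simp: abs_mult intro!: mult_left_mono order_trans[OF wL])
    show "(\<lambda>y. v (y + c) * w y) \<in> borel_measurable lborel"
      using borel_measurable_integrable[OF sh[OF v, of c]] borel_measurable_integrable[OF w]
      by (rule borel_measurable_times)
  qed
  show ?thesis
    using u
  proof (induct u rule: lborel_L1_induct)
    case (ivl a b)
    show ?case
    proof (rule integral_dominated_convergence)
      show "integrable lborel (\<lambda>x. \<bar>w x\<bar>)" using w by simp
      show "AE x in lborel. norm (indicator {a<..b} (x + h k) * w x) \<le> \<bar>w x\<bar>" for k
        by (auto simp: indicator_def)
      show "AE y in lborel. (\<lambda>k. indicator {a<..b} (y + h k) * w y) \<longlonglongrightarrow> indicator {a<..b} y * w y"
        using AE_lborel_singleton[of a] AE_lborel_singleton[of b]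
      proof eventually_elim
        case (elim y)
        have yh: "(\<lambda>k. y + h k) \<longlonglongrightarrow> y" using tendsto_add[OF tendsto_const h, of y] by simp
        have "\<forall>\<^sub>F k in sequentially. (y + h k \<in> {a<..b}) = (y \<in> {a<..b})"
        proof (cases "y \<in> {a<..b}")
          case True
          then have "a < y" "y < b" using elim by auto
          show ?thesis
            using order_tendstoD(1)[OF yh \<open>a < y\<close>] order_tendstoD(2)[OF yh \<open>y < b\<close>]
            by eventually_elim (use \<open>a < y\<close> \<open>y < b\<close> in auto)
        next
          case False
          then have "y < a \<or> b < y" using elim by auto
          then show ?thesis
          proof
            assume "y < a" from order_tendstoD(2)[OF yh this] show ?thesis
              by eventually_elim (use False in auto)
          next
            assume "b < y" from order_tendstoD(1)[OF yh this] show ?thesis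
              by eventually_elim (use False in auto)
          qed
        qed
        then have "\<forall>\<^sub>F k in sequentially. indicator {a<..b} y * w y = indicator {a<..b} (y + h k) * w y"
          by eventually_elim (auto simp: indicator_def)
        then show ?case by (rule Lim_transform_eventually[OF tendsto_const])
      qed
    qed auto
  next
    case (add u v)
    have "(\<lambda>k. LINT y|lborel. (u (y + h k) + v (y + h k)) * w y) =
        (\<lambda>k. (LINT y|lborel. u (y + h k) * w y) + (LINT y|lborel. v (y + h k) * w y))"
      by (subst Bochner_Integration.integral_add[symmetric]) (auto simp: distrib_right iw[OF add(1)] iw[OF add(3)])
    moreover have "(LINT y|lborel. (u y + v y) * w y) = (LINT y|lborel. u y * w y) + (LINT y|lborel. v y * w y)"
      using iw[OF add(1), of 0] iw[OF add(3), of 0]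
      by (subst Bochner_Integration.integral_add[symmetric]) (auto simp: algebra_simps)
    ultimately show ?case using tendsto_add[OF add(2,4)] by simp
  next
    case (scale u c)
    have "(LINT y|lborel. u (y + d) * c * w y) = (LINT y|lborel. u (y + d) * w y) * c" for d
      by (subst integral_mult_left_zero[symmetric]) (simp add: ac_simps)
    from this this[of 0] show ?case using tendsto_mult_right[OF scale(2), of c] by (simp add: mult.commute)
  next
    case (lim u s)
    have bd: "\<bar>(LINT y|lborel. u (y + c) * w y) - (LINT y|lborel. s i (y + c) * w y)\<bar>
        \<le> L * (LINT x|lborel. \<bar>s i x - u x\<bar>)" for i c
    proof -
      have i1: "integrable lborel (\<lambda>x. \<bar>s i x - u x\<bar>)" using lim by auto
      have "\<bar>(LINT y|lborel. u (y + c) * w y) - (LINT y|lborel. s i (y + c) * w y)\<bar>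
         = \<bar>LINT y|lborel. u (y + c) * w y - s i (y + c) * w y\<bar>"
        by (subst Bochner_Integration.integral_diff) (auto intro: iw lim)
      also have "\<dots> \<le> (LINT y|lborel. \<bar>u (y + c) * w y - s i (y + c) * w y\<bar>)"
        by (rule integral_abs_bound)
      also have "\<dots> \<le> (LINT y|lborel. L * \<bar>s i (y + c) - u (y + c)\<bar>)"
      proof (rule integral_mono)
        show "integrable lborel (\<lambda>y. \<bar>u (y + c) * w y - s i (y + c) * w y\<bar>)"
          by (intro integrable_abs Bochner_Integration.integrable_diff iw lim)
        show "integrable lborel (\<lambda>y. L * \<bar>s i (y + c) - u (y + c)\<bar>)"
          using sh[OF i1, of c] by simp
        show "\<bar>u (y + c) * w y - s i (y + c) * w y\<bar> \<le> L * \<bar>s i (y + c) - u (y + c)\<bar>" for y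
        proof -
          have "\<bar>u (y + c) * w y - s i (y + c) * w y\<bar> = \<bar>w y\<bar> * \<bar>s i (y + c) - u (y + c)\<bar>"
            unfolding left_diff_distrib[symmetric] abs_mult by (simp add: abs_minus_commute)
          also have "\<dots> \<le> L * \<bar>s i (y + c) - u (y + c)\<bar>" using wL by (intro mult_right_mono) auto
          finally show ?thesis .
        qed
      qed
      also have "\<dots> = L * (LINT x|lborel. \<bar>s i x - u x\<bar>)"
        using lborel_integral_real_affine[of 1 "\<lambda>x. \<bar>s i x - u x\<bar>" c] by (simp add: add.commute)
      finally show ?thesis .
    qed
    show ?case
    proof (rule tendstoI)
      fix e :: real assume e: "e > 0"
      have "(\<lambda>i. L * (LINT x|lborel. \<bar>s i x - u x\<bar>)) \<longlonglongrightarrow> 0" using tendsto_mult_right_zero[OF lim(4)] .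
      then have "\<forall>\<^sub>F i in sequentially. dist (L * (LINT x|lborel. \<bar>s i x - u x\<bar>)) 0 < e / 3"
        using e by (intro tendstoD) auto
      then obtain i where i: "dist (L * (LINT x|lborel. \<bar>s i x - u x\<bar>)) 0 < e / 3"
        using eventually_happens'[OF sequentially_bot] by blast
      have "\<forall>\<^sub>F k in sequentially. dist (LINT y|lborel. s i (y + h k) * w y) (LINT y|lborel. s i y * w y) < e / 3"
        using lim(2) e by (intro tendstoD) auto
      then show "\<forall>\<^sub>F k in sequentially. dist (LINT y|lborel. u (y + h k) * w y) (LINT y|lborel. u y * w y) < e"
      proof eventually_elim
        case (elim k)
        have ar: "\<bar>a - c\<bar> < e / 3 \<Longrightarrow> \<bar>b - a\<bar> \<le> D \<Longrightarrow> \<bar>d - c\<bar> \<le> D \<Longrightarrow> D < e / 3 \<Longrightarrow> \<bar>b - d\<bar> < e" for a b c d D :: real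
          by linarith
        have "L * (LINT x|lborel. \<bar>s i x - u x\<bar>) < e / 3" using i by (simp add: dist_real_def)
        from ar[OF elim[unfolded dist_real_def] bd[of "h k" i] _ this] show ?case using bd[of 0 i] by (simp add: dist_real_def)
      qed
    qed
  qed
qed

section \<open>Convolution of integrable functions and its transform\<close>

lemma integrable_pair_conv:
  fixes g h :: "real \<Rightarrow> real"
  assumes g: "integrable lborel g" and h: "integrable lborel h"
  shows "integrable (lborel \<Otimes>\<^sub>M lborel) (\<lambda>(x, u). g (x - u) * h u)"
proof -
  note [measurable] = borel_measurable_integrable[OF g] borel_measurable_integrable[OF h]
  have sh: "integrable lborel (\<lambda>y. g (y - c))" for c
    using lborel_integrable_real_affine[OF g, of 1 "-c"] by simp
  have "integrable (lborel \<Otimes>\<^sub>M lborel) (\<lambda>(u, x). g (x - u) * h u)"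
  proof (rule lborel_pair.Fubini_integrable)
    have "(LINT x|lborel. \<bar>g (x - u)\<bar>) = (LINT x|lborel. \<bar>g x\<bar>)" for u
      using lborel_integral_real_affine[of 1 "\<lambda>x. \<bar>g x\<bar>" "-u"] by simp
    then show "integrable lborel (\<lambda>u. LINT x|lborel. norm (case (u, x) of (u, x) \<Rightarrow> g (x - u) * h u))"
      using h by (simp add: abs_mult)
  qed (use sh in auto)
  then show ?thesis by (subst lborel_pair.integrable_product_swap_iff[symmetric]) (simp add: split_beta')
qed

lemma
  fixes g h :: "real \<Rightarrow> real"
  assumes g: "integrable lborel g" and h: "integrable lborel h"
  shows integrable_real_conv: "integrable lborel (\<lambda>x. LINT u|lborel. g (x - u) * h u)" (is ?i)
    and FT_real_conv: "FT (\<lambda>x. LINT u|lborel. g (x - u) * h u) t = FT g t * FT h t" (is ?f)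
proof -
  note [measurable] = borel_measurable_integrable[OF g] borel_measurable_integrable[OF h]
  show ?i using lborel_pair.integrable_fst'[OF integrable_pair_conv[OF g h]] by simp
  have ip: "integrable (lborel \<Otimes>\<^sub>M lborel) (\<lambda>(x, u). complex_of_real (g (x - u) * h u) * iexp (t * x))"
    by (rule Bochner_Integration.integrable_bound[OF integrable_pair_conv[OF g h]])
       (auto simp del: of_real_mult)
  have "FT (\<lambda>x. LINT u|lborel. g (x - u) * h u) t =
      (LINT x|lborel. LINT u|lborel. complex_of_real (g (x - u) * h u) * iexp (t * x))"
    unfolding FT_def by (simp only: integral_complex_of_real[symmetric] integral_mult_left_zero[symmetric])
  also have "\<dots> = (LINT u|lborel. LINT x|lborel. complex_of_real (g (x - u) * h u) * iexp (t * x))"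
    using lborel_pair.Fubini_integral[OF ip] by simp
  also have "\<dots> = (LINT u|lborel. FT g t * (complex_of_real (h u) * iexp (t * u)))"
  proof (rule Bochner_Integration.integral_cong[OF refl])
    fix u
    have "(LINT x|lborel. complex_of_real (g (x - u) * h u) * iexp (t * x))
       = (LINT x|lborel. complex_of_real (g x * h u) * iexp (t * (x + u)))"
      using lborel_integral_real_affine[of 1 "\<lambda>x. complex_of_real (g (x - u) * h u) * iexp (t * x)" u]
      by (simp add: add.commute)
    also have "\<dots> = (LINT x|lborel. (complex_of_real (g x) * iexp (t * x)) * (complex_of_real (h u) * iexp (t * u)))"
      by (simp add: exp_add distrib_left ac_simps)
    also have "\<dots> = FT g t * (complex_of_real (h u) * iexp (t * u))"
      unfolding FT_def by simp
    finally show "(LINT x|lborel. complex_of_real (g (x - u) * h u) * iexp (t * x))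
        = FT g t * (complex_of_real (h u) * iexp (t * u))" .
  qed
  also have "\<dots> = FT g t * FT h t" unfolding FT_def by simp
  finally show ?f .
qed

section \<open>Gaussian weights and the two Plancherel inequalities\<close>

lemma FT_std_normal: "FT std_normal_density t = of_real (exp (- (t\<^sup>2) / 2))"
proof -
  have "char std_normal_distribution t = FT std_normal_density t"
    unfolding char_def FT_def by (subst integral_density) (auto simp: scaleR_conv_of_real)
  then show ?thesis by (simp add: char_std_normal_distribution)
qed

lemma integrable_std_normal: "integrable lborel std_normal_density"
  using integrable_normal_moment[of 1 0 0] by simp

lemma integral_std_normal: "(LINT x|lborel. std_normal_density x) = 1"
  by (rule integral_normal_density) simp

lemma exp_square_eq: "exp (- ((t::real)\<^sup>2) / 2) = sqrt (2 * pi) * std_normal_density t"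
  by (simp add: std_normal_density_def)

lemma integrable_gauss_weight:
  fixes s :: real
  assumes "s > 0"
  shows "integrable lborel (\<lambda>t. exp (- ((t / s)\<^sup>2) / 2))"
proof -
  have "integrable lborel (\<lambda>t::real. std_normal_density (0 + (1/s) * t))"
    using assms by (intro lborel_integrable_real_affine integrable_std_normal) auto
  then have "integrable lborel (\<lambda>t. sqrt (2 * pi) * std_normal_density (t / s))" by simp
  then show ?thesis by (subst exp_square_eq)
qed

lemma FT_gauss_weight:
  fixes s :: real
  assumes "s > 0"
  shows "FT (\<lambda>t. exp (- ((t / s)\<^sup>2) / 2)) z = of_real (2 * pi * s * std_normal_density (s * z))"
proof -
  have "FT (\<lambda>t. exp (- ((t / s)\<^sup>2) / 2)) z =
      (LINT t|lborel. complex_of_real (sqrt (2 * pi) * std_normal_density (t / s)) * iexp (z * t))"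
    unfolding FT_def by (subst exp_square_eq) simp
  also have "\<dots> = \<bar>s\<bar> *\<^sub>R (LINT t|lborel. complex_of_real (sqrt (2 * pi) * std_normal_density t) * iexp (z * (s * t)))"
    using assms lborel_integral_real_affine[of s "\<lambda>t. complex_of_real (sqrt (2 * pi) * std_normal_density (t / s)) * iexp (z * t)" 0]
    by simp
  also have "\<dots> = of_real (s * sqrt (2 * pi)) * FT std_normal_density (s * z)"
    unfolding FT_def using assms
    by (subst integral_mult_right_zero[symmetric], subst integral_scaleR_right[symmetric])
       (auto simp: scaleR_conv_of_real ac_simps)
  also have "\<dots> = of_real (s * sqrt (2 * pi) * (sqrt (2 * pi) * std_normal_density (s * z)))"
    unfolding FT_std_normal exp_square_eq by simp
  also have "s * sqrt (2 * pi) * (sqrt (2 * pi) * std_normal_density (s * z)) = 2 * pi * s * std_normal_density (s * z)"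
    by simp
  finally show ?thesis .
qed

text \<open>Fubini. It replaces Fourier inversion, which would require integrable transforms: it
  moves the transform from the autocorrelation of u to a Gaussian weight, where it is
  explicit.\<close>

lemma FT_multiplication_formula:
  assumes a: "integrable lborel a" and b: "integrable lborel b"
  shows "(LINT t|lborel. of_real (a t) * FT b t) = (LINT h|lborel. of_real (b h) * FT a h)"
proof -
  note [measurable] = borel_measurable_integrable[OF a] borel_measurable_integrable[OF b]
  have "integrable (lborel \<Otimes>\<^sub>M lborel) (\<lambda>(t, h). a t * b h)"
  proof (rule lborel_pair.Fubini_integrable)
    show "integrable lborel (\<lambda>t. LINT h|lborel. norm (case (t, h) of (t, h) \<Rightarrow> a t * b h))"
      using a by (simp add: abs_mult)
  qed (use b in auto)
  then have ip: "integrable (lborel \<Otimes>\<^sub>M lborel) (\<lambda>(t, h). complex_of_real (a t * b h) * iexp (t * h))"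
    by (rule Bochner_Integration.integrable_bound) (auto simp del: of_real_mult)
  have "(LINT t|lborel. of_real (a t) * FT b t) = (LINT t|lborel. LINT h|lborel. complex_of_real (a t * b h) * iexp (t * h))"
    unfolding FT_def by (subst integral_mult_right_zero[symmetric]) (simp add: ac_simps)
  also have "\<dots> = (LINT h|lborel. LINT t|lborel. complex_of_real (a t * b h) * iexp (t * h))"
    using lborel_pair.Fubini_integral[OF ip] by simp
  also have "\<dots> = (LINT h|lborel. of_real (b h) * FT a h)"
    unfolding FT_def by (subst integral_mult_right_zero[symmetric]) (simp add: ac_simps)
  finally show ?thesis .
qed

text \<open>|FT u|^2 is the transform of the autocorrelation of u, that is of the convolution of u
  with its reflection, whose transform is the conjugate. The Gaussian weight makes the left side
  finite for any u in L^1. As s grows the weight rises to 1 and the shifts z / s vanish, which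
  yields the two one-sided inequalities that follow.\<close>

lemma gauss_Plancherel:
  assumes u: "integrable lborel u" and s: "s > 0"
  shows "(LINT t|lborel. (norm (FT u t))\<^sup>2 * exp (- ((t / s)\<^sup>2) / 2)) =
    2 * pi * (LINT z|lborel. std_normal_density z * (LINT y|lborel. u (y + z / s) * u y))"
proof -
  define v where "v y = u (- y)" for y
  define G where "G h = (LINT y|lborel. u (y + h) * u y)" for h
  define g where "g t = exp (- ((t / s)\<^sup>2) / 2)" for t
  have v: "integrable lborel v" unfolding v_def using lborel_integrable_real_affine[OF u, of "-1" 0] by simp
  have FTv: "FT v t = cnj (FT u t)" for t
  proof -
    have "FT v t = (LINT x|lborel. complex_of_real (u x) * iexp (t * (- x)))"
      unfolding FT_def v_def
      using lborel_integral_real_affine[of "-1" "\<lambda>x. complex_of_real (u (-x)) * iexp (t * x)" 0] by simp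
    also have "\<dots> = (LINT x|lborel. cnj (complex_of_real (u x) * iexp (t * x)))"
      by (simp add: exp_cnj)
    also have "\<dots> = cnj (FT u t)" unfolding FT_def by (rule Bochner_Integration.integral_cnj)
    finally show ?thesis .
  qed
  have G: "G = (\<lambda>h. LINT x|lborel. u (h - x) * v x)"
  proof
    fix h show "G h = (LINT x|lborel. u (h - x) * v x)"
      using lborel_integral_real_affine[of "-1" "\<lambda>x. u (h - x) * v x" 0]
      by (simp add: v_def G_def add.commute)
  qed
  have iG: "integrable lborel G" unfolding G by (rule integrable_real_conv[OF u v])
  note [measurable] = borel_measurable_integrable[OF iG]
  have FTG: "FT G t = of_real ((norm (FT u t))\<^sup>2)" for t
    unfolding G FT_real_conv[OF u v] FTv by (metis complex_norm_square)
  have ig: "integrable lborel g" unfolding g_def by (rule integrable_gauss_weight[OF s])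
  have "complex_of_real (LINT t|lborel. (norm (FT u t))\<^sup>2 * g t) = (LINT t|lborel. of_real (g t) * FT G t)"
    unfolding integral_complex_of_real[symmetric] FTG by (simp add: mult.commute)
  also have "\<dots> = (LINT h|lborel. of_real (G h) * FT g h)" by (rule FT_multiplication_formula[OF ig iG])
  also have "\<dots> = complex_of_real (LINT h|lborel. G h * (2 * pi * s * std_normal_density (s * h)))"
    unfolding integral_complex_of_real[symmetric] g_def FT_gauss_weight[OF s] by simp
  also have "(LINT h|lborel. G h * (2 * pi * s * std_normal_density (s * h))) =
      2 * pi * (LINT z|lborel. std_normal_density z * G (z / s))"
    using s lborel_integral_real_affine[of s "\<lambda>z. std_normal_density z * G (z / s)" 0]
    by (simp add: integral_mult_right_zero[symmetric] ac_simps del: integral_mult_right_zero)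
  finally show ?thesis unfolding G_def g_def of_real_eq_iff .
qed

lemma integrable_norm_FT_sq_gauss:
  assumes u: "integrable lborel u" and s: "s > 0"
  shows "integrable lborel (\<lambda>t. (norm (FT u t))\<^sup>2 * exp (- ((t / s)\<^sup>2) / 2))"
proof (rule Bochner_Integration.integrable_bound)
  note [measurable] = borel_measurable_integrable[OF u]
  let ?C = "LINT x|lborel. \<bar>u x\<bar>"
  show "integrable lborel (\<lambda>t. ?C\<^sup>2 * exp (- ((t / s)\<^sup>2) / 2))"
    using integrable_gauss_weight[OF s] by simp
  show "AE t in lborel. norm ((norm (FT u t))\<^sup>2 * exp (- ((t / s)\<^sup>2) / 2)) \<le> norm (?C\<^sup>2 * exp (- ((t / s)\<^sup>2) / 2))"
    by (auto simp: abs_mult intro!: power_mono norm_FT_le)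
qed (use borel_measurable_integrable[OF u] in measurable)

text \<open>By the inequality between geometric and arithmetic means an autocorrelation is at most
  its value at 0, so the weighted integrals are bounded uniformly in the weight; Fatou's lemma
  removes the weight.\<close>

lemma Plancherel_upper:
  assumes u: "integrable lborel u" and u2: "integrable lborel (\<lambda>x. (u x)\<^sup>2)"
  shows "(\<integral>\<^sup>+ t. ennreal ((norm (FT u t))\<^sup>2) \<partial>lborel) \<le> ennreal (2 * pi * (LINT x|lborel. (u x)\<^sup>2))"
proof -
  note [measurable] = borel_measurable_integrable[OF u]
  let ?g = "\<lambda>k t. (norm (FT u t))\<^sup>2 * exp (- ((t / real (Suc k))\<^sup>2) / 2)"
  have le: "(LINT t|lborel. ?g k t) \<le> 2 * pi * (LINT x|lborel. (u x)\<^sup>2)" for k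
  proof -
    have sh: "integrable lborel (\<lambda>y. (u (y + c))\<^sup>2)" for c
      using lborel_integrable_real_affine[OF u2, of 1 c] by (simp add: add.commute)
    have G: "(LINT y|lborel. u (y + c) * u y) \<le> (LINT x|lborel. (u x)\<^sup>2)" for c
    proof -
      have "(LINT y|lborel. u (y + c) * u y) \<le> (LINT y|lborel. ((u (y + c))\<^sup>2 + (u y)\<^sup>2) / 2)"
      proof (rule integral_mono)
        have *: "\<bar>u (y + c) * u y\<bar> \<le> ((u (y + c))\<^sup>2 + (u y)\<^sup>2) / 2" for y
          using sum_squares_bound[of "u (y + c)" "u y"] sum_squares_bound[of "- u (y + c)" "u y"] by (simp add: abs_le_iff)
        then show "u (y + c) * u y \<le> ((u (y + c))\<^sup>2 + (u y)\<^sup>2) / 2" for y by (rule abs_le_D1)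
        show i: "integrable lborel (\<lambda>y. ((u (y + c))\<^sup>2 + (u y)\<^sup>2) / 2)" using sh u2 by auto
        show "integrable lborel (\<lambda>y. u (y + c) * u y)"
          by (rule Bochner_Integration.integrable_bound[OF i]) (use * in \<open>auto intro: order_trans[OF *]\<close>)
      qed
      also have "\<dots> = ((LINT y|lborel. (u (y + c))\<^sup>2) + (LINT y|lborel. (u y)\<^sup>2)) / 2"
        using sh u2 by simp
      also have "\<dots> = (LINT x|lborel. (u x)\<^sup>2)"
        using lborel_integral_real_affine[of 1 "\<lambda>x. (u x)\<^sup>2" c] by (simp add: add.commute)
      finally show ?thesis .
    qed
    have "(LINT z|lborel. std_normal_density z * (LINT y|lborel. u (y + z / Suc k) * u y))
        \<le> (LINT z|lborel. std_normal_density z * (LINT x|lborel. (u x)\<^sup>2))"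
      using integrable_std_normal G by (intro integral_mono') (auto intro!: mult_left_mono)
    then show ?thesis using gauss_Plancherel[OF u, of "Suc k"] by (simp add: integral_std_normal)
  qed
  have "(\<integral>\<^sup>+ t. ennreal ((norm (FT u t))\<^sup>2) \<partial>lborel) = (\<integral>\<^sup>+ t. liminf (\<lambda>k. ennreal (?g k t)) \<partial>lborel)"
  proof (rule nn_integral_cong)
    fix t
    have "(\<lambda>k. ?g k t) \<longlonglongrightarrow> (norm (FT u t))\<^sup>2 * exp (- (0\<^sup>2) / 2)"
      by (intro tendsto_intros) (rule LIMSEQ_Suc, rule lim_const_over_n, simp)
    then have "(\<lambda>k. ennreal (?g k t)) \<longlonglongrightarrow> ennreal ((norm (FT u t))\<^sup>2)" by (intro tendsto_ennrealI) simp
    then show "ennreal ((norm (FT u t))\<^sup>2) = liminf (\<lambda>k. ennreal (?g k t))"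
      by (rule lim_imp_Liminf[OF sequentially_bot, symmetric])
  qed
  also have "\<dots> \<le> liminf (\<lambda>k. \<integral>\<^sup>+ t. ennreal (?g k t) \<partial>lborel)"
    by (rule nn_integral_liminf) measurable
  also have "\<dots> = liminf (\<lambda>k. ennreal (LINT t|lborel. ?g k t))"
    by (subst nn_integral_eq_integral[OF integrable_norm_FT_sq_gauss[OF u]]) auto
  also have "\<dots> \<le> limsup (\<lambda>k. ennreal (LINT t|lborel. ?g k t))"
    by (rule Liminf_le_Limsup) simp
  also have "\<dots> \<le> ennreal (2 * pi * (LINT x|lborel. (u x)\<^sup>2))"
    by (rule Limsup_bounded) (use le in \<open>auto intro!: ennreal_leI\<close>)
  finally show ?thesis .
qed

text \<open>The weight is at most 1, so each weighted integral is below the full one. Boundedness of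
  u makes its autocorrelation continuous at 0, and the weighted integrals converge to the left side.
  This direction turns decay of characteristic functions into an L^2 bound for a density.\<close>

lemma Plancherel_lower:
  assumes u: "integrable lborel u" and L: "\<And>x. \<bar>u x\<bar> \<le> L"
  shows "ennreal (2 * pi * (LINT x|lborel. (u x)\<^sup>2)) \<le> (\<integral>\<^sup>+ t. ennreal ((norm (FT u t))\<^sup>2) \<partial>lborel)"
proof -
  note [measurable] = borel_measurable_integrable[OF u]
  define a where "a k = 2 * pi * (LINT z|lborel. std_normal_density z * (LINT y|lborel. u (y + z / real (Suc k)) * u y))" for k
  have le: "ennreal (a k) \<le> (\<integral>\<^sup>+ t. ennreal ((norm (FT u t))\<^sup>2) \<partial>lborel)" for k
  proof -
    have "ennreal (a k) = (\<integral>\<^sup>+ t. ennreal ((norm (FT u t))\<^sup>2 * exp (- ((t / real (Suc k))\<^sup>2) / 2)) \<partial>lborel)"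
      unfolding a_def
      by (subst gauss_Plancherel[OF u, symmetric], simp, rule nn_integral_eq_integral[symmetric])
         (rule integrable_norm_FT_sq_gauss[OF u], auto)
    also have "\<dots> \<le> (\<integral>\<^sup>+ t. ennreal ((norm (FT u t))\<^sup>2) \<partial>lborel)"
      by (intro nn_integral_mono ennreal_leI mult_left_le) auto
    finally show ?thesis .
  qed
  have L0: "L \<ge> 0" using L[of 0] by linarith
  have "(\<lambda>k. LINT z|lborel. std_normal_density z * (LINT y|lborel. u (y + z / real (Suc k)) * u y))
      \<longlonglongrightarrow> (LINT z|lborel. std_normal_density z * (LINT y|lborel. u y * u y))"
  proof (rule integral_dominated_convergence)
    show "integrable lborel (\<lambda>z. std_normal_density z * (L * (LINT y|lborel. \<bar>u y\<bar>)))"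
      using integrable_std_normal by simp
    show "AE z in lborel. (\<lambda>k. std_normal_density z * (LINT y|lborel. u (y + z / real (Suc k)) * u y))
      \<longlonglongrightarrow> std_normal_density z * (LINT y|lborel. u y * u y)"
      by (intro AE_I2 tendsto_intros tendsto_translate_weak[OF u u L] LIMSEQ_Suc[OF lim_const_over_n])
    show "AE z in lborel. norm (std_normal_density z * (LINT y|lborel. u (y + z / real (Suc k)) * u y))
        \<le> std_normal_density z * (L * (LINT y|lborel. \<bar>u y\<bar>))" for k
    proof (rule AE_I2)
      fix z :: real
      have "\<bar>LINT y|lborel. u (y + z / real (Suc k)) * u y\<bar> \<le> (LINT y|lborel. \<bar>u (y + z / real (Suc k)) * u y\<bar>)"
        by (rule integral_abs_bound)
      also have "\<dots> \<le> (LINT y|lborel. L * \<bar>u y\<bar>)"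
        by (rule integral_mono') (use u L L0 in \<open>auto simp: abs_mult intro!: mult_right_mono\<close>)
      finally show "norm (std_normal_density z * (LINT y|lborel. u (y + z / real (Suc k)) * u y))
        \<le> std_normal_density z * (L * (LINT y|lborel. \<bar>u y\<bar>))"
        by (simp add: abs_mult mult_left_mono del: of_nat_Suc)
    qed
  qed auto
  then have "a \<longlonglongrightarrow> 2 * pi * (LINT x|lborel. (u x)\<^sup>2)"
    unfolding a_def[abs_def] by (intro tendsto_intros) (simp add: integral_std_normal power2_eq_square)
  then have "(\<lambda>k. ennreal (a k)) \<longlonglongrightarrow> ennreal (2 * pi * (LINT x|lborel. (u x)\<^sup>2))"
    by (rule tendsto_ennrealI)
  then show ?thesis by (rule LIMSEQ_le_const2) (use le in auto)
qed

section \<open>Convolution of densities\<close>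

text \<open>Values in \<open>ennreal\<close> keep convolution total and Tonelli free of
  integrability conditions; the densities may be infinite on null sets.\<close>

definition conv :: "(real \<Rightarrow> ennreal) \<Rightarrow> (real \<Rightarrow> ennreal) \<Rightarrow> real \<Rightarrow> ennreal" where
  "conv g h x = (\<integral>\<^sup>+ u. g (x - u) * h u \<partial>lborel)"

lemma measurable_conv_pair:
  assumes [measurable]: "case_prod g \<in> borel_measurable (Y \<Otimes>\<^sub>M borel)"
    and [measurable]: "case_prod h \<in> borel_measurable (Y \<Otimes>\<^sub>M borel)"
  shows "(\<lambda>(y, x). conv (g y) (h y) x) \<in> borel_measurable (Y \<Otimes>\<^sub>M borel)"
proof -
  have [measurable]: "(\<lambda>w. g (fst (fst w)) (snd (fst w) - snd w)) \<in> borel_measurable ((Y \<Otimes>\<^sub>M borel) \<Otimes>\<^sub>M borel)"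
    using measurable_compose[OF _ assms(1), of "\<lambda>w. (fst (fst w), snd (fst w) - snd w)" "(Y \<Otimes>\<^sub>M borel) \<Otimes>\<^sub>M borel"]
    by simp
  have [measurable]: "(\<lambda>w. h (fst (fst w)) (snd w)) \<in> borel_measurable ((Y \<Otimes>\<^sub>M borel) \<Otimes>\<^sub>M borel)"
    using measurable_compose[OF _ assms(2), of "\<lambda>w. (fst (fst w), snd w)" "(Y \<Otimes>\<^sub>M borel) \<Otimes>\<^sub>M borel"]
    by simp
  have "(\<lambda>w. \<integral>\<^sup>+ u. g (fst w) (snd w - u) * h (fst w) u \<partial>lborel) \<in> borel_measurable (Y \<Otimes>\<^sub>M borel)"
    by (rule lborel.borel_measurable_nn_integral) (simp add: split_beta')
  then show ?thesis by (simp add: conv_def split_beta')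
qed

lemma measurable_conv [measurable]:
  assumes [measurable]: "g \<in> borel_measurable borel" "h \<in> borel_measurable borel"
  shows "conv g h \<in> borel_measurable borel"
  unfolding conv_def[abs_def] by measurable

text \<open>Tonelli and the translation x = r + u. In this form \<open>conv\<close> is recognised as
  the density of a sum of independent variables.\<close>

lemma nn_integral_mult_conv:
  assumes [measurable]: "H \<in> borel_measurable borel" "g \<in> borel_measurable borel" "h \<in> borel_measurable borel"
  shows "(\<integral>\<^sup>+ x. H x * conv g h x \<partial>lborel) = (\<integral>\<^sup>+ r. \<integral>\<^sup>+ u. H (r + u) * g r * h u \<partial>lborel \<partial>lborel)"
proof -
  have "(\<integral>\<^sup>+ x. H x * conv g h x \<partial>lborel) = (\<integral>\<^sup>+ x. \<integral>\<^sup>+ u. H x * g (x - u) * h u \<partial>lborel \<partial>lborel)"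
    unfolding conv_def by (simp add: nn_integral_cmult[symmetric] mult.assoc)
  also have "\<dots> = (\<integral>\<^sup>+ u. \<integral>\<^sup>+ x. H x * g (x - u) * h u \<partial>lborel \<partial>lborel)"
    by (rule lborel_pair.Fubini'[symmetric]) simp
  also have "\<dots> = (\<integral>\<^sup>+ u. \<integral>\<^sup>+ r. H (r + u) * g r * h u \<partial>lborel \<partial>lborel)"
  proof (rule nn_integral_cong)
    fix u :: real
    show "(\<integral>\<^sup>+ x. H x * g (x - u) * h u \<partial>lborel) = (\<integral>\<^sup>+ r. H (r + u) * g r * h u \<partial>lborel)"
      by (subst nn_integral_real_affine[where c=1 and t=u]) (auto simp: add.commute)
  qed
  also have "\<dots> = (\<integral>\<^sup>+ r. \<integral>\<^sup>+ u. H (r + u) * g r * h u \<partial>lborel \<partial>lborel)"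
    by (rule lborel_pair.Fubini') simp
  finally show ?thesis .
qed

lemma nn_integral_conv:
  assumes [measurable]: "g \<in> borel_measurable borel" "h \<in> borel_measurable borel"
  shows "(\<integral>\<^sup>+ x. conv g h x \<partial>lborel) = (\<integral>\<^sup>+ x. g x \<partial>lborel) * (\<integral>\<^sup>+ x. h x \<partial>lborel)"
  using nn_integral_mult_conv[of "\<lambda>_. 1" g h] by (simp add: nn_integral_cmult nn_integral_multc)

lemma conv_add:
  assumes [measurable]: "a \<in> borel_measurable borel" "b \<in> borel_measurable borel" "h \<in> borel_measurable borel"
  shows "conv (\<lambda>x. a x + b x) h x = conv a h x + conv b h x"
  unfolding conv_def by (subst nn_integral_add[symmetric]) (auto simp: distrib_right)

lemma conv_le:
  assumes [measurable]: "h \<in> borel_measurable borel" and "\<And>x. g x \<le> L"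
  shows "conv g h x \<le> L * (\<integral>\<^sup>+ u. h u \<partial>lborel)"
  unfolding conv_def
  by (subst nn_integral_cmult[symmetric]) (auto intro!: nn_integral_mono mult_right_mono assms)

lemma AE_less_top:
  assumes "g \<in> borel_measurable M" "(\<integral>\<^sup>+ x. g x \<partial>M) < \<infinity>"
  shows "AE x in M. g x < \<infinity>"
  using nn_integral_PInf_AE[OF assms(1)] assms(2) by (auto simp: less_top)

lemma enn2real_conv:
  assumes [measurable]: "g \<in> borel_measurable borel" "h \<in> borel_measurable borel"
    and g: "(\<integral>\<^sup>+ x. g x \<partial>lborel) < \<infinity>" and h: "(\<integral>\<^sup>+ x. h x \<partial>lborel) < \<infinity>"
  shows "enn2real (conv g h x) = (LINT u|lborel. enn2real (g (x - u)) * enn2real (h u))"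
proof -
  have "AE u in lborel. g u < \<infinity>" by (rule AE_less_top) (use g in auto)
  from AE_borel_affine[OF _ _ this, of "-1" x] have "AE u in lborel. g (x - u) < \<infinity>" by simp
  moreover have "AE u in lborel. h u < \<infinity>" by (rule AE_less_top) (use h in auto)
  ultimately have "conv g h x = (\<integral>\<^sup>+ u. ennreal (enn2real (g (x - u)) * enn2real (h u)) \<partial>lborel)"
    unfolding conv_def
    by (intro nn_integral_cong_AE) (auto elim!: eventually_elim2 simp: ennreal_mult)
  then show ?thesis by (subst integral_eq_nn_integral) auto
qed

lemma integrable_enn2real:
  assumes [measurable]: "g \<in> borel_measurable M" and "(\<integral>\<^sup>+ x. g x \<partial>M) < \<infinity>"
  shows "integrable M (\<lambda>x. enn2real (g x))"
proof (rule integrableI_bounded)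
  have "(\<integral>\<^sup>+ x. ennreal (norm (enn2real (g x))) \<partial>M) \<le> (\<integral>\<^sup>+ x. g x \<partial>M)"
    by (intro nn_integral_mono) (auto simp: ennreal_enn2real_if)
  then show "(\<integral>\<^sup>+ x. ennreal (norm (enn2real (g x))) \<partial>M) < \<infinity>" using assms(2) by auto
qed auto

lemma FT_conv:
  assumes [measurable]: "g \<in> borel_measurable borel" "h \<in> borel_measurable borel"
    and g: "(\<integral>\<^sup>+ x. g x \<partial>lborel) < \<infinity>" and h: "(\<integral>\<^sup>+ x. h x \<partial>lborel) < \<infinity>"
  shows "FT (\<lambda>x. enn2real (conv g h x)) t = FT (\<lambda>x. enn2real (g x)) t * FT (\<lambda>x. enn2real (h x)) t"
  unfolding enn2real_conv[OF assms] by (rule FT_real_conv) (use g h in \<open>auto intro!: integrable_enn2real\<close>)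

text \<open>This is t log^+ t, a convex function that vanishes on [0, 1]: the part of t log t that
  can drive an entropy to -infinity. The value at infinity is chosen so that the tangent bounds hold
  there too.\<close>

definition Psi :: "ennreal \<Rightarrow> ennreal" where
  "Psi t = (if t = \<infinity> then \<infinity> else ennreal (enn2real t * max 0 (ln (enn2real t))))"

lemma measurable_Psi [measurable]: "Psi \<in> borel_measurable borel"
  unfolding Psi_def[abs_def] by measurable

lemma Psi_0 [simp]: "Psi 0 = 0" by (simp add: Psi_def)

text \<open>The tangent of t ln t at m has slope 1 + ln m and intercept -m, and t ln t lies below
  \<open>Psi\<close>. The intercept is moved to the other side to avoid truncated
  subtraction.\<close>

lemma Psi_tangent:
  assumes m: "m \<ge> (1::real)"
  shows "ennreal (1 + ln m) * t \<le> Psi t + ennreal m"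
proof (cases "t = \<infinity>")
  case False
  then obtain r where r: "t = ennreal r" "r \<ge> 0" by (cases t) auto
  have "(1 + ln m) * r \<le> r * max 0 (ln r) + m"
  proof (cases "r = 0")
    case False
    with r have "r > 0" by simp
    then have "ln (m / r) \<le> m / r - 1" using m by (intro ln_le_minus_one) auto
    then have "r * (ln m - ln r) \<le> m - r" using \<open>r > 0\<close> m by (simp add: ln_div field_simps)
    moreover have "r * ln r \<le> r * max 0 (ln r)" using \<open>r > 0\<close> by (intro mult_left_mono) auto
    ultimately show ?thesis by (simp add: algebra_simps)
  qed (use m in auto)
  then show ?thesis using r m
    by (simp add: Psi_def ennreal_mult'[symmetric] ennreal_plus[symmetric] del: ennreal_plus)
qed (simp add: Psi_def)

text \<open>Jensen's inequality for the probability density u -> h u: the tangent of t ln t is taken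
  at the mean \<open>conv b h x\<close> itself. Means below 1 need no argument, as
  \<open>Psi\<close> vanishes there.\<close>

lemma Psi_conv_le:
  assumes [measurable]: "b \<in> borel_measurable borel" "h \<in> borel_measurable borel"
    and h: "(\<integral>\<^sup>+ x. h x \<partial>lborel) = 1"
  shows "Psi (conv b h x) \<le> conv (\<lambda>x. Psi (b x)) h x"
proof -
  have key: "ennreal (1 + ln m) * conv b h x \<le> conv (\<lambda>x. Psi (b x)) h x + ennreal m" if m: "m \<ge> 1" for m
  proof -
    have "ennreal (1 + ln m) * conv b h x = (\<integral>\<^sup>+ u. ennreal (1 + ln m) * b (x - u) * h u \<partial>lborel)"
      unfolding conv_def by (simp add: nn_integral_cmult[symmetric] mult.assoc)
    also have "\<dots> \<le> (\<integral>\<^sup>+ u. (Psi (b (x - u)) + ennreal m) * h u \<partial>lborel)"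
      by (intro nn_integral_mono mult_right_mono Psi_tangent m) auto
    also have "\<dots> = conv (\<lambda>x. Psi (b x)) h x + ennreal m"
      unfolding conv_def by (simp add: distrib_right nn_integral_add nn_integral_cmult h)
    finally show ?thesis .
  qed
  show ?thesis
  proof (cases "conv b h x = \<infinity>")
    case True
    \<comment> \<open>The tangent at m = 1 has slope 1, so an infinite mean forces the right side to
      be infinite.\<close>
    with key[of 1] have "conv (\<lambda>x. Psi (b x)) h x = \<infinity>" by (auto simp: top_unique)
    then show ?thesis by simp
  next
    case False
    then obtain m where m: "conv b h x = ennreal m" "m \<ge> 0" by (cases "conv b h x") auto
    show ?thesis
    proof (cases "m \<ge> 1")
      case True
      then have "ennreal (m * ln m) + ennreal m \<le> conv (\<lambda>x. Psi (b x)) h x + ennreal m"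
        using key[OF True] m
        by (simp add: ennreal_mult'[symmetric] ennreal_plus[symmetric] algebra_simps del: ennreal_plus)
      then have "ennreal (m * ln m) \<le> conv (\<lambda>x. Psi (b x)) h x"
        by (simp add: add.commute[of _ "ennreal m"] ennreal_add_left_cancel_le)
      then show ?thesis using m True by (simp add: Psi_def max_def)
    next
      case False
      then have "ln m \<le> 0" using m(2) by (cases "m = 0") auto
      then show ?thesis using m by (simp add: Psi_def max_def)
    qed
  qed
qed

text \<open>\<open>csum F m g k\<close> is the convolution of \<open>g\<close> with \<open>F (m + 1), \<dots>, F (m + k)\<close>; \<open>F m\<close> itself does not occur.\<close>

fun csum :: "(nat \<Rightarrow> real \<Rightarrow> ennreal) \<Rightarrow> nat \<Rightarrow> (real \<Rightarrow> ennreal) \<Rightarrow> nat \<Rightarrow> real \<Rightarrow> ennreal" where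
  "csum F m g 0 = g"
| "csum F m g (Suc k) = conv (csum F m g k) (F (Suc (m + k)))"

lemma csum_add: "csum F m g (j + k) = csum F (m + j) (csum F m g j) k"
  by (induct k) (simp_all add: add.assoc)

lemma csum_cong: "(\<And>i. m < i \<Longrightarrow> i \<le> m + k \<Longrightarrow> F i = F' i) \<Longrightarrow> csum F m g k = csum F' m g k"
  by (induct k) auto

context
  fixes F :: "nat \<Rightarrow> real \<Rightarrow> ennreal"
  assumes F [measurable]: "\<And>i. F i \<in> borel_measurable borel"
    and F1: "\<And>i. (\<integral>\<^sup>+ x. F i x \<partial>lborel) = 1"
begin

lemma measurable_csum [measurable]: "g \<in> borel_measurable borel \<Longrightarrow> csum F m g k \<in> borel_measurable borel"
  by (induct k) auto

lemma nn_integral_csum: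
  "g \<in> borel_measurable borel \<Longrightarrow> (\<integral>\<^sup>+ x. csum F m g k x \<partial>lborel) = (\<integral>\<^sup>+ x. g x \<partial>lborel)"
  by (induct k) (auto simp: nn_integral_conv F1 measurable_csum)

lemma csum_plus:
  assumes [measurable]: "a \<in> borel_measurable borel" "b \<in> borel_measurable borel"
  shows "csum F m (\<lambda>x. a x + b x) k x = csum F m a k x + csum F m b k x"
proof (induct k arbitrary: x)
  case (Suc k)
  then have "csum F m (\<lambda>x. a x + b x) k = (\<lambda>x. csum F m a k x + csum F m b k x)" by auto
  then show ?case by (simp add: conv_add)
qed auto

lemma csum_le: "(\<And>x. g x \<le> L) \<Longrightarrow> csum F m g k x \<le> L"
proof (induct k arbitrary: x)
  case (Suc k)
  show ?case using conv_le[OF F[of "Suc (m + k)"], of "csum F m g k" L x] Suc by (simp add: F1)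
qed auto

text \<open>Jensen pointwise, then Tonelli: convolving with a density of mass 1 does not change an
  integral. A bound for the first summands thus persists under any number of further ones.\<close>

lemma nn_integral_Psi_csum_le:
  assumes [measurable]: "g \<in> borel_measurable borel"
  shows "(\<integral>\<^sup>+ x. Psi (csum F m g k x) \<partial>lborel) \<le> (\<integral>\<^sup>+ x. Psi (g x) \<partial>lborel)"
proof (induct k)
  case (Suc k)
  have "(\<integral>\<^sup>+ x. Psi (csum F m g (Suc k) x) \<partial>lborel)
      \<le> (\<integral>\<^sup>+ x. conv (\<lambda>x. Psi (csum F m g k x)) (F (Suc (m + k))) x \<partial>lborel)"
    by (auto intro!: nn_integral_mono Psi_conv_le F1)
  also have "\<dots> = (\<integral>\<^sup>+ x. Psi (csum F m g k x) \<partial>lborel)"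
    by (subst nn_integral_conv) (auto simp: F1)
  finally show ?case using Suc by simp
qed auto

lemma FT_csum:
  assumes [measurable]: "g \<in> borel_measurable borel" and g: "(\<integral>\<^sup>+ x. g x \<partial>lborel) < \<infinity>"
  shows "FT (\<lambda>x. enn2real (csum F m g k x)) t =
    FT (\<lambda>x. enn2real (g x)) t * (\<Prod>i\<in>{m<..m+k}. FT (\<lambda>x. enn2real (F i x)) t)"
proof (induct k)
  case (Suc k)
  have "{m<..m+Suc k} = insert (Suc (m+k)) {m<..m+k}" by auto
  then show ?case using Suc g
    by (simp add: FT_conv nn_integral_csum F1 ac_simps)
qed auto

end

section \<open>Convergence of entropies\<close>

text \<open>The log-sum inequality with weights 1 - e and e. The loss - ln (1 - e) falls on A and
  vanishes with e; the loss - ln e may be large but falls on B, whose mass tends to 0 while e is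
  fixed.\<close>

lemma log_sum_le:
  fixes A B e :: real
  assumes "A \<ge> 0" "B \<ge> 0" "0 < e" "e < 1"
  shows "(A + B) * ln (A + B) \<le> A * ln A + B * ln B - A * ln (1 - e) - B * ln e"
proof (cases "A = 0 \<or> B = 0")
  case True
  have "B * ln e \<le> 0" "A * ln (1 - e) \<le> 0" using assms by (auto intro!: mult_nonneg_nonpos)
  with True show ?thesis by auto
next
  case False
  with assms have AB: "A > 0" "B > 0" by auto
  have "A * ln ((A + B) * (1 - e) / A) \<le> A * ((A + B) * (1 - e) / A - 1)"
    using assms AB by (intro mult_left_mono ln_le_minus_one) auto
  moreover have "B * ln ((A + B) * e / B) \<le> B * ((A + B) * e / B - 1)"
    using assms AB by (intro mult_left_mono ln_le_minus_one) auto
  moreover have "ln ((A + B) * (1 - e) / A) = ln (A + B) + ln (1 - e) - ln A"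
    "ln ((A + B) * e / B) = ln (A + B) + ln e - ln B"
    using assms AB by (simp_all add: ln_mult ln_div)
  moreover have "A * ((A + B) * (1 - e) / A - 1) = (A + B) * (1 - e) - A"
    "B * ((A + B) * e / B - 1) = (A + B) * e - B" using AB by (simp_all add: field_simps)
  ultimately have "A * (ln (A + B) + ln (1 - e) - ln A) \<le> (A + B) * (1 - e) - A"
    "B * (ln (A + B) + ln e - ln B) \<le> (A + B) * e - B" by simp_all
  then show ?thesis by (simp add: algebra_simps)
qed

text \<open>A substitute for the second order expansion of \<open>a ln a\<close> at \<open>f\<close>: with \<open>g = max f c\<close> the coefficients
  stay bounded, so that convergence in \<open>L\<^sup>2\<close> and weak convergence suffice.\<close>

lemma xlnx_upper:
  fixes a g c f :: real
  assumes "a \<ge> 0" "c > 0" "g \<ge> c"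
  shows "a * ln a \<le> a\<^sup>2 / c + a * (ln g - 1 - 2 * f / c + 2 * f / g) + (f\<^sup>2 / c - f\<^sup>2 / g)"
proof -
  have g: "g > 0" using assms by simp
  have 1: "a * ln a \<le> a * ln g - a + a\<^sup>2 / g"
  proof (cases "a = 0")
    case False
    with assms have "a > 0" by simp
    then have "a * ln (a / g) \<le> a * (a / g - 1)" using g by (intro mult_left_mono ln_le_minus_one) auto
    then show ?thesis using \<open>a > 0\<close> g by (simp add: ln_div algebra_simps power2_eq_square)
  qed auto
  \<comment> \<open>Replacing 1 / g by 1 / c gives the quadratic term a constant coefficient, so
    only the integral of a^2 has to be known; the remaining terms are linear in a.\<close>
  have "(a - f)\<^sup>2 / g \<le> (a - f)\<^sup>2 / c" using assms by (intro divide_left_mono) auto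
  then have "a\<^sup>2 / g \<le> a\<^sup>2 / c - 2 * a * f / c + f\<^sup>2 / c + 2 * a * f / g - f\<^sup>2 / g"
    by (simp add: power2_diff add_divide_distrib diff_divide_distrib)
  with 1 show ?thesis by (simp add: algebra_simps)
qed

text \<open>The pointwise form of Gibbs' inequality, from ln x <= x - 1 at x = f / a. When a and f
  have equal mass, the last two terms cancel on integration.\<close>

lemma xlnx_lower:
  fixes a f :: real
  assumes "a \<ge> 0" "f > 0"
  shows "a * ln a \<ge> a * ln f + a - f"
proof (cases "a = 0")
  case False
  with assms have "a > 0" by simp
  then have "a * ln (f / a) \<le> a * (f / a - 1)" using assms by (intro mult_left_mono ln_le_minus_one) auto
  then show ?thesis using \<open>a > 0\<close> assms by (simp add: ln_div algebra_simps)
qed (use assms in auto)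

section \<open>Integrals of the centred normal density\<close>

lemma ln_normal_density:
  assumes "\<sigma> > 0"
  shows "ln (normal_density 0 \<sigma> x) = - ln (2 * pi * \<sigma>\<^sup>2) / 2 - x\<^sup>2 / (2 * \<sigma>\<^sup>2)"
  using assms by (simp add: normal_density_def ln_mult ln_div ln_sqrt) (simp add: field_simps)

lemma normal_density_sq:
  assumes "\<sigma> > 0"
  shows "(normal_density 0 \<sigma> x)\<^sup>2 = 1 / (2 * \<sigma> * sqrt pi) * normal_density 0 (\<sigma> / sqrt 2) x"
proof -
  have "(exp (- x\<^sup>2 / (2 * \<sigma>\<^sup>2)))\<^sup>2 = exp (- x\<^sup>2 / \<sigma>\<^sup>2)"
    by (simp add: power2_eq_square exp_add[symmetric] field_simps)
  moreover have "2 * pi * (\<sigma> / sqrt 2)\<^sup>2 = pi * \<sigma>\<^sup>2" by (simp add: power_divide)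
  moreover have "2 * (\<sigma> / sqrt 2)\<^sup>2 = \<sigma>\<^sup>2" by (simp add: power_divide)
  moreover have "(1 / sqrt (2 * pi * \<sigma>\<^sup>2))\<^sup>2 = 1 / (2 * \<sigma> * sqrt pi) * (1 / sqrt (pi * \<sigma>\<^sup>2))"
    using assms by (simp add: power_divide real_sqrt_mult power2_eq_square field_simps)
  ultimately show ?thesis by (simp only: normal_density_def power_mult_distrib diff_zero)
qed

text \<open>The constant is the density at 0 of the difference of two independent N(0, \<sigma>^2)
  variables; it is the value against which the L^2 bounds are measured.\<close>

lemma integral_normal_density_sq:
  assumes "\<sigma> > 0"
  shows "integrable lborel (\<lambda>x. (normal_density 0 \<sigma> x)\<^sup>2)"
    and "(LINT x|lborel. (normal_density 0 \<sigma> x)\<^sup>2) = 1 / (2 * \<sigma> * sqrt pi)"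
  using assms unfolding normal_density_sq[OF assms] by auto

lemma normal_density_le:
  "normal_density 0 \<sigma> x \<le> 1 / sqrt (2 * pi * \<sigma>\<^sup>2)"
  unfolding normal_density_def by (intro mult_left_le) auto

lemma integrable_normal_x2:
  assumes "\<sigma> > 0"
  shows "integrable lborel (\<lambda>x. normal_density 0 \<sigma> x * x\<^sup>2)"
    and "(LINT x|lborel. normal_density 0 \<sigma> x * x\<^sup>2) = \<sigma>\<^sup>2"
  using integrable_normal_moment[OF assms, of 0 2] integral_normal_moment_even[OF assms, of 0 1] by auto

lemma integral_normal_ln_normal:
  assumes s: "\<sigma> > 0"
  shows "integrable lborel (\<lambda>x. normal_density 0 \<sigma> x * ln (normal_density 0 \<sigma> x))"
    and "(LINT x|lborel. normal_density 0 \<sigma> x * ln (normal_density 0 \<sigma> x)) = - (1 / 2 * ln (2 * pi * exp 1 * \<sigma>\<^sup>2))"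
proof -
  have eq: "normal_density 0 \<sigma> x * ln (normal_density 0 \<sigma> x) =
      normal_density 0 \<sigma> x * (- ln (2 * pi * \<sigma>\<^sup>2) / 2) - normal_density 0 \<sigma> x * x\<^sup>2 / (2 * \<sigma>\<^sup>2)" for x
    by (simp add: ln_normal_density[OF s] algebra_simps)
  show "integrable lborel (\<lambda>x. normal_density 0 \<sigma> x * ln (normal_density 0 \<sigma> x))"
    unfolding eq using integrable_normal_x2[OF s] s by auto
  have "(LINT x|lborel. normal_density 0 \<sigma> x * ln (normal_density 0 \<sigma> x)) = - ln (2 * pi * \<sigma>\<^sup>2) / 2 - \<sigma>\<^sup>2 / (2 * \<sigma>\<^sup>2)"
    unfolding eq using integrable_normal_x2[OF s] s
    by (subst Bochner_Integration.integral_diff) auto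
  also have "\<dots> = - (1 / 2 * ln (2 * pi * exp 1 * \<sigma>\<^sup>2))"
    using s by (simp add: ln_mult) (simp add: field_simps)
  finally show "(LINT x|lborel. normal_density 0 \<sigma> x * ln (normal_density 0 \<sigma> x)) = - (1 / 2 * ln (2 * pi * exp 1 * \<sigma>\<^sup>2))" .
qed

lemma isCont_normal_density: "\<sigma> > 0 \<Longrightarrow> isCont (normal_density 0 \<sigma>) x"
  unfolding normal_density_def[abs_def] by (intro continuous_intros) auto

text \<open>The measure spaces vary with n, so convergence of A n to \<phi> has no literal meaning;
  it is encoded by the bound \<open>A2\<close> with limit \<open>\<alpha>\<close> and by the test
  functions in \<open>CLT\<close>. The quadratic majorant of a ln a needs exactly these two. B n
  costs only its mass and its integral of t log^+ t. By \<open>XG\<close> functions of X n alone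
  integrate as on the real line, although \<mu> n has infinite mass.\<close>

lemma entropy_limit:
  fixes \<mu> :: "nat \<Rightarrow> 'c measure" and X p A B :: "nat \<Rightarrow> 'c \<Rightarrow> real" and \<sigma> :: real
  assumes s: "\<sigma> > 0"
    and [measurable]: "\<And>n. X n \<in> borel_measurable (\<mu> n)" "\<And>n. p n \<in> borel_measurable (\<mu> n)"
      "\<And>n. A n \<in> borel_measurable (\<mu> n)" "\<And>n. B n \<in> borel_measurable (\<mu> n)"
    and A0: "\<And>n w. A n w \<ge> 0" and B0: "\<And>n w. B n w \<ge> 0" and p0: "\<And>n w. p n w \<ge> 0"
    and pAB: "\<And>n. AE w in \<mu> n. p n w = A n w + B n w"
    and p1: "\<And>n. (\<integral>\<^sup>+ w. ennreal (p n w) \<partial>\<mu> n) = 1"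
    and px2: "\<And>n. (\<integral>\<^sup>+ w. ennreal (p n w * (X n w)\<^sup>2) \<partial>\<mu> n) = ennreal (\<sigma>\<^sup>2)"
    and A2: "\<And>n. (\<integral>\<^sup>+ w. ennreal ((A n w)\<^sup>2) \<partial>\<mu> n) \<le> ennreal (\<alpha> n)"
    and \<alpha>: "\<alpha> \<longlonglongrightarrow> 1 / (2 * \<sigma> * sqrt pi)"
    and B1: "\<And>n. (\<integral>\<^sup>+ w. ennreal (B n w) \<partial>\<mu> n) \<le> ennreal (\<beta> n)"
    and \<beta>: "\<beta> \<longlonglongrightarrow> 0"
    and B2: "\<And>n. (\<integral>\<^sup>+ w. ennreal (B n w * max 0 (ln (B n w))) \<partial>\<mu> n) \<le> ennreal (\<gamma> n)"
    and \<gamma>: "\<gamma> \<longlonglongrightarrow> 0"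
    and nonneg: "\<And>n. \<alpha> n \<ge> 0" "\<And>n. \<beta> n \<ge> 0" "\<And>n. \<gamma> n \<ge> 0"
    and XG: "\<And>n. distr (\<mu> n) borel (X n) = lborel"
    and CLT: "\<And>F. continuous_on UNIV F \<Longrightarrow> bounded (range F) \<Longrightarrow>
      (\<lambda>n. LINT w|\<mu> n. p n w * F (X n w)) \<longlonglongrightarrow> (LINT x|lborel. normal_density 0 \<sigma> x * F x)"
  shows "integrable (\<mu> n) (\<lambda>w. p n w * ln (p n w))"
    and "(\<lambda>n. LINT w|\<mu> n. p n w * ln (p n w)) \<longlonglongrightarrow> - (1 / 2 * ln (2 * pi * exp 1 * \<sigma>\<^sup>2))"
proof -
  define \<phi> where "\<phi> = normal_density 0 \<sigma>"
  have \<phi>0: "\<phi> x > 0" for x unfolding \<phi>_def using s by (rule normal_density_pos)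
  have \<phi>m [measurable]: "\<phi> \<in> borel_measurable borel" unfolding \<phi>_def by simp
  have i\<phi>: "integrable lborel \<phi>" "(LINT x|lborel. \<phi> x) = 1" unfolding \<phi>_def using s by auto
  define C where "C = 1 / sqrt (2 * pi * \<sigma>\<^sup>2)"
  have \<phi>C: "\<phi> x \<le> C" for x unfolding \<phi>_def C_def by (rule normal_density_le)
  have C0: "C > 0" using \<phi>0[of 0] \<phi>C[of 0] by simp
  let ?H = "1 / 2 * ln (2 * pi * exp 1 * \<sigma>\<^sup>2)"
  have intX: "integrable (\<mu> n) (\<lambda>w. G (X n w))" "(LINT w|\<mu> n. G (X n w)) = (LINT x|lborel. G x)"
    if "integrable lborel G" for G :: "real \<Rightarrow> real" and n
  proof -
    have [measurable]: "G \<in> borel_measurable borel" using borel_measurable_integrable[OF that] by simp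
    show "integrable (\<mu> n) (\<lambda>w. G (X n w))"
      using that unfolding XG[of n, symmetric] by (subst (asm) integrable_distr_eq) auto
    show "(LINT w|\<mu> n. G (X n w)) = (LINT x|lborel. G x)"
      unfolding XG[of n, symmetric] by (subst integral_distr) auto
  qed
  have ip: "integrable (\<mu> n) (p n)" "(LINT w|\<mu> n. p n w) = 1" for n
  proof -
    show "integrable (\<mu> n) (p n)" by (rule integrableI_nonneg) (use p0 p1 in auto)
    show "(LINT w|\<mu> n. p n w) = 1" by (subst integral_eq_nn_integral) (use p0 p1 in auto)
  qed
  have ix2: "integrable (\<mu> n) (\<lambda>w. p n w * (X n w)\<^sup>2)" "(LINT w|\<mu> n. p n w * (X n w)\<^sup>2) = \<sigma>\<^sup>2" for n
  proof -
    show "integrable (\<mu> n) (\<lambda>w. p n w * (X n w)\<^sup>2)" by (rule integrableI_nonneg) (use p0 px2 in auto)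
    show "(LINT w|\<mu> n. p n w * (X n w)\<^sup>2) = \<sigma>\<^sup>2" by (subst integral_eq_nn_integral) (use p0 px2 in auto)
  qed
  have iA2: "integrable (\<mu> n) (\<lambda>w. (A n w)\<^sup>2)" "(LINT w|\<mu> n. (A n w)\<^sup>2) \<le> \<alpha> n" for n
  proof -
    show "integrable (\<mu> n) (\<lambda>w. (A n w)\<^sup>2)"
      by (rule integrableI_nonneg) (use le_less_trans[OF A2] in auto)
    show "(LINT w|\<mu> n. (A n w)\<^sup>2) \<le> \<alpha> n"
      by (rule integral_real_bounded) (use A2 nonneg in auto)
  qed
  have iB: "integrable (\<mu> n) (B n)" "(LINT w|\<mu> n. B n w) \<le> \<beta> n" for n
  proof -
    show "integrable (\<mu> n) (B n)"
      by (rule integrableI_nonneg) (use le_less_trans[OF B1] B0 in auto)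
    show "(LINT w|\<mu> n. B n w) \<le> \<beta> n"
      by (rule integral_real_bounded) (use B1 nonneg in auto)
  qed
  have iPB: "integrable (\<mu> n) (\<lambda>w. B n w * max 0 (ln (B n w)))" "(LINT w|\<mu> n. B n w * max 0 (ln (B n w))) \<le> \<gamma> n" for n
  proof -
    show "integrable (\<mu> n) (\<lambda>w. B n w * max 0 (ln (B n w)))"
      by (rule integrableI_nonneg) (use le_less_trans[OF B2] B0 in auto)
    show "(LINT w|\<mu> n. B n w * max 0 (ln (B n w))) \<le> \<gamma> n"
      by (rule integral_real_bounded) (use B2 nonneg in auto)
  qed
  have iA: "integrable (\<mu> n) (A n)" "(LINT w|\<mu> n. A n w) \<le> 1" for n
  proof -
    show i: "integrable (\<mu> n) (A n)"
      by (rule Bochner_Integration.integrable_bound[OF ip(1)[of n]])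
         (use pAB[of n] A0[of n] B0[of n] in \<open>auto elim!: eventually_mono\<close>)
    have "(LINT w|\<mu> n. A n w) \<le> (LINT w|\<mu> n. p n w)"
      by (rule integral_mono_AE[OF i ip(1)]) (use pAB[of n] B0[of n] in \<open>auto elim!: eventually_mono\<close>)
    with ip show "(LINT w|\<mu> n. A n w) \<le> 1" by simp
  qed
  define g where "g c x = max (\<phi> x) c" for c x
  \<comment> \<open>\<open>F c\<close> and \<open>G c\<close> are the coefficient of a and the
    constant term of \<open>xlnx_upper\<close> at f = \<phi>. The floor c in \<open>g\<close> makes
    \<open>F c\<close> bounded and continuous, as a test function for \<open>CLT\<close> has to be,
    and \<open>G c\<close> integrable.\<close>
  define F where "F c x = ln (g c x) - 1 - 2 * \<phi> x / c + 2 * \<phi> x / g c x" for c x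
  define G where "G c x = (\<phi> x)\<^sup>2 / c - (\<phi> x)\<^sup>2 / g c x" for c x
  have gc: "c \<le> g c x \<and> \<phi> x \<le> g c x" for c x by (auto simp: g_def)
  then have gc1: "c \<le> g c x" for c x by blast
  have \<phi>g: "0 \<le> \<phi> x / g c x" "\<phi> x / g c x \<le> 1" if "c > 0" for c x
    using gc[of c x] \<phi>0[of x] that by (auto simp: divide_le_eq_1)
  have cont_g: "continuous_on UNIV (g c)" for c
    unfolding g_def[abs_def] \<phi>_def
    by (intro continuous_intros continuous_at_imp_continuous_on ballI isCont_normal_density s)
  have cont_\<phi>: "continuous_on UNIV \<phi>"
    unfolding \<phi>_def by (intro continuous_at_imp_continuous_on ballI isCont_normal_density s)
  have cont_F: "continuous_on UNIV (F c)" if "c > 0" for c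
    unfolding F_def[abs_def] using that gc1[of c]
    by (intro continuous_intros cont_g cont_\<phi>) (metis less_le_trans less_irrefl)+
  have [measurable]: "F c \<in> borel_measurable borel" "G c \<in> borel_measurable borel" "g c \<in> borel_measurable borel" for c
    unfolding F_def[abs_def] G_def[abs_def] g_def[abs_def] by measurable
  have bdF: "\<exists>K\<ge>0. \<forall>x. \<bar>F c x\<bar> \<le> K" if c: "c > 0" for c
  proof (intro exI conjI allI)
    fix x
    have "ln c \<le> ln (g c x)" "ln (g c x) \<le> ln (max C c)"
      using c gc[of c x] \<phi>C[of x] by (auto simp: g_def)
    then have "\<bar>ln (g c x)\<bar> \<le> \<bar>ln c\<bar> + \<bar>ln (max C c)\<bar>" by linarith
    moreover have "\<bar>2 * \<phi> x / c\<bar> \<le> 2 * C / c"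
      using \<phi>0[of x] \<phi>C[of x] c by (auto simp: abs_mult divide_right_mono)
    moreover have "\<bar>2 * \<phi> x / g c x\<bar> \<le> 2" using \<phi>g[OF c, of x] by auto
    ultimately show "\<bar>F c x\<bar> \<le> \<bar>ln c\<bar> + \<bar>ln (max C c)\<bar> + 1 + 2 * C / c + 2" unfolding F_def by linarith
  qed (use c C0 in auto)
  have i\<phi>2: "integrable lborel (\<lambda>x. (\<phi> x)\<^sup>2)" "(LINT x|lborel. (\<phi> x)\<^sup>2) = 1 / (2 * \<sigma> * sqrt pi)"
    unfolding \<phi>_def by (rule integral_normal_density_sq[OF s])+
  have i\<phi>g: "integrable lborel (\<lambda>x. (\<phi> x)\<^sup>2 / g c x)" if c: "c > 0" for c
  proof (rule Bochner_Integration.integrable_bound[OF i\<phi>(1)])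
    show "AE x in lborel. norm ((\<phi> x)\<^sup>2 / g c x) \<le> norm (\<phi> x)"
    proof (rule AE_I2)
      fix x
      have "(\<phi> x)\<^sup>2 / g c x = \<phi> x * (\<phi> x / g c x)" by (simp add: power2_eq_square)
      also have "\<dots> \<le> \<phi> x" using \<phi>g[OF c, of x] \<phi>0[of x] by (intro mult_left_le) auto
      finally show "norm ((\<phi> x)\<^sup>2 / g c x) \<le> norm (\<phi> x)" using \<phi>0[of x] gc[of c x] c by simp
    qed
  qed measurable
  have iG: "integrable lborel (G c)" if "c > 0" for c
    unfolding G_def[abs_def] using i\<phi>2 i\<phi>g[OF that] by auto
  \<comment> \<open>\<open>U\<close> majorises p ln p pointwise and \<open>R\<close> bounds its
    integral. For fixed c and e, \<open>R\<close> tends to \<open>V c - ln (1 - e)\<close> as n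
    grows; c and e go to 0 only afterwards.\<close>
  define V where "V c = 1 / (2 * \<sigma> * sqrt pi) / c + (LINT x|lborel. \<phi> x * F c x) + (LINT x|lborel. G c x)" for c
  define U where "U c e n w = (A n w)\<^sup>2 / c + A n w * F c (X n w) + G c (X n w)
      + B n w * max 0 (ln (B n w)) - A n w * ln (1 - e) - B n w * ln e" for c e n w
  define R where "R c K e n = \<alpha> n / c + (LINT w|\<mu> n. p n w * F c (X n w)) + K * \<beta> n + (LINT x|lborel. G c x)
      + \<gamma> n - ln (1 - e) - \<beta> n * ln e" for c K e n
  have U: "integrable (\<mu> n) (U c e n)" "(LINT w|\<mu> n. U c e n w) \<le> R c K e n" "AE w in \<mu> n. p n w * ln (p n w) \<le> U c e n w"
    if c: "c > 0" and e: "0 < e" "e < 1" and K: "\<And>x. \<bar>F c x\<bar> \<le> K" for c e K n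
  proof -
    have bdd: "integrable (\<mu> n) (\<lambda>w. h w * F c (X n w))" if "integrable (\<mu> n) h" for h
    proof (rule Bochner_Integration.integrable_bound)
      have [measurable]: "h \<in> borel_measurable (\<mu> n)" using that by auto
      show "(\<lambda>w. h w * F c (X n w)) \<in> borel_measurable (\<mu> n)" by measurable
      show "integrable (\<mu> n) (\<lambda>w. h w * K)" using that by simp
      show "AE w in \<mu> n. norm (h w * F c (X n w)) \<le> norm (h w * K)"
        by (rule AE_I2) (auto simp: abs_mult intro!: mult_left_mono order_trans[OF K])
    qed
    note iAF = bdd[OF iA(1)[of n]] and iBF = bdd[OF iB(1)[of n]] and ipF = bdd[OF ip(1)[of n]]
    note ints = iA2[of n] iAF iA[of n] iB[of n] iPB[of n] intX[OF iG[OF c], of n]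
    show "integrable (\<mu> n) (U c e n)" unfolding U_def[abs_def]
      by (intro Bochner_Integration.integrable_add Bochner_Integration.integrable_diff
          integrable_divide_zero integrable_mult_left ints)
    have "(LINT w|\<mu> n. U c e n w) = (LINT w|\<mu> n. (A n w)\<^sup>2) / c + (LINT w|\<mu> n. A n w * F c (X n w)) + (LINT x|lborel. G c x)
        + (LINT w|\<mu> n. B n w * max 0 (ln (B n w))) - (LINT w|\<mu> n. A n w) * ln (1 - e) - (LINT w|\<mu> n. B n w) * ln e"
      unfolding U_def using ints by simp
    \<comment> \<open>\<open>CLT\<close> concerns p only, so A is written as p - B; the integral of
      B F is at most K times the vanishing mass of B.\<close>
    also have "(LINT w|\<mu> n. A n w * F c (X n w)) = (LINT w|\<mu> n. p n w * F c (X n w)) - (LINT w|\<mu> n. B n w * F c (X n w))"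
      unfolding Bochner_Integration.integral_diff[OF ipF iBF, symmetric]
      by (rule integral_cong_AE) (use pAB[of n] in \<open>auto elim!: eventually_mono simp: algebra_simps\<close>)
    also have "(LINT w|\<mu> n. (A n w)\<^sup>2) / c + ((LINT w|\<mu> n. p n w * F c (X n w)) - (LINT w|\<mu> n. B n w * F c (X n w))) + (LINT x|lborel. G c x)
        + (LINT w|\<mu> n. B n w * max 0 (ln (B n w))) - (LINT w|\<mu> n. A n w) * ln (1 - e) - (LINT w|\<mu> n. B n w) * ln e \<le> R c K e n"
    proof -
      have "(LINT w|\<mu> n. (A n w)\<^sup>2) / c \<le> \<alpha> n / c" using c iA2 by (intro divide_right_mono) auto
      moreover have "- (LINT w|\<mu> n. B n w * F c (X n w)) \<le> K * \<beta> n"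
      proof -
        have K0: "K \<ge> 0" using K[of 0] by linarith
        have "- (LINT w|\<mu> n. B n w * F c (X n w)) = (LINT w|\<mu> n. - (B n w * F c (X n w)))" by simp
        also have "\<dots> \<le> (LINT w|\<mu> n. K * B n w)"
        proof (rule integral_mono)
          show "- (B n w * F c (X n w)) \<le> K * B n w" for w
            using mult_left_mono[of "- F c (X n w)" K "B n w"] B0[of n w] K[of "X n w"] by (simp add: mult.commute abs_le_iff)
        qed (use iBF iB in auto)
        also have "\<dots> \<le> K * \<beta> n" using iB[of n] K0 by (auto intro!: mult_left_mono)
        finally show ?thesis .
      qed
      moreover have "(LINT w|\<mu> n. A n w) * (- ln (1 - e)) \<le> 1 * (- ln (1 - e))"
        using e iA[of n] by (intro mult_right_mono) auto
      moreover have "(LINT w|\<mu> n. B n w) * (- ln e) \<le> \<beta> n * (- ln e)"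
        using e iB[of n] by (intro mult_right_mono) auto
      ultimately show ?thesis unfolding R_def using iPB(2)[of n] by simp
    qed
    finally show "(LINT w|\<mu> n. U c e n w) \<le> R c K e n" .
    show "AE w in \<mu> n. p n w * ln (p n w) \<le> U c e n w"
      using pAB[of n]
    proof eventually_elim
      case (elim w)
      have "B n w * ln (B n w) \<le> B n w * max 0 (ln (B n w))" using B0[of n w] by (intro mult_left_mono) auto
      then show ?case
        using log_sum_le[OF A0[of n w] B0[of n w] e] xlnx_upper[OF A0[of n w] c gc1[of c "X n w"], of "\<phi> (X n w)"]
        unfolding elim U_def F_def G_def by linarith
    qed
  qed
  \<comment> \<open>The second moment is exactly \<sigma>^2, so the Gibbs bound against \<phi> takes
    the limiting value for every n, not only in the limit.\<close>
  have low: "integrable (\<mu> n) (\<lambda>w. p n w * ln (\<phi> (X n w)) + p n w - \<phi> (X n w))"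
     "(LINT w|\<mu> n. p n w * ln (\<phi> (X n w)) + p n w - \<phi> (X n w)) = - ?H" for n
  proof -
    have eq: "p n w * ln (\<phi> (X n w)) = p n w * (- ln (2 * pi * \<sigma>\<^sup>2) / 2) - p n w * (X n w)\<^sup>2 / (2 * \<sigma>\<^sup>2)" for w
      unfolding \<phi>_def ln_normal_density[OF s] by (simp add: algebra_simps)
    show "integrable (\<mu> n) (\<lambda>w. p n w * ln (\<phi> (X n w)) + p n w - \<phi> (X n w))"
      unfolding eq using ip ix2 intX[OF i\<phi>(1)] by auto
    have "(LINT w|\<mu> n. p n w * ln (\<phi> (X n w)) + p n w - \<phi> (X n w)) = - ln (2 * pi * \<sigma>\<^sup>2) / 2 - \<sigma>\<^sup>2 / (2 * \<sigma>\<^sup>2)"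
      unfolding eq using ip ix2 intX[OF i\<phi>(1)] i\<phi> by simp
    also have "\<dots> = - ?H" using s by (simp add: ln_mult) (simp add: field_simps)
    finally show "(LINT w|\<mu> n. p n w * ln (\<phi> (X n w)) + p n w - \<phi> (X n w)) = - ?H" .
  qed
  have lowle: "p n w * ln (\<phi> (X n w)) + p n w - \<phi> (X n w) \<le> p n w * ln (p n w)" for n w
    by (rule xlnx_lower[OF p0 \<phi>0])
  show int: "integrable (\<mu> n) (\<lambda>w. p n w * ln (p n w))" for n
  proof -
    obtain K where K: "\<And>x. \<bar>F 1 x\<bar> \<le> K" using bdF[of 1] by auto
    have UU: "integrable (\<mu> n) (U 1 (1/2) n)" "AE w in \<mu> n. p n w * ln (p n w) \<le> U 1 (1/2) n w"
      using U[of 1 "1/2" K n] K by auto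
    show ?thesis
    proof (rule Bochner_Integration.integrable_bound)
      show "integrable (\<mu> n) (\<lambda>w. \<bar>U 1 (1/2) n w\<bar> + \<bar>p n w * ln (\<phi> (X n w)) + p n w - \<phi> (X n w)\<bar>)"
        using UU low by auto
      show "AE w in \<mu> n. norm (p n w * ln (p n w)) \<le> norm (\<bar>U 1 (1/2) n w\<bar> + \<bar>p n w * ln (\<phi> (X n w)) + p n w - \<phi> (X n w)\<bar>)"
        using UU(2) by eventually_elim (use lowle[of n] in \<open>smt (verit) real_norm_def\<close>)
    qed auto
  qed
  have lower: "- ?H \<le> (LINT w|\<mu> n. p n w * ln (p n w))" for n
    unfolding low(2)[of n, symmetric] by (rule integral_mono[OF low(1) int lowle])
  have Vlim: "(\<lambda>k. V (1 / real (Suc k))) \<longlonglongrightarrow> - ?H"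
  proof -
    \<comment> \<open>At a = \<phi> the terms with 1 / c cancel, and what remains has a limit as c
      tends to 0.\<close>
    have Veq: "V c = (LINT x|lborel. \<phi> x * ln (g c x) - \<phi> x + (\<phi> x)\<^sup>2 / g c x)" if c: "c > 0" for c
    proof -
      obtain K where K: "\<And>x. \<bar>F c x\<bar> \<le> K" using bdF[OF c] by auto
      have i1: "integrable lborel (\<lambda>x. \<phi> x * F c x)"
      proof (rule Bochner_Integration.integrable_bound)
        show "integrable lborel (\<lambda>x. \<phi> x * K)" using i\<phi> by simp
        show "AE x in lborel. norm (\<phi> x * F c x) \<le> norm (\<phi> x * K)"
          by (rule AE_I2) (auto simp: abs_mult intro!: mult_left_mono order_trans[OF K])
      qed measurable
      have "V c = (LINT x|lborel. (\<phi> x)\<^sup>2 / c + \<phi> x * F c x + G c x)"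
        unfolding V_def i\<phi>2(2)[symmetric] using i1 iG[OF c] i\<phi>2(1) by simp
      also have "\<dots> = (LINT x|lborel. \<phi> x * ln (g c x) - \<phi> x + (\<phi> x)\<^sup>2 / g c x)"
        by (rule Bochner_Integration.integral_cong) (auto simp: F_def G_def algebra_simps power2_eq_square)
      finally show ?thesis .
    qed
    have "(\<lambda>k. LINT x|lborel. \<phi> x * ln (g (1 / real (Suc k)) x) - \<phi> x + (\<phi> x)\<^sup>2 / g (1 / real (Suc k)) x)
        \<longlonglongrightarrow> (LINT x|lborel. \<phi> x * ln (\<phi> x))"
    proof (rule integral_dominated_convergence)
      have "integrable lborel (\<lambda>x. \<phi> x * ln (\<phi> x))"
        unfolding \<phi>_def by (rule integral_normal_ln_normal[OF s])
      then show "integrable lborel (\<lambda>x. \<bar>\<phi> x * ln (\<phi> x)\<bar> + 2 * \<phi> x)" using i\<phi> by auto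
      show "AE x in lborel. (\<lambda>k. \<phi> x * ln (g (1 / real (Suc k)) x) - \<phi> x + (\<phi> x)\<^sup>2 / g (1 / real (Suc k)) x)
        \<longlonglongrightarrow> \<phi> x * ln (\<phi> x)"
      proof (rule AE_I2)
        fix x
        have "(\<lambda>k. g (1 / real (Suc k)) x) \<longlonglongrightarrow> max (\<phi> x) 0"
          unfolding g_def by (intro tendsto_intros LIMSEQ_Suc[OF lim_const_over_n])
        then have "(\<lambda>k. g (1 / real (Suc k)) x) \<longlonglongrightarrow> \<phi> x" using \<phi>0[of x] by (simp add: max_def)
        then have "(\<lambda>k. \<phi> x * ln (g (1 / real (Suc k)) x) - \<phi> x + (\<phi> x)\<^sup>2 / g (1 / real (Suc k)) x)
          \<longlonglongrightarrow> \<phi> x * ln (\<phi> x) - \<phi> x + (\<phi> x)\<^sup>2 / \<phi> x"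
          using \<phi>0[of x] by (intro tendsto_intros) auto
        then show "(\<lambda>k. \<phi> x * ln (g (1 / real (Suc k)) x) - \<phi> x + (\<phi> x)\<^sup>2 / g (1 / real (Suc k)) x)
          \<longlonglongrightarrow> \<phi> x * ln (\<phi> x)" using \<phi>0[of x] by (simp add: power2_eq_square)
      qed
      show "AE x in lborel. norm (\<phi> x * ln (g (1 / real (Suc k)) x) - \<phi> x + (\<phi> x)\<^sup>2 / g (1 / real (Suc k)) x)
          \<le> \<bar>\<phi> x * ln (\<phi> x)\<bar> + 2 * \<phi> x" for k
      proof (rule AE_I2)
        fix x
        let ?c = "1 / real (Suc k)"
        have c: "?c > 0" "?c \<le> 1" by auto
        have "ln (\<phi> x) \<le> ln (g ?c x)" using gc[of ?c x] \<phi>0[of x] by simp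
        \<comment> \<open>Since c <= 1, raising \<phi> to the level c keeps the logarithm between ln
          \<phi> and max (ln \<phi>) 0; hence |ln \<phi>| dominates it for all c at once.\<close>
        moreover have "ln (g ?c x) \<le> max (ln (\<phi> x)) 0"
        proof (cases "\<phi> x \<le> ?c")
          case True
          have "ln ?c \<le> 0" using c by (simp only: ln_le_zero_iff)
          moreover have "g ?c x = ?c" using True by (simp only: g_def max_absorb2)
          ultimately show ?thesis by (simp only: le_max_iff_disj) simp
        qed (auto simp: g_def)
        ultimately have "\<bar>ln (g ?c x)\<bar> \<le> \<bar>ln (\<phi> x)\<bar>" by linarith
        then have "\<bar>\<phi> x * ln (g ?c x)\<bar> \<le> \<bar>\<phi> x * ln (\<phi> x)\<bar>" by (simp add: abs_mult mult_left_mono)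
        moreover have "\<bar>(\<phi> x)\<^sup>2 / g ?c x\<bar> \<le> \<phi> x"
        proof -
          have "(\<phi> x)\<^sup>2 / g ?c x = \<phi> x * (\<phi> x / g ?c x)" by (simp add: power2_eq_square)
          also have "\<dots> \<le> \<phi> x" using \<phi>g[OF c(1), of x] \<phi>0[of x] by (intro mult_left_le) auto
          finally have "(\<phi> x)\<^sup>2 / g ?c x \<le> \<phi> x" .
          moreover have "0 \<le> (\<phi> x)\<^sup>2 / g ?c x" using order_trans[OF less_imp_le[OF c(1)] gc1[of ?c x]] by (intro divide_nonneg_nonneg) (auto simp del: of_nat_Suc)
          ultimately show ?thesis by (simp only: abs_of_nonneg)
        qed
        ultimately show "norm (\<phi> x * ln (g ?c x) - \<phi> x + (\<phi> x)\<^sup>2 / g ?c x) \<le> \<bar>\<phi> x * ln (\<phi> x)\<bar> + 2 * \<phi> x"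
          using \<phi>0[of x] unfolding real_norm_def by linarith
      qed
    qed measurable
    moreover have "(LINT x|lborel. \<phi> x * ln (\<phi> x)) = - ?H"
      unfolding \<phi>_def by (rule integral_normal_ln_normal[OF s])
    ultimately show ?thesis by (simp add: Veq del: of_nat_Suc)
  qed
  show "(\<lambda>n. LINT w|\<mu> n. p n w * ln (p n w)) \<longlonglongrightarrow> - ?H"
  proof (rule order_tendstoI)
    fix a assume "a < - ?H"
    then show "\<forall>\<^sub>F n in sequentially. a < (LINT w|\<mu> n. p n w * ln (p n w))"
      by (intro always_eventually allI less_le_trans[OF _ lower])
  next
    fix a assume a: "- ?H < a"
    \<comment> \<open>One sequence index drives both limits: c = 1 / (k + 1) and e = 1 / (k + 2),
      shifted so that e < 1 already at k = 0.\<close>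
    have "(\<lambda>k. 1 / real (Suc (Suc k))) \<longlonglongrightarrow> 0"
      by (intro LIMSEQ_Suc lim_const_over_n)
    then have "(\<lambda>k. V (1 / real (Suc k)) - ln (1 - 1 / real (Suc (Suc k)))) \<longlonglongrightarrow> - ?H - ln (1 - 0)"
      by (intro tendsto_diff[OF Vlim] tendsto_ln tendsto_diff tendsto_const) auto
    then have "(\<lambda>k. V (1 / real (Suc k)) - ln (1 - 1 / real (Suc (Suc k)))) \<longlonglongrightarrow> - ?H" by simp
    from order_tendstoD(2)[OF this a] obtain k where
      k: "V (1 / real (Suc k)) - ln (1 - 1 / real (Suc (Suc k))) < a"
      using eventually_happens'[OF sequentially_bot] by blast
    define c where "c = 1 / real (Suc k)"
    define e where "e = 1 / real (Suc (Suc k))"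
    have c: "c > 0" and e: "0 < e" "e < 1" by (auto simp: c_def e_def)
    obtain K where K: "\<And>x. \<bar>F c x\<bar> \<le> K" using bdF[OF c] by auto
    have "bounded (range (F c))" using K by (auto simp: bounded_iff)
    from CLT[OF cont_F[OF c] this]
    have "R c K e \<longlonglongrightarrow> 1 / (2 * \<sigma> * sqrt pi) / c + (LINT x|lborel. \<phi> x * F c x) + K * 0
        + (LINT x|lborel. G c x) + 0 - ln (1 - e) - 0 * ln e"
      unfolding R_def[abs_def] \<phi>_def[symmetric] using c
      by (intro tendsto_intros \<alpha> \<beta> \<gamma>) auto
    then have "R c K e \<longlonglongrightarrow> V c - ln (1 - e)" by (simp add: V_def)
    then have "\<forall>\<^sub>F n in sequentially. R c K e n < a"
      by (rule order_tendstoD(2)) (use k in \<open>simp add: c_def e_def\<close>)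
    then show "\<forall>\<^sub>F n in sequentially. (LINT w|\<mu> n. p n w * ln (p n w)) < a"
    proof eventually_elim
      case (elim n)
      have "(LINT w|\<mu> n. p n w * ln (p n w)) \<le> (LINT w|\<mu> n. U c e n w)"
        by (rule integral_mono_AE[OF int U(1,3)[OF c e K]])
      also have "\<dots> \<le> R c K e n" by (rule U(2)[OF c e K])
      finally show ?case using elim by simp
    qed
  qed
qed

section \<open>Characteristic functions of densities\<close>

lemma one_minus_cos_le: "1 - cos (x::real) \<le> x\<^sup>2 / 2"
proof -
  have "1 - cos x = 2 * (sin (x / 2))\<^sup>2" using cos_double_sin[of "x / 2"] by simp
  moreover have "\<bar>sin (x/2)\<bar>\<^sup>2 \<le> \<bar>x/2\<bar>\<^sup>2" by (intro power_mono abs_sin_x_le_abs_x) auto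
  ultimately show ?thesis by (simp add: power_divide)
qed

lemma tendsto_sin_scaled: 
  assumes h: "h \<longlonglongrightarrow> (0::real)" "\<And>k. h k \<noteq> 0"
  shows "(\<lambda>k. sin (h k * x) / h k) \<longlonglongrightarrow> x"
proof -
  have "((\<lambda>t. sin (t * x)) has_real_derivative x) (at 0)"
    by (auto intro!: derivative_eq_intros)
  then have "((\<lambda>t. sin (t * x) / t) \<longlongrightarrow> x) (at 0)"
    by (simp add: DERIV_def)
  then show ?thesis using h by (auto simp: tendsto_at_iff_sequentially comp_def)
qed

context
  fixes d :: "real \<Rightarrow> real" and v :: real
  assumes d: "integrable lborel d" and d0: "\<And>x. d x \<ge> 0" and d1: "(LINT x|lborel. d x) = 1"
begin

lemma measurable_d [measurable]: "d \<in> borel_measurable borel"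
  using borel_measurable_integrable[OF d] by simp

lemma norm_FT_density_le_1: "norm (FT d t) \<le> 1"
  using norm_FT_le[of d t] d0 d1 by simp

lemma integrable_density_bounded:
  assumes [measurable]: "c \<in> borel_measurable borel" and "\<And>x. \<bar>c x\<bar> \<le> (1::real)"
  shows "integrable lborel (\<lambda>x. d x * c x)"
  by (rule Bochner_Integration.integrable_bound[OF d])
     (use d0 assms(2) in \<open>auto simp: abs_mult intro!: mult_left_le\<close>)

lemma Re_FT: "Re (FT d t) = (LINT x|lborel. d x * cos (t * x))"
proof -
  have "Re (FT d t) = (LINT x|lborel. Re (complex_of_real (d x) * iexp (t * x)))"
    unfolding FT_def by (rule integral_Re[symmetric, OF integrable_FT[OF d]])
  then show ?thesis by (simp add: Re_exp)
qed

lemma Im_FT: "Im (FT d t) = (LINT x|lborel. d x * sin (t * x))"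
proof -
  have "Im (FT d t) = (LINT x|lborel. Im (complex_of_real (d x) * iexp (t * x)))"
    unfolding FT_def by (rule integral_Im[symmetric, OF integrable_FT[OF d]])
  then show ?thesis by (simp add: Im_exp)
qed

lemma one_minus_Re_FT: "1 - Re (FT d t) = (LINT x|lborel. d x * (1 - cos (t * x)))"
proof -
  have "1 - Re (FT d t) = (LINT x|lborel. d x) - (LINT x|lborel. d x * cos (t * x))" by (simp add: Re_FT d1)
  also have "\<dots> = (LINT x|lborel. d x - d x * cos (t * x))"
    by (rule Bochner_Integration.integral_diff[symmetric]) (auto intro!: d integrable_density_bounded)
  finally show ?thesis by (simp add: right_diff_distrib)
qed

text \<open>If the modulus were 1, rotation by the argument a would make the integral of d (1 - cos
  (t x - a)) vanish. Then d would live on an arithmetic progression, a null set, which a density of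
  mass 1 cannot do.\<close>

lemma norm_FT_less_1:
  assumes t: "t \<noteq> 0"
  shows "norm (FT d t) < 1"
proof (rule ccontr)
  assume "\<not> norm (FT d t) < 1"
  then have n1: "norm (FT d t) = 1" using norm_FT_density_le_1[of t] by simp
  define a where "a = Arg (FT d t)"
  have F: "FT d t = cis a" using rcis_cmod_Arg[of "FT d t"] n1 by (simp add: rcis_def a_def)
  have c: "integrable lborel (\<lambda>x. d x * cos (t * x))" "integrable lborel (\<lambda>x. d x * sin (t * x))"
    by (auto intro!: integrable_density_bounded)
  have eq: "d x * (1 - cos (t * x - a)) = d x - (d x * cos (t * x) * cos a + d x * sin (t * x) * sin a)" for x
    by (simp add: cos_diff algebra_simps)
  have "(LINT x|lborel. d x * (1 - cos (t * x - a))) = 1 - (Re (FT d t) * cos a + Im (FT d t) * sin a)"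
    unfolding eq Re_FT Im_FT using c d d1 by simp
  also have "\<dots> = 0" unfolding F by (simp add: power2_eq_square[symmetric])
  finally have "(LINT x|lborel. d x * (1 - cos (t * x - a))) = 0" .
  moreover have "integrable lborel (\<lambda>x. d x * (1 - cos (t * x - a)))"
    unfolding eq using c d by auto
  ultimately have "AE x in lborel. d x * (1 - cos (t * x - a)) = 0"
    using d0 by (subst (asm) integral_nonneg_eq_0_iff_AE) (auto intro!: AE_I2 mult_nonneg_nonneg)
  moreover have "countable {x. cos (t * x - a) = 1}"
  proof (rule countable_subset)
    show "{x. cos (t * x - a) = 1} \<subseteq> (\<lambda>n::int. (of_int n * 2 * pi + a) / t) ` UNIV"
    proof
      fix x assume "x \<in> {x. cos (t * x - a) = 1}"
      then obtain n :: int where "t * x - a = of_int n * 2 * pi" by (auto simp: cos_one_2pi_int)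
      then have "x = (of_int n * 2 * pi + a) / t" using t by (simp add: field_simps)
      then show "x \<in> (\<lambda>n::int. (of_int n * 2 * pi + a) / t) ` UNIV" by blast
    qed
  qed auto
  then have "AE x in lborel. x \<notin> {x. cos (t * x - a) = 1}"
    by (intro AE_not_in countable_imp_null_set_lborel)
  ultimately have "AE x in lborel. d x = 0" by eventually_elim auto
  then have "(LINT x|lborel. d x) = (LINT x|(lborel::real measure). 0)" by (intro integral_cong_AE) auto
  then show False using d1 by simp
qed

context
  assumes x2: "integrable lborel (\<lambda>x. d x * x\<^sup>2)" and v: "(LINT x|lborel. d x * x\<^sup>2) = v"
begin

lemma integrable_density_x: "integrable lborel (\<lambda>x. d x * \<bar>x\<bar>)"
proof (rule Bochner_Integration.integrable_bound)
  show "integrable lborel (\<lambda>x. d x + d x * x\<^sup>2)" using d x2 by simp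
  show "AE x in lborel. norm (d x * \<bar>x\<bar>) \<le> norm (d x + d x * x\<^sup>2)"
  proof (rule AE_I2)
    fix x :: real
    have "\<bar>x\<bar> \<le> 1 + x\<^sup>2" using sum_squares_bound[of 1 "\<bar>x\<bar>"] by simp
    from mult_left_mono[OF this d0[of x]]
    show "norm (d x * \<bar>x\<bar>) \<le> norm (d x + d x * x\<^sup>2)" using d0[of x] by (simp add: abs_mult distrib_left)
  qed
qed measurable

text \<open>The imaginary part is dropped, then 1 - x^2 <= 2 (1 - x) and 1 - cos u <= u^2 / 2 are
  used. After division by t^2 the bound no longer depends on t, and so dominates the average over
  labels.\<close>

lemma one_minus_norm_FT_sq_le: "1 - (norm (FT d t))\<^sup>2 \<le> v * t\<^sup>2"
proof -
  have R: "\<bar>Re (FT d t)\<bar> \<le> 1" using abs_Re_le_cmod[of "FT d t"] norm_FT_density_le_1[of t] by linarith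
  have "1 - (norm (FT d t))\<^sup>2 \<le> 1 - (Re (FT d t))\<^sup>2" by (simp add: cmod_power2)
  also have "\<dots> = (1 - Re (FT d t)) * (1 + Re (FT d t))" by (simp add: power2_eq_square algebra_simps)
  also have "\<dots> \<le> (1 - Re (FT d t)) * 2" using R by (intro mult_left_mono) auto
  also have "1 - Re (FT d t) \<le> (LINT x|lborel. t\<^sup>2 / 2 * (d x * x\<^sup>2))"
    unfolding one_minus_Re_FT
  proof (rule integral_mono)
    have "\<bar>(1 - c) / 2\<bar> \<le> 1" if "- 1 \<le> c" "c \<le> 1" for c :: real using that by (simp add: abs_le_iff)
    then have *: "\<bar>(1 - cos u) / 2\<bar> \<le> 1" for u :: real
      using cos_ge_minus_one[of u] cos_le_one[of u] by blast
    show "integrable lborel (\<lambda>x. d x * (1 - cos (t * x)))"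
      using integrable_mult_right[OF integrable_density_bounded[of "\<lambda>x. (1 - cos (t * x)) / 2"], of 2] * by simp
    show "integrable lborel (\<lambda>x. t\<^sup>2 / 2 * (d x * x\<^sup>2))" using x2 by simp
    show "d x * (1 - cos (t * x)) \<le> t\<^sup>2 / 2 * (d x * x\<^sup>2)" for x
      using mult_left_mono[OF one_minus_cos_le[of "t * x"] d0[of x]] by (simp add: power_mult_distrib ac_simps)
  qed
  finally show ?thesis using v by (simp add: mult.commute)
qed

text \<open>In 1 - |FT|^2 = (1 - Re)(1 + Re) - Im^2, divided by h^2, the first term tends to (v / 2)
  2 and Im / h tends to the mean. Centring is thus what makes the limit equal to v.\<close>

lemma tendsto_one_minus_norm_FT_sq:
  assumes mean: "(LINT x|lborel. d x * x) = 0"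
    and h: "h \<longlonglongrightarrow> (0::real)" "\<And>k. h k \<noteq> 0"
  shows "(\<lambda>k. (1 - (norm (FT d (h k)))\<^sup>2) / (h k)\<^sup>2) \<longlonglongrightarrow> v"
proof -
  have A: "(\<lambda>k. LINT x|lborel. d x * (1 - cos (h k * x)) / (h k)\<^sup>2) \<longlonglongrightarrow> (LINT x|lborel. d x * (x\<^sup>2 / 2))"
  proof (rule integral_dominated_convergence)
    show "integrable lborel (\<lambda>x. d x * x\<^sup>2 / 2)" using x2 by simp
    show "AE x in lborel. (\<lambda>k. d x * (1 - cos (h k * x)) / (h k)\<^sup>2) \<longlonglongrightarrow> d x * (x\<^sup>2 / 2)"
    proof (rule AE_I2)
      fix x
      have eq: "d x * (1 - cos (h k * x)) / (h k)\<^sup>2 = d x * (2 * (sin (h k * (x / 2)) / h k)\<^sup>2)" for k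
        using cos_double_sin[of "h k * (x / 2)"] by (simp add: power_divide)
      have "(\<lambda>k. d x * (2 * (sin (h k * (x / 2)) / h k)\<^sup>2)) \<longlonglongrightarrow> d x * (2 * (x / 2)\<^sup>2)"
        by (intro tendsto_intros tendsto_sin_scaled h)
      then show "(\<lambda>k. d x * (1 - cos (h k * x)) / (h k)\<^sup>2) \<longlonglongrightarrow> d x * (x\<^sup>2 / 2)"
        unfolding eq by (simp add: power_divide)
    qed
    show "AE x in lborel. norm (d x * (1 - cos (h k * x)) / (h k)\<^sup>2) \<le> d x * x\<^sup>2 / 2" for k
    proof (rule AE_I2)
      fix x
      have "(1 - cos (h k * x)) / (h k)\<^sup>2 \<le> x\<^sup>2 / 2"
        using one_minus_cos_le[of "h k * x"] h(2)[of k] by (simp add: power_mult_distrib field_simps)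
      moreover have "(1 - cos (h k * x)) / (h k)\<^sup>2 \<ge> 0" by simp
      ultimately show "norm (d x * (1 - cos (h k * x)) / (h k)\<^sup>2) \<le> d x * x\<^sup>2 / 2"
        using mult_left_mono[of "(1 - cos (h k * x)) / (h k)\<^sup>2" "x\<^sup>2 / 2" "d x"] d0[of x] by (simp add: abs_mult)
    qed
  qed measurable
  have B: "(\<lambda>k. LINT x|lborel. d x * sin (h k * x) / h k) \<longlonglongrightarrow> (LINT x|lborel. d x * x)"
  proof (rule integral_dominated_convergence)
    show "integrable lborel (\<lambda>x. d x * \<bar>x\<bar>)" by (rule integrable_density_x)
    show "AE x in lborel. (\<lambda>k. d x * sin (h k * x) / h k) \<longlonglongrightarrow> d x * x"
      by (rule AE_I2) (use tendsto_mult_left[OF tendsto_sin_scaled[OF h]] in simp)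
    show "AE x in lborel. norm (d x * sin (h k * x) / h k) \<le> d x * \<bar>x\<bar>" for k
    proof (rule AE_I2)
      fix x
      have "\<bar>sin (h k * x)\<bar> / \<bar>h k\<bar> \<le> \<bar>x\<bar>"
        using abs_sin_x_le_abs_x[of "h k * x"] h(2)[of k] by (simp add: abs_mult field_simps)
      from mult_left_mono[OF this d0[of x]]
      show "norm (d x * sin (h k * x) / h k) \<le> d x * \<bar>x\<bar>" using d0[of x] by (simp add: abs_mult)
    qed
  qed measurable
  have A': "(\<lambda>k. (1 - Re (FT d (h k))) / (h k)\<^sup>2) \<longlonglongrightarrow> v / 2"
    using A v unfolding one_minus_Re_FT by simp
  have B': "(\<lambda>k. Im (FT d (h k)) / h k) \<longlonglongrightarrow> 0"
    using B mean unfolding Im_FT by simp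
  have C: "(\<lambda>k. Re (FT d (h k))) \<longlonglongrightarrow> 1"
  proof -
    have "(\<lambda>k. FT d (h k)) \<longlonglongrightarrow> FT d 0"
      using isCont_FT[OF d, of 0] h(1) by (rule isCont_tendsto_compose)
    then have "(\<lambda>k. Re (FT d (h k))) \<longlonglongrightarrow> Re (FT d 0)" by (rule tendsto_Re)
    then show ?thesis using d1 by (simp add: Re_FT)
  qed
  have "(\<lambda>k. (1 - Re (FT d (h k))) / (h k)\<^sup>2 * (1 + Re (FT d (h k))) - (Im (FT d (h k)) / h k)\<^sup>2)
      \<longlonglongrightarrow> v / 2 * (1 + 1) - 0\<^sup>2"
    by (intro tendsto_intros A' B' C)
  moreover have "(1 - Re (FT d (h k))) / (h k)\<^sup>2 * (1 + Re (FT d (h k))) - (Im (FT d (h k)) / h k)\<^sup>2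
      = (1 - (norm (FT d (h k)))\<^sup>2) / (h k)\<^sup>2" for k
    by (simp add: cmod_power2 power_divide diff_divide_distrib[symmetric]) (simp add: power2_eq_square algebra_simps)
  ultimately show ?thesis by simp
qed

end
end

declare measurable_d [measurable del]

lemma gauss_integral:
  assumes "\<sigma> > 0"
  shows "integrable lborel (\<lambda>u. exp (- (\<sigma>\<^sup>2 * u\<^sup>2)))" "(LINT u|lborel. exp (- (\<sigma>\<^sup>2 * u\<^sup>2))) = sqrt pi / \<sigma>"
proof -
  \<comment> \<open>This is the deviation for which 2 s^2 = 1 / \<sigma>^2, so that the integrand is
    a multiple of a normal density.\<close>
  define s where "s = 1 / (sqrt 2 * \<sigma>)"
  have s: "s > 0" using assms by (simp add: s_def)
  have s2: "2 * s\<^sup>2 = 1 / \<sigma>\<^sup>2" by (simp add: s_def power_mult_distrib power_divide)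
  have eq: "exp (- (\<sigma>\<^sup>2 * u\<^sup>2)) = sqrt pi / \<sigma> * normal_density 0 s u" for u
  proof -
    have "2 * pi * s\<^sup>2 = pi * (2 * s\<^sup>2)" by simp
    then have "2 * pi * s\<^sup>2 = pi / \<sigma>\<^sup>2" unfolding s2 by simp
    then have "sqrt (2 * pi * s\<^sup>2) = sqrt pi / \<sigma>" using assms by (simp add: real_sqrt_divide)
    then show ?thesis unfolding normal_density_def s2 using assms by (simp add: field_simps)
  qed
  show "integrable lborel (\<lambda>u. exp (- (\<sigma>\<^sup>2 * u\<^sup>2)))" "(LINT u|lborel. exp (- (\<sigma>\<^sup>2 * u\<^sup>2))) = sqrt pi / \<sigma>"
    unfolding eq using s by auto
qed

text \<open>Laplace's method. Near 0, q <= exp (- (1 - q)) and t = u / sqrt n produce exp (-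
  \<sigma>^2 u^2) in the limit, with integral sqrt pi / \<sigma>. Away from 0, q <= \<theta> < 1,
  and the geometric factor beats the polynomial bound 2 pi n on the integral of w. The sequence
  \<alpha> is chosen before w, since the weight used later changes with n.\<close>

lemma power_char_integral_bound:
  fixes q :: "real \<Rightarrow> real" and n0 :: nat
  assumes s: "\<sigma> > 0" and q01: "\<And>t. 0 \<le> q t" "\<And>t. q t \<le> 1"
    and [measurable]: "q \<in> borel_measurable borel"
    and lim: "((\<lambda>t. (1 - q t) / t\<^sup>2) \<longlongrightarrow> \<sigma>\<^sup>2) (at 0)"
    and far: "\<And>\<delta>. \<delta> > 0 \<Longrightarrow> \<exists>\<theta><1. \<forall>t. \<bar>t\<bar> \<ge> \<delta> \<longrightarrow> q t \<le> \<theta>"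
  shows "\<exists>\<alpha>. \<alpha> \<longlonglongrightarrow> 1 / (2 * \<sigma> * sqrt pi) \<and> (\<forall>n. \<alpha> n \<ge> 0) \<and>
    (\<forall>n\<ge>2 * n0 + 1. \<forall>w. w \<in> borel_measurable borel \<longrightarrow> (\<forall>t. 0 \<le> w t \<and> w t \<le> 1) \<longrightarrow>
      (\<integral>\<^sup>+ t. ennreal (w t) \<partial>lborel) \<le> ennreal (2 * pi * real n) \<longrightarrow>
      ennreal (sqrt n) * (\<integral>\<^sup>+ t. ennreal (w t * q t ^ (n - n0)) \<partial>lborel) \<le> ennreal (2 * pi * \<alpha> n))"
proof -
  have "\<forall>\<^sub>F t in at 0. \<sigma>\<^sup>2 / 2 < (1 - q t) / t\<^sup>2"
    using s by (intro order_tendstoD[OF lim]) auto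
  then obtain \<delta> where \<delta>: "\<delta> > 0" "\<And>t. t \<noteq> 0 \<Longrightarrow> \<bar>t\<bar> < \<delta> \<Longrightarrow> \<sigma>\<^sup>2 / 2 < (1 - q t) / t\<^sup>2"
    unfolding eventually_at by auto
  have near: "\<sigma>\<^sup>2 / 2 * t\<^sup>2 \<le> 1 - q t" if "\<bar>t\<bar> < \<delta>" for t
  proof (cases "t = 0")
    case False
    then show ?thesis using \<delta>(2)[OF False that] by (simp add: field_simps)
  qed (use q01 in simp)
  obtain \<theta>' where \<theta>': "\<theta>' < 1" "\<And>t. \<bar>t\<bar> \<ge> \<delta> \<Longrightarrow> q t \<le> \<theta>'" using far[OF \<delta>(1)] by auto
  \<comment> \<open>The maximum with 1/2 makes \<theta> positive; \<open>\<theta> ^ n0\<close>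
    becomes a denominator below.\<close>
  define \<theta> where "\<theta> = max (1/2) \<theta>'"
  have \<theta>: "\<theta> < 1" "\<theta> > 0" "\<And>t. \<bar>t\<bar> \<ge> \<delta> \<Longrightarrow> q t \<le> \<theta>" using \<theta>' by (auto simp: \<theta>_def le_max_iff_disj)
  \<comment> \<open>\<open>J n\<close> is the majorant of the near part in the variable u = t sqrt
    n, cut off where the estimate for q ends.\<close>
  define J where "J n u = indicator {u. \<bar>u\<bar> < \<delta> * sqrt n} u * exp (- (real (n - n0) * (1 - q (u / sqrt n))))" for n :: nat and u :: real
  have [measurable]: "J n \<in> borel_measurable borel" for n unfolding J_def[abs_def] by measurable
  have J0: "J n u \<ge> 0" for n u by (simp add: J_def)
  define \<alpha>1 where "\<alpha>1 n = (LINT u|lborel. J n u)" for n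
  have lim1: "(LINT u|lborel. J n u) \<ge> 0" for n by (rule integral_nonneg_AE) (use J0 in auto)
  \<comment> \<open>Half of the exponent survives once n >= 2 n0. With 1 - q >= \<sigma>^2 t^2 / 2
    this gives (n / 2)(\<sigma>^2 / 2)(u^2 / n) = (\<sigma> / 2)^2 u^2, the exponent of the
    dominating Gaussian. The 1 in the threshold 2 n0 + 1 makes n positive.\<close>
  have nn: "real n / 2 \<le> real (n - n0)" if "n \<ge> 2 * n0" for n using that by simp
  have Jdom: "J n u \<le> exp (- ((\<sigma>/2)\<^sup>2 * u\<^sup>2))" if n: "n \<ge> 2 * n0 + 1" for n u
  proof (cases "\<bar>u\<bar> < \<delta> * sqrt n")
    case True
    have n1: "real n > 0" using n by simp
    have "\<bar>u / sqrt n\<bar> < \<delta>" using True n1 by (simp add: field_simps)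
    from near[OF this] have "\<sigma>\<^sup>2 / 2 * (u\<^sup>2 / n) \<le> 1 - q (u / sqrt n)" by (simp add: power_divide)
    then have "real n / 2 * (\<sigma>\<^sup>2 / 2 * (u\<^sup>2 / n)) \<le> real (n - n0) * (1 - q (u / sqrt n))"
      using nn[of n] n by (intro mult_mono) auto
    then have "(\<sigma>/2)\<^sup>2 * u\<^sup>2 \<le> real (n - n0) * (1 - q (u / sqrt n))" using n1 by (simp add: power_divide)
    then show ?thesis using True by (simp add: J_def)
  qed (simp add: J_def)
  have iJ: "integrable lborel (J n)" if n: "n \<ge> 2 * n0 + 1" for n
    by (rule Bochner_Integration.integrable_bound[OF gauss_integral(1)[of "\<sigma>/2"]])
       (use Jdom[OF n] J0 s in auto)
  have \<alpha>1: "\<alpha>1 \<longlonglongrightarrow> sqrt pi / \<sigma>"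
  proof -
    have "(\<lambda>k. LINT u|lborel. J (k + (2 * n0 + 1)) u) \<longlonglongrightarrow> (LINT u|lborel. exp (- (\<sigma>\<^sup>2 * u\<^sup>2)))"
    proof (rule integral_dominated_convergence)
      show "integrable lborel (\<lambda>u. exp (- ((\<sigma>/2)\<^sup>2 * u\<^sup>2)))" using s by (intro gauss_integral) auto
      show "AE u in lborel. norm (J (k + (2 * n0 + 1)) u) \<le> exp (- ((\<sigma>/2)\<^sup>2 * u\<^sup>2))" for k
        using Jdom[of "k + (2 * n0 + 1)"] J0 by auto
      show "AE u in lborel. (\<lambda>k. J (k + (2 * n0 + 1)) u) \<longlonglongrightarrow> exp (- (\<sigma>\<^sup>2 * u\<^sup>2))"
        using AE_lborel_singleton[of 0]
      proof (rule eventually_mono, intro LIMSEQ_ignore_initial_segment)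
        fix u :: real assume u: "u \<noteq> 0"
        have h0: "(\<lambda>n. u / sqrt n) \<longlonglongrightarrow> 0"
          by (intro tendsto_divide_0[OF tendsto_const] filterlim_at_top_imp_at_infinity
              filterlim_compose[OF sqrt_at_top] filterlim_real_sequentially)
        have E: "\<forall>\<^sub>F n in sequentially. \<bar>u\<bar> < \<delta> * sqrt n"
        proof -
          have "\<forall>\<^sub>F n in sequentially. dist (u / sqrt n) 0 < \<delta>" using h0 \<delta>(1) by (rule tendstoD)
          then show ?thesis using eventually_gt_at_top[of 0] by eventually_elim (auto simp: field_simps)
        qed
        have r: "(\<lambda>n. real (n - n0) / real n) \<longlonglongrightarrow> 1"
        proof -
          have "(\<lambda>n. 1 - real n0 / real n) \<longlonglongrightarrow> 1 - 0" by (intro tendsto_intros lim_const_over_n)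
          moreover have "\<forall>\<^sub>F n in sequentially. 1 - real n0 / real n = real (n - n0) / real n"
            using eventually_gt_at_top[of n0] by eventually_elim (auto simp: field_simps of_nat_diff)
          ultimately show ?thesis by (simp add: Lim_transform_eventually)
        qed
        have ex: "(\<lambda>n. real (n - n0) * (1 - q (u / sqrt n))) \<longlonglongrightarrow> \<sigma>\<^sup>2 * u\<^sup>2"
        proof -
          have "(\<lambda>n. (1 - q (u / sqrt (real (Suc n)))) / (u / sqrt (real (Suc n)))\<^sup>2) \<longlonglongrightarrow> \<sigma>\<^sup>2"
            using lim[unfolded tendsto_at_iff_sequentially comp_def, rule_format, of "\<lambda>n. u / sqrt (real (Suc n))"]
              u LIMSEQ_Suc[OF h0] by simp
          then have "(\<lambda>n. (1 - q (u / sqrt (real n))) / (u / sqrt (real n))\<^sup>2) \<longlonglongrightarrow> \<sigma>\<^sup>2" by (rule LIMSEQ_imp_Suc)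
          then have "(\<lambda>n. real (n - n0) / real n * ((1 - q (u / sqrt (real n))) / (u / sqrt (real n))\<^sup>2) * u\<^sup>2) \<longlonglongrightarrow> 1 * \<sigma>\<^sup>2 * u\<^sup>2"
            by (intro tendsto_intros r)
          moreover have "\<forall>\<^sub>F n in sequentially. real (n - n0) / real n * ((1 - q (u / sqrt (real n))) / (u / sqrt (real n))\<^sup>2) * u\<^sup>2
              = real (n - n0) * (1 - q (u / sqrt n))"
            using eventually_gt_at_top[of 0] by eventually_elim (use u in \<open>auto simp: power_divide\<close>)
          ultimately show ?thesis by (simp add: Lim_transform_eventually)
        qed
        have "(\<lambda>n. exp (- (real (n - n0) * (1 - q (u / sqrt n))))) \<longlonglongrightarrow> exp (- (\<sigma>\<^sup>2 * u\<^sup>2))"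
          by (intro tendsto_intros ex)
        moreover have "\<forall>\<^sub>F n in sequentially. exp (- (real (n - n0) * (1 - q (u / sqrt n)))) = J n u"
          using E by eventually_elim (simp add: J_def)
        ultimately show "(\<lambda>n. J n u) \<longlonglongrightarrow> exp (- (\<sigma>\<^sup>2 * u\<^sup>2))" by (rule Lim_transform_eventually)
      qed
    qed auto
    then have "(\<lambda>k. \<alpha>1 (k + (2 * n0 + 1))) \<longlonglongrightarrow> sqrt pi / \<sigma>"
      by (simp only: \<alpha>1_def gauss_integral(2)[OF s])
    then show ?thesis by (rule LIMSEQ_offset)
  qed
  define \<alpha>2 where "\<alpha>2 n = sqrt n * \<theta> ^ (n - n0) * (2 * pi * n)" for n
  have \<alpha>2: "\<alpha>2 \<longlonglongrightarrow> 0"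
  proof (rule Lim_null_comparison)
    \<comment> \<open>The square root splits n^2 \<theta>^n into the square of n (sqrt \<theta>)^n,
      which is a standard null sequence.\<close>
    have "(\<lambda>n. real n * sqrt \<theta> ^ n) \<longlonglongrightarrow> 0" using \<theta> by (intro powser_times_n_limit_0) simp
    then have "(\<lambda>n. (real n * sqrt \<theta> ^ n)\<^sup>2 * (2 * pi / \<theta> ^ n0)) \<longlonglongrightarrow> 0\<^sup>2 * (2 * pi / \<theta> ^ n0)"
      by (intro tendsto_intros)
    then show "(\<lambda>n. (real n * sqrt \<theta> ^ n)\<^sup>2 * (2 * pi / \<theta> ^ n0)) \<longlonglongrightarrow> 0" by simp
    show "\<forall>\<^sub>F n in sequentially. norm (\<alpha>2 n) \<le> (real n * sqrt \<theta> ^ n)\<^sup>2 * (2 * pi / \<theta> ^ n0)"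
      using eventually_ge_at_top[of "max 1 n0"]
    proof eventually_elim
      case (elim n)
      have "sqrt n \<le> sqrt n * sqrt n" using elim by (intro mult_le_cancel_left1[THEN iffD2]) auto
      then have "sqrt n \<le> n" by simp
      then have le: "sqrt n * \<theta> ^ (n - n0) * (2 * pi * n) \<le> n * \<theta> ^ (n - n0) * (2 * pi * n)"
        using \<theta> by (intro mult_right_mono) auto
      have "\<theta> ^ (n - n0) = \<theta> ^ n / \<theta> ^ n0" using elim \<theta> by (simp add: power_diff)
      also have "\<theta> ^ n = (sqrt \<theta> ^ n)\<^sup>2" using \<theta> by (simp add: power_mult_distrib[symmetric] power2_eq_square)
      finally have "n * \<theta> ^ (n - n0) * (2 * pi * n) = (real n * sqrt \<theta> ^ n)\<^sup>2 * (2 * pi / \<theta> ^ n0)"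
        by (simp add: power2_eq_square)
      then show ?case using le \<theta> by (simp add: \<alpha>2_def)
    qed
  qed
  \<comment> \<open>Below the threshold nothing is claimed; n is a nonnegative placeholder
    there.\<close>
  define \<alpha> where "\<alpha> n = (if n \<ge> 2 * n0 + 1 then (\<alpha>1 n + \<alpha>2 n) / (2 * pi) else n)" for n
  have \<alpha>20: "\<alpha>2 n \<ge> 0" for n unfolding \<alpha>2_def using \<theta> by simp
  have "(\<lambda>n. (\<alpha>1 n + \<alpha>2 n) / (2 * pi)) \<longlonglongrightarrow> (sqrt pi / \<sigma> + 0) / (2 * pi)"
    by (intro tendsto_intros \<alpha>1 \<alpha>2) auto
  also have "(sqrt pi / \<sigma> + 0) / (2 * pi) = 1 / (2 * \<sigma> * sqrt pi)"
  proof -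
    have "sqrt pi / pi = 1 / sqrt pi" by (simp add: real_div_sqrt divide_simps)
    moreover have "(sqrt pi / \<sigma> + 0) / (2 * pi) = (sqrt pi / pi) / (2 * \<sigma>)" by simp
    ultimately show ?thesis by simp
  qed
  finally have "\<alpha> \<longlonglongrightarrow> 1 / (2 * \<sigma> * sqrt pi)"
    by (rule Lim_transform_eventually)
       (use eventually_ge_at_top[of "2 * n0 + 1"] in eventually_elim, simp add: \<alpha>_def)
  moreover have "\<alpha> n \<ge> 0" for n using \<alpha>20[of n] lim1[of n] by (auto simp: \<alpha>_def \<alpha>1_def)
  moreover have "ennreal (sqrt n) * (\<integral>\<^sup>+ t. ennreal (w t * q t ^ (n - n0)) \<partial>lborel) \<le> ennreal (2 * pi * \<alpha> n)"
    if [measurable]: "w \<in> borel_measurable borel" and w: "\<And>t. 0 \<le> w t" "\<And>t. w t \<le> 1"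
      and wi: "(\<integral>\<^sup>+ t. ennreal (w t) \<partial>lborel) \<le> ennreal (2 * pi * real n)" and n: "n \<ge> 2 * n0 + 1" for w n
  proof -
    have n1: "real n > 0" using n by simp
    have "(\<integral>\<^sup>+ t. ennreal (w t * q t ^ (n - n0)) \<partial>lborel)
       \<le> (\<integral>\<^sup>+ t. ennreal (J n (t * sqrt n)) + ennreal (\<theta> ^ (n - n0)) * ennreal (w t) \<partial>lborel)"
    proof (rule nn_integral_mono)
      fix t
      show "ennreal (w t * q t ^ (n - n0)) \<le> ennreal (J n (t * sqrt n)) + ennreal (\<theta> ^ (n - n0)) * ennreal (w t)"
      proof (cases "\<bar>t\<bar> < \<delta>")
        case True
        have "q t \<le> exp (- (1 - q t))" using exp_ge_add_one_self[of "- (1 - q t)"] by simp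
        then have "q t ^ (n - n0) \<le> exp (- (1 - q t)) ^ (n - n0)" by (intro power_mono q01)
        also have "\<dots> = J n (t * sqrt n)" using True n1 by (simp add: J_def abs_mult exp_of_nat_mult[symmetric] right_diff_distrib)
        finally have "w t * q t ^ (n - n0) \<le> 1 * J n (t * sqrt n)" using w q01 by (intro mult_mono) auto
        then show ?thesis by (auto intro: order_trans[OF ennreal_leI])
      next
        case False
        then have "w t * q t ^ (n - n0) \<le> w t * \<theta> ^ (n - n0)"
          using w q01 \<theta>(3)[of t] by (intro mult_left_mono power_mono) auto
        then have "ennreal (w t * q t ^ (n - n0)) \<le> ennreal (\<theta> ^ (n - n0)) * ennreal (w t)"
          using w \<theta> by (simp add: ennreal_mult'[symmetric] mult.commute ennreal_leI)
        then show ?thesis by (rule order_trans) simp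
      qed
    qed
    also have "\<dots> = (\<integral>\<^sup>+ t. ennreal (J n (t * sqrt n)) \<partial>lborel) + ennreal (\<theta> ^ (n - n0)) * (\<integral>\<^sup>+ t. ennreal (w t) \<partial>lborel)"
      by (simp add: nn_integral_add nn_integral_cmult)
    finally have "ennreal (sqrt n) * (\<integral>\<^sup>+ t. ennreal (w t * q t ^ (n - n0)) \<partial>lborel) \<le>
      ennreal (sqrt n) * (\<integral>\<^sup>+ t. ennreal (J n (t * sqrt n)) \<partial>lborel)
      + ennreal (sqrt n) * (ennreal (\<theta> ^ (n - n0)) * (\<integral>\<^sup>+ t. ennreal (w t) \<partial>lborel))"
      by (simp add: distrib_left[symmetric] mult_left_mono)
    also have "ennreal (sqrt n) * (\<integral>\<^sup>+ t. ennreal (J n (t * sqrt n)) \<partial>lborel) = (\<integral>\<^sup>+ t. ennreal (J n t) \<partial>lborel)"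
      using n1 by (subst (2) nn_integral_real_affine[where c="sqrt n" and t=0]) (auto simp: mult.commute)
    also have "\<dots> = ennreal (\<alpha>1 n)"
      unfolding \<alpha>1_def by (rule nn_integral_eq_integral[OF iJ[OF n]]) (simp add: J0)
    also have "ennreal (sqrt n) * (ennreal (\<theta> ^ (n - n0)) * (\<integral>\<^sup>+ t. ennreal (w t) \<partial>lborel))
        \<le> ennreal (sqrt n) * (ennreal (\<theta> ^ (n - n0)) * ennreal (2 * pi * real n))"
      by (intro mult_left_mono wi) auto
    also have "\<dots> = ennreal (\<alpha>2 n)" using \<theta> by (simp add: \<alpha>2_def ennreal_mult'[symmetric] mult.assoc)
    also have "ennreal (\<alpha>1 n) + ennreal (\<alpha>2 n) = ennreal (2 * pi * \<alpha> n)"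
      using n \<alpha>20[of n] lim1[of n] by (simp add: \<alpha>_def \<alpha>1_def ennreal_plus[symmetric] del: ennreal_plus)
    finally show ?thesis by (simp add: add_left_mono)
  qed
  ultimately show ?thesis by (intro exI[of _ \<alpha>]) auto
qed

section \<open>Sums with conditionally independent summands\<close>

text \<open>\<nu> is the law of the label and \<open>f y\<close> the density of the centred variable
  given the label y. The conditions are imposed for every y of the type, not almost every y, so that
  later arguments carry no exceptional sets. For the same reason measurability of sections is stated
  separately: joint measurability yields it only for y in the space of \<nu>.\<close>

locale cond_density = prob_space \<nu> for \<nu> :: "'b measure" +
  fixes f :: "'b \<Rightarrow> real \<Rightarrow> ennreal" and \<sigma> :: real
  assumes measurable_f [measurable]: "case_prod f \<in> borel_measurable (\<nu> \<Otimes>\<^sub>M borel)"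
    and measurable_f_section [measurable]: "\<And>y. f y \<in> borel_measurable borel"
    and nn_integral_f: "\<And>y. (\<integral>\<^sup>+ x. f y x \<partial>lborel) = 1"
    and second_moment_f: "\<And>y. (\<integral>\<^sup>+ x. f y x * ennreal (x\<^sup>2) \<partial>lborel) < \<infinity>"
    and mean_f: "\<And>y. (LINT x|lborel. enn2real (f y x) * x) = 0"
    and variance_f: "(\<integral>\<^sup>+ y. \<integral>\<^sup>+ x. f y x * ennreal (x\<^sup>2) \<partial>lborel \<partial>\<nu>) = ennreal (\<sigma>\<^sup>2)"
    and \<sigma>_pos: "\<sigma> > 0"
begin

definition cond_char :: "'b \<Rightarrow> real \<Rightarrow> complex" where
  "cond_char y t = FT (\<lambda>x. enn2real (f y x)) t"

text \<open>The characteristic function of X - X', where X and X' share one label and are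
  independent given it. The variance of this difference is 2 \<sigma>^2, whence the expansion 1 -
  \<sigma>^2 t^2 at 0.\<close>

definition mean_sq_char :: "real \<Rightarrow> real" where
  "mean_sq_char t = (LINT y|\<nu>. (norm (cond_char y t))\<^sup>2)"

section \<open>Moments and characteristic functions of the conditional densities\<close>

lemma AE_f_finite: "AE x in lborel. f y x < \<infinity>"
  by (rule AE_less_top) (auto simp: nn_integral_f)

lemma
  shows integrable_f: "integrable lborel (\<lambda>x. enn2real (f y x))"
    and integral_f: "(LINT x|lborel. enn2real (f y x)) = 1"
proof -
  show "integrable lborel (\<lambda>x. enn2real (f y x))"
    by (rule integrable_enn2real) (auto simp: nn_integral_f)
  have "(\<integral>\<^sup>+ x. ennreal (enn2real (f y x)) \<partial>lborel) = (\<integral>\<^sup>+ x. f y x \<partial>lborel)"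
    by (rule nn_integral_cong_AE) (use AE_f_finite[of y] in \<open>auto elim!: eventually_mono\<close>)
  then show "(LINT x|lborel. enn2real (f y x)) = 1"
    by (subst integral_eq_nn_integral) (auto simp: nn_integral_f)
qed

lemma enn2real_second_moment:
  "(\<integral>\<^sup>+ x. ennreal (enn2real (f y x) * x\<^sup>2) \<partial>lborel) = (\<integral>\<^sup>+ x. f y x * ennreal (x\<^sup>2) \<partial>lborel)"
  by (rule nn_integral_cong_AE) (use AE_f_finite[of y] in \<open>auto elim!: eventually_mono simp: ennreal_mult\<close>)

lemma integrable_f_x2: "integrable lborel (\<lambda>x. enn2real (f y x) * x\<^sup>2)"
  by (rule integrableI_nonneg) (use second_moment_f[of y] in \<open>auto simp: enn2real_second_moment\<close>)

definition var :: "'b \<Rightarrow> real" where "var y = (LINT x|lborel. enn2real (f y x) * x\<^sup>2)"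

lemma ennreal_var: "ennreal (var y) = (\<integral>\<^sup>+ x. f y x * ennreal (x\<^sup>2) \<partial>lborel)"
  unfolding var_def enn2real_second_moment[symmetric]
  by (rule nn_integral_eq_integral[symmetric]) (auto intro!: integrable_f_x2)

lemma var_nonneg: "var y \<ge> 0" unfolding var_def by simp

lemma measurable_var [measurable]: "var \<in> borel_measurable \<nu>"
proof -
  have "(\<lambda>y. LINT x|lborel. enn2real (case_prod f (y, x)) * x\<^sup>2) \<in> borel_measurable \<nu>"
    by (rule lborel.borel_measurable_lebesgue_integral) measurable
  then show ?thesis by (simp add: var_def[abs_def])
qed

lemma integrable_var: "integrable \<nu> var" and integral_var: "(LINT y|\<nu>. var y) = \<sigma>\<^sup>2"
proof -
  have *: "(\<integral>\<^sup>+ y. ennreal (var y) \<partial>\<nu>) = ennreal (\<sigma>\<^sup>2)" by (simp add: ennreal_var variance_f)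
  show "integrable \<nu> var" by (rule integrableI_nonneg) (use * var_nonneg in auto)
  show "(LINT y|\<nu>. var y) = \<sigma>\<^sup>2" by (subst integral_eq_nn_integral) (use * var_nonneg in auto)
qed

lemma measurable_cond_char_pair [measurable]: "(\<lambda>(y, t). cond_char y t) \<in> borel_measurable (\<nu> \<Otimes>\<^sub>M borel)"
proof -
  have [measurable]: "(\<lambda>w. f (fst (fst w)) (snd w)) \<in> borel_measurable ((\<nu> \<Otimes>\<^sub>M borel) \<Otimes>\<^sub>M borel)"
    using measurable_compose[OF _ measurable_f, of "\<lambda>w. (fst (fst w), snd w)" "(\<nu> \<Otimes>\<^sub>M borel) \<Otimes>\<^sub>M borel"]
    by simp
  have "(\<lambda>w. LINT x|lborel. complex_of_real (enn2real (f (fst w) x)) * iexp (snd w * x)) \<in> borel_measurable (\<nu> \<Otimes>\<^sub>M borel)"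
    by (rule lborel.borel_measurable_lebesgue_integral) (simp add: split_beta')
  then show ?thesis by (simp add: cond_char_def FT_def split_beta')
qed

lemma measurable_cond_char [measurable]: "(\<lambda>y. cond_char y t) \<in> borel_measurable \<nu>"
  using measurable_compose[OF _ measurable_cond_char_pair, of "\<lambda>y. (y, t)" \<nu>] by simp

lemma norm_cond_char_le_1: "norm (cond_char y t) \<le> 1"
  unfolding cond_char_def by (rule norm_FT_density_le_1[OF integrable_f _ integral_f]) simp

lemma norm_cond_char_sq_le_1: "(norm (cond_char y t))\<^sup>2 \<le> 1"
  using norm_cond_char_le_1[of y t] by (simp add: power_le_one)

lemma integrable_norm_cond_char_sq: "integrable \<nu> (\<lambda>y. (norm (cond_char y t))\<^sup>2)"
  by (rule integrable_const_bound[of _ 1]) (auto simp: norm_cond_char_sq_le_1)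

lemma mean_sq_char_nonneg: "mean_sq_char t \<ge> 0" unfolding mean_sq_char_def by simp

lemma mean_sq_char_le_1: "mean_sq_char t \<le> 1"
proof -
  have "mean_sq_char t \<le> (LINT y|\<nu>. 1)" unfolding mean_sq_char_def
    by (rule integral_mono[OF integrable_norm_cond_char_sq]) (auto simp: norm_cond_char_sq_le_1)
  then show ?thesis by (simp add: prob_space)
qed

lemma one_minus_mean_sq_char: "1 - mean_sq_char t = (LINT y|\<nu>. 1 - (norm (cond_char y t))\<^sup>2)"
  unfolding mean_sq_char_def using integrable_norm_cond_char_sq by (simp add: prob_space)

lemma measurable_mean_sq_char [measurable]: "mean_sq_char \<in> borel_measurable borel"
proof -
  have "(\<lambda>t. LINT y|\<nu>. (norm (cond_char y t))\<^sup>2) \<in> borel_measurable borel"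
  proof (rule borel_measurable_lebesgue_integral)
    have "(\<lambda>w. cond_char (snd w) (fst w)) \<in> borel_measurable (borel \<Otimes>\<^sub>M \<nu>)"
      using measurable_compose[OF _ measurable_cond_char_pair, of "\<lambda>w. (snd w, fst w)" "borel \<Otimes>\<^sub>M \<nu>"] by simp
    then show "(\<lambda>(t, y). (norm (cond_char y t))\<^sup>2) \<in> borel_measurable (borel \<Otimes>\<^sub>M \<nu>)" by (simp add: split_beta')
  qed
  then show ?thesis by (simp add: mean_sq_char_def[abs_def])
qed

text \<open>For each label the quotient tends to the conditional variance and is also bounded by it,
  uniformly in t. Its integrability is all that dominated convergence asks.\<close>

lemma tendsto_mean_sq_char: "((\<lambda>t. (1 - mean_sq_char t) / t\<^sup>2) \<longlongrightarrow> \<sigma>\<^sup>2) (at 0)"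
  unfolding tendsto_at_iff_sequentially comp_def
proof (intro allI impI)
  fix h :: "nat \<Rightarrow> real" assume "\<forall>k. h k \<in> UNIV - {0}" and h: "h \<longlonglongrightarrow> 0"
  then have h0: "\<And>k. h k \<noteq> 0" by auto
  have "(\<lambda>k. LINT y|\<nu>. (1 - (norm (cond_char y (h k)))\<^sup>2) / (h k)\<^sup>2) \<longlonglongrightarrow> (LINT y|\<nu>. var y)"
  proof (rule integral_dominated_convergence)
    show "integrable \<nu> var" by (rule integrable_var)
    show "AE y in \<nu>. (\<lambda>k. (1 - (norm (cond_char y (h k)))\<^sup>2) / (h k)\<^sup>2) \<longlonglongrightarrow> var y"
      unfolding cond_char_def
      by (intro AE_I2 tendsto_one_minus_norm_FT_sq integrable_f integral_f integrable_f_x2 h h0 mean_f)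
         (auto simp: var_def)
    show "AE y in \<nu>. norm ((1 - (norm (cond_char y (h k)))\<^sup>2) / (h k)\<^sup>2) \<le> var y" for k
    proof (rule AE_I2)
      fix y
      have "1 - (norm (cond_char y (h k)))\<^sup>2 \<le> var y * (h k)\<^sup>2"
        unfolding cond_char_def by (rule one_minus_norm_FT_sq_le[OF integrable_f _ integral_f integrable_f_x2]) (auto simp: var_def)
      then have "(1 - (norm (cond_char y (h k)))\<^sup>2) / (h k)\<^sup>2 \<le> var y" using h0[of k] by (simp add: divide_le_eq)
      moreover have "0 \<le> (1 - (norm (cond_char y (h k)))\<^sup>2) / (h k)\<^sup>2"
        using norm_cond_char_sq_le_1[of y "h k"] by simp
      ultimately show "norm ((1 - (norm (cond_char y (h k)))\<^sup>2) / (h k)\<^sup>2) \<le> var y" by simp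
    qed
  qed measurable
  then show "(\<lambda>k. (1 - mean_sq_char (h k)) / (h k)\<^sup>2) \<longlonglongrightarrow> \<sigma>\<^sup>2" by (simp add: one_minus_mean_sq_char integral_var)
qed

text \<open>Equality would force modulus 1 for almost every label, whereas a density has modulus
  below 1 for every label.\<close>

lemma mean_sq_char_less_1:
  assumes "t \<noteq> 0"
  shows "mean_sq_char t < 1"
proof (rule ccontr)
  assume "\<not> mean_sq_char t < 1"
  then have "(LINT y|\<nu>. 1 - (norm (cond_char y t))\<^sup>2) = 0" using mean_sq_char_le_1[of t] one_minus_mean_sq_char[of t] by simp
  moreover have "integrable \<nu> (\<lambda>y. 1 - (norm (cond_char y t))\<^sup>2)" using integrable_norm_cond_char_sq by auto
  ultimately have "AE y in \<nu>. 1 - (norm (cond_char y t))\<^sup>2 = 0"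
    by (subst (asm) integral_nonneg_eq_0_iff_AE) (auto simp: norm_cond_char_sq_le_1)
  moreover have "norm (cond_char y t) < 1" for y
    unfolding cond_char_def by (rule norm_FT_less_1[OF integrable_f _ integral_f assms]) simp
  then have "(norm (cond_char y t))\<^sup>2 < 1" for y by (simp add: power_less_one_iff)
  then have "1 - (norm (cond_char y t))\<^sup>2 \<noteq> 0" for y by (metis eq_iff_diff_eq_0 less_irrefl)
  ultimately have "AE y in \<nu>. False" by simp
  then show False by simp
qed

lemma isCont_mean_sq_char: "isCont mean_sq_char t"
  unfolding continuous_at_sequentially
proof safe
  fix X assume X: "X \<longlonglongrightarrow> t"
  have "(\<lambda>k. LINT y|\<nu>. (norm (cond_char y (X k)))\<^sup>2) \<longlonglongrightarrow> (LINT y|\<nu>. (norm (cond_char y t))\<^sup>2)"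
  proof (rule integral_dominated_convergence[where w="\<lambda>_. 1"])
    show "AE y in \<nu>. (\<lambda>k. (norm (cond_char y (X k)))\<^sup>2) \<longlonglongrightarrow> (norm (cond_char y t))\<^sup>2"
      unfolding cond_char_def
      by (intro AE_I2 tendsto_intros isCont_tendsto_compose[OF isCont_FT X] integrable_f)
  qed (auto simp: norm_cond_char_sq_le_1)
  then show "(mean_sq_char \<circ> X) \<longlonglongrightarrow> mean_sq_char t" by (simp add: mean_sq_char_def comp_def)
qed

lemma mean_sq_char_at_infinity:
  assumes X: "filterlim X at_infinity sequentially"
  shows "(\<lambda>k::nat. mean_sq_char (X k)) \<longlonglongrightarrow> 0"
proof -
  have "(\<lambda>k. LINT y|\<nu>. (norm (cond_char y (X k)))\<^sup>2) \<longlonglongrightarrow> (LINT y|\<nu>. 0)"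
  proof (rule integral_dominated_convergence[where w="\<lambda>_. 1"])
    show "AE y in \<nu>. (\<lambda>k. (norm (cond_char y (X k)))\<^sup>2) \<longlonglongrightarrow> 0"
    proof (rule AE_I2)
      fix y
      have "(\<lambda>k. FT (\<lambda>x. enn2real (f y x)) (X k)) \<longlonglongrightarrow> 0"
        by (rule filterlim_compose[OF Riemann_Lebesgue[OF integrable_f] X])
      then have "(\<lambda>k. (norm (cond_char y (X k)))\<^sup>2) \<longlonglongrightarrow> (norm (0::complex))\<^sup>2"
        unfolding cond_char_def by (intro tendsto_intros)
      then show "(\<lambda>k. (norm (cond_char y (X k)))\<^sup>2) \<longlonglongrightarrow> 0" by simp
    qed
  qed (auto simp: norm_cond_char_sq_le_1)
  then show ?thesis by (simp add: mean_sq_char_def)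
qed

text \<open>Decay at infinity gives the bound 1/2 outside a compact set. On the compact remainder a
  continuous function that is everywhere below 1 attains its supremum.\<close>

lemma mean_sq_char_far:
  assumes \<delta>: "\<delta> > 0"
  shows "\<exists>\<theta><1. \<forall>t. \<bar>t\<bar> \<ge> \<delta> \<longrightarrow> mean_sq_char t \<le> \<theta>"
proof -
  have "\<exists>R. \<forall>t. \<bar>t\<bar> \<ge> R \<longrightarrow> mean_sq_char t \<le> 1/2"
  proof (rule ccontr)
    assume "\<not> ?thesis"
    then have "\<forall>k::nat. \<exists>t. \<bar>t\<bar> \<ge> real k \<and> mean_sq_char t > 1/2" by (metis not_le)
    then obtain X where X: "\<And>k::nat. \<bar>X k\<bar> \<ge> real k" "\<And>k. mean_sq_char (X k) > 1/2" by metis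
    have "filterlim X at_infinity sequentially"
      unfolding filterlim_at_infinity_conv_norm_at_top
      by (rule filterlim_at_top_mono[OF filterlim_real_sequentially]) (use X in auto)
    from mean_sq_char_at_infinity[OF this] have "\<forall>\<^sub>F k in sequentially. mean_sq_char (X k) < 1/2"
      by (rule order_tendstoD) simp
    then obtain k where "mean_sq_char (X k) < 1/2" using eventually_happens'[OF sequentially_bot] by blast
    with X(2)[of k] show False by simp
  qed
  then obtain R where R: "\<And>t. \<bar>t\<bar> \<ge> R \<Longrightarrow> mean_sq_char t \<le> 1/2" by auto
  \<comment> \<open>The outer radius \<open>max \<delta> R\<close> ensures that the set is nonempty
    even when R is below \<delta>.\<close>
  define K where "K = {t. \<delta> \<le> \<bar>t\<bar> \<and> \<bar>t\<bar> \<le> max \<delta> R}"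
  have "closed K" unfolding K_def by (intro closed_Collect_conj closed_Collect_le continuous_intros)
  moreover have "bounded K" unfolding K_def by (auto simp: bounded_iff)
  ultimately have "compact K" by (simp add: compact_eq_bounded_closed)
  moreover have "K \<noteq> {}" using \<delta> by (auto simp: K_def intro!: exI[of _ \<delta>])
  moreover have "continuous_on K mean_sq_char" by (intro continuous_at_imp_continuous_on ballI isCont_mean_sq_char)
  ultimately obtain t0 where t0: "t0 \<in> K" "\<And>t. t \<in> K \<Longrightarrow> mean_sq_char t \<le> mean_sq_char t0"
    using continuous_attains_sup by metis
  have "mean_sq_char t0 < 1" using t0(1) \<delta> by (intro mean_sq_char_less_1) (auto simp: K_def)
  moreover have "mean_sq_char t \<le> max (1/2) (mean_sq_char t0)" if "\<bar>t\<bar> \<ge> \<delta>" for t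
  proof (cases "\<bar>t\<bar> \<ge> R")
    case True then show ?thesis using R[of t] by (auto simp: max_def)
  next
    case False
    then have "t \<in> K" using that by (auto simp: K_def)
    then show ?thesis using t0(2)[of t] by (auto simp: max_def)
  qed
  ultimately show ?thesis by (intro exI[of _ "max (1/2) (mean_sq_char t0)"]) auto
qed

lemmas mean_sq_char_bound = power_char_integral_bound[OF \<sigma>_pos mean_sq_char_nonneg mean_sq_char_le_1 measurable_mean_sq_char tendsto_mean_sq_char mean_sq_char_far]

section \<open>Conditional densities of partial sums\<close>

text \<open>\<open>{Suc 0..n}\<close> is the simp normal form of \<open>{1..n}\<close>.\<close>

abbreviation P :: "nat \<Rightarrow> (nat \<Rightarrow> 'b) measure" where
  "P n \<equiv> PiM {Suc 0..n} (\<lambda>_. \<nu>)"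

sublocale pp: product_sigma_finite "\<lambda>_::nat. \<nu>" by standard

lemma prob_P: "prob_space (P n)"
  by (intro prob_space_PiM prob_space_axioms)

lemma measurable_P_lborel: "sets (P n \<Otimes>\<^sub>M lborel) = sets (P n \<Otimes>\<^sub>M borel)"
  by (intro sets_pair_measure_cong) auto

text \<open>The summands are numbered from 1. Through natural subtraction \<open>dens 0\<close>
  coincides with \<open>dens 1\<close>, a dummy value that lets measurability and unit mass hold
  without a condition on n.\<close>

definition dens :: "nat \<Rightarrow> (nat \<Rightarrow> 'b) \<Rightarrow> real \<Rightarrow> ennreal" where
  "dens n y = csum (\<lambda>i. f (y i)) 1 (f (y 1)) (n - 1)"

lemma dens_1: "dens (Suc 0) y = f (y 1)" by (simp add: dens_def)

lemma dens_Suc: "n \<ge> 1 \<Longrightarrow> dens (Suc n) y = conv (dens n y) (f (y (Suc n)))"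
  by (cases n) (auto simp: dens_def)

lemma dens_split:
  assumes "1 \<le> n0" "n0 \<le> n"
  shows "dens n y = csum (\<lambda>i. f (y i)) n0 (dens n0 y) (n - n0)"
  using csum_add[of "\<lambda>i. f (y i)" 1 "f (y 1)" "n0 - 1" "n - n0"] assms by (simp add: dens_def)

lemma dens_cong: 
  assumes "1 \<le> n" "\<And>i. 1 \<le> i \<Longrightarrow> i \<le> n \<Longrightarrow> y i = y' i"
  shows "dens n y = dens n y'"
proof -
  have "csum (\<lambda>i. f (y i)) 1 (f (y 1)) (n - 1) = csum (\<lambda>i. f (y' i)) 1 (f (y 1)) (n - 1)"
    by (rule csum_cong) (use assms in auto)
  then show ?thesis using assms by (simp add: dens_def)
qed

lemma measurable_f_component:
  assumes "i \<in> {Suc 0..n}"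
  shows "(\<lambda>(y, x). f (y i) x) \<in> borel_measurable (P n \<Otimes>\<^sub>M borel)"
proof -
  have "(\<lambda>w. (fst w i, snd w)) \<in> P n \<Otimes>\<^sub>M borel \<rightarrow>\<^sub>M \<nu> \<Otimes>\<^sub>M borel"
    using assms by measurable
  from measurable_compose[OF this measurable_f] show ?thesis by (simp add: split_beta')
qed

lemma measurable_csum_pair:
  assumes "(\<lambda>(y, x). g y x) \<in> borel_measurable (P n \<Otimes>\<^sub>M borel)" "m + k \<le> n"
  shows "(\<lambda>(y, x). csum (\<lambda>i. f (y i)) m (g y) k x) \<in> borel_measurable (P n \<Otimes>\<^sub>M borel)"
  using assms(2)
proof (induct k)
  case 0 then show ?case using assms(1) by simp
next
  case (Suc k)
  then show ?case
    using measurable_conv_pair[of "\<lambda>y. csum (\<lambda>i. f (y i)) m (g y) k" "P n" "\<lambda>y. f (y (Suc (m + k)))"]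
      measurable_f_component[of "Suc (m + k)" n] by simp
qed

lemma measurable_dens_pair [measurable]:
  assumes "1 \<le> n" "n \<le> n'"
  shows "(\<lambda>(y, x). dens n y x) \<in> borel_measurable (P n' \<Otimes>\<^sub>M borel)"
  unfolding dens_def using assms
  by (intro measurable_csum_pair measurable_f_component) auto

lemma measurable_dens [measurable]: "dens n y \<in> borel_measurable borel"
  unfolding dens_def by (intro measurable_csum) (auto simp: nn_integral_f)

lemma nn_integral_dens: "(\<integral>\<^sup>+ x. dens n y x \<partial>lborel) = 1"
  unfolding dens_def by (subst nn_integral_csum) (auto simp: nn_integral_f)

lemma AE_dens_finite: "AE x in lborel. dens n y x < \<infinity>"
  by (rule AE_less_top) (auto simp: nn_integral_dens)

lemma dens_second_moment:
  assumes "n \<ge> 1"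
  shows "(\<integral>\<^sup>+ x. ennreal (x\<^sup>2) * dens n y x \<partial>lborel) = (\<Sum>i=Suc 0..n. ennreal (var (y i)))"
  using assms
proof (induct n rule: dec_induct)
  case base
  then show ?case by (simp add: dens_1 ennreal_var mult.commute)
next
  case (step n)
  \<comment> \<open>The conditional mean of the new summand is 0, so the cross term 2 r u integrates
    to 0 and the variances add.\<close>
  have inner: "(\<integral>\<^sup>+ u. ennreal ((r + u)\<^sup>2) * f z u \<partial>lborel) = ennreal (r\<^sup>2) + ennreal (var z)" for r z
  proof -
    let ?d = "\<lambda>u. enn2real (f z u)"
    have i: "integrable lborel (\<lambda>u. ?d u * u)"
      by (rule Bochner_Integration.integrable_bound[OF integrable_density_x[OF integrable_f _ integral_f integrable_f_x2 refl]])
         (auto simp: abs_mult)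
    have eq: "?d u * (r + u)\<^sup>2 = r\<^sup>2 * ?d u + 2 * r * (?d u * u) + ?d u * u\<^sup>2" for u
      by (simp add: power2_eq_square algebra_simps)
    have ieq: "integrable lborel (\<lambda>u. ?d u * (r + u)\<^sup>2)"
      unfolding eq using i integrable_f[of z] integrable_f_x2[of z] by auto
    have "(\<integral>\<^sup>+ u. ennreal ((r + u)\<^sup>2) * f z u \<partial>lborel) = (\<integral>\<^sup>+ u. ennreal (?d u * (r + u)\<^sup>2) \<partial>lborel)"
      by (rule nn_integral_cong_AE)
         (use AE_f_finite[of z] in \<open>auto elim!: eventually_mono simp: ennreal_mult mult.commute\<close>)
    also have "\<dots> = ennreal (LINT u|lborel. ?d u * (r + u)\<^sup>2)"
      by (rule nn_integral_eq_integral[OF ieq]) auto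
    also have "(LINT u|lborel. ?d u * (r + u)\<^sup>2) = r\<^sup>2 + var z"
      unfolding eq using i integrable_f[of z] integrable_f_x2[of z] by (simp add: integral_f mean_f var_def)
    finally show ?thesis by (simp add: var_nonneg)
  qed
  have "(\<integral>\<^sup>+ x. ennreal (x\<^sup>2) * dens (Suc n) y x \<partial>lborel) =
      (\<integral>\<^sup>+ r. \<integral>\<^sup>+ u. ennreal ((r + u)\<^sup>2) * dens n y r * f (y (Suc n)) u \<partial>lborel \<partial>lborel)"
    using step by (simp add: dens_Suc nn_integral_mult_conv)
  also have "\<dots> = (\<integral>\<^sup>+ r. dens n y r * (ennreal (r\<^sup>2) + ennreal (var (y (Suc n)))) \<partial>lborel)"
    unfolding inner[symmetric]
    by (intro nn_integral_cong, subst nn_integral_cmult[symmetric]) (auto simp: ac_simps)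
  also have "\<dots> = (\<integral>\<^sup>+ r. ennreal (r\<^sup>2) * dens n y r + dens n y r * ennreal (var (y (Suc n))) \<partial>lborel)"
    by (simp add: distrib_left mult.commute)
  also have "\<dots> = (\<integral>\<^sup>+ x. ennreal (x\<^sup>2) * dens n y x \<partial>lborel) + ennreal (var (y (Suc n)))"
    by (simp add: nn_integral_add nn_integral_multc nn_integral_dens)
  finally show ?case using step by (simp add: add.commute)
qed

lemma nn_integral_dens_second_moment:
  assumes "n \<ge> 1"
  shows "(\<integral>\<^sup>+ y. \<integral>\<^sup>+ x. ennreal (x\<^sup>2) * dens n y x \<partial>lborel \<partial>P n) = ennreal (n * \<sigma>\<^sup>2)"
proof -
  have "(\<integral>\<^sup>+ y. ennreal (var (y i)) \<partial>P n) = ennreal (\<sigma>\<^sup>2)" if "i \<in> {Suc 0..n}" for i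
  proof -
    interpret Q: product_prob_space "\<lambda>_::nat. \<nu>" "{Suc 0..n}" by standard
    have "(\<integral>\<^sup>+ y. ennreal (var (y i)) \<partial>P n) = (\<integral>\<^sup>+ z. ennreal (var z) \<partial>distr (P n) \<nu> (\<lambda>y. y i))"
      using that by (subst nn_integral_distr) auto
    also have "distr (P n) \<nu> (\<lambda>y. y i) = \<nu>" by (rule Q.PiM_component[OF that])
    finally show ?thesis by (simp add: ennreal_var variance_f)
  qed
  then have "(\<integral>\<^sup>+ y. (\<Sum>i=Suc 0..n. ennreal (var (y i))) \<partial>P n) = (\<Sum>i=Suc 0..n. ennreal (\<sigma>\<^sup>2))"
    by (subst nn_integral_sum) auto
  then show ?thesis using assms by (simp add: dens_second_moment ennreal_mult ennreal_of_nat_eq_real_of_nat)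
qed

text \<open>J is the law of one pair of value and label. \<open>H\<close> is generalised in the
  induction because integrating out the last pair replaces it by another function; the induction
  hypothesis applies to that one, and Tonelli reassembles the last density into a convolution. The
  lemma identifies \<open>dens n\<close> as the conditional density of the sum given the
  labels.\<close>

lemma nn_integral_block_sum:
  fixes J :: "(real \<times> 'b) measure"
  assumes J: "prob_space J" and sJ: "sets J = sets (borel \<Otimes>\<^sub>M \<nu>)"
    and law: "\<And>h. h \<in> borel_measurable (borel \<Otimes>\<^sub>M \<nu>) \<Longrightarrow>
      (\<integral>\<^sup>+ w. h w \<partial>J) = (\<integral>\<^sup>+ y. \<integral>\<^sup>+ x. h (x, y) * f y x \<partial>lborel \<partial>\<nu>)"
    and n: "n \<ge> Suc 0"
    and H: "H \<in> borel_measurable (P n \<Otimes>\<^sub>M borel)"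
  shows "(\<integral>\<^sup>+ w. H (\<lambda>i\<in>{Suc 0..n}. snd (w i), \<Sum>i=Suc 0..n. fst (w i)) \<partial>PiM {Suc 0..n} (\<lambda>_. J))
    = (\<integral>\<^sup>+ y. \<integral>\<^sup>+ x. H (y, x) * dens n y x \<partial>lborel \<partial>P n)"
  using n H
proof (induct n arbitrary: H rule: dec_induct)
  case base
  interpret J: prob_space J by fact
  interpret Jp: product_sigma_finite "\<lambda>_::nat. J" by standard
  have m1 [measurable_cong]: "sets J = sets (borel \<Otimes>\<^sub>M \<nu>)" by fact
  note [measurable] = base
  define h where "h = (\<lambda>w::real \<times> 'b. H (\<lambda>i\<in>{Suc 0..Suc 0}. snd w, fst w))"
  have [measurable]: "h \<in> borel_measurable (borel \<Otimes>\<^sub>M \<nu>)"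
    unfolding h_def by (measurable; simp)
  have "(\<integral>\<^sup>+ w. H (\<lambda>i\<in>{Suc 0..Suc 0}. snd (w i), \<Sum>i=Suc 0..Suc 0. fst (w i)) \<partial>PiM {Suc 0..Suc 0} (\<lambda>_. J))
    = (\<integral>\<^sup>+ w. h (w (Suc 0)) \<partial>PiM {Suc 0} (\<lambda>_. J))"
  proof -
    have "H (\<lambda>i\<in>{Suc 0..Suc 0}. snd (w i), \<Sum>i=Suc 0..Suc 0. fst (w i)) = h (w (Suc 0))" for w :: "nat \<Rightarrow> real \<times> 'b"
    proof -
      have "(\<lambda>i\<in>{Suc 0..Suc 0}. snd (w i)) = (\<lambda>i\<in>{Suc 0..Suc 0}. snd (w (Suc 0)))" by (auto simp: restrict_def)
      then show ?thesis unfolding h_def by (simp only:) simp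
    qed
    then show ?thesis by simp
  qed
  also have "\<dots> = (\<integral>\<^sup>+ w. h w \<partial>J)" by (rule Jp.product_nn_integral_singleton) simp
  also have "\<dots> = (\<integral>\<^sup>+ z. \<integral>\<^sup>+ x. h (x, z) * f z x \<partial>lborel \<partial>\<nu>)" by (rule law) simp
  also have "\<dots> = (\<integral>\<^sup>+ y. (\<integral>\<^sup>+ x. h (x, y (Suc 0)) * f (y (Suc 0)) x \<partial>lborel) \<partial>PiM {Suc 0} (\<lambda>_. \<nu>))"
    by (rule pp.product_nn_integral_singleton[symmetric]) measurable
  also have "\<dots> = (\<integral>\<^sup>+ y. \<integral>\<^sup>+ x. H (y, x) * dens (Suc 0) y x \<partial>lborel \<partial>P (Suc 0))"
  proof -
    have "h (x, y (Suc 0)) * f (y (Suc 0)) x = H (y, x) * dens (Suc 0) y x" if "y \<in> space (P (Suc 0))" for y x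
    proof -
      have "(\<lambda>i\<in>{Suc 0..Suc 0}. y (Suc 0)) = y"
        using that by (auto simp: space_PiM PiE_def extensional_def restrict_def)
      then show ?thesis unfolding h_def by (simp add: dens_1)
    qed
    then have "(\<integral>\<^sup>+ y. \<integral>\<^sup>+ x. h (x, y (Suc 0)) * f (y (Suc 0)) x \<partial>lborel \<partial>P (Suc 0))
        = (\<integral>\<^sup>+ y. \<integral>\<^sup>+ x. H (y, x) * dens (Suc 0) y x \<partial>lborel \<partial>P (Suc 0))" by (intro nn_integral_cong) auto
    then show ?thesis by simp
  qed
  finally show ?case .
next
  case (step n)
  interpret J: prob_space J by fact
  interpret Jp: product_sigma_finite "\<lambda>_::nat. J" by standard
  have m1 [measurable_cong]: "sets J = sets (borel \<Otimes>\<^sub>M \<nu>)" by fact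
  have ins: "{Suc 0..Suc n} = insert (Suc n) {Suc 0..n}" by auto
  note [measurable] = step(4)
  \<comment> \<open>The last pair, with label z and value u, is integrated out while the first n
    labels and the sum of their values are kept.\<close>
  define H' where "H' = (\<lambda>w. \<integral>\<^sup>+ z. \<integral>\<^sup>+ u. H ((fst w)(Suc n := z), snd w + u) * f z u \<partial>lborel \<partial>\<nu>)"
  have H'm: "H' \<in> borel_measurable (P n \<Otimes>\<^sub>M borel)"
  proof -
    let ?T = "((P n \<Otimes>\<^sub>M (borel :: real measure)) \<Otimes>\<^sub>M \<nu>) \<Otimes>\<^sub>M (borel :: real measure)"
    have "(\<lambda>v. ((fst (fst (fst v)))(Suc n := snd (fst v)), snd (fst (fst v)) + snd v)) \<in> ?T \<rightarrow>\<^sub>M P (Suc n) \<Otimes>\<^sub>M borel"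
    proof (rule measurable_Pair)
      show "(\<lambda>v. (fst (fst (fst v)))(Suc n := snd (fst v))) \<in> ?T \<rightarrow>\<^sub>M P (Suc n)"
        by (rule measurable_fun_upd[of _ "{Suc 0..n}"]) auto
    qed measurable
    from measurable_compose[OF this step(4)]
    have [measurable]: "(\<lambda>v. H ((fst (fst (fst v)))(Suc n := snd (fst v)), snd (fst (fst v)) + snd v)) \<in> borel_measurable ?T" .
    have "(\<lambda>v. (snd (fst v), snd v)) \<in> ?T \<rightarrow>\<^sub>M \<nu> \<Otimes>\<^sub>M borel" by measurable
    from measurable_compose[OF this measurable_f]
    have [measurable]: "(\<lambda>v. f (snd (fst v)) (snd v)) \<in> borel_measurable ?T" by simp
    have [measurable]: "(\<lambda>v. \<integral>\<^sup>+ u. H ((fst (fst v))(Suc n := snd v), snd (fst v) + u) * f (snd v) u \<partial>lborel)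
        \<in> borel_measurable ((P n \<Otimes>\<^sub>M borel) \<Otimes>\<^sub>M \<nu>)"
      by (rule lborel.borel_measurable_nn_integral) (simp add: split_beta')
    show ?thesis unfolding H'_def by (rule borel_measurable_nn_integral) (simp add: split_beta')
  qed
  define R where "R w = (\<lambda>i\<in>{Suc 0..n}. snd (w i))" for w :: "nat \<Rightarrow> real \<times> 'b"
  define S where "S w = (\<Sum>i=Suc 0..n. fst (w i))" for w :: "nat \<Rightarrow> real \<times> 'b"
  have updm: "(\<lambda>z. y(Suc n := z)) \<in> \<nu> \<rightarrow>\<^sub>M P (Suc n)" if "y \<in> space (P n)" for y
    unfolding ins by (rule measurable_component_update) (use that in auto)
  have Hm: "(\<lambda>v. H (y(Suc n := snd v), c + fst v)) \<in> borel_measurable (borel \<Otimes>\<^sub>M \<nu>)" if "y \<in> space (P n)" for y c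
  proof -
    note [measurable] = updm[OF that]
    show ?thesis by measurable
  qed
  have "(\<integral>\<^sup>+ w. H (\<lambda>i\<in>{Suc 0..Suc n}. snd (w i), \<Sum>i=Suc 0..Suc n. fst (w i)) \<partial>PiM {Suc 0..Suc n} (\<lambda>_. J))
    = (\<integral>\<^sup>+ w. \<integral>\<^sup>+ v. H ((R w)(Suc n := snd v), S w + fst v) \<partial>J \<partial>PiM {Suc 0..n} (\<lambda>_. J))"
  proof -
    have eq: "(\<lambda>i\<in>{Suc 0..Suc n}. snd ((w(Suc n := v)) i)) = (R w)(Suc n := snd v)"
      "(\<Sum>i=Suc 0..Suc n. fst ((w(Suc n := v)) i)) = S w + fst v" for w v
      by (auto simp: R_def S_def restrict_def fun_eq_iff)
    have "(\<integral>\<^sup>+ w. H (\<lambda>i\<in>{Suc 0..Suc n}. snd (w i), \<Sum>i=Suc 0..Suc n. fst (w i)) \<partial>PiM (insert (Suc n) {Suc 0..n}) (\<lambda>_. J))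
      = (\<integral>\<^sup>+ w. \<integral>\<^sup>+ v. H (\<lambda>i\<in>{Suc 0..Suc n}. snd ((w(Suc n := v)) i), \<Sum>i=Suc 0..Suc n. fst ((w(Suc n := v)) i)) \<partial>J \<partial>PiM {Suc 0..n} (\<lambda>_. J))"
      by (rule Jp.product_nn_integral_insert) (simp_all add: ins[symmetric])
    then show ?thesis unfolding eq ins[symmetric] .
  qed
  also have "\<dots> = (\<integral>\<^sup>+ w. H' (R w, S w) \<partial>PiM {Suc 0..n} (\<lambda>_. J))"
  proof (rule nn_integral_cong)
    fix w assume "w \<in> space (PiM {Suc 0..n} (\<lambda>_. J))"
    then have "R w \<in> space (P n)"
      using sets_eq_imp_space_eq[OF sJ] by (auto simp: space_PiM R_def space_pair_measure PiE_iff)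
    from law[OF Hm[OF this]] show "(\<integral>\<^sup>+ v. H ((R w)(Suc n := snd v), S w + fst v) \<partial>J) = H' (R w, S w)"
      by (simp add: H'_def)
  qed
  also have "\<dots> = (\<integral>\<^sup>+ y. \<integral>\<^sup>+ x. H' (y, x) * dens n y x \<partial>lborel \<partial>P n)"
    unfolding R_def S_def by (rule step(3)[OF H'm])
  also have "\<dots> = (\<integral>\<^sup>+ y. \<integral>\<^sup>+ z. (\<integral>\<^sup>+ x. H (y(Suc n := z), x) * dens (Suc n) (y(Suc n := z)) x \<partial>lborel) \<partial>\<nu> \<partial>P n)"
  proof (rule nn_integral_cong)
    fix y assume y: "y \<in> space (P n)"
    note [measurable] = updm[OF y]
    interpret PS: pair_sigma_finite lborel \<nu> ..
    have [measurable]: "(\<lambda>v. f (snd (fst v)) (snd v)) \<in> borel_measurable ((lborel \<Otimes>\<^sub>M \<nu>) \<Otimes>\<^sub>M lborel)"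
      using measurable_compose[OF _ measurable_f, of "\<lambda>v. (snd (fst v), snd v)" "(lborel \<Otimes>\<^sub>M \<nu>) \<Otimes>\<^sub>M lborel"] by simp
    have Hn [measurable]: "(\<lambda>v. H (y(Suc n := snd (fst v)), fst (fst v) + snd v)) \<in> borel_measurable ((lborel \<Otimes>\<^sub>M \<nu>) \<Otimes>\<^sub>M lborel)"
      by measurable
    have m: "(\<lambda>v. \<integral>\<^sup>+ u. H (y(Suc n := snd v), fst v + u) * dens n y (fst v) * f (snd v) u \<partial>lborel) \<in> borel_measurable (lborel \<Otimes>\<^sub>M \<nu>)"
      by (rule lborel.borel_measurable_nn_integral) (simp add: split_beta')
    have fz: "(\<lambda>u. H (y(Suc n := z), x + u)) \<in> borel_measurable lborel" if "z \<in> space \<nu>" for z x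
    proof -
      have "y(Suc n := z) \<in> space (P (Suc n))" using updm[OF y] that by (rule measurable_space)
      then show ?thesis by measurable
    qed
    have fz0: "(\<lambda>u. H (y(Suc n := z), u)) \<in> borel_measurable borel" if "z \<in> space \<nu>" for z
      using fz[OF that, of 0] by simp
    have "(\<integral>\<^sup>+ x. H' (y, x) * dens n y x \<partial>lborel) =
       (\<integral>\<^sup>+ x. \<integral>\<^sup>+ z. (\<integral>\<^sup>+ u. H (y(Suc n := z), x + u) * dens n y x * f z u \<partial>lborel) \<partial>\<nu> \<partial>lborel)"
    proof (rule nn_integral_cong)
      fix x :: real
      have mz: "(\<lambda>z. \<integral>\<^sup>+ u. H (y(Suc n := z), x + u) * f z u \<partial>lborel) \<in> borel_measurable \<nu>"
      proof (rule lborel.borel_measurable_nn_integral)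
        have [measurable]: "(\<lambda>v. f (fst v) (snd v)) \<in> borel_measurable (\<nu> \<Otimes>\<^sub>M lborel)"
          using measurable_f by (simp add: split_beta')
        show "(\<lambda>(z, u). H (y(Suc n := z), x + u) * f z u) \<in> borel_measurable (\<nu> \<Otimes>\<^sub>M lborel)"
          unfolding split_beta' by measurable
      qed
      have "H' (y, x) * dens n y x = (\<integral>\<^sup>+ z. (\<integral>\<^sup>+ u. H (y(Suc n := z), x + u) * f z u \<partial>lborel) * dens n y x \<partial>\<nu>)"
        unfolding H'_def using mz by (simp add: nn_integral_multc)
      also have "\<dots> = (\<integral>\<^sup>+ z. (\<integral>\<^sup>+ u. H (y(Suc n := z), x + u) * dens n y x * f z u \<partial>lborel) \<partial>\<nu>)"
      proof (rule nn_integral_cong)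
        fix z assume "z \<in> space \<nu>"
        note [measurable] = fz[OF this, of x]
        show "(\<integral>\<^sup>+ u. H (y(Suc n := z), x + u) * f z u \<partial>lborel) * dens n y x
            = (\<integral>\<^sup>+ u. H (y(Suc n := z), x + u) * dens n y x * f z u \<partial>lborel)"
          by (subst nn_integral_multc[symmetric]) (auto simp: mult.commute mult.left_commute)
      qed
      finally show "H' (y, x) * dens n y x = (\<integral>\<^sup>+ z. (\<integral>\<^sup>+ u. H (y(Suc n := z), x + u) * dens n y x * f z u \<partial>lborel) \<partial>\<nu>)" .
    qed
    also have "\<dots> = (\<integral>\<^sup>+ z. \<integral>\<^sup>+ x. (\<integral>\<^sup>+ u. H (y(Suc n := z), x + u) * dens n y x * f z u \<partial>lborel) \<partial>lborel \<partial>\<nu>)"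
      by (rule PS.Fubini'[symmetric]) (use m in \<open>simp add: split_beta'\<close>)
    also have "\<dots> = (\<integral>\<^sup>+ z. (\<integral>\<^sup>+ x. H (y(Suc n := z), x) * dens (Suc n) (y(Suc n := z)) x \<partial>lborel) \<partial>\<nu>)"
    proof (rule nn_integral_cong)
      fix z assume z: "z \<in> space \<nu>"
      \<comment> \<open>\<open>dens n\<close> reads the labels 1 to n only, so the new label enters
        through the last factor alone.\<close>
      have "dens n (y(Suc n := z)) = dens n y" by (rule dens_cong) (use step in auto)
      then have "dens (Suc n) (y(Suc n := z)) = conv (dens n y) (f z)" using step by (simp add: dens_Suc)
      then show "(\<integral>\<^sup>+ x. (\<integral>\<^sup>+ u. H (y(Suc n := z), x + u) * dens n y x * f z u \<partial>lborel) \<partial>lborel)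
          = (\<integral>\<^sup>+ x. H (y(Suc n := z), x) * dens (Suc n) (y(Suc n := z)) x \<partial>lborel)"
        using nn_integral_mult_conv[OF fz0[OF z] measurable_dens measurable_f_section] by simp
    qed
    finally show "(\<integral>\<^sup>+ x. H' (y, x) * dens n y x \<partial>lborel) =
      (\<integral>\<^sup>+ z. (\<integral>\<^sup>+ x. H (y(Suc n := z), x) * dens (Suc n) (y(Suc n := z)) x \<partial>lborel) \<partial>\<nu>)" .
  qed
  also have "\<dots> = (\<integral>\<^sup>+ y. \<integral>\<^sup>+ x. H (y, x) * dens (Suc n) y x \<partial>lborel \<partial>P (Suc n))"
    unfolding ins
  proof (rule pp.product_nn_integral_insert[symmetric])
    have [measurable]: "(\<lambda>(y, x). dens (Suc n) y x) \<in> borel_measurable (P (Suc n) \<Otimes>\<^sub>M lborel)"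
      unfolding measurable_cong_sets[OF measurable_P_lborel refl] by (rule measurable_dens_pair) auto
    show "(\<lambda>y. \<integral>\<^sup>+ x. H (y, x) * dens (Suc n) y x \<partial>lborel) \<in> borel_measurable (PiM (insert (Suc n) {Suc 0..n}) (\<lambda>_. \<nu>))"
      unfolding ins[symmetric] by measurable
  qed auto
  finally show ?case .
qed

text \<open>\<open>Gu\<close> expresses that G depends on the first n0 labels only; every later
  label then integrates out as a separate factor. Here the averages of squared characteristic
  functions become powers.\<close>

lemma nn_integral_P_prod:
  assumes G: "\<And>k. G \<in> borel_measurable (P (n0 + k))"
    and Gu: "\<And>y i z. i > n0 \<Longrightarrow> G (y(i := z)) = G y"
    and U [measurable]: "U \<in> borel_measurable \<nu>"
  shows "(\<integral>\<^sup>+ y. G y * (\<Prod>i\<in>{n0<..n0+k}. U (y i)) \<partial>P (n0 + k)) = (\<integral>\<^sup>+ y. G y \<partial>P n0) * (\<integral>\<^sup>+ z. U z \<partial>\<nu>) ^ k"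
proof (induct k)
  case (Suc k)
  have ins: "{Suc 0..n0 + Suc k} = insert (n0 + Suc k) {Suc 0..n0 + k}" by auto
  have ins2: "{n0<..n0 + Suc k} = insert (n0 + Suc k) {n0<..n0 + k}" by auto
  note [measurable] = G[of k] G[of "Suc k"]
  have "(\<integral>\<^sup>+ y. G y * (\<Prod>i\<in>{n0<..n0+Suc k}. U (y i)) \<partial>P (n0 + Suc k)) =
    (\<integral>\<^sup>+ y. \<integral>\<^sup>+ z. G (y(n0 + Suc k := z)) * (\<Prod>i\<in>{n0<..n0+Suc k}. U ((y(n0 + Suc k := z)) i)) \<partial>\<nu> \<partial>P (n0 + k))"
    unfolding ins by (rule pp.product_nn_integral_insert) (simp, simp, unfold ins[symmetric], measurable)
  also have "\<dots> = (\<integral>\<^sup>+ y. (\<integral>\<^sup>+ z. (G y * (\<Prod>i\<in>{n0<..n0+k}. U (y i))) * U z \<partial>\<nu>) \<partial>P (n0 + k))"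
  proof (intro nn_integral_cong)
    fix y z
    have "(\<Prod>i\<in>{n0<..n0+k}. U ((y(n0 + Suc k := z)) i)) = (\<Prod>i\<in>{n0<..n0+k}. U (y i))"
      by (rule prod.cong) auto
    then show "G (y(n0 + Suc k := z)) * (\<Prod>i\<in>{n0<..n0+Suc k}. U ((y(n0 + Suc k := z)) i)) =
       (G y * (\<Prod>i\<in>{n0<..n0+k}. U (y i))) * U z"
      unfolding ins2 by (subst prod.insert) (auto simp: Gu ac_simps)
  qed
  also have "\<dots> = (\<integral>\<^sup>+ y. G y * (\<Prod>i\<in>{n0<..n0+k}. U (y i)) \<partial>P (n0 + k)) * (\<integral>\<^sup>+ z. U z \<partial>\<nu>)"
    by (simp add: nn_integral_cmult nn_integral_multc)
  finally show ?case using Suc by (simp add: ac_simps)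
qed simp

section \<open>Truncation of the initial block at a level\<close>

text \<open>The level \<open>L\<close> will be the number \<open>n\<close> of summands: a power of \<open>n\<close> is harmless against the exponential
  decay of the characteristic function away from \<open>0\<close>, and the mass above the level is \<open>o(1 / ln n)\<close>.\<close>

definition good :: "real \<Rightarrow> nat \<Rightarrow> (nat \<Rightarrow> 'b) \<Rightarrow> real \<Rightarrow> ennreal" where
  "good L n0 y x = (if dens n0 y x \<le> ennreal L then dens n0 y x else 0)"

definition bad :: "real \<Rightarrow> nat \<Rightarrow> (nat \<Rightarrow> 'b) \<Rightarrow> real \<Rightarrow> ennreal" where
  "bad L n0 y x = (if dens n0 y x \<le> ennreal L then 0 else dens n0 y x)"

lemma good_bad: "good L n0 y x + bad L n0 y x = dens n0 y x"
  by (simp add: good_def bad_def)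

lemma good_le: "good L n0 y x \<le> ennreal L" "good L n0 y x \<le> dens n0 y x"
  and bad_le: "bad L n0 y x \<le> dens n0 y x"
  by (auto simp: good_def bad_def)

lemma measurable_good [measurable]: "good L n0 y \<in> borel_measurable borel"
  and measurable_bad [measurable]: "bad L n0 y \<in> borel_measurable borel"
  unfolding good_def[abs_def] bad_def[abs_def] by measurable

lemma measurable_good_pair:
  assumes "1 \<le> n0" "n0 \<le> n"
  shows "(\<lambda>(y, x). good L n0 y x) \<in> borel_measurable (P n \<Otimes>\<^sub>M borel)"
    and "(\<lambda>(y, x). bad L n0 y x) \<in> borel_measurable (P n \<Otimes>\<^sub>M borel)"
proof -
  note [measurable] = measurable_dens_pair[OF assms]
  have *: "(\<lambda>w. dens n0 (fst w) (snd w)) \<in> borel_measurable (P n \<Otimes>\<^sub>M borel)"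
    using measurable_dens_pair[OF assms] by (simp add: split_beta')
  note [measurable] = *
  show "(\<lambda>(y, x). good L n0 y x) \<in> borel_measurable (P n \<Otimes>\<^sub>M borel)"
    "(\<lambda>(y, x). bad L n0 y x) \<in> borel_measurable (P n \<Otimes>\<^sub>M borel)"
    unfolding good_def bad_def split_beta' by measurable
qed

definition good_sum :: "nat \<Rightarrow> nat \<Rightarrow> (nat \<Rightarrow> 'b) \<Rightarrow> real \<Rightarrow> ennreal" where
  "good_sum n0 n y = csum (\<lambda>i. f (y i)) n0 (good n n0 y) (n - n0)"

definition bad_sum :: "nat \<Rightarrow> nat \<Rightarrow> (nat \<Rightarrow> 'b) \<Rightarrow> real \<Rightarrow> ennreal" where
  "bad_sum n0 n y = csum (\<lambda>i. f (y i)) n0 (bad n n0 y) (n - n0)"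

lemma measurable_good_sum [measurable]: "good_sum n0 n y \<in> borel_measurable borel"
  and measurable_bad_sum [measurable]: "bad_sum n0 n y \<in> borel_measurable borel"
  unfolding good_sum_def bad_sum_def by (intro measurable_csum; auto simp: nn_integral_f)+

lemma measurable_good_sum_pair:
  assumes "1 \<le> n0" "n0 \<le> n"
  shows "(\<lambda>(y, x). good_sum n0 n y x) \<in> borel_measurable (P n \<Otimes>\<^sub>M borel)"
    and "(\<lambda>(y, x). bad_sum n0 n y x) \<in> borel_measurable (P n \<Otimes>\<^sub>M borel)"
  unfolding good_sum_def bad_sum_def using assms
  by (intro measurable_csum_pair measurable_good_pair; simp)+

lemma good_sum_bad_sum:
  assumes "1 \<le> n0" "n0 \<le> n"
  shows "dens n y x = good_sum n0 n y x + bad_sum n0 n y x"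
  unfolding dens_split[OF assms] good_sum_def bad_sum_def
  by (subst csum_plus[symmetric]) (auto simp: good_bad nn_integral_f)

lemma good_sum_le: "good_sum n0 n y x \<le> ennreal n"
  unfolding good_sum_def by (rule csum_le) (auto simp: nn_integral_f good_le)

lemma nn_integral_good_le: "(\<integral>\<^sup>+ x. good L n0 y x \<partial>lborel) \<le> 1"
  using nn_integral_mono[of lborel "good L n0 y" "dens n0 y"] by (simp add: good_le nn_integral_dens)

lemma nn_integral_good_sum_le: "(\<integral>\<^sup>+ x. good_sum n0 n y x \<partial>lborel) \<le> 1"
  unfolding good_sum_def by (subst nn_integral_csum) (auto simp: nn_integral_f nn_integral_good_le)

lemma nn_integral_bad_sum: "(\<integral>\<^sup>+ x. bad_sum n0 n y x \<partial>lborel) = (\<integral>\<^sup>+ x. bad n n0 y x \<partial>lborel)"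
  unfolding bad_sum_def by (subst nn_integral_csum) (auto simp: nn_integral_f)

lemma nn_integral_Psi_bad_sum: "(\<integral>\<^sup>+ x. Psi (bad_sum n0 n y x) \<partial>lborel) \<le> (\<integral>\<^sup>+ x. Psi (bad n n0 y x) \<partial>lborel)"
  unfolding bad_sum_def by (rule nn_integral_Psi_csum_le) (auto simp: nn_integral_f)

definition FT_good :: "nat \<Rightarrow> nat \<Rightarrow> (nat \<Rightarrow> 'b) \<Rightarrow> real \<Rightarrow> complex" where
  "FT_good n0 n y t = FT (\<lambda>x. enn2real (good n n0 y x)) t"

lemma FT_good_sum: "FT (\<lambda>x. enn2real (good_sum n0 n y x)) t = FT_good n0 n y t * (\<Prod>i\<in>{n0<..n0 + (n - n0)}. cond_char (y i) t)"
  unfolding good_sum_def FT_good_def cond_char_def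
  by (rule FT_csum) (auto simp: nn_integral_f intro!: le_less_trans[OF nn_integral_good_le])

lemma integrable_good: "integrable lborel (\<lambda>x. enn2real (good L n0 y x))"
  by (rule integrable_enn2real) (auto intro!: le_less_trans[OF nn_integral_good_le])

lemma integral_good_le: "(LINT x|lborel. enn2real (good L n0 y x)) \<le> 1"
proof (rule integral_real_bounded)
  have "(\<integral>\<^sup>+ x. ennreal (enn2real (good L n0 y x)) \<partial>lborel) \<le> (\<integral>\<^sup>+ x. good L n0 y x \<partial>lborel)"
    by (intro nn_integral_mono) (auto simp: ennreal_enn2real_if)
  then show "(\<integral>\<^sup>+ x. ennreal (enn2real (good L n0 y x)) \<partial>lborel) \<le> ennreal 1"
    using nn_integral_good_le[of L n0 y] by simp
qed simp

lemma norm_FT_good_sq_le_1: "(norm (FT_good n0 n y t))\<^sup>2 \<le> 1"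
proof -
  have "norm (FT_good n0 n y t) \<le> (LINT x|lborel. \<bar>enn2real (good n n0 y x)\<bar>)"
    unfolding FT_good_def by (rule norm_FT_le)
  then have "norm (FT_good n0 n y t) \<le> 1" using integral_good_le[of n n0 y] by simp
  then show ?thesis by (simp add: power_le_one)
qed

text \<open>A function bounded by n and of mass at most 1 has an integral of its square at most
  n.\<close>

lemma FT_good_Plancherel: "(\<integral>\<^sup>+ t. ennreal ((norm (FT_good n0 n y t))\<^sup>2) \<partial>lborel) \<le> ennreal (2 * pi * real n)"
proof -
  have g: "enn2real (good n n0 y x) \<le> n" for x
    using enn2real_mono[OF good_le(1)[of "real n" n0 y x]] by simp
  have i2: "integrable lborel (\<lambda>x. (enn2real (good n n0 y x))\<^sup>2)"
  proof (rule Bochner_Integration.integrable_bound)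
    show "integrable lborel (\<lambda>x. n * enn2real (good n n0 y x))" using integrable_good by simp
  qed (use g in \<open>auto simp: power2_eq_square intro!: AE_I2 mult_right_mono\<close>)
  have "(LINT x|lborel. (enn2real (good n n0 y x))\<^sup>2) \<le> (LINT x|lborel. n * enn2real (good n n0 y x))"
    by (rule integral_mono[OF i2]) (use g integrable_good in \<open>auto simp: power2_eq_square intro!: mult_right_mono\<close>)
  also have "\<dots> \<le> n" using integral_good_le[of n n0 y] mult_left_mono[of _ 1 "real n"] by simp
  finally have "(LINT x|lborel. (enn2real (good n n0 y x))\<^sup>2) \<le> n" .
  then have "ennreal (2 * pi * (LINT x|lborel. (enn2real (good n n0 y x))\<^sup>2)) \<le> ennreal (2 * pi * real n)"
    by (intro ennreal_leI mult_left_mono) auto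
  with Plancherel_upper[OF integrable_good i2] show ?thesis unfolding FT_good_def by (rule order_trans)
qed

lemma measurable_FT_good_pair:
  assumes "1 \<le> n0" "n0 \<le> n'"
  shows "(\<lambda>(y, t). FT_good n0 n y t) \<in> borel_measurable (P n' \<Otimes>\<^sub>M borel)"
proof -
  have [measurable]: "(\<lambda>w. good n n0 (fst (fst w)) (snd w)) \<in> borel_measurable ((P n' \<Otimes>\<^sub>M borel) \<Otimes>\<^sub>M borel)"
    using measurable_compose[OF _ measurable_good_pair(1)[OF assms], of "\<lambda>w. (fst (fst w), snd w)" "(P n' \<Otimes>\<^sub>M borel) \<Otimes>\<^sub>M borel"]
    by simp
  have "(\<lambda>w. LINT x|lborel. complex_of_real (enn2real (good n n0 (fst w) x)) * iexp (snd w * x)) \<in> borel_measurable (P n' \<Otimes>\<^sub>M borel)"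
    by (rule lborel.borel_measurable_lebesgue_integral) (simp add: split_beta')
  then show ?thesis by (simp add: FT_good_def FT_def split_beta')
qed

lemma measurable_FT_good:
  assumes "1 \<le> n0" "n0 \<le> n'"
  shows "(\<lambda>y. FT_good n0 n y t) \<in> borel_measurable (P n')"
  using measurable_compose[OF _ measurable_FT_good_pair[OF assms], of "\<lambda>y. (y, t)" "P n'"] by simp

text \<open>This is the weight w of \<open>power_char_integral_bound\<close>: real, between 0 and 1,
  with integral at most 2 pi n.\<close>

definition mean_sq_FT_good :: "nat \<Rightarrow> nat \<Rightarrow> real \<Rightarrow> real" where
  "mean_sq_FT_good n0 n t = enn2real (\<integral>\<^sup>+ y. ennreal ((norm (FT_good n0 n y t))\<^sup>2) \<partial>P n0)"

lemma ennreal_mean_sq_FT_good: "ennreal (mean_sq_FT_good n0 n t) = (\<integral>\<^sup>+ y. ennreal ((norm (FT_good n0 n y t))\<^sup>2) \<partial>P n0)"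
  and mean_sq_FT_good_bounds: "0 \<le> mean_sq_FT_good n0 n t" "mean_sq_FT_good n0 n t \<le> 1"
proof -
  interpret Pn: prob_space "P n0" by (rule prob_P)
  have "(\<integral>\<^sup>+ y. ennreal ((norm (FT_good n0 n y t))\<^sup>2) \<partial>P n0) \<le> (\<integral>\<^sup>+ y. 1 \<partial>P n0)"
    by (intro nn_integral_mono) (auto simp: norm_FT_good_sq_le_1)
  then have le: "(\<integral>\<^sup>+ y. ennreal ((norm (FT_good n0 n y t))\<^sup>2) \<partial>P n0) \<le> 1" by (simp add: Pn.emeasure_space_1)
  show "ennreal (mean_sq_FT_good n0 n t) = (\<integral>\<^sup>+ y. ennreal ((norm (FT_good n0 n y t))\<^sup>2) \<partial>P n0)"
    unfolding mean_sq_FT_good_def using le by (intro ennreal_enn2real) (auto simp: less_top[symmetric] top_unique)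
  show "0 \<le> mean_sq_FT_good n0 n t" by (simp add: mean_sq_FT_good_def)
  show "mean_sq_FT_good n0 n t \<le> 1" unfolding mean_sq_FT_good_def using enn2real_mono[OF le] by simp
qed

lemma measurable_mean_sq_FT_good [measurable]:
  assumes "1 \<le> n0"
  shows "mean_sq_FT_good n0 n \<in> borel_measurable borel"
proof -
  interpret Pn: prob_space "P n0" by (rule prob_P)
  have [measurable]: "(\<lambda>w. FT_good n0 n (snd w) (fst w)) \<in> borel_measurable (borel \<Otimes>\<^sub>M P n0)"
    using measurable_compose[OF _ measurable_FT_good_pair[OF assms order_refl], of "\<lambda>w. (snd w, fst w)" "borel \<Otimes>\<^sub>M P n0"] by simp
  have [measurable]: "(\<lambda>t. \<integral>\<^sup>+ y. ennreal ((norm (FT_good n0 n y t))\<^sup>2) \<partial>P n0) \<in> borel_measurable borel"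
    by (rule Pn.borel_measurable_nn_integral) (simp add: split_beta')
  show ?thesis unfolding mean_sq_FT_good_def[abs_def] by measurable
qed

lemma nn_integral_mean_sq_FT_good:
  assumes "1 \<le> n0"
  shows "(\<integral>\<^sup>+ t. ennreal (mean_sq_FT_good n0 n t) \<partial>lborel) \<le> ennreal (2 * pi * real n)"
proof -
  interpret Pn: prob_space "P n0" by (rule prob_P)
  interpret PS: pair_sigma_finite "P n0" lborel ..
  have m: "(\<lambda>(y, t). ennreal ((norm (FT_good n0 n y t))\<^sup>2)) \<in> borel_measurable (P n0 \<Otimes>\<^sub>M lborel)"
    using measurable_FT_good_pair[OF assms order_refl, of n] measurable_cong_sets[OF measurable_P_lborel refl]
    by (simp add: split_beta')
  have "(\<integral>\<^sup>+ t. ennreal (mean_sq_FT_good n0 n t) \<partial>lborel) = (\<integral>\<^sup>+ y. \<integral>\<^sup>+ t. ennreal ((norm (FT_good n0 n y t))\<^sup>2) \<partial>lborel \<partial>P n0)"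
    unfolding ennreal_mean_sq_FT_good by (rule PS.Fubini'[OF m])
  also have "\<dots> \<le> (\<integral>\<^sup>+ y. ennreal (2 * pi * real n) \<partial>P n0)"
    by (intro nn_integral_mono FT_good_Plancherel)
  finally show ?thesis by (simp add: Pn.emeasure_space_1)
qed

lemma dens_upd:
  assumes "1 \<le> n0" "i > n0"
  shows "dens n0 (y(i := z)) = dens n0 y"
  by (rule dens_cong) (use assms in auto)

text \<open>Plancherel is applied for each fixed sequence of labels. Tonelli then lets the labels be
  averaged at fixed t, where the squared transform is a product of a factor in the first n0 labels
  and one factor for each later label.\<close>

lemma nn_integral_good_sum_sq:
  assumes n0: "1 \<le> n0" "n0 \<le> n"
  shows "(\<integral>\<^sup>+ y. \<integral>\<^sup>+ x. ennreal ((enn2real (good_sum n0 n y x))\<^sup>2) \<partial>lborel \<partial>P n)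
    \<le> ennreal (1 / (2 * pi)) * (\<integral>\<^sup>+ t. ennreal (mean_sq_FT_good n0 n t * mean_sq_char t ^ (n - n0)) \<partial>lborel)"
proof -
  interpret Pn: prob_space "P n" by (rule prob_P)
  interpret PS: pair_sigma_finite "P n" lborel ..
  define U where "U t z = ennreal ((norm (cond_char z t))\<^sup>2)" for t z
  define G where "G t y = ennreal ((norm (FT_good n0 n y t))\<^sup>2)" for t y
  have nn: "n0 + (n - n0) = n" using n0 by simp
  have Um [measurable]: "U t \<in> borel_measurable \<nu>" for t unfolding U_def[abs_def] by measurable
  have Gm: "G t \<in> borel_measurable (P (n0 + k))" for t k
    unfolding G_def[abs_def] using measurable_FT_good[of n0 "n0 + k" n t] n0 by simp
  have [measurable]: "(\<lambda>w. FT_good n0 n (fst w) (snd w)) \<in> borel_measurable (P n \<Otimes>\<^sub>M borel)"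
    using measurable_FT_good_pair[OF n0, of n] by (simp add: split_beta')
  have phm [measurable]: "(\<lambda>w. cond_char (fst w i) (snd w)) \<in> borel_measurable (P n \<Otimes>\<^sub>M borel)" if "i \<in> {n0<..n}" for i
  proof -
    have "i \<in> {Suc 0..n}" using that by auto
    then have "(\<lambda>w. (fst w i, snd w)) \<in> P n \<Otimes>\<^sub>M (borel :: real measure) \<rightarrow>\<^sub>M \<nu> \<Otimes>\<^sub>M borel" by measurable
    from measurable_compose[OF this measurable_cond_char_pair] show ?thesis by simp
  qed
  have m: "(\<lambda>(y, t). G t y * (\<Prod>i\<in>{n0<..n}. U t (y i))) \<in> borel_measurable (P n \<Otimes>\<^sub>M lborel)"
    unfolding G_def U_def split_beta' measurable_cong_sets[OF measurable_P_lborel refl] by measurable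
  have "(\<integral>\<^sup>+ x. ennreal ((enn2real (good_sum n0 n y x))\<^sup>2) \<partial>lborel)
      \<le> ennreal (1 / (2 * pi)) * (\<integral>\<^sup>+ t. G t y * (\<Prod>i\<in>{n0<..n}. U t (y i)) \<partial>lborel)" for y
  proof -
    let ?u = "\<lambda>x. enn2real (good_sum n0 n y x)"
    have iu: "integrable lborel ?u"
      by (rule integrable_enn2real) (auto intro!: le_less_trans[OF nn_integral_good_sum_le])
    have bu: "\<bar>?u x\<bar> \<le> n" for x using enn2real_mono[OF good_sum_le[of n0 n y x]] by simp
    have iu2: "integrable lborel (\<lambda>x. (?u x)\<^sup>2)"
    proof (rule Bochner_Integration.integrable_bound)
      show "integrable lborel (\<lambda>x. n * ?u x)" using iu by simp
    qed (use bu in \<open>auto simp: power2_eq_square intro!: AE_I2 mult_right_mono\<close>)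
    have "(\<integral>\<^sup>+ x. ennreal ((?u x)\<^sup>2) \<partial>lborel) = ennreal (LINT x|lborel. (?u x)\<^sup>2)"
      by (rule nn_integral_eq_integral[OF iu2]) auto
    also have "\<dots> = ennreal (1 / (2 * pi)) * ennreal (2 * pi * (LINT x|lborel. (?u x)\<^sup>2))"
      by (subst ennreal_mult'[symmetric]) auto
    also have "\<dots> \<le> ennreal (1 / (2 * pi)) * (\<integral>\<^sup>+ t. ennreal ((norm (FT ?u t))\<^sup>2) \<partial>lborel)"
      by (intro mult_left_mono Plancherel_lower[OF iu bu]) auto
    also have "(\<integral>\<^sup>+ t. ennreal ((norm (FT ?u t))\<^sup>2) \<partial>lborel) = (\<integral>\<^sup>+ t. G t y * (\<Prod>i\<in>{n0<..n}. U t (y i)) \<partial>lborel)"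
      unfolding FT_good_sum nn G_def U_def
      by (simp add: norm_mult power_mult_distrib prod_norm[symmetric] prod_power_distrib ennreal_mult prod_ennreal prod_nonneg)
    finally show ?thesis .
  qed
  then have "(\<integral>\<^sup>+ y. \<integral>\<^sup>+ x. ennreal ((enn2real (good_sum n0 n y x))\<^sup>2) \<partial>lborel \<partial>P n)
     \<le> (\<integral>\<^sup>+ y. ennreal (1 / (2 * pi)) * (\<integral>\<^sup>+ t. G t y * (\<Prod>i\<in>{n0<..n}. U t (y i)) \<partial>lborel) \<partial>P n)"
    by (intro nn_integral_mono)
  also have "\<dots> = ennreal (1 / (2 * pi)) * (\<integral>\<^sup>+ y. \<integral>\<^sup>+ t. G t y * (\<Prod>i\<in>{n0<..n}. U t (y i)) \<partial>lborel \<partial>P n)"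
    by (rule nn_integral_cmult) (use lborel.borel_measurable_nn_integral_fst[OF m] in simp)
  also have "(\<integral>\<^sup>+ y. \<integral>\<^sup>+ t. G t y * (\<Prod>i\<in>{n0<..n}. U t (y i)) \<partial>lborel \<partial>P n)
    = (\<integral>\<^sup>+ t. \<integral>\<^sup>+ y. G t y * (\<Prod>i\<in>{n0<..n}. U t (y i)) \<partial>P n \<partial>lborel)"
    by (rule PS.Fubini'[symmetric, OF m])
  also have "\<dots> = (\<integral>\<^sup>+ t. ennreal (mean_sq_FT_good n0 n t * mean_sq_char t ^ (n - n0)) \<partial>lborel)"
  proof (rule nn_integral_cong)
    fix t
    have "(\<integral>\<^sup>+ y. G t y * (\<Prod>i\<in>{n0<..n0+(n-n0)}. U t (y i)) \<partial>P (n0 + (n - n0)))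
        = (\<integral>\<^sup>+ y. G t y \<partial>P n0) * (\<integral>\<^sup>+ z. U t z \<partial>\<nu>) ^ (n - n0)"
    proof (rule nn_integral_P_prod[OF Gm _ Um])
      fix y i z assume "n0 < i"
      then show "G t (y(i := z)) = G t y" by (simp only: G_def FT_good_def good_def dens_upd[OF n0(1)])
    qed
    also have "(\<integral>\<^sup>+ y. G t y \<partial>P n0) = ennreal (mean_sq_FT_good n0 n t)" by (simp add: G_def ennreal_mean_sq_FT_good)
    also have "(\<integral>\<^sup>+ z. U t z \<partial>\<nu>) = ennreal (mean_sq_char t)"
      unfolding U_def mean_sq_char_def by (rule nn_integral_eq_integral[OF integrable_norm_cond_char_sq]) auto
    finally show "(\<integral>\<^sup>+ y. G t y * (\<Prod>i\<in>{n0<..n}. U t (y i)) \<partial>P n) = ennreal (mean_sq_FT_good n0 n t * mean_sq_char t ^ (n - n0))"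
      unfolding nn using mean_sq_FT_good_bounds mean_sq_char_nonneg by (simp add: ennreal_mult ennreal_power)
  qed
  finally show ?thesis .
qed

text \<open>The density of the normalised centred sum, as a real function of labels and point
  jointly. Infinite values of \<open>dens\<close> become 0, which for each label sequence concerns
  only a null set of points.\<close>

definition scaled_dens :: "nat \<Rightarrow> (nat \<Rightarrow> 'b) \<times> real \<Rightarrow> real" where
  "scaled_dens n w = sqrt n * enn2real (dens n (fst w) (sqrt n * snd w))"

lemma nn_integral_rescale:
  assumes [measurable]: "G \<in> borel_measurable borel" and s: "s > (0::real)"
  shows "(\<integral>\<^sup>+ x. ennreal s * G (s * x) \<partial>lborel) = (\<integral>\<^sup>+ x. G x \<partial>lborel)"
  using s by (subst (2) nn_integral_real_affine[where c=s and t=0]) (auto simp: nn_integral_cmult)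

lemma AE_rescale:
  assumes "AE x in lborel. Q x" "Measurable.pred borel Q" "s \<noteq> (0::real)"
  shows "AE x in lborel. Q (s * x)"
  using AE_borel_affine[OF assms(3,2,1), of 0] by simp

lemma measurable_rescale_pair:
  assumes "(\<lambda>(y, x). g y x) \<in> borel_measurable (P n \<Otimes>\<^sub>M (borel :: real measure))"
  shows "(\<lambda>w. (s::real) * enn2real (g (fst w) (s * snd w))) \<in> borel_measurable (P n \<Otimes>\<^sub>M lborel)"
proof -
  have "(\<lambda>w. (fst w, s * snd w)) \<in> P n \<Otimes>\<^sub>M borel \<rightarrow>\<^sub>M P n \<Otimes>\<^sub>M borel" by measurable
  from measurable_compose[OF this assms] have [measurable]: "(\<lambda>w. g (fst w) (s * snd w)) \<in> borel_measurable (P n \<Otimes>\<^sub>M borel)"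
    by simp
  show ?thesis unfolding measurable_cong_sets[OF measurable_P_lborel refl] by measurable
qed

lemma measurable_scaled_dens: "1 \<le> n \<Longrightarrow> scaled_dens n \<in> borel_measurable (P n \<Otimes>\<^sub>M lborel)"
  unfolding scaled_dens_def[abs_def] by (intro measurable_rescale_pair measurable_dens_pair) auto

lemma scaled_dens_nonneg: "scaled_dens n w \<ge> 0" by (simp add: scaled_dens_def)

lemma scaled_dens_section:
  assumes n: "n \<ge> 1" and [measurable]: "G \<in> borel_measurable borel"
  shows "(\<integral>\<^sup>+ x. ennreal (scaled_dens n (y, x)) * G (sqrt n * x) \<partial>lborel) = (\<integral>\<^sup>+ x. dens n y x * G x \<partial>lborel)"
proof -
  have s: "sqrt n > 0" using n by simp
  have "AE x in lborel. dens n y (sqrt n * x) < \<infinity>"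
    by (rule AE_rescale[OF AE_dens_finite]) (use s in auto)
  then have "(\<integral>\<^sup>+ x. ennreal (scaled_dens n (y, x)) * G (sqrt n * x) \<partial>lborel)
      = (\<integral>\<^sup>+ x. ennreal (sqrt n) * (dens n y (sqrt n * x) * G (sqrt n * x)) \<partial>lborel)"
    by (intro nn_integral_cong_AE)
       (auto elim!: eventually_mono simp: scaled_dens_def ennreal_mult mult.assoc)
  also have "\<dots> = (\<integral>\<^sup>+ x. dens n y x * G x \<partial>lborel)"
    by (rule nn_integral_rescale[of "\<lambda>x. dens n y x * G x"]) (use s in auto)
  finally show ?thesis .
qed

lemma nn_integral_scaled_dens_section: "n \<ge> 1 \<Longrightarrow> (\<integral>\<^sup>+ x. ennreal (scaled_dens n (y, x)) \<partial>lborel) = 1"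
  using scaled_dens_section[of n "\<lambda>_. 1" y] by (simp add: nn_integral_dens)

lemma nn_integral_scaled_dens:
  assumes n: "n \<ge> 1"
  shows "(\<integral>\<^sup>+ w. ennreal (scaled_dens n w) \<partial>(P n \<Otimes>\<^sub>M lborel)) = 1"
    and "(\<integral>\<^sup>+ w. ennreal (scaled_dens n w * (snd w)\<^sup>2) \<partial>(P n \<Otimes>\<^sub>M lborel)) = ennreal (\<sigma>\<^sup>2)"
proof -
  interpret Pn: prob_space "P n" by (rule prob_P)
  note [measurable] = measurable_scaled_dens[OF n]
  show "(\<integral>\<^sup>+ w. ennreal (scaled_dens n w) \<partial>(P n \<Otimes>\<^sub>M lborel)) = 1"
    by (subst lborel.nn_integral_fst[symmetric]) (auto simp: nn_integral_scaled_dens_section[OF n] Pn.emeasure_space_1)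
  have sec: "(\<integral>\<^sup>+ x. ennreal (scaled_dens n (y, x) * x\<^sup>2) \<partial>lborel) = (\<integral>\<^sup>+ x. ennreal (x\<^sup>2) * dens n y x \<partial>lborel) * ennreal (1 / n)" for y
  proof -
    have "(\<integral>\<^sup>+ x. ennreal (scaled_dens n (y, x) * x\<^sup>2) \<partial>lborel) = (\<integral>\<^sup>+ x. ennreal (scaled_dens n (y, x)) * ennreal ((sqrt n * x)\<^sup>2 / n) \<partial>lborel)"
      using n by (intro nn_integral_cong) (simp add: ennreal_mult scaled_dens_nonneg power_mult_distrib)
    also have "\<dots> = (\<integral>\<^sup>+ x. dens n y x * ennreal (x\<^sup>2 / n) \<partial>lborel)"
      by (rule scaled_dens_section[OF n, of "\<lambda>x. ennreal (x\<^sup>2 / n)"]) simp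
    also have "\<dots> = (\<integral>\<^sup>+ x. (ennreal (x\<^sup>2) * dens n y x) * ennreal (1 / n) \<partial>lborel)"
    proof (rule nn_integral_cong)
      fix x :: real
      have "ennreal (x\<^sup>2 / n) = ennreal (x\<^sup>2) * ennreal (1 / n)" by (subst ennreal_mult[symmetric]) auto
      then show "dens n y x * ennreal (x\<^sup>2 / n) = (ennreal (x\<^sup>2) * dens n y x) * ennreal (1 / n)"
        by (simp add: ac_simps)
    qed
    finally show ?thesis by (simp add: nn_integral_multc)
  qed
  have [measurable]: "(\<lambda>(y, x). dens n y x) \<in> borel_measurable (P n \<Otimes>\<^sub>M lborel)"
    using measurable_dens_pair[of n n] n unfolding measurable_cong_sets[OF measurable_P_lborel refl] by simp
  have "(\<integral>\<^sup>+ w. ennreal (scaled_dens n w * (snd w)\<^sup>2) \<partial>(P n \<Otimes>\<^sub>M lborel)) =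
      (\<integral>\<^sup>+ y. \<integral>\<^sup>+ x. ennreal (scaled_dens n (y, x) * x\<^sup>2) \<partial>lborel \<partial>P n)"
    by (subst lborel.nn_integral_fst[symmetric]) auto
  also have "\<dots> = ennreal (n * \<sigma>\<^sup>2) * ennreal (1 / n)"
    unfolding sec by (subst nn_integral_multc) (use n in \<open>auto simp: nn_integral_dens_second_moment\<close>)
  also have "\<dots> = ennreal (\<sigma>\<^sup>2)" using n by (subst ennreal_mult[symmetric]) auto
  finally show "(\<integral>\<^sup>+ w. ennreal (scaled_dens n w * (snd w)\<^sup>2) \<partial>(P n \<Otimes>\<^sub>M lborel)) = ennreal (\<sigma>\<^sup>2)" .
qed

section \<open>Mass and entropy contribution of the part above the level\<close>

lemma Psi_enn2real: "ennreal (enn2real b * max 0 (ln (enn2real b))) \<le> Psi b"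
  by (simp add: Psi_def)

text \<open>Wherever \<open>bad\<close> is nonzero it exceeds n, so its logarithm exceeds ln
  n.\<close>

lemma Psi_bad_lower:
  fixes n :: nat
  assumes "1 \<le> n"
  shows "bad n n0 y x * ennreal (ln n) \<le> Psi (bad n n0 y x)"
proof (cases "bad n n0 y x = 0 \<or> bad n n0 y x = \<infinity>")
  case False
  then obtain b where b: "bad n n0 y x = ennreal b" "b \<ge> 0" "b > 0" by (cases "bad n n0 y x") (auto simp: less_le)
  have "\<not> ennreal b \<le> ennreal n"
    using b False by (auto simp: bad_def split: if_splits)
  then have "real n < b" by (meson ennreal_leI not_le)
  then have "ln n \<le> ln b" using assms by simp
  moreover have "0 \<le> ln n" using assms by simp
  ultimately have "b * ln n \<le> b * max 0 (ln b)" using b by (intro mult_left_mono) auto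
  then show ?thesis using b by (simp add: Psi_def ennreal_mult'[symmetric] ennreal_leI)
qed (auto simp: Psi_def)

definition bad_mass :: "nat \<Rightarrow> nat \<Rightarrow> ennreal" where
  "bad_mass n0 n = (\<integral>\<^sup>+ y. \<integral>\<^sup>+ x. bad n n0 y x \<partial>lborel \<partial>P n0)"

definition bad_Psi :: "nat \<Rightarrow> nat \<Rightarrow> ennreal" where
  "bad_Psi n0 n = (\<integral>\<^sup>+ y. \<integral>\<^sup>+ x. Psi (bad n n0 y x) \<partial>lborel \<partial>P n0)"

lemma P_restrict:
  assumes n: "n0 \<le> n" and [measurable]: "G \<in> borel_measurable (P n0)"
    and G: "\<And>y. G (\<lambda>i\<in>{Suc 0..n0}. y i) = G y"
  shows "(\<integral>\<^sup>+ y. G y \<partial>P n) = (\<integral>\<^sup>+ y. G y \<partial>P n0)"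
proof -
  interpret Q: product_prob_space "\<lambda>_::nat. \<nu>" "{Suc 0..n}" by standard
  have sub: "{Suc 0..n0} \<subseteq> {Suc 0..n}" using n by auto
  have eq: "P n0 = distr (P n) (P n0) (\<lambda>y. restrict y {Suc 0..n0})"
    by (rule Q.distr_restrict) (use sub in auto)
  have m: "(\<lambda>y. restrict y {Suc 0..n0}) \<in> P n \<rightarrow>\<^sub>M P n0" by (rule measurable_restrict_subset[OF sub])
  have "(\<integral>\<^sup>+ y. G y \<partial>P n0) = (\<integral>\<^sup>+ y. G (restrict y {Suc 0..n0}) \<partial>P n)"
    by (subst eq, subst nn_integral_distr[OF m]) auto
  then show ?thesis using G by simp
qed

lemma bad_restrict:
  assumes "1 \<le> n0"
  shows "bad L n0 (\<lambda>i\<in>{Suc 0..n0}. y i) = bad L n0 y"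
proof -
  have "dens n0 (\<lambda>i\<in>{Suc 0..n0}. y i) = dens n0 y" by (rule dens_cong) (use assms in auto)
  then show ?thesis by (simp only: bad_def[abs_def])
qed

context
  fixes n0 :: nat
  assumes n0: "1 \<le> n0"
    and Psi_fin: "(\<integral>\<^sup>+ y. \<integral>\<^sup>+ x. Psi (dens n0 y x) \<partial>lborel \<partial>P n0) < \<infinity>"
begin

lemma measurable_bad_lborel: "(\<lambda>w. bad L n0 (fst w) (snd w)) \<in> borel_measurable (P n0 \<Otimes>\<^sub>M lborel)"
  using measurable_good_pair(2)[OF n0 order_refl, of L]
  unfolding measurable_cong_sets[OF measurable_P_lborel refl] by (simp add: split_beta')

text \<open>Dominated convergence, with \<open>K\<close> applied to the untruncated density as
  dominating function: at almost every point that density is finite and the part above level n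
  vanishes for large n. It serves for \<open>K\<close> the identity and
  \<open>K = Psi\<close>.\<close>

lemma bad_tendsto_0:
  assumes [measurable]: "K \<in> borel_measurable borel" and K: "K (0::ennreal) = (0::ennreal)"
    and fin: "(\<integral>\<^sup>+ y. \<integral>\<^sup>+ x. K (dens n0 y x) \<partial>lborel \<partial>P n0) < \<infinity>"
  shows "(\<lambda>n. \<integral>\<^sup>+ y. \<integral>\<^sup>+ x. K (bad (real n) n0 y x) \<partial>lborel \<partial>P n0) \<longlonglongrightarrow> 0"
proof -
  interpret Pn: prob_space "P n0" by (rule prob_P)
  interpret PS: pair_sigma_finite "P n0" lborel ..
  note [measurable] = measurable_bad_lborel
  have dm [measurable]: "(\<lambda>w. dens n0 (fst w) (snd w)) \<in> borel_measurable (P n0 \<Otimes>\<^sub>M lborel)"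
    using measurable_dens_pair[OF n0 order_refl] unfolding measurable_cong_sets[OF measurable_P_lborel refl]
    by (simp add: split_beta')
  have "(\<lambda>n. \<integral>\<^sup>+ w. K (bad (real n) n0 (fst w) (snd w)) \<partial>(P n0 \<Otimes>\<^sub>M lborel)) \<longlonglongrightarrow> (\<integral>\<^sup>+ w. 0 \<partial>(P n0 \<Otimes>\<^sub>M (lborel :: real measure)))"
  proof (rule nn_integral_dominated_convergence)
    show "(\<integral>\<^sup>+ w. K (dens n0 (fst w) (snd w)) \<partial>(P n0 \<Otimes>\<^sub>M lborel)) < \<infinity>"
      by (subst lborel.nn_integral_fst[symmetric]) (use fin in auto)
    show "AE w in P n0 \<Otimes>\<^sub>M lborel. K (bad (real n) n0 (fst w) (snd w)) \<le> K (dens n0 (fst w) (snd w))" for n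
      by (rule AE_I2) (auto simp: bad_def K)
    have "AE w in P n0 \<Otimes>\<^sub>M lborel. dens n0 (fst w) (snd w) < \<infinity>"
    proof (rule PS.AE_pair_measure)
      show "{w \<in> space (P n0 \<Otimes>\<^sub>M lborel). dens n0 (fst w) (snd w) < \<infinity>} \<in> sets (P n0 \<Otimes>\<^sub>M lborel)"
        by measurable
    qed (simp add: AE_dens_finite del: infinity_ennreal_def)
    then show "AE w in P n0 \<Otimes>\<^sub>M lborel. (\<lambda>n. K (bad (real n) n0 (fst w) (snd w))) \<longlonglongrightarrow> 0"
    proof eventually_elim
      case (elim w)
      then obtain r where r: "dens n0 (fst w) (snd w) = ennreal r" "r \<ge> 0"
        by (cases "dens n0 (fst w) (snd w)") auto
      obtain m :: nat where m: "r \<le> m" using real_arch_simple by blast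
      have "\<forall>\<^sub>F n in sequentially. 0 = K (bad (real n) n0 (fst w) (snd w))"
        by (intro eventually_sequentiallyI[of m]) (use r m in \<open>auto simp: bad_def K ennreal_leI\<close>)
      then show ?case by (rule Lim_transform_eventually[OF tendsto_const])
    qed
  qed measurable
  moreover have "(\<integral>\<^sup>+ w. K (bad (real n) n0 (fst w) (snd w)) \<partial>(P n0 \<Otimes>\<^sub>M lborel))
     = (\<integral>\<^sup>+ y. \<integral>\<^sup>+ x. K (bad (real n) n0 y x) \<partial>lborel \<partial>P n0)" for n
    by (subst lborel.nn_integral_fst[symmetric]) auto
  ultimately show ?thesis by simp
qed

lemma bad_Psi_tendsto: "bad_Psi n0 \<longlonglongrightarrow> 0"
  unfolding bad_Psi_def[abs_def] by (rule bad_tendsto_0) (use Psi_fin in auto)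

lemma bad_mass_tendsto: "bad_mass n0 \<longlonglongrightarrow> 0"
proof -
  interpret Pn: prob_space "P n0" by (rule prob_P)
  show ?thesis unfolding bad_mass_def[abs_def]
    by (rule bad_tendsto_0[of "\<lambda>x. x"]) (auto simp: nn_integral_dens Pn.emeasure_space_1)
qed

lemma bad_mass_finite: "bad_mass n0 n < \<infinity>"
proof -
  interpret Pn: prob_space "P n0" by (rule prob_P)
  have "bad_mass n0 n \<le> (\<integral>\<^sup>+ y. \<integral>\<^sup>+ x. dens n0 y x \<partial>lborel \<partial>P n0)"
    unfolding bad_mass_def by (intro nn_integral_mono bad_le)
  then show ?thesis by (auto simp: nn_integral_dens Pn.emeasure_space_1 intro: le_less_trans)
qed

lemma bad_Psi_finite: "bad_Psi n0 n < \<infinity>"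
proof -
  have "bad_Psi n0 n \<le> (\<integral>\<^sup>+ y. \<integral>\<^sup>+ x. Psi (dens n0 y x) \<partial>lborel \<partial>P n0)"
    unfolding bad_Psi_def by (intro nn_integral_mono) (auto simp: bad_def)
  then show ?thesis using Psi_fin by (auto intro: le_less_trans)
qed

text \<open>Combined with \<open>bad_Psi_tendsto\<close> this is the rate o(1 / ln n) for the mass
  above the level.\<close>

lemma bad_Psi_bad_mass:
  assumes "n \<ge> 1"
  shows "ennreal (ln n) * bad_mass n0 n \<le> bad_Psi n0 n"
proof -
  note [measurable] = measurable_bad_lborel
  have "ennreal (ln n) * bad_mass n0 n = (\<integral>\<^sup>+ y. \<integral>\<^sup>+ x. bad n n0 y x * ennreal (ln n) \<partial>lborel \<partial>P n0)"
    unfolding bad_mass_def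
    by (subst nn_integral_cmult[symmetric], measurable)
       (auto intro!: nn_integral_cong simp: nn_integral_cmult mult.commute)
  also have "\<dots> \<le> bad_Psi n0 n"
    unfolding bad_Psi_def by (intro nn_integral_mono Psi_bad_lower assms)
  finally show ?thesis .
qed

end

text \<open>The locale contains densities but no random variables, so the limit theorem for the
  averaged laws enters as the hypothesis \<open>CLT\<close>. Indices are shifted by N because the
  L^2 bound for the truncated part starts at 2 n0 + 1.\<close>

theorem entropy_dens_limit:
  assumes n0: "1 \<le> n0"
    and Psi_fin: "(\<integral>\<^sup>+ y. \<integral>\<^sup>+ x. Psi (dens n0 y x) \<partial>lborel \<partial>P n0) < \<infinity>"
    and CLT: "\<And>F. continuous_on UNIV F \<Longrightarrow> bounded (range F) \<Longrightarrow>
      (\<lambda>n. LINT w|(P n \<Otimes>\<^sub>M lborel). scaled_dens n w * F (snd w)) \<longlonglongrightarrow> (LINT x|lborel. normal_density 0 \<sigma> x * F x)"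
  defines "N \<equiv> 2 * n0 + 1"
  shows "integrable (P (k + N) \<Otimes>\<^sub>M lborel) (\<lambda>w. scaled_dens (k + N) w * ln (scaled_dens (k + N) w))"
    and "(\<lambda>k. LINT w|(P (k + N) \<Otimes>\<^sub>M lborel). scaled_dens (k + N) w * ln (scaled_dens (k + N) w)) \<longlonglongrightarrow> - (1 / 2 * ln (2 * pi * exp 1 * \<sigma>\<^sup>2))"
proof -
  define A where "A n w = sqrt n * enn2real (good_sum n0 n (fst w) (sqrt n * snd w))" for n :: nat and w
  define B where "B n w = sqrt n * enn2real (bad_sum n0 n (fst w) (sqrt n * snd w))" for n :: nat and w
  obtain \<alpha> where \<alpha>: "\<alpha> \<longlonglongrightarrow> 1 / (2 * \<sigma> * sqrt pi)" "\<And>n. \<alpha> n \<ge> 0"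
    and \<alpha>b: "\<And>n w. n \<ge> 2 * n0 + 1 \<Longrightarrow> w \<in> borel_measurable borel \<Longrightarrow> (\<forall>t. 0 \<le> w t \<and> w t \<le> 1) \<Longrightarrow>
      (\<integral>\<^sup>+ t. ennreal (w t) \<partial>lborel) \<le> ennreal (2 * pi * real n) \<Longrightarrow>
      ennreal (sqrt n) * (\<integral>\<^sup>+ t. ennreal (w t * mean_sq_char t ^ (n - n0)) \<partial>lborel) \<le> ennreal (2 * pi * \<alpha> n)"
    using mean_sq_char_bound[of n0] by auto
  have N: "k + N \<ge> 1" "k + N \<ge> n0" "k + N \<ge> 2 * n0 + 1" for k by (auto simp: N_def)
  have sn: "sqrt (real n) > 0" if "n \<ge> 1" for n using that by simp
  have Am: "A n \<in> borel_measurable (P n \<Otimes>\<^sub>M lborel)" "B n \<in> borel_measurable (P n \<Otimes>\<^sub>M lborel)" if "n0 \<le> n" for n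
    unfolding A_def[abs_def] B_def[abs_def] using measurable_good_sum_pair[OF n0 that]
    by (intro measurable_rescale_pair; simp)+
  have Ads: "(\<lambda>x. good_sum n0 n y x) \<in> borel_measurable borel" "(\<lambda>x. bad_sum n0 n y x) \<in> borel_measurable borel" for n y by measurable
  have A2: "(\<integral>\<^sup>+ w. ennreal ((A n w)\<^sup>2) \<partial>(P n \<Otimes>\<^sub>M lborel)) \<le> ennreal (\<alpha> n)" if n: "n \<ge> 2 * n0 + 1" for n
  proof -
    have n1: "n \<ge> 1" "n0 \<le> n" using n by auto
    note [measurable] = Am[OF n1(2)]
    have [measurable]: "(\<lambda>(y, x). good_sum n0 n y x) \<in> borel_measurable (P n \<Otimes>\<^sub>M lborel)"
      unfolding measurable_cong_sets[OF measurable_P_lborel refl] by (rule measurable_good_sum_pair[OF n0 n1(2)])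
    have "(\<integral>\<^sup>+ w. ennreal ((A n w)\<^sup>2) \<partial>(P n \<Otimes>\<^sub>M lborel)) = (\<integral>\<^sup>+ y. \<integral>\<^sup>+ x. ennreal ((A n (y, x))\<^sup>2) \<partial>lborel \<partial>P n)"
      by (subst lborel.nn_integral_fst[symmetric]) auto
    also have "\<dots> = (\<integral>\<^sup>+ y. ennreal (sqrt n) * (\<integral>\<^sup>+ x. ennreal ((enn2real (good_sum n0 n y x))\<^sup>2) \<partial>lborel) \<partial>P n)"
    proof (rule nn_integral_cong)
      fix y
      \<comment> \<open>Squaring brings a factor n. One sqrt n is absorbed by the substitution x ->
        sqrt n x; the other remains and matches the factor in the bound for powers.\<close>
      have "(\<integral>\<^sup>+ x. ennreal ((A n (y, x))\<^sup>2) \<partial>lborel)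
        = (\<integral>\<^sup>+ x. ennreal (sqrt n) * (ennreal (sqrt n) * ennreal ((enn2real (good_sum n0 n y (sqrt n * x)))\<^sup>2)) \<partial>lborel)"
      proof (rule nn_integral_cong)
        fix x
        have "(A n (y, x))\<^sup>2 = sqrt n * (sqrt n * (enn2real (good_sum n0 n y (sqrt n * x)))\<^sup>2)"
          by (simp add: A_def power2_eq_square ac_simps)
        then show "ennreal ((A n (y, x))\<^sup>2) = ennreal (sqrt n) * (ennreal (sqrt n) * ennreal ((enn2real (good_sum n0 n y (sqrt n * x)))\<^sup>2))"
          by (metis ennreal_mult' real_sqrt_ge_zero of_nat_0_le_iff)
      qed
      also have "\<dots> = (\<integral>\<^sup>+ x. ennreal (sqrt n) * ennreal ((enn2real (good_sum n0 n y x))\<^sup>2) \<partial>lborel)"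
        by (rule nn_integral_rescale[of "\<lambda>x. ennreal (sqrt n) * ennreal ((enn2real (good_sum n0 n y x))\<^sup>2)"]) (use sn[OF n1(1)] in auto)
      finally show "(\<integral>\<^sup>+ x. ennreal ((A n (y, x))\<^sup>2) \<partial>lborel) = ennreal (sqrt n) * (\<integral>\<^sup>+ x. ennreal ((enn2real (good_sum n0 n y x))\<^sup>2) \<partial>lborel)"
        by (simp add: nn_integral_cmult)
    qed
    also have "\<dots> = ennreal (sqrt n) * (\<integral>\<^sup>+ y. \<integral>\<^sup>+ x. ennreal ((enn2real (good_sum n0 n y x))\<^sup>2) \<partial>lborel \<partial>P n)"
      by (rule nn_integral_cmult) measurable
    also have "\<dots> \<le> ennreal (sqrt n) * (ennreal (1 / (2 * pi)) * (\<integral>\<^sup>+ t. ennreal (mean_sq_FT_good n0 n t * mean_sq_char t ^ (n - n0)) \<partial>lborel))"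
      by (intro mult_left_mono nn_integral_good_sum_sq n0 n1) auto
    also have "\<dots> = ennreal (1 / (2 * pi)) * (ennreal (sqrt n) * (\<integral>\<^sup>+ t. ennreal (mean_sq_FT_good n0 n t * mean_sq_char t ^ (n - n0)) \<partial>lborel))"
      by (simp only: mult.left_commute)
    also have "\<dots> \<le> ennreal (1 / (2 * pi)) * ennreal (2 * pi * \<alpha> n)"
      by (intro mult_left_mono \<alpha>b n measurable_mean_sq_FT_good n0 nn_integral_mean_sq_FT_good) (auto simp: mean_sq_FT_good_bounds)
    also have "\<dots> = ennreal (\<alpha> n)" by (subst ennreal_mult'[symmetric]) auto
    finally show ?thesis .
  qed
  have bmf: "ennreal (enn2real (bad_mass n0 n)) = bad_mass n0 n" for n
    using bad_mass_finite[OF n0 Psi_fin, of n] by (simp add: ennreal_enn2real less_top)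
  have bPf: "ennreal (enn2real (bad_Psi n0 n)) = bad_Psi n0 n" for n
    using bad_Psi_finite[OF n0 Psi_fin, of n] by (simp add: ennreal_enn2real less_top)
  have badm: "(\<lambda>y. \<integral>\<^sup>+ x. K (bad L n0 y x) \<partial>lborel) \<in> borel_measurable (P n)"
    if "n0 \<le> n" and [measurable]: "K \<in> borel_measurable borel" for K :: "ennreal \<Rightarrow> ennreal" and L n
  proof -
    have [measurable]: "(\<lambda>w. bad L n0 (fst w) (snd w)) \<in> borel_measurable (P n \<Otimes>\<^sub>M lborel)"
      using measurable_good_pair(2)[OF n0 that(1), of L]
      unfolding measurable_cong_sets[OF measurable_P_lborel refl] by (simp add: split_beta')
    show ?thesis by (rule lborel.borel_measurable_nn_integral) (simp add: split_beta')
  qed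
  \<comment> \<open>The part above the level is a function of the first n0 labels, so the other
    labels integrate to 1.\<close>
  have Pr: "(\<integral>\<^sup>+ y. \<integral>\<^sup>+ x. K (bad L n0 y x) \<partial>lborel \<partial>P n) = (\<integral>\<^sup>+ y. \<integral>\<^sup>+ x. K (bad L n0 y x) \<partial>lborel \<partial>P n0)"
    if "n0 \<le> n" and K: "K \<in> borel_measurable borel" for K :: "ennreal \<Rightarrow> ennreal" and L n
    by (rule P_restrict[OF that(1) badm[OF order_refl K]]) (simp only: bad_restrict[OF n0])
  have Bdm: "(\<lambda>w. bad_sum n0 n (fst w) (snd w)) \<in> borel_measurable (P n \<Otimes>\<^sub>M lborel)" if "n0 \<le> n" for n
    using measurable_good_sum_pair(2)[OF n0 that] unfolding measurable_cong_sets[OF measurable_P_lborel refl] by (simp add: split_beta')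
  have B1s: "(\<integral>\<^sup>+ x. ennreal (enn2real (bad_sum n0 n y x)) \<partial>lborel) \<le> (\<integral>\<^sup>+ x. bad n n0 y x \<partial>lborel)" for n y
    unfolding nn_integral_bad_sum[symmetric] by (intro nn_integral_mono) (auto simp: ennreal_enn2real_if)
  have B1: "(\<integral>\<^sup>+ w. ennreal (B n w) \<partial>(P n \<Otimes>\<^sub>M lborel)) \<le> ennreal (enn2real (bad_mass n0 n))" if n: "n \<ge> 1" "n0 \<le> n" for n
  proof -
    note [measurable] = Am[OF n(2)]
    have "(\<integral>\<^sup>+ w. ennreal (B n w) \<partial>(P n \<Otimes>\<^sub>M lborel)) = (\<integral>\<^sup>+ y. \<integral>\<^sup>+ x. ennreal (B n (y, x)) \<partial>lborel \<partial>P n)"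
      by (subst lborel.nn_integral_fst[symmetric]) auto
    also have "\<dots> \<le> (\<integral>\<^sup>+ y. \<integral>\<^sup>+ x. bad n n0 y x \<partial>lborel \<partial>P n)"
    proof (rule nn_integral_mono)
      fix y
      have "(\<integral>\<^sup>+ x. ennreal (B n (y, x)) \<partial>lborel) = (\<integral>\<^sup>+ x. ennreal (sqrt n) * ennreal (enn2real (bad_sum n0 n y (sqrt n * x))) \<partial>lborel)"
        by (simp add: B_def ennreal_mult)
      also have "\<dots> = (\<integral>\<^sup>+ x. ennreal (enn2real (bad_sum n0 n y x)) \<partial>lborel)"
        by (rule nn_integral_rescale[of "\<lambda>x. ennreal (enn2real (bad_sum n0 n y x))"]) (use sn[OF n(1)] in auto)
      finally show "(\<integral>\<^sup>+ x. ennreal (B n (y, x)) \<partial>lborel) \<le> (\<integral>\<^sup>+ x. bad n n0 y x \<partial>lborel)"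
        using B1s[of n y] by simp
    qed
    also have "\<dots> = bad_mass n0 n" unfolding bad_mass_def using Pr[OF n(2), of "\<lambda>x. x" n] by simp
    finally show ?thesis by (simp add: bmf)
  qed
  \<comment> \<open>The logarithm of sqrt n b is (ln n) / 2 + ln b; the first term is bounded
    crudely by ln n. It costs ln n times the mass above the level, which is at most
    \<open>bad_Psi\<close>, and so is the cost of the second term: hence the factor 2.\<close>
  have B2: "(\<integral>\<^sup>+ w. ennreal (B n w * max 0 (ln (B n w))) \<partial>(P n \<Otimes>\<^sub>M lborel)) \<le> ennreal (2 * enn2real (bad_Psi n0 n))" if n: "n \<ge> 1" "n0 \<le> n" for n
  proof -
    note [measurable] = Am[OF n(2)]
    have "(\<integral>\<^sup>+ w. ennreal (B n w * max 0 (ln (B n w))) \<partial>(P n \<Otimes>\<^sub>M lborel)) = (\<integral>\<^sup>+ y. \<integral>\<^sup>+ x. ennreal (B n (y, x) * max 0 (ln (B n (y, x)))) \<partial>lborel \<partial>P n)"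
      by (subst lborel.nn_integral_fst[symmetric]) auto
    also have "\<dots> \<le> (\<integral>\<^sup>+ y. ennreal (ln n) * (\<integral>\<^sup>+ x. bad n n0 y x \<partial>lborel) + (\<integral>\<^sup>+ x. Psi (bad n n0 y x) \<partial>lborel) \<partial>P n)"
    proof (rule nn_integral_mono)
      fix y
      let ?b = "\<lambda>x. enn2real (bad_sum n0 n y x)"
      have pt: "B n (y, x) * max 0 (ln (B n (y, x))) \<le> sqrt n * (ln n * ?b (sqrt n * x) + ?b (sqrt n * x) * max 0 (ln (?b (sqrt n * x))))" for x
      proof (cases "?b (sqrt n * x) = 0")
        case False
        then have b: "?b (sqrt n * x) > 0" by (metis enn2real_nonneg less_le)
        have l0: "ln n \<ge> 0" using n by simp
        have "ln (B n (y, x)) = ln n / 2 + ln (?b (sqrt n * x))"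
          using b n by (simp add: B_def ln_mult ln_sqrt)
        then have "max 0 (ln (B n (y, x))) \<le> ln n + max 0 (ln (?b (sqrt n * x)))" using l0 by (auto simp: max_def)
        then have "B n (y, x) * max 0 (ln (B n (y, x))) \<le> B n (y, x) * (ln n + max 0 (ln (?b (sqrt n * x))))"
          by (intro mult_left_mono) (auto simp: B_def)
        then show ?thesis by (simp add: B_def algebra_simps)
      qed (simp add: B_def)
      have "(\<integral>\<^sup>+ x. ennreal (B n (y, x) * max 0 (ln (B n (y, x)))) \<partial>lborel)
        \<le> (\<integral>\<^sup>+ x. ennreal (sqrt n) * ennreal (ln n * ?b (sqrt n * x) + ?b (sqrt n * x) * max 0 (ln (?b (sqrt n * x)))) \<partial>lborel)"
        using pt by (intro nn_integral_mono) (simp add: ennreal_mult'[symmetric] ennreal_leI)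
      also have "\<dots> = (\<integral>\<^sup>+ x. ennreal (ln n * ?b x + ?b x * max 0 (ln (?b x))) \<partial>lborel)"
        by (rule nn_integral_rescale[of "\<lambda>x. ennreal (ln n * ?b x + ?b x * max 0 (ln (?b x)))"]) (use sn[OF n(1)] in auto)
      also have "\<dots> \<le> (\<integral>\<^sup>+ x. ennreal (ln n) * ennreal (?b x) + Psi (bad_sum n0 n y x) \<partial>lborel)"
      proof (rule nn_integral_mono)
        fix x
        have "ennreal (ln n * ?b x + ?b x * max 0 (ln (?b x))) = ennreal (ln n) * ennreal (?b x) + ennreal (?b x * max 0 (ln (?b x)))"
          using n by (subst ennreal_plus) (auto simp: ennreal_mult)
        then show "ennreal (ln n * ?b x + ?b x * max 0 (ln (?b x))) \<le> ennreal (ln n) * ennreal (?b x) + Psi (bad_sum n0 n y x)"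
          by (simp add: add_left_mono Psi_enn2real)
      qed
      also have "\<dots> = ennreal (ln n) * (\<integral>\<^sup>+ x. ennreal (?b x) \<partial>lborel) + (\<integral>\<^sup>+ x. Psi (bad_sum n0 n y x) \<partial>lborel)"
        by (simp add: nn_integral_add nn_integral_cmult)
      also have "\<dots> \<le> ennreal (ln n) * (\<integral>\<^sup>+ x. bad n n0 y x \<partial>lborel) + (\<integral>\<^sup>+ x. Psi (bad n n0 y x) \<partial>lborel)"
        by (intro add_mono mult_left_mono B1s nn_integral_Psi_bad_sum) auto
      finally show "(\<integral>\<^sup>+ x. ennreal (B n (y, x) * max 0 (ln (B n (y, x)))) \<partial>lborel)
        \<le> ennreal (ln n) * (\<integral>\<^sup>+ x. bad n n0 y x \<partial>lborel) + (\<integral>\<^sup>+ x. Psi (bad n n0 y x) \<partial>lborel)" .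
    qed
    also have "\<dots> = ennreal (ln n) * bad_mass n0 n + bad_Psi n0 n"
      using badm[OF n(2), of "\<lambda>x. x" n] badm[OF n(2), of Psi n] Pr[OF n(2), of "\<lambda>x. x" n] Pr[OF n(2), of Psi n]
      by (simp add: nn_integral_add nn_integral_cmult bad_mass_def bad_Psi_def)
    also have "\<dots> \<le> bad_Psi n0 n + bad_Psi n0 n" by (intro add_right_mono bad_Psi_bad_mass[OF n0 Psi_fin] n)
    also have "\<dots> = ennreal (2 * enn2real (bad_Psi n0 n))"
      by (subst (1 2) bPf[symmetric]) (simp add: ennreal_plus[symmetric] del: ennreal_plus)
    finally show ?thesis .
  qed
  have \<beta>: "(\<lambda>n. enn2real (bad_mass n0 n)) \<longlonglongrightarrow> 0" "(\<lambda>n. 2 * enn2real (bad_Psi n0 n)) \<longlonglongrightarrow> 0"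
  proof -
    show "(\<lambda>n. enn2real (bad_mass n0 n)) \<longlonglongrightarrow> 0"
      by (rule tendsto_enn2real) (use bad_mass_tendsto[OF n0 Psi_fin] in simp_all)
    have "(\<lambda>n. enn2real (bad_Psi n0 n)) \<longlonglongrightarrow> 0"
      by (rule tendsto_enn2real) (use bad_Psi_tendsto[OF n0 Psi_fin] in simp_all)
    from tendsto_mult_right_zero[OF this] show "(\<lambda>n. 2 * enn2real (bad_Psi n0 n)) \<longlonglongrightarrow> 0" .
  qed
  \<comment> \<open>Additivity holds only almost everywhere, as \<open>enn2real\<close> sends
    infinity to 0.\<close>
  have pAB: "AE w in P n \<Otimes>\<^sub>M lborel. scaled_dens n w = A n w + B n w" if n: "n \<ge> 1" "n0 \<le> n" for n
  proof -
    interpret Pn: prob_space "P n" by (rule prob_P)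
    interpret PS: pair_sigma_finite "P n" lborel ..
    note [measurable] = Am[OF n(2)] measurable_scaled_dens[OF n(1)]
    show ?thesis
    proof (rule PS.AE_pair_measure)
      show "{w \<in> space (P n \<Otimes>\<^sub>M lborel). scaled_dens n w = A n w + B n w} \<in> sets (P n \<Otimes>\<^sub>M lborel)" by measurable
      show "AE y in P n. AE x in lborel. scaled_dens n (y, x) = A n (y, x) + B n (y, x)"
      proof (rule AE_I2)
        fix y
        have "AE x in lborel. dens n y (sqrt n * x) < \<infinity>"
          by (rule AE_rescale[OF AE_dens_finite]) (use n in auto)
        then show "AE x in lborel. scaled_dens n (y, x) = A n (y, x) + B n (y, x)"
        proof eventually_elim
          case (elim x)
          have "enn2real (good_sum n0 n y (sqrt n * x) + bad_sum n0 n y (sqrt n * x)) = enn2real (good_sum n0 n y (sqrt n * x)) + enn2real (bad_sum n0 n y (sqrt n * x))"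
            using elim unfolding good_sum_bad_sum[OF n0 n(2)] by (intro enn2real_plus) (auto simp: less_top)
          then show ?case by (simp add: scaled_dens_def A_def B_def good_sum_bad_sum[OF n0 n(2)] distrib_left)
        qed
      qed
    qed
  qed
  \<comment> \<open>The labels carry total mass 1, so the second projection of the product measure
    is Lebesgue measure itself.\<close>
  have XG: "distr (P n \<Otimes>\<^sub>M lborel) borel snd = (lborel :: real measure)" for n
  proof (rule measure_eqI)
    interpret Pn: prob_space "P n" by (rule prob_P)
    fix S :: "real set" assume "S \<in> sets (distr (P n \<Otimes>\<^sub>M lborel) borel snd)"
    then have S: "S \<in> sets borel" by simp
    have "snd -` S \<inter> space (P n \<Otimes>\<^sub>M (lborel :: real measure)) = space (P n) \<times> S" by (auto simp: space_pair_measure)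
    then show "emeasure (distr (P n \<Otimes>\<^sub>M lborel) borel snd) S = emeasure lborel S"
      using S by (subst emeasure_distr) (auto simp: lborel.emeasure_pair_measure_Times Pn.emeasure_space_1 measurable_cong_sets[OF measurable_P_lborel refl])
  qed simp
  note E = entropy_limit[where \<mu>="\<lambda>k. P (k + N) \<Otimes>\<^sub>M lborel" and X="\<lambda>k. snd" and p="\<lambda>k. scaled_dens (k + N)"
      and A="\<lambda>k. A (k + N)" and B="\<lambda>k. B (k + N)" and \<sigma>=\<sigma> and \<alpha>="\<lambda>k. \<alpha> (k + N)"
      and \<beta>="\<lambda>k. enn2real (bad_mass n0 (k + N))" and \<gamma>="\<lambda>k. 2 * enn2real (bad_Psi n0 (k + N))",
      OF \<sigma>_pos _ measurable_scaled_dens[OF N(1)] Am(1)[OF N(2)] Am(2)[OF N(2)] _ _ scaled_dens_nonneg pAB[OF N(1,2)]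
        nn_integral_scaled_dens(1)[OF N(1)] nn_integral_scaled_dens(2)[OF N(1)] A2[OF N(3)] LIMSEQ_ignore_initial_segment[OF \<alpha>(1)]
        B1[OF N(1,2)] LIMSEQ_ignore_initial_segment[OF \<beta>(1)] B2[OF N(1,2)] LIMSEQ_ignore_initial_segment[OF \<beta>(2)]
        \<alpha>(2) _ _ XG LIMSEQ_ignore_initial_segment[OF CLT]]
  have sm: "snd \<in> borel_measurable (P n \<Otimes>\<^sub>M (lborel :: real measure))" for n
    unfolding measurable_cong_sets[OF measurable_P_lborel refl] by measurable
  have nonneg: "A n w \<ge> 0" "B n w \<ge> 0" for n w by (auto simp: A_def B_def)
  show "integrable (P (k + N) \<Otimes>\<^sub>M lborel) (\<lambda>w. scaled_dens (k + N) w * ln (scaled_dens (k + N) w))"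
    by (rule E(1)) (use sm nonneg in auto)
  show "(\<lambda>k. LINT w|(P (k + N) \<Otimes>\<^sub>M lborel). scaled_dens (k + N) w * ln (scaled_dens (k + N) w)) \<longlonglongrightarrow> - (1 / 2 * ln (2 * pi * exp 1 * \<sigma>\<^sup>2))"
    by (rule E(2)) (use sm nonneg in auto)
qed

end

section \<open>Regular conditional laws\<close>

text \<open>The hypothesis is tested on the set where G < F. Finiteness of the integral of G allows
  the subtraction, and a nonnegative function with zero integral vanishes almost everywhere.\<close>

lemma AE_le_of_nn_integral_le:
  assumes [measurable]: "F \<in> borel_measurable \<nu>" "G \<in> borel_measurable \<nu>"
    and le: "\<And>B. B \<in> sets \<nu> \<Longrightarrow> (\<integral>\<^sup>+ y\<in>B. F y \<partial>\<nu>) \<le> (\<integral>\<^sup>+ y\<in>B. G y \<partial>\<nu>)"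
    and fin: "(\<integral>\<^sup>+ y. G y \<partial>\<nu>) < \<infinity>"
  shows "AE y in \<nu>. F y \<le> G y"
proof -
  define B where "B = {y \<in> space \<nu>. G y < F y}"
  have B [measurable]: "B \<in> sets \<nu>" unfolding B_def by measurable
  have Gf: "(\<integral>\<^sup>+ y\<in>B. G y \<partial>\<nu>) < \<infinity>"
    by (rule le_less_trans[OF _ fin]) (auto intro!: nn_integral_mono simp: indicator_def)
  have "(\<integral>\<^sup>+ y. F y * indicator B y - G y * indicator B y \<partial>\<nu>) = (\<integral>\<^sup>+ y\<in>B. F y \<partial>\<nu>) - (\<integral>\<^sup>+ y\<in>B. G y \<partial>\<nu>)"
    by (rule nn_integral_diff) (use Gf in \<open>auto simp: B_def indicator_def less_top\<close>)
  also have "\<dots> = 0" using le[OF B] le_less_trans[OF le[OF B] Gf] by (simp add: diff_eq_0_iff_ennreal)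
  finally have "AE y in \<nu>. F y * indicator B y - G y * indicator B y = 0"
    by (subst (asm) nn_integral_0_iff_AE) auto
  then show ?thesis
  proof (rule AE_mp, intro AE_I2 impI)
    fix y assume y: "y \<in> space \<nu>" and eq: "F y * indicator B y - G y * indicator B y = 0"
    show "F y \<le> G y"
    proof (rule ccontr)
      assume "\<not> F y \<le> G y"
      then have "y \<in> B" "G y < F y" using y by (auto simp: B_def)
      with eq show False by (simp add: diff_eq_0_iff_ennreal) (use \<open>G y < F y\<close> in auto)
    qed
  qed
qed

lemma rat_seq_above: "\<exists>q :: nat \<Rightarrow> real. (\<forall>n. q n \<in> \<rat> \<and> x < q n) \<and> q \<longlonglongrightarrow> x"
proof -
  have "\<exists>q\<in>\<rat>. x < q \<and> q < x + 1 / real (Suc n)" for n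
    by (rule Rats_dense_in_real) simp
  then obtain q where q: "\<And>n. q n \<in> \<rat>" "\<And>n. x < q n" "\<And>n. q n < x + 1 / real (Suc n)" by metis
  have "q \<longlonglongrightarrow> x"
  proof (rule real_tendsto_sandwich[where f="\<lambda>_. x" and h="\<lambda>n. x + 1 / real (Suc n)"])
    show "(\<lambda>n. x + 1 / real (Suc n)) \<longlonglongrightarrow> x"
      using tendsto_add[OF tendsto_const LIMSEQ_Suc[OF lim_const_over_n], of x 1] by simp
  qed (use q in \<open>auto intro!: always_eventually less_imp_le simp del: of_nat_Suc\<close>)
  with q show ?thesis by blast
qed

text \<open>Distribution functions are right-continuous. Reducing equality to countably many
  conditions is what allows it to be checked almost everywhere in a parameter.\<close>

lemma real_distribution_eqI_Rats:
  assumes "real_distribution M1" "real_distribution M2"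
    and eq: "\<And>q. q \<in> \<rat> \<Longrightarrow> emeasure M1 {..q} = emeasure M2 {..q}"
  shows "M1 = M2"
proof (rule cdf_unique[OF assms(1,2)], rule ext)
  interpret M1: real_distribution M1 by fact
  interpret M2: real_distribution M2 by fact
  fix x :: real
  obtain q where q: "\<And>n. q n \<in> \<rat>" "\<And>n. x < q n" "q \<longlonglongrightarrow> x" using rat_seq_above[of x] by blast
  have f: "filterlim q (at_right x) sequentially"
    using q by (auto simp: filterlim_at intro!: always_eventually)
  have "(\<lambda>n. cdf M1 (q n)) \<longlonglongrightarrow> cdf M1 x" "(\<lambda>n. cdf M2 (q n)) \<longlonglongrightarrow> cdf M2 x"
    using filterlim_compose[OF M1.cdf_is_right_cont[of x, unfolded continuous_within] f]
      filterlim_compose[OF M2.cdf_is_right_cont[of x, unfolded continuous_within] f] by auto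
  moreover have "cdf M1 (q n) = cdf M2 (q n)" for n using eq[OF q(1)] by (simp add: cdf_def measure_def)
  ultimately show "cdf M1 x = cdf M2 x" using LIMSEQ_unique by simp
qed

lemma prob_algebra_real_distribution: "\<mu> \<in> space (prob_algebra borel) \<Longrightarrow> real_distribution \<mu>"
  by (auto simp: space_prob_algebra real_distribution_def real_distribution_axioms_def)

text \<open>For each half-line both versions are densities of the same measure, hence agree almost
  everywhere; rational endpoints leave a countable union of exceptional null sets. By this, any
  convenient version may stand in for the one chosen in \<open>cond_law\<close>.\<close>

lemma regular_cond_law_unique:
  assumes M: "prob_space M" and Y: "Y \<in> M \<rightarrow>\<^sub>M N"
    and k1: "is_regular_cond_law M N X Y \<kappa>" and k2: "is_regular_cond_law M N X Y \<kappa>'"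
  shows "AE y in distr M N Y. \<kappa> y = \<kappa>' y"
proof -
  interpret prob_space M by fact
  interpret D: prob_space "distr M N Y" by (rule prob_space_distr[OF Y])
  have m: "\<kappa> \<in> N \<rightarrow>\<^sub>M prob_algebra borel" "\<kappa>' \<in> N \<rightarrow>\<^sub>M prob_algebra borel"
    using k1 k2 by (auto simp: is_regular_cond_law_def)
  have em: "(\<lambda>y. emeasure (\<kappa> y) A) \<in> borel_measurable N" "(\<lambda>y. emeasure (\<kappa>' y) A) \<in> borel_measurable N" if "A \<in> sets borel" for A
    using m[THEN measurable_prob_algebraD] that by (auto intro: measurable_emeasure_kernel)
  have "AE y in distr M N Y. emeasure (\<kappa> y) {..q} = emeasure (\<kappa>' y) {..q}" for q
  proof (rule D.density_unique_finite_measure)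
    fix B assume "B \<in> sets (distr M N Y)"
    then have "B \<in> sets N" by simp
    then have "emeasure M {\<omega> \<in> space M. X \<omega> \<in> {..q} \<and> Y \<omega> \<in> B} = (\<integral>\<^sup>+ y\<in>B. emeasure (\<kappa> y) {..q} \<partial>distr M N Y)"
      "emeasure M {\<omega> \<in> space M. X \<omega> \<in> {..q} \<and> Y \<omega> \<in> B} = (\<integral>\<^sup>+ y\<in>B. emeasure (\<kappa>' y) {..q} \<partial>distr M N Y)"
      using k1 k2 atMost_borel[of q] unfolding is_regular_cond_law_def by blast+
    then show "(\<integral>\<^sup>+ y\<in>B. emeasure (\<kappa> y) {..q} \<partial>distr M N Y) = (\<integral>\<^sup>+ y\<in>B. emeasure (\<kappa>' y) {..q} \<partial>distr M N Y)"
      by simp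
  qed (use em in auto)
  then have "AE y in distr M N Y. \<forall>q\<in>\<rat>. emeasure (\<kappa> y) {..q} = emeasure (\<kappa>' y) {..q}"
    by (subst AE_ball_countable) (auto intro: countable_rat)
  then show ?thesis
  proof (rule AE_mp, intro AE_I2 impI)
    fix y assume "y \<in> space (distr M N Y)" and eq: "\<forall>q\<in>\<rat>. emeasure (\<kappa> y) {..q} = emeasure (\<kappa>' y) {..q}"
    then have "y \<in> space N" by simp
    then have "\<kappa> y \<in> space (prob_algebra borel)" "\<kappa>' y \<in> space (prob_algebra borel)"
      using m by (auto dest: measurable_space)
    then show "\<kappa> y = \<kappa>' y" using eq by (intro real_distribution_eqI_Rats prob_algebra_real_distribution) auto
  qed
qed

text \<open>The structure is all on the side of the real variable, and the label space stays
  arbitrary. Conditional distribution functions at rational points come from Radon-Nikodym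
  derivatives; for almost every label they are monotone with the right limits, and their
  right-continuous regularisation defines a probability measure.\<close>

lemma regular_cond_law_exists:
  assumes M: "prob_space M" and X [measurable]: "X \<in> borel_measurable M" and Y [measurable]: "Y \<in> M \<rightarrow>\<^sub>M N"
  shows "\<exists>\<kappa>. is_regular_cond_law M N X Y \<kappa>"
proof -
  interpret prob_space M by fact
  define \<nu> where "\<nu> = distr M N Y"
  have s\<nu> [measurable_cong, simp]: "sets \<nu> = sets N" "space \<nu> = space N" by (auto simp: \<nu>_def)
  interpret D: prob_space \<nu> unfolding \<nu>_def by (rule prob_space_distr[OF Y])
  define E where "E t B = {\<omega> \<in> space M. X \<omega> \<le> t \<and> Y \<omega> \<in> B}" for t B
  have E [measurable]: "E t B \<in> sets M" if "B \<in> sets N" for t B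
    unfolding E_def using that by measurable
  have EN: "E t (space N) = {\<omega> \<in> space M. X \<omega> \<le> t}" for t
    using measurable_space[OF Y] by (auto simp: E_def)
  \<comment> \<open>The measure B -> P(X <= t, Y in B), dominated by the law of Y; its density with
    respect to that law is the conditional distribution function at t.\<close>
  define Q where "Q t = distr (density M (indicator {\<omega> \<in> space M. X \<omega> \<le> t})) N Y" for t
  have Q: "emeasure (Q t) B = emeasure M (E t B)" if "B \<in> sets N" for t B
  proof -
    have "emeasure (Q t) B = emeasure (density M (indicator {\<omega> \<in> space M. X \<omega> \<le> t})) (Y -` B \<inter> space M)"
      unfolding Q_def using that by (subst emeasure_distr) auto
    also have "\<dots> = (\<integral>\<^sup>+ \<omega>. indicator {\<omega> \<in> space M. X \<omega> \<le> t} \<omega> * indicator (Y -` B \<inter> space M) \<omega> \<partial>M)"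
      using that by (subst emeasure_density) auto
    also have "\<dots> = (\<integral>\<^sup>+ \<omega>. indicator (E t B) \<omega> \<partial>M)"
      by (intro nn_integral_cong) (auto simp: E_def indicator_def)
    finally show ?thesis using E[OF that] by simp
  qed
  \<comment> \<open>a version of the conditional distribution function, for each fixed \<open>t\<close>\<close>
  define F where "F t = RN_deriv \<nu> (Q t)" for t
  have F [measurable]: "F t \<in> borel_measurable N" for t
    using borel_measurable_RN_deriv[of \<nu> "Q t"] by (simp add: F_def cong: measurable_cong_sets)
  have dF: "(\<integral>\<^sup>+ y\<in>B. F t y \<partial>\<nu>) = emeasure M (E t B)" if B: "B \<in> sets N" for t B
  proof -
    have "absolutely_continuous \<nu> (Q t)"
      unfolding absolutely_continuous_def
    proof
      fix B assume "B \<in> null_sets \<nu>"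
      then have B: "B \<in> sets N" and "emeasure \<nu> B = 0" by auto
      then have 0: "emeasure M (Y -` B \<inter> space M) = 0" by (simp add: \<nu>_def emeasure_distr)
      have "emeasure M (E t B) \<le> emeasure M (Y -` B \<inter> space M)"
        using B by (intro emeasure_mono) (auto simp: E_def)
      then have "emeasure (Q t) B = 0" using 0 B by (simp add: Q)
      then show "B \<in> null_sets (Q t)" using B by (auto simp: Q_def)
    qed
    then have "density \<nu> (F t) = Q t" unfolding F_def by (rule D.density_RN_deriv) (simp add: Q_def)
    then have "emeasure (density \<nu> (F t)) B = emeasure M (E t B)" using Q[OF B] by simp
    then show ?thesis using B by (subst (asm) emeasure_density) auto
  qed
  have dF1: "(\<integral>\<^sup>+ y. F t y \<partial>\<nu>) = emeasure M (E t (space N))" for t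
  proof -
    have "(\<integral>\<^sup>+ y. F t y \<partial>\<nu>) = (\<integral>\<^sup>+ y\<in>space N. F t y \<partial>\<nu>)"
      by (intro nn_integral_cong) simp
    then show ?thesis using dF[of "space N" t] by simp
  qed
  have fin: "(\<integral>\<^sup>+ y. F t y \<partial>\<nu>) < \<infinity>" for t unfolding dF1 by (simp add: less_top[symmetric])
  have mono: "AE y in \<nu>. F s y \<le> F t y" if "s \<le> t" for s t
  proof (rule AE_le_of_nn_integral_le)
    fix B assume "B \<in> sets \<nu>"
    then have B: "B \<in> sets N" by simp
    show "(\<integral>\<^sup>+ y\<in>B. F s y \<partial>\<nu>) \<le> (\<integral>\<^sup>+ y\<in>B. F t y \<partial>\<nu>)"
      unfolding dF[OF B] using that B by (intro emeasure_mono) (auto simp: E_def)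
  qed (use fin in auto)
  have le1: "AE y in \<nu>. F t y \<le> 1" for t
  proof (rule AE_le_of_nn_integral_le)
    fix B assume "B \<in> sets \<nu>"
    then have B: "B \<in> sets N" by simp
    have "emeasure M (E t B) \<le> emeasure M (Y -` B \<inter> space M)" using B by (intro emeasure_mono) (auto simp: E_def)
    then show "(\<integral>\<^sup>+ y\<in>B. F t y \<partial>\<nu>) \<le> (\<integral>\<^sup>+ y\<in>B. 1 \<partial>\<nu>)"
      unfolding dF[OF B] using B by (simp add: \<nu>_def emeasure_distr)
  qed (auto simp: D.emeasure_space_1[simplified])
  \<comment> \<open>Each \<open>F t\<close> is determined only up to null sets, so the limit is
    found through integrals: the supremum has integral 1 and is at most 1 almost everywhere, hence
    equals 1.\<close>
  have top: "AE y in \<nu>. (SUP n::nat. F (real n) y) = 1"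
  proof -
    have "AE y in \<nu>. \<forall>n. F (real n) y \<le> F (real (Suc n)) y" by (simp add: AE_all_countable mono)
    then have "(\<integral>\<^sup>+ y. (SUP n::nat. F (real n) y) \<partial>\<nu>) = (SUP n::nat. \<integral>\<^sup>+ y. F (real n) y \<partial>\<nu>)"
      by (intro nn_integral_monotone_convergence_SUP_AE) (auto simp: AE_all_countable)
    also have "\<dots> = (SUP n::nat. emeasure M (E (real n) (space N)))" by (simp add: dF1)
    also have "\<dots> = emeasure M (\<Union>n::nat. E (real n) (space N))"
      by (rule SUP_emeasure_incseq) (auto simp: incseq_def E_def)
    also have "(\<Union>n::nat. E (real n) (space N)) = space M" unfolding EN using real_arch_simple by auto
    finally have i1: "(\<integral>\<^sup>+ y. (SUP n::nat. F (real n) y) \<partial>\<nu>) = 1" by (simp add: emeasure_space_1)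
    have "AE y in \<nu>. \<forall>n. F (real n) y \<le> 1" by (simp add: AE_all_countable le1)
    then have l1: "AE y in \<nu>. (SUP n::nat. F (real n) y) \<le> 1"
      by eventually_elim (auto intro: SUP_least)
    have "(\<integral>\<^sup>+ y. 1 - (SUP n::nat. F (real n) y) \<partial>\<nu>) = (\<integral>\<^sup>+ y. 1 \<partial>\<nu>) - (\<integral>\<^sup>+ y. (SUP n::nat. F (real n) y) \<partial>\<nu>)"
      by (rule nn_integral_diff) (use i1 l1 in auto)
    also have "\<dots> = 0" by (simp add: i1 D.emeasure_space_1[simplified])
    finally have "AE y in \<nu>. 1 - (SUP n::nat. F (real n) y) = 0" by (subst (asm) nn_integral_0_iff_AE) auto
    with l1 show ?thesis by eventually_elim (auto simp: diff_eq_0_iff_ennreal)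
  qed
  have bot: "AE y in \<nu>. (INF n::nat. F (- real n) y) = 0"
  proof -
    have "(\<integral>\<^sup>+ y. (INF n::nat. F (- real n) y) \<partial>\<nu>) \<le> emeasure M (E (- real n) (space N))" for n :: nat
      unfolding dF1[symmetric] by (intro nn_integral_mono INF_lower) auto
    then have "(\<integral>\<^sup>+ y. (INF n::nat. F (- real n) y) \<partial>\<nu>) \<le> (INF n::nat. emeasure M (E (- real n) (space N)))"
      by (intro INF_greatest)
    also have "\<dots> = emeasure M (\<Inter>n::nat. E (- real n) (space N))"
      by (rule INF_emeasure_decseq) (auto simp: decseq_def E_def)
    also have "(\<Inter>n::nat. E (- real n) (space N)) = {}"
    proof -
      have "\<exists>n::nat. \<not> x \<le> - real n" for x :: real
      proof -
        obtain n :: nat where "- x < real n" using reals_Archimedean2 by blast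
        then show ?thesis by (intro exI[of _ n]) simp
      qed
      then show ?thesis unfolding EN by auto
    qed
    finally have "(\<integral>\<^sup>+ y. (INF n::nat. F (- real n) y) \<partial>\<nu>) = 0" by simp
    then show ?thesis by (subst (asm) nn_integral_0_iff_AE) auto
  qed
  \<comment> \<open>Only countably many conditions, all at rational points, so that
    \<open>good\<close> is measurable and of full measure.\<close>
  define good where "good y \<longleftrightarrow> (\<forall>s\<in>\<rat>. \<forall>t\<in>\<rat>. s \<le> t \<longrightarrow> F s y \<le> F t y) \<and> (\<forall>t\<in>\<rat>. F t y \<le> 1)
    \<and> (SUP n::nat. F (real n) y) = 1 \<and> (INF n::nat. F (- real n) y) = 0" for y
  have good_AE: "AE y in \<nu>. good y"
    unfolding good_def using mono le1 top bot
    by (auto simp: AE_ball_countable countable_rat AE_conj_iff intro: AE_I2)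
  have [measurable]: "Measurable.pred N good"
  proof -
    have alt: "good = (\<lambda>y. (\<forall>s t::rat. real_of_rat s \<le> real_of_rat t \<longrightarrow> F (of_rat s) y \<le> F (of_rat t) y)
      \<and> (\<forall>t::rat. F (of_rat t) y \<le> 1) \<and> (SUP n::nat. F (real n) y) = 1 \<and> (INF n::nat. F (- real n) y) = 0)"
      unfolding good_def[abs_def] Rats_def by simp
    show ?thesis unfolding alt by measurable
  qed
  \<comment> \<open>An infimum over rationals strictly above x, which makes \<open>c y\<close>
    right-continuous by construction; at x itself it may differ from \<open>F x y\<close>.\<close>
  define c where "c y x = (INF q\<in>{q\<in>\<rat>. x < q}. F q y)" for y x
  have cr: "countable {q\<in>\<rat>. x < (q::real)}" for x by (rule countable_subset[OF _ countable_rat]) auto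
  have [measurable]: "(\<lambda>y. c y x) \<in> borel_measurable N" for x
    unfolding c_def by (rule borel_measurable_INF[OF cr]) auto
  \<comment> \<open>On the exceptional null set any fixed probability measure will do; the point
    mass at 0 keeps the kernel measurable.\<close>
  define \<kappa> where "\<kappa> y = (if good y then interval_measure (\<lambda>x. enn2real (c y x)) else return borel 0)" for y
  have c_le: "c y x \<le> F q y" if "q \<in> \<rat>" "x < q" for q x y
    unfolding c_def using that by (intro INF_lower) auto
  have c_mono: "c y x \<le> c y x'" if "x \<le> x'" for x x' y
    unfolding c_def using that by (intro INF_superset_mono) auto
  have c_ge: "F p y \<le> c y x" if "good y" "p \<in> \<rat>" "p \<le> x" for p x y
    unfolding c_def using that by (intro INF_greatest) (auto simp: good_def)
  have c_le1: "c y x \<le> 1" if "good y" for x y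
  proof -
    obtain q where "q \<in> \<rat>" "x < q" using rat_seq_above[of x] by blast
    then show ?thesis using c_le[of q x y] that by (auto simp: good_def intro: order_trans)
  qed
  have c_right: "(c y \<longlongrightarrow> c y x) (at_right x)" for x y
  proof (rule order_tendstoI)
    fix a assume "a < c y x"
    then show "\<forall>\<^sub>F z in at_right x. a < c y z"
      unfolding eventually_at_filter
      by (intro always_eventually) (auto intro!: less_le_trans[OF \<open>a < c y x\<close> c_mono])
  next
    fix a assume "c y x < a"
    then obtain q where q: "q \<in> \<rat>" "x < q" "F q y < a" unfolding c_def by (auto simp: INF_less_iff)
    have "\<forall>\<^sub>F z in at_right x. z < q" unfolding eventually_at_right_field using q(2) by blast
    then show "\<forall>\<^sub>F z in at_right x. c y z < a"
      by eventually_elim (use c_le[OF q(1)] q(3) in \<open>auto intro: le_less_trans\<close>)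
  qed
  have c_top: "(c y \<longlongrightarrow> 1) at_top" if g: "good y" for y
  proof (rule order_tendstoI)
    fix a :: ennreal assume "a < 1"
    then have "a < (SUP n::nat. F (real n) y)" using g by (simp add: good_def)
    then obtain n :: nat where n: "a < F (real n) y" by (auto simp: less_SUP_iff)
    show "\<forall>\<^sub>F z in at_top. a < c y z"
      using eventually_ge_at_top[of "real n"]
      by eventually_elim (use n c_ge[OF g, of "real n"] in \<open>auto intro: less_le_trans\<close>)
  next
    fix a :: ennreal assume "1 < a"
    then show "\<forall>\<^sub>F z in at_top. c y z < a"
      by (intro always_eventually) (auto intro: le_less_trans c_le1[OF g])
  qed
  have c_bot: "(c y \<longlongrightarrow> 0) at_bot" if g: "good y" for y
  proof (rule order_tendstoI)
    fix a :: ennreal assume "0 < a"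
    then have "(INF n::nat. F (- real n) y) < a" using g by (simp add: good_def)
    then obtain n :: nat where n: "F (- real n) y < a" by (auto simp: INF_less_iff)
    show "\<forall>\<^sub>F z in at_bot. c y z < a"
      using eventually_gt_at_bot[of "- real n"] eventually_at_bot_dense[of "\<lambda>z. z < - real n"]
      by (auto simp: eventually_at_bot_dense intro!: exI[of _ "- real n"] le_less_trans[OF c_le n])
  qed auto
  have G: "real_distribution (interval_measure (\<lambda>x. enn2real (c y x)))"
    "emeasure (interval_measure (\<lambda>x. enn2real (c y x))) {..x} = c y x" if g: "good y" for x y
  proof -
    have fin: "ennreal (enn2real (c y x)) = c y x" for x
      using c_le1[OF g, of x] by (intro ennreal_enn2real) (auto simp: less_top[symmetric] top_unique)
    have 1: "enn2real (c y x) \<le> enn2real (c y x')" if "x \<le> x'" for x x'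
      using c_mono[OF that, of y] c_le1[OF g, of x'] by (intro enn2real_mono) (auto intro: le_less_trans)
    have 2: "continuous (at_right a) (\<lambda>x. enn2real (c y x))" for a
      unfolding continuous_within by (rule tendsto_enn2real) (use c_right[of y a] in \<open>simp_all add: fin\<close>)
    have 3: "((\<lambda>x. enn2real (c y x)) \<longlongrightarrow> 0) at_bot" by (rule tendsto_enn2real) (use c_bot[OF g] in simp_all)
    have 4: "((\<lambda>x. enn2real (c y x)) \<longlongrightarrow> 1) at_top" by (rule tendsto_enn2real) (use c_top[OF g] in simp_all)
    show "real_distribution (interval_measure (\<lambda>x. enn2real (c y x)))"
      by (rule real_distribution_interval_measure[OF 1 2 3 4])
    show "emeasure (interval_measure (\<lambda>x. enn2real (c y x))) {..x} = c y x"
      using emeasure_interval_measure_Iic[OF 1 2 3, of x] by (simp add: fin)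
  qed
  have \<kappa>: "\<kappa> \<in> N \<rightarrow>\<^sub>M prob_algebra borel"
  proof (rule measurable_prob_algebra_generated[where \<Omega>=UNIV and G="range (\<lambda>a. {..a})"])
    show "sets borel = sigma_sets UNIV (range (\<lambda>a::real. {..a}))" by (subst borel_eq_atMost) simp
    show "Int_stable (range (\<lambda>a::real. {..a}))" by (auto simp: Int_stable_def)
    show "prob_space (\<kappa> y)" for y
      using G(1)[of y] by (auto simp: \<kappa>_def real_distribution_def prob_space_return)
    show "sets (\<kappa> y) = sets borel" for y by (simp add: \<kappa>_def)
    fix A :: "real set" assume "A \<in> range (\<lambda>a. {..a})"
    then obtain x where A: "A = {..x}" by auto
    have eq: "(\<lambda>y. emeasure (\<kappa> y) A) = (\<lambda>y. if good y then c y x else indicator {..x} 0)"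
      unfolding A \<kappa>_def by (auto simp: G(2))
    show "(\<lambda>y. emeasure (\<kappa> y) A) \<in> borel_measurable N" unfolding eq by measurable
  qed auto
  \<comment> \<open>Monotonicity gives \<open>F x y \<le> c y x\<close> almost everywhere.
    Right-continuity of the distribution function of X bounds the integral of \<open>c\<close> by
    that of \<open>F x\<close>; both are finite, so the two functions agree almost
    everywhere.\<close>
  have \<kappa>F: "AE y in \<nu>. emeasure (\<kappa> y) {..x} = F x y" for x
  proof -
    have "AE y in \<nu>. \<forall>q\<in>{q\<in>\<rat>. x < q}. F x y \<le> F q y"
      by (subst AE_ball_countable[OF cr]) (auto intro!: mono)
    then have le: "AE y in \<nu>. F x y \<le> c y x"
      by eventually_elim (auto simp: c_def intro!: INF_greatest)
    obtain q where q: "\<And>n. q n \<in> \<rat>" "\<And>n. x < q n" "q \<longlonglongrightarrow> x" using rat_seq_above[of x] by blast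
    interpret R: real_distribution "distr M borel X" by simp
    have cdf: "ennreal (cdf (distr M borel X) t) = (\<integral>\<^sup>+ y. F t y \<partial>\<nu>)" for t
      unfolding dF1 EN cdf_def
      by (subst R.emeasure_eq_measure[symmetric], subst emeasure_distr) (auto intro!: arg_cong[where f="emeasure M"])
    have "filterlim q (at_right x) sequentially"
      using q by (auto simp: filterlim_at intro!: always_eventually)
    from filterlim_compose[OF R.cdf_is_right_cont[of x, unfolded continuous_within] this]
    have "(\<lambda>n. ennreal (cdf (distr M borel X) (q n))) \<longlonglongrightarrow> ennreal (cdf (distr M borel X) x)" by (rule tendsto_ennrealI)
    then have "(\<integral>\<^sup>+ y. c y x \<partial>\<nu>) \<le> ennreal (cdf (distr M borel X) x)"
      by (rule LIMSEQ_le_const) (auto simp: cdf intro!: nn_integral_mono c_le q)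
    then have ci: "(\<integral>\<^sup>+ y. c y x \<partial>\<nu>) \<le> (\<integral>\<^sup>+ y. F x y \<partial>\<nu>)" by (simp add: cdf)
    have "(\<integral>\<^sup>+ y. c y x - F x y \<partial>\<nu>) = (\<integral>\<^sup>+ y. c y x \<partial>\<nu>) - (\<integral>\<^sup>+ y. F x y \<partial>\<nu>)"
      by (rule nn_integral_diff) (use le fin[of x] in auto)
    also have "\<dots> = 0" using ci fin[of x] by (auto simp: diff_eq_0_iff_ennreal less_top)
    finally have "AE y in \<nu>. c y x - F x y = 0" by (subst (asm) nn_integral_0_iff_AE) auto
    with le good_AE show ?thesis
    proof eventually_elim
      case (elim y)
      have "c y x < top" using c_le1[OF elim(2), of x] by (auto simp: less_top[symmetric] top_unique)
      then have "c y x \<le> F x y" using elim(3) by (auto simp: diff_eq_0_iff_ennreal)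
      then show ?case using elim by (auto simp: \<kappa>_def G(2))
    qed
  qed
  have "emeasure M {\<omega> \<in> space M. X \<omega> \<in> A \<and> Y \<omega> \<in> B} = (\<integral>\<^sup>+ y\<in>B. emeasure (\<kappa> y) A \<partial>\<nu>)"
    if A: "A \<in> sets borel" and B [measurable]: "B \<in> sets N" for A B
  proof -
    \<comment> \<open>For fixed B both sides of the defining identity are finite Borel measures in
      A, so agreement on half-lines is enough.\<close>
    define \<mu>1 where "\<mu>1 = distr (density M (indicator (Y -` B \<inter> space M))) borel X"
    define \<mu>2 where "\<mu>2 = density \<nu> (indicator B) \<bind> \<kappa>"
    have YB [measurable]: "Y -` B \<inter> space M \<in> sets M" by measurable
    have e1: "emeasure \<mu>1 A = emeasure M {\<omega> \<in> space M. X \<omega> \<in> A \<and> Y \<omega> \<in> B}" if A [measurable]: "A \<in> sets borel" for A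
    proof -
      have "emeasure \<mu>1 A = (\<integral>\<^sup>+ \<omega>. indicator (Y -` B \<inter> space M) \<omega> * indicator (X -` A \<inter> space M) \<omega> \<partial>M)"
        unfolding \<mu>1_def by (subst emeasure_distr) (auto simp: emeasure_density)
      also have "\<dots> = (\<integral>\<^sup>+ \<omega>. indicator {\<omega> \<in> space M. X \<omega> \<in> A \<and> Y \<omega> \<in> B} \<omega> \<partial>M)"
        by (intro nn_integral_cong) (auto simp: indicator_def)
      also have "\<dots> = emeasure M {\<omega> \<in> space M. X \<omega> \<in> A \<and> Y \<omega> \<in> B}" by (rule nn_integral_indicator) measurable
      finally show ?thesis .
    qed
    have ne: "space (density \<nu> (indicator B)) \<noteq> {}" using D.not_empty by simp
    have \<kappa>s: "\<kappa> \<in> density \<nu> (indicator B) \<rightarrow>\<^sub>M subprob_algebra borel"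
      using measurable_prob_algebraD[OF \<kappa>] by (simp cong: measurable_cong_sets)
    have em: "(\<lambda>y. emeasure (\<kappa> y) A) \<in> borel_measurable N" if "A \<in> sets borel" for A
      using measurable_emeasure_kernel[OF measurable_prob_algebraD[OF \<kappa>] that] .
    have e2: "emeasure \<mu>2 A = (\<integral>\<^sup>+ y\<in>B. emeasure (\<kappa> y) A \<partial>\<nu>)" if A: "A \<in> sets borel" for A
      unfolding \<mu>2_def emeasure_bind[OF ne \<kappa>s A]
      using em[OF A] by (subst nn_integral_density) (auto simp: mult.commute)
    have s2: "sets \<mu>2 = sets borel" unfolding \<mu>2_def by (rule sets_bind[OF _ ne]) (use \<kappa> in \<open>auto dest!: measurable_space simp: space_prob_algebra\<close>)
    have eqI: "emeasure \<mu>1 {..x} = emeasure \<mu>2 {..x}" for x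
    proof -
      have "emeasure \<mu>2 {..x} = (\<integral>\<^sup>+ y\<in>B. F x y \<partial>\<nu>)"
        unfolding e2[OF atMost_borel] by (rule nn_integral_cong_AE) (use \<kappa>F[of x] in \<open>auto elim!: eventually_mono\<close>)
      then show ?thesis using e1[of "{..x}"] dF[OF B, of x] by (simp add: E_def)
    qed
    have f1: "finite_borel_measure \<mu>1"
      unfolding finite_borel_measure_def finite_borel_measure_axioms_def
      by (auto simp: \<mu>1_def intro!: finite_measureI) (simp add: \<mu>1_def[symmetric] e1 less_top[symmetric] emeasure_eq_measure)
    have f2: "finite_borel_measure \<mu>2"
    proof -
      have UNb: "UNIV \<in> sets (borel :: real measure)" by simp
      have "emeasure \<mu>2 UNIV \<le> (\<integral>\<^sup>+ y. 1 \<partial>\<nu>)"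
        unfolding e2[OF UNb]
        using \<kappa> by (intro nn_integral_mono)
          (auto dest!: measurable_space simp: space_prob_algebra indicator_def intro!: prob_space.emeasure_le_1)
      then have "emeasure \<mu>2 UNIV < \<infinity>" by (auto simp: D.emeasure_space_1[simplified] intro: le_less_trans)
      then show ?thesis
        unfolding finite_borel_measure_def finite_borel_measure_axioms_def
        using s2 sets_eq_imp_space_eq[OF s2] by (auto intro!: finite_measureI)
    qed
    have "\<mu>1 = \<mu>2"
      by (rule cdf_unique'[OF f1 f2]) (simp add: fun_eq_iff cdf_def measure_def eqI)
    then show ?thesis using e1[OF A] e2[OF A] by simp
  qed
  then show ?thesis using \<kappa> unfolding is_regular_cond_law_def \<nu>_def by blast
qed

section \<open>Integrals of extended-real functions\<close>

lemma ereal_integral_cong_AE: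
  "AE x in M. f x = g x \<Longrightarrow> ereal_integral M f = ereal_integral M g"
  unfolding ereal_integral_def
  by (intro arg_cong2[where f="(-)"] arg_cong[where f=enn2ereal] nn_integral_cong_AE) (auto elim!: eventually_mono)

lemma ereal_integral_distr:
  assumes "T \<in> M \<rightarrow>\<^sub>M N" "f \<in> borel_measurable N"
  shows "ereal_integral (distr M N T) f = ereal_integral M (\<lambda>x. f (T x))"
  unfolding ereal_integral_def using assms by (simp add: nn_integral_distr)

lemma ereal_integral_lborel_translate:
  fixes f :: "real \<Rightarrow> ereal"
  assumes [measurable]: "f \<in> borel_measurable borel"
  shows "ereal_integral lborel (\<lambda>x. f (x + c)) = ereal_integral lborel f"
  unfolding ereal_integral_def
  using nn_integral_real_affine[of "\<lambda>x. e2ennreal (f x)" 1 c] nn_integral_real_affine[of "\<lambda>x. e2ennreal (- f x)" 1 c]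
  by (simp add: add.commute)

lemma e2ennreal_enn2ereal_diff:
  "a < \<infinity> \<Longrightarrow> e2ennreal (enn2ereal a - enn2ereal b) = a - b"
  "a < \<infinity> \<Longrightarrow> e2ennreal (- (enn2ereal a - enn2ereal b)) = b - a"
proof -
  assume "a < \<infinity>"
  then obtain r where r: "a = ennreal r" "r \<ge> 0" by (cases a) auto
  show "e2ennreal (enn2ereal a - enn2ereal b) = a - b"
    using r by (cases b) (auto simp: ennreal_minus e2ennreal_ereal enn2ereal_ennreal e2ennreal_neg)
  show "e2ennreal (- (enn2ereal a - enn2ereal b)) = b - a"
    using r by (cases b) (auto simp: ennreal_minus e2ennreal_ereal enn2ereal_ennreal e2ennreal_infty)
qed

text \<open>An inner integral is a difference p - n whose own positive and negative parts are not p
  and n. For truncated subtraction p + (n - p) = n + (p - n); integrating this over the labels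
  restores p and n. Finiteness of the integral of p permits the cancellation, while that of n may be
  infinite: this is the case of entropy -infinity.\<close>

lemma ereal_integral_iterated:
  fixes g :: "'c \<times> real \<Rightarrow> real"
  assumes Q: "prob_space Q" and [measurable]: "g \<in> borel_measurable (Q \<Otimes>\<^sub>M lborel)"
    and fin: "(\<integral>\<^sup>+ w. ennreal (g w) \<partial>(Q \<Otimes>\<^sub>M lborel)) < \<infinity>"
  shows "ereal_integral Q (\<lambda>y. ereal_integral lborel (\<lambda>x. ereal (g (y, x)))) =
    enn2ereal (\<integral>\<^sup>+ w. ennreal (g w) \<partial>(Q \<Otimes>\<^sub>M lborel)) - enn2ereal (\<integral>\<^sup>+ w. ennreal (- g w) \<partial>(Q \<Otimes>\<^sub>M lborel))"
proof -
  define p where "p y = (\<integral>\<^sup>+ x. ennreal (g (y, x)) \<partial>lborel)" for y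
  define n where "n y = (\<integral>\<^sup>+ x. ennreal (- g (y, x)) \<partial>lborel)" for y
  have [measurable]: "p \<in> borel_measurable Q" "n \<in> borel_measurable Q"
    unfolding p_def[abs_def] n_def[abs_def] by measurable
  have P: "(\<integral>\<^sup>+ w. ennreal (g w) \<partial>(Q \<Otimes>\<^sub>M lborel)) = (\<integral>\<^sup>+ y. p y \<partial>Q)"
    unfolding p_def by (subst lborel.nn_integral_fst[symmetric]) auto
  have N: "(\<integral>\<^sup>+ w. ennreal (- g w) \<partial>(Q \<Otimes>\<^sub>M lborel)) = (\<integral>\<^sup>+ y. n y \<partial>Q)"
    unfolding n_def by (subst lborel.nn_integral_fst[symmetric]) auto
  have pf: "AE y in Q. p y < \<infinity>"
    using nn_integral_PInf_AE[of p Q] fin unfolding P by (auto simp: less_top)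
  have inner: "ereal_integral lborel (\<lambda>x. ereal (g (y, x))) = enn2ereal (p y) - enn2ereal (n y)" for y
    by (simp add: ereal_integral_def p_def n_def)
  define Z1 where "Z1 = (\<integral>\<^sup>+ y. p y - n y \<partial>Q)"
  define Z2 where "Z2 = (\<integral>\<^sup>+ y. n y - p y \<partial>Q)"
  have "ereal_integral Q (\<lambda>y. ereal_integral lborel (\<lambda>x. ereal (g (y, x)))) = enn2ereal Z1 - enn2ereal Z2"
    unfolding ereal_integral_def[of Q] inner Z1_def Z2_def
    by (intro arg_cong2[where f="(-)"] arg_cong[where f=enn2ereal] nn_integral_cong_AE)
       (use pf in \<open>auto elim!: eventually_mono simp: e2ennreal_enn2ereal_diff\<close>)
  also have "\<dots> = enn2ereal (\<integral>\<^sup>+ y. p y \<partial>Q) - enn2ereal (\<integral>\<^sup>+ y. n y \<partial>Q)"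
  proof -
    have "(\<integral>\<^sup>+ y. p y + (n y - p y) \<partial>Q) = (\<integral>\<^sup>+ y. n y + (p y - n y) \<partial>Q)"
    proof (rule nn_integral_cong_AE, use pf in eventually_elim)
      fix y assume "p y < \<infinity>"
      then show "p y + (n y - p y) = n y + (p y - n y)"
        by (cases "p y"; cases "n y"; cases "enn2real (p y) \<le> enn2real (n y)")
           (auto simp: ennreal_minus ennreal_plus[symmetric] ennreal_neg simp del: ennreal_plus)
    qed
    then have eq: "(\<integral>\<^sup>+ y. p y \<partial>Q) + Z2 = (\<integral>\<^sup>+ y. n y \<partial>Q) + Z1"
      unfolding Z1_def Z2_def by (simp add: nn_integral_add)
    have z1: "Z1 \<le> (\<integral>\<^sup>+ y. p y \<partial>Q)" unfolding Z1_def by (intro nn_integral_mono) (auto intro: diff_le_self_ennreal)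
    have z2: "Z2 \<le> (\<integral>\<^sup>+ y. n y \<partial>Q)" unfolding Z2_def by (intro nn_integral_mono) (auto intro: diff_le_self_ennreal)
    obtain a where a: "(\<integral>\<^sup>+ y. p y \<partial>Q) = ennreal a" "a \<ge> 0" using fin unfolding P by (cases "\<integral>\<^sup>+ y. p y \<partial>Q") auto
    obtain b where b: "Z1 = ennreal b" "b \<ge> 0" using z1 a by (cases Z1) (auto simp: top_unique)
    show ?thesis
    proof (cases "(\<integral>\<^sup>+ y. n y \<partial>Q) = \<infinity>")
      case True
      then have "Z2 = \<infinity>" using eq a by (cases Z2) (auto simp: ennreal_plus[symmetric] simp del: ennreal_plus)
      then show ?thesis using True a b by (simp add: enn2ereal_ennreal)
    next
      case False
      then obtain c where c: "(\<integral>\<^sup>+ y. n y \<partial>Q) = ennreal c" "c \<ge> 0" by (cases "\<integral>\<^sup>+ y. n y \<partial>Q") auto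
      then obtain d where d: "Z2 = ennreal d" "d \<ge> 0" using z2 by (cases Z2) (auto simp: top_unique)
      have "a + d = c + b" using eq a b c d by (simp add: ennreal_plus[symmetric] del: ennreal_plus)
      then show ?thesis using a b c d by (simp add: enn2ereal_ennreal)
    qed
  qed
  finally show ?thesis unfolding P N .
qed

section \<open>Conditional laws with densities\<close>

lemma differential_entropy_density:
  assumes [measurable]: "r \<in> borel_measurable borel"
  shows "differential_entropy (density lborel r) = ereal_integral lborel (\<lambda>x. ereal (- (enn2real (r x) * ln (enn2real (r x)))))"
proof -
  have "AE x in lborel. r x = RN_deriv lborel (density lborel r) x"
    by (rule sigma_finite_measure.RN_deriv_unique[OF sigma_finite_lborel]) auto
  then show ?thesis unfolding differential_entropy_def Let_def
    by (intro ereal_integral_cong_AE) (auto elim!: eventually_mono)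
qed

lemma regular_cond_law_density:
  assumes r: "case_prod r \<in> borel_measurable (N \<Otimes>\<^sub>M borel)"
    and r1: "\<And>y. y \<in> space N \<Longrightarrow> (\<integral>\<^sup>+ x. r y x \<partial>lborel) = 1"
    and law: "\<And>A B. A \<in> sets borel \<Longrightarrow> B \<in> sets N \<Longrightarrow>
      emeasure M {\<omega> \<in> space M. X \<omega> \<in> A \<and> Y \<omega> \<in> B} = (\<integral>\<^sup>+ y\<in>B. (\<integral>\<^sup>+ x\<in>A. r y x \<partial>lborel) \<partial>distr M N Y)"
  shows "is_regular_cond_law M N X Y (\<lambda>y. density lborel (r y))"
proof -
  have rs [measurable]: "r y \<in> borel_measurable borel" if "y \<in> space N" for y
    using measurable_compose[OF measurable_Pair1'[OF that] r] by simp
  have em: "emeasure (density lborel (r y)) A = (\<integral>\<^sup>+ x\<in>A. r y x \<partial>lborel)" if "y \<in> space N" "A \<in> sets borel" for y A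
    using rs[OF that(1)] that by (simp add: emeasure_density)
  have pr: "prob_space (density lborel (r y))" if "y \<in> space N" for y
    by (rule prob_spaceI) (use em[OF that, of UNIV] r1[OF that] in simp)
  have "(\<lambda>y. density lborel (r y)) \<in> N \<rightarrow>\<^sub>M subprob_algebra borel"
  proof (rule measurable_subprob_algebra)
    fix A :: "real set" assume "A \<in> sets borel"
    note [measurable] = this
    have [measurable]: "(\<lambda>w. r (fst w) (snd w)) \<in> borel_measurable (N \<Otimes>\<^sub>M lborel)"
      using r by (simp add: split_beta' cong: measurable_cong_sets)
    have "(\<lambda>y. \<integral>\<^sup>+ x\<in>A. r y x \<partial>lborel) \<in> borel_measurable N"
      by (rule lborel.borel_measurable_nn_integral) (simp add: split_beta')
    then show "(\<lambda>y. emeasure (density lborel (r y)) A) \<in> borel_measurable N"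
      by (rule measurable_cong[THEN iffD1, rotated]) (simp add: em)
  qed (auto intro!: prob_space_imp_subprob_space pr)
  then have "(\<lambda>y. density lborel (r y)) \<in> N \<rightarrow>\<^sub>M prob_algebra borel"
    using pr by (intro measurable_prob_algebraI)
  moreover have "emeasure M {\<omega> \<in> space M. X \<omega> \<in> A \<and> Y \<omega> \<in> B} = (\<integral>\<^sup>+ y\<in>B. emeasure (density lborel (r y)) A \<partial>distr M N Y)"
    if "A \<in> sets borel" "B \<in> sets N" for A B
    unfolding law[OF that] by (intro nn_integral_cong) (simp add: em that)
  ultimately show ?thesis unfolding is_regular_cond_law_def by blast
qed

text \<open>Densities picked separately for each y need not depend measurably on y. The
  Radon-Nikodym derivative of the joint law is jointly measurable; the joint law is dominated
  because a null set of the product has null sections for almost every y.\<close>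

lemma joint_law_density:
  assumes M: "prob_space M" and X [measurable]: "X \<in> borel_measurable M" and Y [measurable]: "Y \<in> M \<rightarrow>\<^sub>M N"
    and k: "is_regular_cond_law M N X Y \<kappa>"
    and ac: "AE y in distr M N Y. absolutely_continuous lborel (\<kappa> y)"
  shows "\<exists>\<rho>. \<rho> \<in> borel_measurable (N \<Otimes>\<^sub>M borel) \<and>
    distr M (N \<Otimes>\<^sub>M borel) (\<lambda>\<omega>. (Y \<omega>, X \<omega>)) = density (distr M N Y \<Otimes>\<^sub>M lborel) \<rho>"
proof -
  interpret prob_space M by fact
  define \<nu> where "\<nu> = distr M N Y"
  have s\<nu> [measurable_cong, simp]: "sets \<nu> = sets N" "space \<nu> = space N" by (auto simp: \<nu>_def)
  interpret D: prob_space \<nu> unfolding \<nu>_def by (rule prob_space_distr[OF Y])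
  interpret PS: pair_sigma_finite \<nu> "lborel :: real measure" ..
  have \<kappa>: "\<kappa> \<in> N \<rightarrow>\<^sub>M prob_algebra borel" using k by (simp add: is_regular_cond_law_def)
  have \<kappa>s: "sets (\<kappa> y) = sets borel" "prob_space (\<kappa> y)" if "y \<in> space N" for y
    using measurable_space[OF \<kappa> that] by (auto simp: space_prob_algebra)
  define J0 where "J0 = distr M (N \<Otimes>\<^sub>M borel) (\<lambda>\<omega>. (Y \<omega>, X \<omega>))"
  \<comment> \<open>\<open>K y\<close> is the product of the point mass at y with
    \<open>\<kappa> y\<close>. Mixing these over the law of Y gives the joint law, as comparison on
    rectangles shows.\<close>
  define K where "K y = distr (\<kappa> y) (N \<Otimes>\<^sub>M borel) (Pair y)" for y
  have K: "K \<in> N \<rightarrow>\<^sub>M prob_algebra (N \<Otimes>\<^sub>M borel)"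
    unfolding K_def[abs_def] using \<kappa> by (rule measurable_distr_prob_space2) simp
  have K': "K \<in> \<nu> \<rightarrow>\<^sub>M subprob_algebra (N \<Otimes>\<^sub>M borel)"
    using measurable_prob_algebraD[OF K] by (simp cong: measurable_cong_sets)
  have emK: "emeasure (K y) C = emeasure (\<kappa> y) (Pair y -` C)" if y: "y \<in> space N" and C: "C \<in> sets (N \<Otimes>\<^sub>M borel)" for y C
  proof -
    have "Pair y \<in> \<kappa> y \<rightarrow>\<^sub>M N \<Otimes>\<^sub>M borel" using measurable_Pair1'[OF y] \<kappa>s[OF y] by (simp cong: measurable_cong_sets)
    moreover have "space (\<kappa> y) = UNIV" using sets_eq_imp_space_eq[OF \<kappa>s(1)[OF y]] by simp
    ultimately show ?thesis unfolding K_def using C by (subst emeasure_distr) auto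
  qed
  have em2: "emeasure (\<nu> \<bind> K) C = (\<integral>\<^sup>+ y. emeasure (\<kappa> y) (Pair y -` C) \<partial>\<nu>)" if C: "C \<in> sets (N \<Otimes>\<^sub>M borel)" for C
    using D.not_empty by (subst emeasure_bind[OF _ K' C]) (auto intro!: nn_integral_cong simp: emK C)
  have eq: "J0 = \<nu> \<bind> K"
  proof (rule measure_eqI_generator_eq[OF Int_stable_pair_measure_generator[of N "borel :: real measure"]])
    show "{a \<times> b |a b. a \<in> sets N \<and> b \<in> sets borel} \<subseteq> Pow (space N \<times> space (borel :: real measure))"
      by (rule pair_measure_closed)
    show "sets J0 = sigma_sets (space N \<times> space (borel :: real measure)) {a \<times> b |a b. a \<in> sets N \<and> b \<in> sets borel}"
      by (simp add: J0_def sets_pair_measure)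
    show "sets (\<nu> \<bind> K) = sigma_sets (space N \<times> space (borel :: real measure)) {a \<times> b |a b. a \<in> sets N \<and> b \<in> sets borel}"
      using D.not_empty K by (subst sets_bind[where N="N \<Otimes>\<^sub>M borel"])
        (auto simp: sets_pair_measure dest!: measurable_space simp: space_prob_algebra)
    show "range (\<lambda>_::nat. space N \<times> (UNIV :: real set)) \<subseteq> {a \<times> b |a b. a \<in> sets N \<and> b \<in> sets borel}" by force
    show "(\<Union>i::nat. space N \<times> (UNIV :: real set)) = space N \<times> space borel" by simp
    show "emeasure J0 (space N \<times> UNIV) \<noteq> \<infinity>" for i :: nat
      unfolding J0_def by (subst emeasure_distr) (auto simp: emeasure_eq_measure)
    fix C assume "C \<in> {a \<times> b |a b. a \<in> sets N \<and> b \<in> sets (borel :: real measure)}"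
    then obtain B A where C: "C = B \<times> A" "B \<in> sets N" "A \<in> sets borel" by auto
    have "emeasure J0 C = emeasure M {\<omega> \<in> space M. X \<omega> \<in> A \<and> Y \<omega> \<in> B}"
      unfolding J0_def C(1) using C by (subst emeasure_distr) (auto intro!: arg_cong[where f="emeasure M"])
    also have "\<dots> = (\<integral>\<^sup>+ y\<in>B. emeasure (\<kappa> y) A \<partial>\<nu>)" using k C unfolding is_regular_cond_law_def \<nu>_def by blast
    also have "\<dots> = (\<integral>\<^sup>+ y. emeasure (\<kappa> y) (Pair y -` C) \<partial>\<nu>)"
      unfolding C(1) by (intro nn_integral_cong) (auto simp: indicator_def)
    also have "\<dots> = emeasure (\<nu> \<bind> K) C" using em2[of C] C(2,3) unfolding C(1) by auto
    finally show "emeasure J0 C = emeasure (\<nu> \<bind> K) C" .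
  qed
  have sP: "sets (\<nu> \<Otimes>\<^sub>M lborel) = sets (N \<Otimes>\<^sub>M borel)" by (intro sets_pair_measure_cong) auto
  have "absolutely_continuous (\<nu> \<Otimes>\<^sub>M lborel) J0"
    unfolding absolutely_continuous_def
  proof
    fix C assume C: "C \<in> null_sets (\<nu> \<Otimes>\<^sub>M (lborel :: real measure))"
    then have Cm: "C \<in> sets (N \<Otimes>\<^sub>M borel)" and C0: "emeasure (\<nu> \<Otimes>\<^sub>M lborel) C = 0" using sP by auto
    have CL [measurable]: "C \<in> sets (\<nu> \<Otimes>\<^sub>M lborel)" using Cm sP by simp
    have "(\<integral>\<^sup>+ y. emeasure lborel (Pair y -` C) \<partial>\<nu>) = 0"
      using C0 lborel.emeasure_pair_measure_alt[OF CL] by simp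
    then have "AE y in \<nu>. emeasure lborel (Pair y -` C) = 0"
      using nn_integral_0_iff_AE[OF lborel.measurable_emeasure_Pair[OF CL]] by simp
    with ac[folded \<nu>_def] have "AE y in \<nu>. emeasure (\<kappa> y) (Pair y -` C) = 0"
    proof eventually_elim
      case (elim y)
      have "Pair y -` C \<in> null_sets lborel" using elim(2) sets_Pair1[OF Cm, of y] by (auto simp: null_sets_def)
      then have "Pair y -` C \<in> null_sets (\<kappa> y)" using elim(1) by (auto simp: absolutely_continuous_def)
      then show ?case by auto
    qed
    then have "emeasure J0 C = 0" unfolding eq em2[OF Cm]
      by (subst nn_integral_cong_AE[of _ "\<lambda>_. 0"]) (auto elim!: eventually_mono)
    then show "C \<in> null_sets J0" using Cm by (auto simp: null_sets_def J0_def)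
  qed
  moreover have "sets J0 = sets (\<nu> \<Otimes>\<^sub>M lborel)" unfolding J0_def sP by simp
  ultimately have "density (\<nu> \<Otimes>\<^sub>M lborel) (RN_deriv (\<nu> \<Otimes>\<^sub>M lborel) J0) = J0"
    by (rule PS.density_RN_deriv)
  moreover have "RN_deriv (\<nu> \<Otimes>\<^sub>M lborel) J0 \<in> borel_measurable (N \<Otimes>\<^sub>M borel)"
    using borel_measurable_RN_deriv[of "\<nu> \<Otimes>\<^sub>M lborel" J0] unfolding measurable_cong_sets[OF sP refl] .
  ultimately show ?thesis unfolding J0_def \<nu>_def by metis
qed

section \<open>Centring at the conditional mean\<close>

lemma nn_integral_shift_real:
  fixes G :: "real \<Rightarrow> ennreal"
  assumes [measurable]: "G \<in> borel_measurable borel"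
  shows "(\<integral>\<^sup>+ x. G (x + c) \<partial>lborel) = (\<integral>\<^sup>+ x. G x \<partial>lborel)"
  by (subst (2) nn_integral_real_affine[where c=1 and t=c]) (auto simp: add.commute)

text \<open>From (x - b)^2 <= 2 (x - a)^2 + 2 (a - b)^2. The centre a is arbitrary, so a finite
  conditional variance yields a finite second moment before the mean is known to exist.\<close>

lemma second_moment_shift_le:
  fixes g :: "real \<Rightarrow> ennreal"
  assumes [measurable]: "g \<in> borel_measurable borel" and g1: "(\<integral>\<^sup>+ x. g x \<partial>lborel) = 1"
    and fin: "(\<integral>\<^sup>+ x. g x * ennreal ((x - a)\<^sup>2) \<partial>lborel) < \<infinity>"
  shows "(\<integral>\<^sup>+ x. g x * ennreal ((x - b)\<^sup>2) \<partial>lborel) < \<infinity>"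
proof -
  have "(\<integral>\<^sup>+ x. g x * ennreal ((x - b)\<^sup>2) \<partial>lborel)
      \<le> (\<integral>\<^sup>+ x. ennreal 2 * (g x * ennreal ((x - a)\<^sup>2)) + ennreal (2 * (a - b)\<^sup>2) * g x \<partial>lborel)"
  proof (rule nn_integral_mono)
    fix x
    have "(x - b)\<^sup>2 \<le> 2 * (x - a)\<^sup>2 + 2 * (a - b)\<^sup>2"
      using sum_squares_bound[of "x - a" "a - b"] by (simp add: power2_eq_square algebra_simps)
    then have "ennreal ((x - b)\<^sup>2) \<le> ennreal 2 * ennreal ((x - a)\<^sup>2) + ennreal (2 * (a - b)\<^sup>2)"
    proof -
      assume "(x - b)\<^sup>2 \<le> 2 * (x - a)\<^sup>2 + 2 * (a - b)\<^sup>2"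
      then have "ennreal ((x - b)\<^sup>2) \<le> ennreal (2 * (x - a)\<^sup>2 + 2 * (a - b)\<^sup>2)" by (rule ennreal_leI)
      also have "\<dots> = ennreal 2 * ennreal ((x - a)\<^sup>2) + ennreal (2 * (a - b)\<^sup>2)"
        by (subst ennreal_plus) (auto simp: ennreal_mult)
      finally show ?thesis .
    qed
    then have "g x * ennreal ((x - b)\<^sup>2) \<le> g x * (ennreal 2 * ennreal ((x - a)\<^sup>2) + ennreal (2 * (a - b)\<^sup>2))"
      by (intro mult_left_mono) auto
    then show "g x * ennreal ((x - b)\<^sup>2) \<le> ennreal 2 * (g x * ennreal ((x - a)\<^sup>2)) + ennreal (2 * (a - b)\<^sup>2) * g x"
      by (simp only: distrib_left mult.commute mult.left_commute)
  qed
  also have "\<dots> = ennreal 2 * (\<integral>\<^sup>+ x. g x * ennreal ((x - a)\<^sup>2) \<partial>lborel) + ennreal (2 * (a - b)\<^sup>2) * 1"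
    by (subst nn_integral_add) (auto simp: nn_integral_cmult g1)
  also have "\<dots> < \<infinity>" using fin by (auto simp: ennreal_mult_less_top)
  finally show ?thesis .
qed

lemma measurable_nn_integral_section:
  assumes "(\<lambda>w. r (fst w) (snd w)) \<in> borel_measurable (N \<Otimes>\<^sub>M (borel :: real measure))"
  shows "(\<lambda>y. \<integral>\<^sup>+ x. r y x \<partial>lborel) \<in> borel_measurable N"
proof -
  have "sets (N \<Otimes>\<^sub>M (lborel :: real measure)) = sets (N \<Otimes>\<^sub>M borel)" by (intro sets_pair_measure_cong) auto
  from measurable_cong_sets[OF this refl] assms
  have "(\<lambda>(y, x). r y x) \<in> borel_measurable (N \<Otimes>\<^sub>M lborel)" by (simp add: split_beta')
  then show ?thesis by (rule lborel.borel_measurable_nn_integral)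
qed

text \<open>The joint density is repaired twice, where its mass is not 1 and where its second moment
  is infinite, and then translated by the conditional mean m. The identity for h describes the joint
  law of the centred variable and the label, which is all that the copies need. Positivity of
  \<sigma> is automatic, because a law with a density is not a point mass.\<close>

lemma centred_conditional_density:
  assumes M: "prob_space M" and X [measurable]: "X \<in> borel_measurable M" and Y [measurable]: "Y \<in> M \<rightarrow>\<^sub>M N"
    and k: "is_regular_cond_law M N X Y \<kappa>"
    and ac: "AE y in distr M N Y. absolutely_continuous lborel (\<kappa> y)"
    and fin: "(\<integral>\<^sup>+ \<omega>. law_variance (\<kappa> (Y \<omega>)) \<partial>M) < \<infinity>"
  shows "\<exists>f m \<sigma>. cond_density (distr M N Y) f \<sigma> \<and> \<sigma>\<^sup>2 = enn2real (\<integral>\<^sup>+ \<omega>. law_variance (\<kappa> (Y \<omega>)) \<partial>M) \<and>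
    m \<in> borel_measurable N \<and> (\<forall>h\<in>borel_measurable (borel \<Otimes>\<^sub>M N).
      (\<integral>\<^sup>+ \<omega>. h (X \<omega> - m (Y \<omega>), Y \<omega>) \<partial>M) = (\<integral>\<^sup>+ y. \<integral>\<^sup>+ x. h (x, y) * f y x \<partial>lborel \<partial>distr M N Y))"
proof -
  interpret prob_space M by fact
  define \<nu> where "\<nu> = distr M N Y"
  have s\<nu> [measurable_cong, simp]: "sets \<nu> = sets N" "space \<nu> = space N" by (auto simp: \<nu>_def)
  interpret D: prob_space \<nu> unfolding \<nu>_def by (rule prob_space_distr[OF Y])
  have sP: "sets (\<nu> \<Otimes>\<^sub>M (lborel :: real measure)) = sets (N \<Otimes>\<^sub>M borel)" by (intro sets_pair_measure_cong) auto
  obtain \<rho> where \<rho>: "\<rho> \<in> borel_measurable (N \<Otimes>\<^sub>M borel)"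
    and J0: "distr M (N \<Otimes>\<^sub>M borel) (\<lambda>\<omega>. (Y \<omega>, X \<omega>)) = density (\<nu> \<Otimes>\<^sub>M lborel) \<rho>"
    using joint_law_density[OF M X Y k ac] unfolding \<nu>_def by blast
  note [measurable] = \<rho>
  have \<rho>L [measurable]: "\<rho> \<in> borel_measurable (\<nu> \<Otimes>\<^sub>M lborel)" unfolding measurable_cong_sets[OF sP refl] by (rule \<rho>)
  have joint: "(\<integral>\<^sup>+ \<omega>. H (Y \<omega>, X \<omega>) \<partial>M) = (\<integral>\<^sup>+ y. \<integral>\<^sup>+ x. \<rho> (y, x) * H (y, x) \<partial>lborel \<partial>\<nu>)"
    if H: "H \<in> borel_measurable (N \<Otimes>\<^sub>M borel)" for H
  proof -
    have [measurable]: "H \<in> borel_measurable (\<nu> \<Otimes>\<^sub>M lborel)" unfolding measurable_cong_sets[OF sP refl] by (rule H)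
    have "(\<integral>\<^sup>+ \<omega>. H (Y \<omega>, X \<omega>) \<partial>M) = (\<integral>\<^sup>+ w. H w \<partial>distr M (N \<Otimes>\<^sub>M borel) (\<lambda>\<omega>. (Y \<omega>, X \<omega>)))"
      using H by (subst nn_integral_distr) auto
    also have "\<dots> = (\<integral>\<^sup>+ w. \<rho> w * H w \<partial>(\<nu> \<Otimes>\<^sub>M lborel))" unfolding J0 by (rule nn_integral_density) measurable
    also have "\<dots> = (\<integral>\<^sup>+ y. \<integral>\<^sup>+ x. \<rho> (y, x) * H (y, x) \<partial>lborel \<partial>\<nu>)"
      by (subst lborel.nn_integral_fst[symmetric]) auto
    finally show ?thesis .
  qed
  have \<rho>s [measurable]: "(\<lambda>x. \<rho> (y, x)) \<in> borel_measurable borel" if "y \<in> space N" for y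
    using measurable_compose[OF measurable_Pair1'[OF that] \<rho>] .
  have \<rho>1m [measurable]: "(\<lambda>y. \<integral>\<^sup>+ x. \<rho> (y, x) \<partial>lborel) \<in> borel_measurable N"
    by (rule measurable_nn_integral_section) simp
  have \<rho>1: "AE y in \<nu>. (\<integral>\<^sup>+ x. \<rho> (y, x) \<partial>lborel) = 1"
  proof (rule D.density_unique_finite_measure)
    fix B assume "B \<in> sets \<nu>"
    then have [measurable]: "B \<in> sets N" by simp
    have "(\<integral>\<^sup>+ y\<in>B. (\<integral>\<^sup>+ x. \<rho> (y, x) \<partial>lborel) \<partial>\<nu>) = (\<integral>\<^sup>+ y. \<integral>\<^sup>+ x. \<rho> (y, x) * indicator B (fst (y, x)) \<partial>lborel \<partial>\<nu>)"
    proof (rule nn_integral_cong)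
      fix y assume "y \<in> space \<nu>"
      then have "(\<lambda>x. \<rho> (y, x)) \<in> borel_measurable lborel" using \<rho>s[of y] by simp
      then show "(\<integral>\<^sup>+ x. \<rho> (y, x) \<partial>lborel) * indicator B y = (\<integral>\<^sup>+ x. \<rho> (y, x) * indicator B (fst (y, x)) \<partial>lborel)"
        by (simp add: nn_integral_multc)
    qed
    also have "\<dots> = (\<integral>\<^sup>+ \<omega>. indicator B (fst (Y \<omega>, X \<omega>)) \<partial>M)" by (rule joint[symmetric]) measurable
    also have "\<dots> = (\<integral>\<^sup>+ y. indicator B y \<partial>\<nu>)" unfolding \<nu>_def by (subst nn_integral_distr) auto
    finally show "(\<integral>\<^sup>+ y\<in>B. (\<integral>\<^sup>+ x. \<rho> (y, x) \<partial>lborel) \<partial>\<nu>) = (\<integral>\<^sup>+ y\<in>B. 1 \<partial>\<nu>)" by simp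
  qed auto
  \<comment> \<open>the normal density on exceptional null sets makes the locale assumptions hold for every \<open>y\<close>\<close>
  define g where "g y x = (if y \<in> space N \<and> (\<integral>\<^sup>+ x. \<rho> (y, x) \<partial>lborel) = 1 then \<rho> (y, x) else ennreal (std_normal_density x))" for y x
  have nd1: "(\<integral>\<^sup>+ x. ennreal (std_normal_density x) \<partial>lborel) = 1"
    using integrable_std_normal integral_std_normal by (subst nn_integral_eq_integral) auto
  have nd2: "(\<integral>\<^sup>+ x. ennreal (std_normal_density x) * ennreal (x\<^sup>2) \<partial>lborel) < \<infinity>"
  proof -
    have "(\<integral>\<^sup>+ x. ennreal (std_normal_density x) * ennreal (x\<^sup>2) \<partial>lborel) = ennreal (LINT x|lborel. std_normal_density x * x\<^sup>2)"
      using integrable_normal_x2(1)[of 1] by (subst nn_integral_eq_integral[symmetric]) (auto simp: ennreal_mult)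
    then show ?thesis by simp
  qed
  have gm: "(\<lambda>w. g (fst w) (snd w)) \<in> borel_measurable (N \<Otimes>\<^sub>M borel)"
    unfolding g_def by measurable
  have gs [measurable]: "g y \<in> borel_measurable borel" for y
    unfolding g_def[abs_def] by (cases "y \<in> space N") auto
  have g1: "(\<integral>\<^sup>+ x. g y x \<partial>lborel) = 1" for y
    unfolding g_def by (cases "y \<in> space N \<and> (\<integral>\<^sup>+ x. \<rho> (y, x) \<partial>lborel) = 1") (auto simp: nd1)
  have g\<rho>: "AE y in \<nu>. y \<in> space N \<and> (\<forall>x. g y x = \<rho> (y, x))"
    using \<rho>1 AE_space[of \<nu>] by eventually_elim (auto simp: g_def)
  \<comment> \<open>\<open>K\<close> is a second regular conditional law, explicit in the density;
    by uniqueness it carries the given variance.\<close>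
  define K where "K y = density lborel (g y)" for y
  have regK: "is_regular_cond_law M N X Y K"
    unfolding K_def[abs_def]
  proof (rule regular_cond_law_density)
    show "case_prod g \<in> borel_measurable (N \<Otimes>\<^sub>M borel)" using gm by (simp add: split_beta')
    fix A B assume [measurable]: "A \<in> sets (borel :: real measure)" "B \<in> sets N"
    have "emeasure M {\<omega> \<in> space M. X \<omega> \<in> A \<and> Y \<omega> \<in> B} = (\<integral>\<^sup>+ \<omega>. indicator {\<omega> \<in> space M. X \<omega> \<in> A \<and> Y \<omega> \<in> B} \<omega> \<partial>M)"
      by (subst nn_integral_indicator) auto
    also have "\<dots> = (\<integral>\<^sup>+ \<omega>. indicator (B \<times> A) (Y \<omega>, X \<omega>) \<partial>M)"
      by (intro nn_integral_cong) (auto simp: indicator_def)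
    also have "\<dots> = (\<integral>\<^sup>+ y. \<integral>\<^sup>+ x. \<rho> (y, x) * indicator (B \<times> A) (y, x) \<partial>lborel \<partial>\<nu>)" by (rule joint) measurable
    also have "\<dots> = (\<integral>\<^sup>+ y\<in>B. (\<integral>\<^sup>+ x\<in>A. g y x \<partial>lborel) \<partial>\<nu>)"
    proof (rule nn_integral_cong_AE, use g\<rho> in eventually_elim)
      fix y assume y: "y \<in> space N \<and> (\<forall>x. g y x = \<rho> (y, x))"
      show "(\<integral>\<^sup>+ x. \<rho> (y, x) * indicator (B \<times> A) (y, x) \<partial>lborel) = (\<integral>\<^sup>+ x\<in>A. g y x \<partial>lborel) * indicator B y"
        using y by (cases "y \<in> B") (auto simp: indicator_times)
    qed
    finally show "emeasure M {\<omega> \<in> space M. X \<omega> \<in> A \<and> Y \<omega> \<in> B} = (\<integral>\<^sup>+ y\<in>B. (\<integral>\<^sup>+ x\<in>A. g y x \<partial>lborel) \<partial>distr M N Y)"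
      unfolding \<nu>_def .
  qed (rule g1)
  have \<kappa>K: "AE y in \<nu>. \<kappa> y = K y" unfolding \<nu>_def by (rule regular_cond_law_unique[OF M Y k regK])
  have Km: "K \<in> N \<rightarrow>\<^sub>M subprob_algebra borel"
    using regK by (auto simp: is_regular_cond_law_def dest: measurable_prob_algebraD)
  \<comment> \<open>A Bochner mean that is 0 by default when the first moment is missing. It is
    compared with the mean \<open>m\<close> of the repaired density only after the second moment is
    known to be finite.\<close>
  define mg where "mg y = (\<integral>z. z \<partial>K y)" for y
  have [measurable]: "mg \<in> borel_measurable N"
    unfolding mg_def[abs_def]
    by (rule measurable_compose[OF Km integral_measurable_subprob_algebra]) simp
  define V where "V y = (\<integral>\<^sup>+ x. g y x * ennreal ((x - mg y)\<^sup>2) \<partial>lborel)" for y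
  have Veq: "law_variance (K y) = V y" for y
    unfolding law_variance_def V_def mg_def[symmetric] unfolding K_def
    by (subst nn_integral_density) auto
  note gm [measurable]
  have [measurable]: "V \<in> borel_measurable N"
    unfolding V_def[abs_def] by (rule measurable_nn_integral_section) measurable
  define I where "I = (\<integral>\<^sup>+ \<omega>. law_variance (\<kappa> (Y \<omega>)) \<partial>M)"
  have IV: "I = (\<integral>\<^sup>+ y. V y \<partial>\<nu>)"
  proof -
    have "AE \<omega> in M. \<kappa> (Y \<omega>) = K (Y \<omega>)" using \<kappa>K unfolding \<nu>_def by (rule AE_distrD[OF Y])
    then have "I = (\<integral>\<^sup>+ \<omega>. V (Y \<omega>) \<partial>M)" unfolding I_def
      by (intro nn_integral_cong_AE) (auto elim!: eventually_mono simp: Veq)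
    then show ?thesis unfolding \<nu>_def by (subst nn_integral_distr) auto
  qed
  have Vfin: "AE y in \<nu>. V y < \<infinity>"
    using nn_integral_PInf_AE[of V \<nu>] fin unfolding IV[symmetric] I_def[symmetric] by (auto simp: less_top)
  define S where "S y = (\<integral>\<^sup>+ x. g y x * ennreal (x\<^sup>2) \<partial>lborel)" for y
  have [measurable]: "S \<in> borel_measurable N"
    unfolding S_def[abs_def] by (rule measurable_nn_integral_section) measurable
  \<comment> \<open>The second repair: a standard normal density wherever the second moment of
    \<open>g y\<close> is infinite, which happens for almost no y.\<close>
  define f0 where "f0 y x = (if y \<in> space N \<and> S y < \<infinity> then g y x else ennreal (std_normal_density x))" for y x
  have f0m [measurable]: "(\<lambda>w. f0 (fst w) (snd w)) \<in> borel_measurable (N \<Otimes>\<^sub>M borel)"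
    unfolding f0_def by measurable
  have f0s [measurable]: "f0 y \<in> borel_measurable borel" for y
    unfolding f0_def[abs_def] by (cases "y \<in> space N \<and> S y < \<infinity>") auto
  have f01: "(\<integral>\<^sup>+ x. f0 y x \<partial>lborel) = 1" for y
    unfolding f0_def by (cases "y \<in> space N \<and> S y < \<infinity>") (auto simp: nd1 g1 simp del: infinity_ennreal_def)
  have f02: "(\<integral>\<^sup>+ x. f0 y x * ennreal (x\<^sup>2) \<partial>lborel) < \<infinity>" for y
    using nd2 unfolding f0_def by (cases "y \<in> space N \<and> S y < \<infinity>") (auto simp: S_def simp del: infinity_ennreal_def)
  have f0g: "AE y in \<nu>. y \<in> space N \<and> f0 y = g y"
    using Vfin AE_space[of \<nu>]
  proof eventually_elim
    case (elim y)
    have "S y < \<infinity>"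
      using second_moment_shift_le[OF gs[of y] g1[of y], where a="mg y" and b=0] elim(1) by (simp add: S_def V_def)
    then show ?case using elim by (auto simp: f0_def)
  qed
  have f0fin: "AE x in lborel. f0 y x < \<infinity>" for y by (rule AE_less_top) (auto simp: f01)
  have f0i: "integrable lborel (\<lambda>x. enn2real (f0 y x))" "(LINT x|lborel. enn2real (f0 y x)) = 1" for y
  proof -
    show "integrable lborel (\<lambda>x. enn2real (f0 y x))" by (rule integrable_enn2real) (auto simp: f01)
    have "(\<integral>\<^sup>+ x. ennreal (enn2real (f0 y x)) \<partial>lborel) = (\<integral>\<^sup>+ x. f0 y x \<partial>lborel)"
      by (rule nn_integral_cong_AE) (use f0fin[of y] in \<open>auto elim!: eventually_mono\<close>)
    then show "(LINT x|lborel. enn2real (f0 y x)) = 1" by (subst integral_eq_nn_integral) (auto simp: f01)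
  qed
  have f0x2: "integrable lborel (\<lambda>x. enn2real (f0 y x) * x\<^sup>2)" for y
  proof (rule integrableI_nonneg)
    have "(\<integral>\<^sup>+ x. ennreal (enn2real (f0 y x) * x\<^sup>2) \<partial>lborel) = (\<integral>\<^sup>+ x. f0 y x * ennreal (x\<^sup>2) \<partial>lborel)"
      by (rule nn_integral_cong_AE) (use f0fin[of y] in \<open>auto elim!: eventually_mono simp: ennreal_mult\<close>)
    then show "(\<integral>\<^sup>+ x. ennreal (enn2real (f0 y x) * x\<^sup>2) \<partial>lborel) < \<infinity>" using f02 by simp
  qed auto
  have f0x: "integrable lborel (\<lambda>x. enn2real (f0 y x) * x)" for y
    by (rule Bochner_Integration.integrable_bound[OF integrable_density_x[OF f0i(1) _ f0i(2) f0x2 refl]])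
       (auto simp: abs_mult)
  define m where "m y = (LINT x|lborel. enn2real (f0 y x) * x)" for y
  have mm [measurable]: "m \<in> borel_measurable N"
  proof -
    have "sets (N \<Otimes>\<^sub>M (lborel :: real measure)) = sets (N \<Otimes>\<^sub>M borel)" by (intro sets_pair_measure_cong) auto
    then have "(\<lambda>(y, x). enn2real (f0 y x) * x) \<in> borel_measurable (N \<Otimes>\<^sub>M lborel)"
      unfolding split_beta' by (subst measurable_cong_sets[OF _ refl]) (assumption, measurable)
    then show ?thesis unfolding m_def[abs_def] by (rule lborel.borel_measurable_lebesgue_integral)
  qed
  have mgm: "AE y in \<nu>. mg y = m y"
    using f0g
  proof eventually_elim
    case (elim y)
    have "K y = density lborel (\<lambda>x. ennreal (enn2real (f0 y x)))"
      unfolding K_def using elim f0fin[of y] by (intro density_cong) (auto elim!: eventually_mono)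
    then show ?case unfolding mg_def m_def by (simp add: integral_density)
  qed
  define f where "f y x = f0 y (x + m y)" for y x
  have fs [measurable]: "f y \<in> borel_measurable borel" for y unfolding f_def[abs_def] by measurable
  have fm [measurable]: "(\<lambda>w. f (fst w) (snd w)) \<in> borel_measurable (N \<Otimes>\<^sub>M borel)"
  proof -
    have "(\<lambda>w. (fst w, snd w + m (fst w))) \<in> N \<Otimes>\<^sub>M borel \<rightarrow>\<^sub>M N \<Otimes>\<^sub>M borel" by measurable
    from measurable_compose[OF this f0m] show ?thesis by (simp add: f_def)
  qed
  have fx2: "(\<integral>\<^sup>+ x. f y x * ennreal (x\<^sup>2) \<partial>lborel) = (\<integral>\<^sup>+ x. f0 y x * ennreal ((x - m y)\<^sup>2) \<partial>lborel)" for y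
    using nn_integral_shift_real[of "\<lambda>x. f0 y x * ennreal ((x - m y)\<^sup>2)" "m y"] by (simp add: f_def)
  have fV: "AE y in \<nu>. (\<integral>\<^sup>+ x. f y x * ennreal (x\<^sup>2) \<partial>lborel) = V y"
    using f0g mgm by eventually_elim (simp add: fx2 V_def)
  define \<sigma> where "\<sigma> = sqrt (enn2real I)"
  have \<sigma>2: "\<sigma>\<^sup>2 = enn2real I" by (simp add: \<sigma>_def)
  have Ifin: "ennreal (enn2real I) = I" using fin by (simp add: I_def ennreal_enn2real less_top)
  have f1: "(\<integral>\<^sup>+ x. f y x \<partial>lborel) = 1" for y
    using nn_integral_shift_real[of "f0 y" "m y"] by (simp add: f_def f01)
  have If: "(\<integral>\<^sup>+ y. \<integral>\<^sup>+ x. f y x * ennreal (x\<^sup>2) \<partial>lborel \<partial>\<nu>) = I"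
    unfolding IV by (rule nn_integral_cong_AE[OF fV])
  \<comment> \<open>Zero variance would confine the density to the single point 0.\<close>
  have "I \<noteq> 0"
  proof
    assume "I = 0"
    then have "AE y in \<nu>. V y = 0" unfolding IV by (subst (asm) nn_integral_0_iff_AE) auto
    with fV have "AE y in \<nu>. False"
    proof eventually_elim
      case (elim y)
      then have "(\<integral>\<^sup>+ x. f y x * ennreal (x\<^sup>2) \<partial>lborel) = 0" by simp
      then have "AE x in lborel. f y x * ennreal (x\<^sup>2) = 0" by (subst (asm) nn_integral_0_iff_AE) auto
      with AE_lborel_singleton[of "0::real"] have "AE x in lborel. f y x = 0" by eventually_elim auto
      then have "(\<integral>\<^sup>+ x. f y x \<partial>lborel) = 0" by (subst nn_integral_0_iff_AE) auto
      then show False using f1[of y] by simp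
    qed
    then show False by simp
  qed
  then have "enn2real I > 0" using fin by (auto simp: I_def enn2real_positive_iff zero_less_iff_neq_zero)
  then have \<sigma>: "\<sigma> > 0" by (simp add: \<sigma>_def)
  have "cond_density \<nu> f \<sigma>"
  proof
    show "case_prod f \<in> borel_measurable (\<nu> \<Otimes>\<^sub>M borel)" using fm by (simp add: split_beta' cong: measurable_cong_sets)
    show "(\<integral>\<^sup>+ x. f y x * ennreal (x\<^sup>2) \<partial>lborel) < \<infinity>" for y
      unfolding fx2 by (rule second_moment_shift_le[OF f0s f01, where a=0]) (use f02 in simp)
    show "(LINT x|lborel. enn2real (f y x) * x) = 0" for y
    proof -
      have "(LINT x|lborel. enn2real (f y x) * x) = (LINT x|lborel. enn2real (f0 y x) * (x - m y))"
        using lborel_integral_real_affine[of 1 "\<lambda>x. enn2real (f0 y x) * (x - m y)" "m y"] by (simp add: f_def add.commute)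
      also have "\<dots> = (LINT x|lborel. enn2real (f0 y x) * x - enn2real (f0 y x) * m y)" by (simp add: right_diff_distrib)
      also have "\<dots> = m y - m y" using f0x f0i by (simp add: m_def)
      finally show ?thesis by simp
    qed
    show "(\<integral>\<^sup>+ y. \<integral>\<^sup>+ x. f y x * ennreal (x\<^sup>2) \<partial>lborel \<partial>\<nu>) = ennreal (\<sigma>\<^sup>2)" by (simp add: If \<sigma>2 Ifin)
  qed (auto simp: f1 \<sigma>)
  moreover have "(\<integral>\<^sup>+ \<omega>. h (X \<omega> - m (Y \<omega>), Y \<omega>) \<partial>M) = (\<integral>\<^sup>+ y. \<integral>\<^sup>+ x. h (x, y) * f y x \<partial>lborel \<partial>\<nu>)"
    if [measurable]: "h \<in> borel_measurable (borel \<Otimes>\<^sub>M N)" for h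
  proof -
    have "(\<integral>\<^sup>+ \<omega>. h (X \<omega> - m (Y \<omega>), Y \<omega>) \<partial>M) = (\<integral>\<^sup>+ y. \<integral>\<^sup>+ x. \<rho> (y, x) * h (x - m y, y) \<partial>lborel \<partial>\<nu>)"
      using joint[of "\<lambda>w. h (snd w - m (fst w), fst w)"] by simp
    also have "\<dots> = (\<integral>\<^sup>+ y. \<integral>\<^sup>+ x. h (x, y) * f y x \<partial>lborel \<partial>\<nu>)"
    proof (rule nn_integral_cong_AE, use f0g g\<rho> in eventually_elim)
      fix y assume y: "y \<in> space N \<and> f0 y = g y" "y \<in> space N \<and> (\<forall>x. g y x = \<rho> (y, x))"
      then have yN: "y \<in> space N" by simp
      have [measurable]: "(\<lambda>x. h (x, y)) \<in> borel_measurable borel"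
        using measurable_compose[OF measurable_Pair2'[OF yN] that] .
      have "(\<integral>\<^sup>+ x. \<rho> (y, x) * h (x - m y, y) \<partial>lborel) = (\<integral>\<^sup>+ x. f0 y x * h (x - m y, y) \<partial>lborel)" using y by simp
      also have "\<dots> = (\<integral>\<^sup>+ x. f0 y (x + m y) * h (x + m y - m y, y) \<partial>lborel)"
        by (rule nn_integral_shift_real[symmetric, of "\<lambda>x. f0 y x * h (x - m y, y)"]) measurable
      finally show "(\<integral>\<^sup>+ x. \<rho> (y, x) * h (x - m y, y) \<partial>lborel) = (\<integral>\<^sup>+ x. h (x, y) * f y x \<partial>lborel)"
        by (simp add: f_def mult.commute)
    qed
    finally show ?thesis .
  qed
  ultimately show ?thesis using \<sigma>2 mm unfolding \<nu>_def[symmetric] I_def[symmetric] by blast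
qed

section \<open>The conditional entropic central limit theorem\<close>

text \<open>A change of numbering: the copies start at 1, while the sums in the central limit
  theorem start at 0.\<close>

lemma (in prob_space) indep_vars_Suc:
  assumes "indep_vars (\<lambda>_. S) X {1..}"
  shows "indep_vars (\<lambda>_. S) (\<lambda>i::nat. X (Suc i)) UNIV"
proof -
  let ?F = "\<lambda>i. {X i -` A \<inter> space M | A. A \<in> sets S}"
  have rv: "\<forall>i\<in>{1..}. random_variable S (X i)" and ind: "indep_sets ?F {1..}"
    using assms by (auto simp: indep_vars_def2)
  have "indep_sets (\<lambda>i. ?F (Suc i)) UNIV"
    unfolding indep_sets_def
  proof (intro conjI ballI allI impI)
    fix i show "?F (Suc i) \<subseteq> events" using ind by (auto simp: indep_sets_def)
  next
    fix J :: "nat set" and A assume J: "J \<noteq> {}" "finite J" and A: "A \<in> (\<Pi> i\<in>J. ?F (Suc i))"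
    define A' where "A' i = A (i - 1)" for i
    have "Suc ` J \<subseteq> {1..}" "Suc ` J \<noteq> {}" "finite (Suc ` J)" using J by auto
    moreover have "A' \<in> (\<Pi> i\<in>Suc ` J. ?F i)" using A by (auto simp: A'_def Pi_iff)
    ultimately have "prob (\<Inter>i\<in>Suc ` J. A' i) = (\<Prod>i\<in>Suc ` J. prob (A' i))"
      using ind unfolding indep_sets_def by blast
    then show "prob (\<Inter>j\<in>J. A j) = (\<Prod>j\<in>J. prob (A j))"
      by (simp add: A'_def prod.reindex)
  qed
  then show ?thesis using rv by (simp add: indep_vars_def2)
qed

text \<open>Each \<open>\<zeta> i\<close> is a pair of centred value and label, and
  \<open>J_law\<close> disintegrates the common law of these pairs through f. Here the densities of
  \<open>cond_density\<close> meet actual random variables.\<close>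

locale centred_copies = cond_density \<nu> f \<sigma> + M: prob_space M
  for \<nu> :: "'b measure" and f \<sigma> and M :: "'a measure" +
  fixes N :: "'b measure" and \<zeta> :: "nat \<Rightarrow> 'a \<Rightarrow> real \<times> 'b" and J :: "(real \<times> 'b) measure"
  assumes sets_\<nu>: "sets \<nu> = sets N"
    and indep: "M.indep_vars (\<lambda>_. borel \<Otimes>\<^sub>M N) \<zeta> {1..}"
    and ident: "\<And>i. i \<ge> 1 \<Longrightarrow> distr M (borel \<Otimes>\<^sub>M N) (\<zeta> i) = J"
    and J_law: "\<And>h. h \<in> borel_measurable (borel \<Otimes>\<^sub>M N) \<Longrightarrow>
      (\<integral>\<^sup>+ w. h w \<partial>J) = (\<integral>\<^sup>+ y. \<integral>\<^sup>+ x. h (x, y) * f y x \<partial>lborel \<partial>\<nu>)"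
begin

definition S :: "nat \<Rightarrow> 'a \<Rightarrow> real" where "S n \<omega> = (\<Sum>i=Suc 0..n. fst (\<zeta> i \<omega>))"

definition block :: "nat \<Rightarrow> 'a \<Rightarrow> nat \<Rightarrow> 'b" where "block n \<omega> = (\<lambda>i\<in>{Suc 0..n}. snd (\<zeta> i \<omega>))"

lemma measurable_\<zeta>: "i \<ge> 1 \<Longrightarrow> \<zeta> i \<in> M \<rightarrow>\<^sub>M borel \<Otimes>\<^sub>M N"
  using indep by (auto simp: M.indep_vars_def)

lemma prob_J: "prob_space J" and sets_J: "sets J = sets (borel \<Otimes>\<^sub>M N)"
proof -
  show "prob_space J" using M.prob_space_distr[OF measurable_\<zeta>[of 1]] ident[of 1] by simp
  show "sets J = sets (borel \<Otimes>\<^sub>M N)" using ident[of 1] by (metis order_refl sets_distr)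
qed

lemma sets_borel_\<nu>: "sets (borel \<Otimes>\<^sub>M \<nu>) = sets (borel \<Otimes>\<^sub>M N)"
  by (intro sets_pair_measure_cong sets_\<nu>) simp

lemma sets_P: "sets (P n) = sets (PiM {Suc 0..n} (\<lambda>_. N))"
  by (intro sets_PiM_cong sets_\<nu>) auto

lemma measurable_S [measurable]: "S n \<in> borel_measurable M"
  unfolding S_def[abs_def]
  by (intro borel_measurable_sum measurable_compose[OF measurable_\<zeta> measurable_fst]) auto

lemma measurable_block: "block n \<in> M \<rightarrow>\<^sub>M PiM {Suc 0..n} (\<lambda>_. N)"
  unfolding block_def[abs_def]
  by (intro measurable_restrict measurable_compose[OF measurable_\<zeta> measurable_snd]) auto

text \<open>Independence and equal laws make the vector of pairs distributed as a product of copies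
  of J, so \<open>nn_integral_block_sum\<close> applies.\<close>

lemma nn_integral_block_S:
  assumes n: "n \<ge> 1" and H: "H \<in> borel_measurable (P n \<Otimes>\<^sub>M borel)"
  shows "(\<integral>\<^sup>+ \<omega>. H (block n \<omega>, S n \<omega>) \<partial>M) = (\<integral>\<^sup>+ y. \<integral>\<^sup>+ x. H (y, x) * dens n y x \<partial>lborel \<partial>P n)"
proof -
  have ind: "M.indep_vars (\<lambda>_. borel \<Otimes>\<^sub>M N) \<zeta> {Suc 0..n}"
    by (rule M.indep_vars_subset[OF indep]) auto
  have "distr M (PiM {Suc 0..n} (\<lambda>_. borel \<Otimes>\<^sub>M N)) (\<lambda>\<omega>. \<lambda>i\<in>{Suc 0..n}. \<zeta> i \<omega>)
      = PiM {Suc 0..n} (\<lambda>i. distr M (borel \<Otimes>\<^sub>M N) (\<zeta> i))"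
    using ind n measurable_\<zeta> by (subst M.indep_vars_iff_distr_eq_PiM'[symmetric]) auto
  also have "\<dots> = PiM {Suc 0..n} (\<lambda>_. J)" by (rule PiM_cong) (auto simp: ident)
  finally have D: "distr M (PiM {Suc 0..n} (\<lambda>_. borel \<Otimes>\<^sub>M N)) (\<lambda>\<omega>. \<lambda>i\<in>{Suc 0..n}. \<zeta> i \<omega>) = PiM {Suc 0..n} (\<lambda>_. J)" .
  have m: "(\<lambda>\<omega>. \<lambda>i\<in>{Suc 0..n}. \<zeta> i \<omega>) \<in> M \<rightarrow>\<^sub>M PiM {Suc 0..n} (\<lambda>_. borel \<Otimes>\<^sub>M N)"
    by (intro measurable_restrict measurable_\<zeta>) auto
  have Hm: "(\<lambda>w. H (\<lambda>i\<in>{Suc 0..n}. snd (w i), \<Sum>i=Suc 0..n. fst (w i))) \<in> borel_measurable (PiM {Suc 0..n} (\<lambda>_. borel \<Otimes>\<^sub>M N))"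
  proof -
    have sP: "sets (P n \<Otimes>\<^sub>M (borel :: real measure)) = sets (PiM {Suc 0..n} (\<lambda>_. N) \<Otimes>\<^sub>M borel)"
      by (intro sets_pair_measure_cong sets_P) simp
    have "H \<in> borel_measurable (PiM {Suc 0..n} (\<lambda>_. N) \<Otimes>\<^sub>M borel)"
      using H unfolding measurable_cong_sets[OF sP refl] .
    then show ?thesis
      by (rule measurable_compose[rotated]) (intro measurable_Pair measurable_restrict, auto)
  qed
  have "(\<integral>\<^sup>+ w. H (\<lambda>i\<in>{Suc 0..n}. snd (w i), \<Sum>i=Suc 0..n. fst (w i)) \<partial>PiM {Suc 0..n} (\<lambda>_. J))
    = (\<integral>\<^sup>+ y. \<integral>\<^sup>+ x. H (y, x) * dens n y x \<partial>lborel \<partial>P n)"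
  proof (rule nn_integral_block_sum[OF prob_J _ _ _ H])
    show "sets J = sets (borel \<Otimes>\<^sub>M \<nu>)" by (simp only: sets_J sets_borel_\<nu>)
    show "(\<integral>\<^sup>+ w. h w \<partial>J) = (\<integral>\<^sup>+ y. \<integral>\<^sup>+ x. h (x, y) * f y x \<partial>lborel \<partial>\<nu>)" if "h \<in> borel_measurable (borel \<Otimes>\<^sub>M \<nu>)" for h
      by (rule J_law) (use that in \<open>simp only: measurable_cong_sets[OF sets_borel_\<nu> refl]\<close>)
  qed (use n in simp)
  then show ?thesis
    unfolding D[symmetric] using Hm
    by (subst (asm) nn_integral_distr[OF m]) (auto simp: block_def S_def cong: restrict_cong)
qed

lemma distr_block: 
  assumes "n \<ge> 1"
  shows "distr M (PiM {Suc 0..n} (\<lambda>_. N)) (block n) = P n"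
proof (rule measure_eqI)
  fix A assume "A \<in> sets (distr M (PiM {Suc 0..n} (\<lambda>_. N)) (block n))"
  then have A: "A \<in> sets (PiM {Suc 0..n} (\<lambda>_. N))" by simp
  then have [measurable]: "A \<in> sets (P n)" using sets_P by simp
  have "emeasure (distr M (PiM {Suc 0..n} (\<lambda>_. N)) (block n)) A = (\<integral>\<^sup>+ \<omega>. indicator A (fst (block n \<omega>, S n \<omega>)) \<partial>M)"
    using A measurable_block by (subst nn_integral_indicator[symmetric], simp, subst nn_integral_distr) auto
  also have "\<dots> = (\<integral>\<^sup>+ y. \<integral>\<^sup>+ x. indicator A (fst (y, x)) * dens n y x \<partial>lborel \<partial>P n)"
    by (rule nn_integral_block_S[OF assms]) measurable
  also have "\<dots> = emeasure (P n) A" by (simp add: nn_integral_cmult nn_integral_dens)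
  finally show "emeasure (distr M (PiM {Suc 0..n} (\<lambda>_. N)) (block n)) A = emeasure (P n) A" .
qed (simp add: sets_P)

lemma distr_S:
  assumes n: "n \<ge> 1"
  shows "distr M borel (\<lambda>\<omega>. S n \<omega> / sqrt n) = distr (density (P n \<Otimes>\<^sub>M lborel) (\<lambda>w. ennreal (scaled_dens n w))) borel snd"
proof (rule measure_eqI)
  fix A assume "A \<in> sets (distr M borel (\<lambda>\<omega>. S n \<omega> / sqrt n))"
  then have [measurable]: "A \<in> sets borel" by simp
  note [measurable] = measurable_scaled_dens[OF n]
  have sm [measurable]: "snd \<in> borel_measurable (P n \<Otimes>\<^sub>M (lborel :: real measure))"
    unfolding measurable_cong_sets[OF measurable_P_lborel refl] by measurable
  have "emeasure (distr M borel (\<lambda>\<omega>. S n \<omega> / sqrt n)) A = (\<integral>\<^sup>+ \<omega>. indicator A (snd (block n \<omega>, S n \<omega>) / sqrt n) \<partial>M)"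
    by (subst nn_integral_indicator[symmetric], simp, subst nn_integral_distr) auto
  also have "\<dots> = (\<integral>\<^sup>+ y. \<integral>\<^sup>+ x. indicator A (snd (y, x) / sqrt n) * dens n y x \<partial>lborel \<partial>P n)"
    by (rule nn_integral_block_S[OF n, of "\<lambda>w. indicator A (snd w / sqrt n)"]) measurable
  also have "\<dots> = (\<integral>\<^sup>+ y. \<integral>\<^sup>+ x. ennreal (scaled_dens n (y, x)) * indicator A x \<partial>lborel \<partial>P n)"
  proof (rule nn_integral_cong)
    fix y
    have "(\<integral>\<^sup>+ x. ennreal (scaled_dens n (y, x)) * indicator A (sqrt n * x / sqrt n) \<partial>lborel) = (\<integral>\<^sup>+ x. dens n y x * indicator A (x / sqrt n) \<partial>lborel)"
      by (rule scaled_dens_section[OF n, of "\<lambda>u. indicator A (u / sqrt n)"]) measurable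
    then show "(\<integral>\<^sup>+ x. indicator A (snd (y, x) / sqrt n) * dens n y x \<partial>lborel) = (\<integral>\<^sup>+ x. ennreal (scaled_dens n (y, x)) * indicator A x \<partial>lborel)"
      using n by (simp add: mult.commute)
  qed
  also have "\<dots> = (\<integral>\<^sup>+ w. ennreal (scaled_dens n w) * indicator A (snd w) \<partial>(P n \<Otimes>\<^sub>M lborel))"
    by (subst lborel.nn_integral_fst[symmetric]) auto
  also have "\<dots> = emeasure (distr (density (P n \<Otimes>\<^sub>M lborel) (\<lambda>w. ennreal (scaled_dens n w))) borel snd) A"
    by (subst nn_integral_indicator[symmetric], simp, subst nn_integral_distr, simp, simp, subst nn_integral_density) auto
  finally show "emeasure (distr M borel (\<lambda>\<omega>. S n \<omega> / sqrt n)) A = emeasure (distr (density (P n \<Otimes>\<^sub>M lborel) (\<lambda>w. ennreal (scaled_dens n w))) borel snd) A" .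
qed simp

lemma LINT_scaled_dens:
  fixes F :: "real \<Rightarrow> real"
  assumes n: "n \<ge> 1" and [measurable]: "F \<in> borel_measurable borel"
  shows "(LINT w|(P n \<Otimes>\<^sub>M lborel). scaled_dens n w * F (snd w)) = (LINT \<omega>|M. F (S n \<omega> / sqrt n))"
proof -
  note [measurable] = measurable_scaled_dens[OF n]
  have sm [measurable]: "snd \<in> borel_measurable (P n \<Otimes>\<^sub>M (lborel :: real measure))"
    unfolding measurable_cong_sets[OF measurable_P_lborel refl] by measurable
  have "(LINT \<omega>|M. F (S n \<omega> / sqrt n)) = (LINT x|distr M borel (\<lambda>\<omega>. S n \<omega> / sqrt n). F x)"
    by (subst integral_distr) auto
  also have "\<dots> = (LINT w|density (P n \<Otimes>\<^sub>M lborel) (\<lambda>w. ennreal (scaled_dens n w)). F (snd w))"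
    unfolding distr_S[OF n] by (subst integral_distr) auto
  also have "\<dots> = (LINT w|(P n \<Otimes>\<^sub>M lborel). scaled_dens n w * F (snd w))"
    by (subst integral_density) (auto simp: scaled_dens_nonneg)
  finally show ?thesis by simp
qed

lemma X_moments:
  assumes i: "i \<ge> 1"
  shows "integrable M (\<lambda>\<omega>. (fst (\<zeta> i \<omega>))\<^sup>2)" "(LINT \<omega>|M. (fst (\<zeta> i \<omega>))\<^sup>2) = \<sigma>\<^sup>2" "(LINT \<omega>|M. fst (\<zeta> i \<omega>)) = 0"
proof -
  note [measurable] = measurable_\<zeta>[OF i]
  have law: "(\<integral>\<^sup>+ \<omega>. h (fst (\<zeta> i \<omega>)) \<partial>M) = (\<integral>\<^sup>+ y. \<integral>\<^sup>+ x. h x * f y x \<partial>lborel \<partial>\<nu>)"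
    if [measurable]: "h \<in> borel_measurable borel" for h
  proof -
    have "(\<integral>\<^sup>+ \<omega>. h (fst (\<zeta> i \<omega>)) \<partial>M) = (\<integral>\<^sup>+ w. h (fst w) \<partial>J)"
      unfolding ident[OF i, symmetric] by (subst nn_integral_distr) auto
    then show ?thesis using J_law[of "\<lambda>w. h (fst w)"] by simp
  qed
  have x2: "(\<integral>\<^sup>+ \<omega>. ennreal ((fst (\<zeta> i \<omega>))\<^sup>2) \<partial>M) = ennreal (\<sigma>\<^sup>2)"
    using law[of "\<lambda>x. ennreal (x\<^sup>2)"] variance_f by (simp add: mult.commute)
  show i2: "integrable M (\<lambda>\<omega>. (fst (\<zeta> i \<omega>))\<^sup>2)" by (rule integrableI_nonneg) (use x2 in auto)
  show "(LINT \<omega>|M. (fst (\<zeta> i \<omega>))\<^sup>2) = \<sigma>\<^sup>2" by (subst integral_eq_nn_integral) (use x2 in auto)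
  have i1: "integrable M (\<lambda>\<omega>. fst (\<zeta> i \<omega>))"
    by (rule M.square_integrable_imp_integrable[OF _ i2]) measurable
  \<comment> \<open>\<open>J_law\<close> speaks of nonnegative integrals only. The vanishing mean is
    therefore transported as equality of the integrals of the positive and the negative part, label
    by label.\<close>
  have sec: "(\<integral>\<^sup>+ x. ennreal x * f y x \<partial>lborel) = (\<integral>\<^sup>+ x. ennreal (- x) * f y x \<partial>lborel)" for y
  proof -
    let ?d = "\<lambda>x. enn2real (f y x)"
    have id: "integrable lborel (\<lambda>x. ?d x * x)"
      by (rule Bochner_Integration.integrable_bound[OF integrable_density_x[OF integrable_f _ integral_f integrable_f_x2 refl]])
         (auto simp: abs_mult)
    have eq: "(\<integral>\<^sup>+ x. ennreal (c * x) * f y x \<partial>lborel) = (\<integral>\<^sup>+ x. ennreal (c * (?d x * x)) \<partial>lborel)" for c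
    proof (rule nn_integral_cong_AE, use AE_f_finite[of y] in eventually_elim)
      fix x assume "f y x < \<infinity>"
      then have "f y x = ennreal (?d x)" by simp
      then show "ennreal (c * x) * f y x = ennreal (c * (?d x * x))"
        by (metis enn2real_nonneg ennreal_mult'' mult.assoc mult.commute)
    qed
    have fin: "(\<integral>\<^sup>+ x. ennreal (?d x * x) \<partial>lborel) < \<infinity>" "(\<integral>\<^sup>+ x. ennreal (- (?d x * x)) \<partial>lborel) < \<infinity>"
      using id unfolding real_integrable_def by (auto simp: less_top)
    have "enn2real (\<integral>\<^sup>+ x. ennreal (?d x * x) \<partial>lborel) - enn2real (\<integral>\<^sup>+ x. ennreal (- (?d x * x)) \<partial>lborel) = 0"
      using mean_f[of y] real_lebesgue_integral_def[OF id] by simp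
    then have "(\<integral>\<^sup>+ x. ennreal (?d x * x) \<partial>lborel) = (\<integral>\<^sup>+ x. ennreal (- (?d x * x)) \<partial>lborel)"
      using fin by (metis ennreal_enn2real eq_iff_diff_eq_0 infinity_ennreal_def)
    then show ?thesis using eq[of 1] eq[of "-1"] by simp
  qed
  have "(\<integral>\<^sup>+ \<omega>. ennreal (fst (\<zeta> i \<omega>)) \<partial>M) = (\<integral>\<^sup>+ \<omega>. ennreal (- fst (\<zeta> i \<omega>)) \<partial>M)"
    using law[of "\<lambda>x. ennreal x"] law[of "\<lambda>x. ennreal (- x)"] by (simp add: sec)
  then show "(LINT \<omega>|M. fst (\<zeta> i \<omega>)) = 0" using real_lebesgue_integral_def[OF i1] by simp
qed

text \<open>Integrating out the labels leaves the unconditional law of the normalised sum of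
  independent, identically distributed, centred values, to which the classical theorem
  applies.\<close>

lemma CLT:
  assumes F: "continuous_on UNIV F" "bounded (range (F :: real \<Rightarrow> real))"
  shows "(\<lambda>n. LINT w|(P n \<Otimes>\<^sub>M lborel). scaled_dens n w * F (snd w)) \<longlonglongrightarrow> (LINT x|lborel. normal_density 0 \<sigma> x * F x)"
proof -
  have [measurable]: "F \<in> borel_measurable borel" using F(1) by (rule borel_measurable_continuous_onI)
  define X where "X i \<omega> = fst (\<zeta> (Suc i) \<omega>)" for i \<omega>
  have Xm [measurable]: "X i \<in> borel_measurable M" for i
    unfolding X_def[abs_def] by (rule measurable_compose[OF measurable_\<zeta> measurable_fst]) simp
  have ind: "M.indep_vars (\<lambda>_. borel) X UNIV"
    unfolding X_def[abs_def]
    by (rule M.indep_vars_compose2[OF M.indep_vars_Suc[OF indep]]) simp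
  have mom: "integrable M (\<lambda>\<omega>. (X i \<omega>)\<^sup>2)" "M.expectation (\<lambda>\<omega>. (X i \<omega>)\<^sup>2) = \<sigma>\<^sup>2" "M.expectation (X i) = 0" for i
    using X_moments[of "Suc i"] by (simp_all add: X_def[abs_def])
  have dX: "distr M borel (X i) = distr J borel fst" for i
    unfolding ident[of "Suc i", simplified, symmetric]
    by (subst distr_distr) (auto simp: X_def[abs_def] comp_def measurable_\<zeta>)
  let ?Z = "\<lambda>n \<omega>. (\<Sum>i<n. X i \<omega>) / sqrt (real n * \<sigma>\<^sup>2)"
  have wc: "weak_conv_m (\<lambda>n. distr M borel (?Z n)) std_normal_distribution"
    by (rule M.central_limit_theorem_zero_mean[OF ind mom(3) \<sigma>_pos mom(1) _ dX]) (simp add: mom)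
  obtain B where B: "\<And>x. norm (F x) \<le> B" using F(2) by (auto simp: bounded_iff)
  \<comment> \<open>The classical normalisation includes \<sigma>; testing with F (\<sigma> x)
    restores the variance \<sigma>^2.\<close>
  have "(\<lambda>n. LINT x|distr M borel (?Z n). F (\<sigma> * x)) \<longlonglongrightarrow> (LINT x|std_normal_distribution. F (\<sigma> * x))"
  proof (rule weak_conv_imp_integral_bdd_continuous_conv[OF _ real_dist_normal_dist wc])
    show "isCont (\<lambda>x. F (\<sigma> * x)) x" for x
      using F(1) by (intro continuous_intros continuous_at_compose[of x "\<lambda>x. \<sigma> * x" F, unfolded comp_def])
        (auto simp: continuous_on_eq_continuous_at)
  qed (use B in auto)
  moreover have "(LINT x|std_normal_distribution. F (\<sigma> * x)) = (LINT x|lborel. normal_density 0 \<sigma> x * F x)"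
  proof -
    have "(LINT x|std_normal_distribution. F (\<sigma> * x)) = (LINT x|lborel. std_normal_density x * F (\<sigma> * x))"
      by (subst integral_density) auto
    also have "\<dots> = (LINT x|lborel. \<sigma> * (normal_density 0 \<sigma> (\<sigma> * x) * F (\<sigma> * x)))"
      using \<sigma>_pos by (intro Bochner_Integration.integral_cong)
        (auto simp: normal_density_def real_sqrt_mult power_mult_distrib)
    also have "\<dots> = (LINT x|lborel. normal_density 0 \<sigma> x * F x)"
      using \<sigma>_pos lborel_integral_real_affine[of \<sigma> "\<lambda>x. normal_density 0 \<sigma> x * F x" 0] by simp
    finally show ?thesis .
  qed
  moreover have "\<forall>\<^sub>F n in sequentially. (LINT x|distr M borel (?Z n). F (\<sigma> * x)) = (LINT w|(P n \<Otimes>\<^sub>M lborel). scaled_dens n w * F (snd w))"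
    using eventually_ge_at_top[of 1]
  proof eventually_elim
    case (elim n)
    have "(\<Sum>i<n. X i \<omega>) = S n \<omega>" for \<omega>
    proof -
      have "{Suc 0..n} = Suc ` {..<n}" by (simp add: image_Suc_lessThan)
      then show ?thesis by (simp add: S_def X_def sum.reindex)
    qed
    then have "F (\<sigma> * ?Z n \<omega>) = F (S n \<omega> / sqrt n)" for \<omega>
      using \<sigma>_pos by (simp add: real_sqrt_mult)
    then show ?case by (subst integral_distr) (auto simp: LINT_scaled_dens[OF elim])
  qed
  ultimately show ?thesis by (simp add: Lim_transform_eventually)
qed

text \<open>Centring changes the normalised sum by a function of the labels alone. Given the labels
  this is a translation, and differential entropy is translation invariant, so the conditional
  entropy can be computed from \<open>scaled_dens\<close>.\<close>

lemma mean_cond_entropy_eq: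
  assumes m [measurable]: "m \<in> borel_measurable N" and n: "n \<ge> 1"
    and \<xi>s: "\<And>i. i \<ge> 1 \<Longrightarrow> \<xi>s i \<in> borel_measurable M"
    and \<zeta>: "\<And>i \<omega>. \<zeta> i \<omega> = (\<xi>s i \<omega> - m (\<eta>s i \<omega>), \<eta>s i \<omega>)"
  shows "mean_cond_entropy M N \<xi>s \<eta>s n =
    ereal_integral (P n) (\<lambda>y. ereal_integral lborel (\<lambda>x. ereal (- (scaled_dens n (y, x) * ln (scaled_dens n (y, x))))))"
proof -
  let ?N = "PiM {Suc 0..n} (\<lambda>_. N)"
  define c where "c y = (\<Sum>i=Suc 0..n. m (y i))" for y :: "nat \<Rightarrow> 'b"
  \<comment> \<open>The density of the sum with the conditional means restored, after division by
    sqrt n.\<close>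
  define r where "r y x = ennreal (sqrt n) * dens n y (sqrt n * x - c y)" for y x
  let ?W = "normalized_sum \<xi>s n"
  have sn: "sqrt (real n) > 0" using n by simp
  have cm [measurable]: "c \<in> borel_measurable ?N" unfolding c_def[abs_def] by measurable
  have sPb: "sets (P n \<Otimes>\<^sub>M (borel :: real measure)) = sets (?N \<Otimes>\<^sub>M borel)"
    by (intro sets_pair_measure_cong sets_P) simp
  have cmP [measurable]: "c \<in> borel_measurable (P n)" using cm unfolding measurable_cong_sets[OF sets_P refl] .
  have block_eq: "initial_block \<eta>s n = block n" by (auto simp: initial_block_def block_def fun_eq_iff \<zeta>)
  have W: "?W \<omega> = (S n \<omega> + c (block n \<omega>)) / sqrt n" for \<omega>
    by (simp add: normalized_sum_def S_def c_def block_def \<zeta> sum_subtractf)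
  have Wm [measurable]: "?W \<in> borel_measurable M"
    unfolding W using measurable_block[of n] cm by measurable
  have dm: "(\<lambda>w. dens n (fst w) (snd w)) \<in> borel_measurable (P n \<Otimes>\<^sub>M borel)"
    using measurable_dens_pair[of n n] n by (simp add: split_beta')
  have rm: "case_prod r \<in> borel_measurable (?N \<Otimes>\<^sub>M borel)"
  proof -
    have a1: "(\<lambda>w. (fst w, sqrt n * snd w - c (fst w))) \<in> ?N \<Otimes>\<^sub>M borel \<rightarrow>\<^sub>M ?N \<Otimes>\<^sub>M borel" by measurable
    have a2: "(\<lambda>w. dens n (fst w) (snd w)) \<in> borel_measurable (?N \<Otimes>\<^sub>M borel)"
      using dm unfolding measurable_cong_sets[OF sPb refl] .
    have "(\<lambda>w. dens n (fst w) (sqrt n * snd w - c (fst w))) \<in> borel_measurable (?N \<Otimes>\<^sub>M borel)"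
      using measurable_compose[OF a1 a2] by simp
    then show ?thesis by (simp add: r_def split_beta')
  qed
  have rint: "(\<integral>\<^sup>+ x. r y x * G x \<partial>lborel) = (\<integral>\<^sup>+ x. dens n y x * G ((x + c y) / sqrt n) \<partial>lborel)"
    if [measurable]: "G \<in> borel_measurable borel" for G y
  proof -
    have "(\<integral>\<^sup>+ x. r y x * G x \<partial>lborel) = (\<integral>\<^sup>+ x. ennreal (sqrt n) * (dens n y (sqrt n * x - c y) * G (sqrt n * x / sqrt n)) \<partial>lborel)"
      using n by (simp add: r_def mult.assoc)
    also have "\<dots> = (\<integral>\<^sup>+ x. dens n y (x - c y) * G (x / sqrt n) \<partial>lborel)"
      by (rule nn_integral_rescale[of "\<lambda>x. dens n y (x - c y) * G (x / sqrt n)"]) (use sn in auto)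
    also have "\<dots> = (\<integral>\<^sup>+ x. dens n y (x + c y - c y) * G ((x + c y) / sqrt n) \<partial>lborel)"
      by (rule nn_integral_shift_real[symmetric]) measurable
    finally show ?thesis by simp
  qed
  have reg: "is_regular_cond_law M ?N ?W (block n) (\<lambda>y. density lborel (r y))"
  proof (rule regular_cond_law_density[OF rm])
    show "(\<integral>\<^sup>+ x. r y x \<partial>lborel) = 1" for y using rint[of "\<lambda>_. 1" y] by (simp add: nn_integral_dens)
    fix A B assume A [measurable]: "A \<in> sets (borel :: real measure)" and B: "B \<in> sets ?N"
    have BP [measurable]: "B \<in> sets (P n)" using B sets_P by simp
    have [measurable]: "(\<lambda>w. indicator B (fst w) * indicator A ((snd w + c (fst w)) / sqrt n) :: ennreal) \<in> borel_measurable (P n \<Otimes>\<^sub>M borel)"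
      by measurable
    have set_m: "{\<omega> \<in> space M. ?W \<omega> \<in> A \<and> block n \<omega> \<in> B} \<in> sets M"
      using measurable_block[of n] B by measurable
    have "emeasure M {\<omega> \<in> space M. ?W \<omega> \<in> A \<and> block n \<omega> \<in> B} = (\<integral>\<^sup>+ \<omega>. indicator {\<omega> \<in> space M. ?W \<omega> \<in> A \<and> block n \<omega> \<in> B} \<omega> \<partial>M)"
      by (rule nn_integral_indicator[OF set_m, symmetric])
    also have "\<dots> = (\<integral>\<^sup>+ \<omega>. indicator B (fst (block n \<omega>, S n \<omega>)) * indicator A ((snd (block n \<omega>, S n \<omega>) + c (fst (block n \<omega>, S n \<omega>))) / sqrt n) \<partial>M)"
      by (intro nn_integral_cong) (auto simp: W indicator_def)
    also have "\<dots> = (\<integral>\<^sup>+ y. \<integral>\<^sup>+ x. indicator B (fst (y, x)) * indicator A ((snd (y, x) + c (fst (y, x))) / sqrt n) * dens n y x \<partial>lborel \<partial>P n)"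
      by (rule nn_integral_block_S[OF n, of "\<lambda>w. indicator B (fst w) * indicator A ((snd w + c (fst w)) / sqrt n)"]) measurable
    also have "\<dots> = (\<integral>\<^sup>+ y\<in>B. (\<integral>\<^sup>+ x\<in>A. r y x \<partial>lborel) \<partial>P n)"
    proof (rule nn_integral_cong)
      fix y
      have "(\<integral>\<^sup>+ x\<in>A. r y x \<partial>lborel) = (\<integral>\<^sup>+ x. dens n y x * indicator A ((x + c y) / sqrt n) \<partial>lborel)"
        by (rule rint) measurable
      then show "(\<integral>\<^sup>+ x. indicator B (fst (y, x)) * indicator A ((snd (y, x) + c (fst (y, x))) / sqrt n) * dens n y x \<partial>lborel)
          = (\<integral>\<^sup>+ x\<in>A. r y x \<partial>lborel) * indicator B y"
        by (cases "y \<in> B") (auto simp: mult.commute)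
    qed
    finally show "emeasure M {\<omega> \<in> space M. ?W \<omega> \<in> A \<and> block n \<omega> \<in> B} =
        (\<integral>\<^sup>+ y\<in>B. (\<integral>\<^sup>+ x\<in>A. r y x \<partial>lborel) \<partial>distr M ?N (block n))"
      unfolding distr_block[OF n] .
  qed
  \<comment> \<open>Exhibiting one regular conditional law makes the choice in
    \<open>cond_law\<close> meaningful, and uniqueness then replaces it by the explicit
    density.\<close>
  have "is_regular_cond_law M ?N ?W (block n) (cond_law M ?N ?W (block n))"
    using someI[of "is_regular_cond_law M ?N ?W (block n)", OF reg] unfolding cond_law_def .
  then have "AE y in distr M ?N (block n). cond_law M ?N ?W (block n) y = density lborel (r y)"
    by (rule regular_cond_law_unique[OF M.prob_space_axioms measurable_block _ reg])
  then have AE: "AE \<omega> in M. cond_law M ?N ?W (block n) (block n \<omega>) = density lborel (r (block n \<omega>))"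
    by (rule AE_distrD[OF measurable_block])
  define h where "h y = ereal_integral lborel (\<lambda>x. ereal (- (scaled_dens n (y, x) * ln (scaled_dens n (y, x)))))" for y
  have rs: "r y \<in> borel_measurable borel" for y unfolding r_def[abs_def] by measurable
  have pWs [measurable]: "(\<lambda>x. scaled_dens n (y, x)) \<in> borel_measurable borel" for y
    unfolding scaled_dens_def fst_conv snd_conv by measurable
  have ent: "differential_entropy (density lborel (r y)) = h y" for y
  proof -
    have "enn2real (r y x) = scaled_dens n (y, x + (- c y / sqrt n))" for x
      using sn by (simp add: r_def scaled_dens_def enn2real_mult right_diff_distrib)
    then have "differential_entropy (density lborel (r y)) =
      ereal_integral lborel (\<lambda>x. ereal (- (scaled_dens n (y, x + (- c y / sqrt n)) * ln (scaled_dens n (y, x + (- c y / sqrt n))))))"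
      by (simp only: differential_entropy_density[OF rs])
    also have "\<dots> = h y" unfolding h_def
      by (rule ereal_integral_lborel_translate[of "\<lambda>x. ereal (- (scaled_dens n (y, x) * ln (scaled_dens n (y, x))))"]) measurable
    finally show ?thesis .
  qed
  have hm: "h \<in> borel_measurable (P n)"
  proof -
    have [measurable]: "(\<lambda>w. scaled_dens n (fst w, snd w)) \<in> borel_measurable (P n \<Otimes>\<^sub>M lborel)" using measurable_scaled_dens[OF n] by simp
    show ?thesis unfolding h_def[abs_def] ereal_integral_def by measurable
  qed
  have "mean_cond_entropy M N \<xi>s \<eta>s n = ereal_integral M (cond_entropy M ?N ?W (block n))"
    by (simp add: mean_cond_entropy_def block_eq)
  also have "\<dots> = ereal_integral M (\<lambda>\<omega>. h (block n \<omega>))"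
    by (rule ereal_integral_cong_AE) (use AE in \<open>auto elim!: eventually_mono simp: cond_entropy_def ent\<close>)
  also have "\<dots> = ereal_integral (distr M ?N (block n)) h"
    by (rule ereal_integral_distr[symmetric, OF measurable_block])
       (use hm in \<open>simp only: measurable_cong_sets[OF sets_P refl]\<close>)
  finally show ?thesis unfolding distr_block[OF n] h_def .
qed

text \<open>Gibbs' inequality against the standard normal density bounds - p ln p by integrable
  terms in p, p x^2 and that density. It excludes the case infinity - infinity, so the mean entropy
  can fail to be finite only by being -infinity.\<close>

lemma pos_part_finite:
  assumes n: "n \<ge> 1"
  shows "(\<integral>\<^sup>+ w. ennreal (- (scaled_dens n w * ln (scaled_dens n w))) \<partial>(P n \<Otimes>\<^sub>M lborel)) < \<infinity>"
proof -
  interpret Pn: prob_space "P n" by (rule prob_P)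
  note [measurable] = measurable_scaled_dens[OF n]
  have sm [measurable]: "snd \<in> borel_measurable (P n \<Otimes>\<^sub>M (lborel :: real measure))"
    unfolding measurable_cong_sets[OF measurable_P_lborel refl] by measurable
  let ?a = "\<bar>ln (2 * pi) / 2\<bar>"
  have "(\<integral>\<^sup>+ w. ennreal (- (scaled_dens n w * ln (scaled_dens n w))) \<partial>(P n \<Otimes>\<^sub>M lborel))
    \<le> (\<integral>\<^sup>+ w. ennreal ?a * ennreal (scaled_dens n w) + (ennreal (scaled_dens n w * (snd w)\<^sup>2) + ennreal (std_normal_density (snd w))) \<partial>(P n \<Otimes>\<^sub>M lborel))"
  proof (rule nn_integral_mono)
    fix w :: "(nat \<Rightarrow> 'b) \<times> real"
    have "ln (std_normal_density (snd w)) = - ln (2 * pi) / 2 - (snd w)\<^sup>2 / 2"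
      using ln_normal_density[of 1 "snd w"] by simp
    then have "- (scaled_dens n w * ln (scaled_dens n w)) \<le> - (scaled_dens n w * (- ln (2 * pi) / 2 - (snd w)\<^sup>2 / 2)) - scaled_dens n w + std_normal_density (snd w)"
      using xlnx_lower[OF scaled_dens_nonneg[of n w] normal_density_pos[of 1 0 "snd w"]] by simp
    also have "\<dots> = scaled_dens n w * (ln (2 * pi) / 2) + scaled_dens n w * (snd w)\<^sup>2 / 2 - scaled_dens n w + std_normal_density (snd w)"
      by (simp add: algebra_simps)
    also have "\<dots> \<le> ?a * scaled_dens n w + (scaled_dens n w * (snd w)\<^sup>2 + std_normal_density (snd w))"
    proof -
      have "scaled_dens n w * (ln (2 * pi) / 2) \<le> scaled_dens n w * ?a" using scaled_dens_nonneg[of n w] by (intro mult_left_mono) auto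
      moreover have "scaled_dens n w * (snd w)\<^sup>2 / 2 \<le> scaled_dens n w * (snd w)\<^sup>2" using scaled_dens_nonneg[of n w] by simp
      ultimately show ?thesis using scaled_dens_nonneg[of n w] unfolding mult.commute[of ?a] by linarith
    qed
    finally have "ennreal (- (scaled_dens n w * ln (scaled_dens n w))) \<le> ennreal (?a * scaled_dens n w + (scaled_dens n w * (snd w)\<^sup>2 + std_normal_density (snd w)))"
      by (rule ennreal_leI)
    also have "\<dots> = ennreal ?a * ennreal (scaled_dens n w) + (ennreal (scaled_dens n w * (snd w)\<^sup>2) + ennreal (std_normal_density (snd w)))"
      using scaled_dens_nonneg[of n w] by (subst ennreal_plus, simp, simp, subst ennreal_plus, simp, simp, subst ennreal_mult) auto
    finally show "ennreal (- (scaled_dens n w * ln (scaled_dens n w))) \<le> \<dots>" .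
  qed
  also have "\<dots> = ennreal ?a * 1 + (ennreal (\<sigma>\<^sup>2) + (\<integral>\<^sup>+ w. ennreal (std_normal_density (snd w)) \<partial>(P n \<Otimes>\<^sub>M lborel)))"
    by (subst nn_integral_add, simp, simp, subst nn_integral_add, simp, simp, subst nn_integral_cmult)
       (auto simp: nn_integral_scaled_dens[OF n])
  also have "(\<integral>\<^sup>+ w. ennreal (std_normal_density (snd w)) \<partial>(P n \<Otimes>\<^sub>M lborel)) = 1"
  proof -
    have "(\<integral>\<^sup>+ x. ennreal (std_normal_density x) \<partial>lborel) = 1"
      using integrable_std_normal integral_std_normal by (subst nn_integral_eq_integral) auto
    then show ?thesis by (subst lborel.nn_integral_fst[symmetric]) (auto simp: Pn.emeasure_space_1)
  qed
  also have "ennreal ?a * 1 + (ennreal (\<sigma>\<^sup>2) + 1) < \<infinity>" by (auto simp: less_top[symmetric])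
  finally show ?thesis .
qed

text \<open>Where the density of the sum is at most 1, \<open>Psi\<close> vanishes; where it exceeds
  1, multiplication by sqrt n >= 1 can only increase the logarithm. Finite entropy of the normalised
  sum thus yields integrability of t log^+ t before normalisation.\<close>

lemma Psi_dens_finite:
  assumes n: "n \<ge> 1" and fin: "(\<integral>\<^sup>+ w. ennreal (scaled_dens n w * ln (scaled_dens n w)) \<partial>(P n \<Otimes>\<^sub>M lborel)) < \<infinity>"
  shows "(\<integral>\<^sup>+ y. \<integral>\<^sup>+ x. Psi (dens n y x) \<partial>lborel \<partial>P n) < \<infinity>"
proof -
  note [measurable] = measurable_scaled_dens[OF n]
  have sn: "sqrt (real n) \<ge> 1" using n by simp
  have "(\<integral>\<^sup>+ y. \<integral>\<^sup>+ x. Psi (dens n y x) \<partial>lborel \<partial>P n) \<le> (\<integral>\<^sup>+ y. \<integral>\<^sup>+ x. ennreal (scaled_dens n (y, x) * ln (scaled_dens n (y, x))) \<partial>lborel \<partial>P n)"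
  proof (rule nn_integral_mono)
    fix y
    have "(\<integral>\<^sup>+ x. Psi (dens n y x) \<partial>lborel) = (\<integral>\<^sup>+ x. ennreal (sqrt n) * Psi (dens n y (sqrt n * x)) \<partial>lborel)"
      by (rule nn_integral_rescale[symmetric]) (use n in auto)
    also have "\<dots> \<le> (\<integral>\<^sup>+ x. ennreal (scaled_dens n (y, x) * ln (scaled_dens n (y, x))) \<partial>lborel)"
    proof (rule nn_integral_mono_AE)
      have "AE x in lborel. dens n y (sqrt n * x) < \<infinity>"
        by (rule AE_rescale[OF AE_dens_finite]) (use n in auto)
      then show "AE x in lborel. ennreal (sqrt n) * Psi (dens n y (sqrt n * x)) \<le> ennreal (scaled_dens n (y, x) * ln (scaled_dens n (y, x)))"
      proof eventually_elim
        case (elim x)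
        then obtain d where d: "dens n y (sqrt n * x) = ennreal d" "d \<ge> 0" by (cases "dens n y (sqrt n * x)") auto
        have p: "scaled_dens n (y, x) = sqrt n * d" using d by (simp add: scaled_dens_def)
        show ?case
        proof (cases "d \<le> 1")
          case True
          then have "max 0 (ln d) = 0" using d by (cases "d = 0") auto
          then show ?thesis using d by (simp add: Psi_def)
        next
          case False
          then have "ln d \<le> ln (sqrt n * d)" using sn d by simp
          then have "sqrt n * (d * ln d) \<le> (sqrt n * d) * ln (sqrt n * d)"
            using d by (simp add: mult.assoc mult_left_mono del: ln_mult)
          moreover have "max 0 (ln d) = ln d" using False by simp
          ultimately show ?thesis using d False by (simp add: Psi_def p ennreal_mult'[symmetric] ennreal_leI)
        qed
      qed
    qed
    finally show "(\<integral>\<^sup>+ x. Psi (dens n y x) \<partial>lborel) \<le> (\<integral>\<^sup>+ x. ennreal (scaled_dens n (y, x) * ln (scaled_dens n (y, x))) \<partial>lborel)" .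
  qed
  also have "\<dots> = (\<integral>\<^sup>+ w. ennreal (scaled_dens n w * ln (scaled_dens n w)) \<partial>(P n \<Otimes>\<^sub>M lborel))"
    by (subst lborel.nn_integral_fst[symmetric]) auto
  finally show ?thesis using fin by (rule le_less_trans)
qed

end

theorem theorem2p1:
  fixes M :: "'a measure" and N :: "'b measure"
    and \<xi> :: "'a \<Rightarrow> real" and \<eta> :: "'a \<Rightarrow> 'b"
    and \<xi>s :: "nat \<Rightarrow> 'a \<Rightarrow> real" and \<eta>s :: "nat \<Rightarrow> 'a \<Rightarrow> 'b"
    and \<sigma>2 :: real
  assumes "prob_space M"
    and "\<xi> \<in> borel_measurable M" and "\<eta> \<in> M \<rightarrow>\<^sub>M N"
    and "indep_copies M N \<xi> \<eta> \<xi>s \<eta>s"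
    and "(\<integral>\<^sup>+ \<omega>. cond_variance M N \<xi> \<eta> \<omega> \<partial>M) < \<infinity>"
    and "\<sigma>2 = enn2real (\<integral>\<^sup>+ \<omega>. cond_variance M N \<xi> \<eta> \<omega> \<partial>M)"
    and "AE y in distr M N \<eta>. absolutely_continuous lborel (cond_law M N \<xi> \<eta> y)"
  shows "(\<lambda>n. mean_cond_entropy M N \<xi>s \<eta>s n) \<longlonglongrightarrow> ereal (1 / 2 * ln (2 * pi * exp 1 * \<sigma>2))
     \<longleftrightarrow> (\<exists>n0\<ge>1. mean_cond_entropy M N \<xi>s \<eta>s n0 > -\<infinity>)"
proof
  let ?h = "mean_cond_entropy M N \<xi>s \<eta>s"
  assume "?h \<longlonglongrightarrow> ereal (1 / 2 * ln (2 * pi * exp 1 * \<sigma>2))"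
  then have "\<forall>\<^sub>F n in sequentially. ?h n > -\<infinity>" by (rule order_tendstoD) simp
  then have "\<forall>\<^sub>F n in sequentially. n \<ge> 1 \<and> ?h n > -\<infinity>" using eventually_ge_at_top[of 1] by eventually_elim simp
  then show "\<exists>n0\<ge>1. ?h n0 > -\<infinity>" using eventually_happens'[OF sequentially_bot] by blast
next
  let ?h = "mean_cond_entropy M N \<xi>s \<eta>s"
  assume "\<exists>n0\<ge>1. ?h n0 > -\<infinity>"
  then obtain n0 where n0: "n0 \<ge> 1" and h0: "?h n0 > -\<infinity>" by blast
  interpret M0: prob_space M by fact
  note [measurable] = assms(2,3)
  have "is_regular_cond_law M N \<xi> \<eta> (cond_law M N \<xi> \<eta>)"
    unfolding cond_law_def by (rule someI_ex[OF regular_cond_law_exists[OF assms(1-3)]])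
  from centred_conditional_density[OF assms(1-3) this assms(7)] assms(5)
  obtain f m \<sigma> where cd: "cond_density (distr M N \<eta>) f \<sigma>" and \<sigma>2: "\<sigma>\<^sup>2 = \<sigma>2"
    and m [measurable]: "m \<in> borel_measurable N"
    and law: "\<And>h. h \<in> borel_measurable (borel \<Otimes>\<^sub>M N) \<Longrightarrow>
      (\<integral>\<^sup>+ \<omega>. h (\<xi> \<omega> - m (\<eta> \<omega>), \<eta> \<omega>) \<partial>M) = (\<integral>\<^sup>+ y. \<integral>\<^sup>+ x. h (x, y) * f y x \<partial>lborel \<partial>distr M N \<eta>)"
    unfolding cond_variance_def assms(6) by blast
  \<comment> \<open>One fixed measurable map of the pair subtracts the conditional mean, so
    independence and equality of laws pass to the centred pairs.\<close>
  define T where "T = (\<lambda>(x, y). (x - m y, y))"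
  have T [measurable]: "T \<in> borel \<Otimes>\<^sub>M N \<rightarrow>\<^sub>M borel \<Otimes>\<^sub>M N" unfolding T_def by measurable
  define \<zeta> where "\<zeta> i \<omega> = T (\<xi>s i \<omega>, \<eta>s i \<omega>)" for i \<omega>
  define J where "J = distr M (borel \<Otimes>\<^sub>M N) (\<lambda>\<omega>. T (\<xi> \<omega>, \<eta> \<omega>))"
  have ind: "M0.indep_vars (\<lambda>_. borel \<Otimes>\<^sub>M N) (\<lambda>i \<omega>. (\<xi>s i \<omega>, \<eta>s i \<omega>)) {1..}"
    and ident: "\<And>i. i \<ge> 1 \<Longrightarrow> distr M (borel \<Otimes>\<^sub>M N) (\<lambda>\<omega>. (\<xi>s i \<omega>, \<eta>s i \<omega>)) = distr M (borel \<Otimes>\<^sub>M N) (\<lambda>\<omega>. (\<xi> \<omega>, \<eta> \<omega>))"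
    using assms(4) by (auto simp: indep_copies_def)
  have pm: "(\<lambda>\<omega>. (\<xi>s i \<omega>, \<eta>s i \<omega>)) \<in> M \<rightarrow>\<^sub>M borel \<Otimes>\<^sub>M N" if "i \<ge> 1" for i
    using ind that by (auto simp: M0.indep_vars_def)
  have \<xi>sm: "\<xi>s i \<in> borel_measurable M" if "i \<ge> 1" for i
    using measurable_compose[OF pm[OF that] measurable_fst] by simp
  have "centred_copies (distr M N \<eta>) f \<sigma> M N \<zeta> J"
  proof (intro centred_copies.intro cd centred_copies_axioms.intro assms(1))
    show "M0.indep_vars (\<lambda>_. borel \<Otimes>\<^sub>M N) \<zeta> {1..}"
      unfolding \<zeta>_def[abs_def] by (rule M0.indep_vars_compose2[OF ind]) (rule T)
    show "distr M (borel \<Otimes>\<^sub>M N) (\<zeta> i) = J" if "i \<ge> 1" for i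
    proof -
      have "distr M (borel \<Otimes>\<^sub>M N) (\<zeta> i) = distr (distr M (borel \<Otimes>\<^sub>M N) (\<lambda>\<omega>. (\<xi>s i \<omega>, \<eta>s i \<omega>))) (borel \<Otimes>\<^sub>M N) T"
        using pm[OF that] by (subst distr_distr) (auto simp: \<zeta>_def[abs_def] comp_def)
      also have "\<dots> = J" unfolding ident[OF that] J_def by (subst distr_distr) (auto simp: comp_def)
      finally show ?thesis .
    qed
    show "(\<integral>\<^sup>+ w. h w \<partial>J) = (\<integral>\<^sup>+ y. \<integral>\<^sup>+ x. h (x, y) * f y x \<partial>lborel \<partial>distr M N \<eta>)"
      if h: "h \<in> borel_measurable (borel \<Otimes>\<^sub>M N)" for h
    proof -
      have "(\<integral>\<^sup>+ w. h w \<partial>J) = (\<integral>\<^sup>+ \<omega>. h (T (\<xi> \<omega>, \<eta> \<omega>)) \<partial>M)"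
        unfolding J_def using h by (subst nn_integral_distr) auto
      then show ?thesis using law[OF h] by (simp add: T_def)
    qed
  qed simp
  then interpret centred_copies "distr M N \<eta>" f \<sigma> M N \<zeta> J .
  have \<zeta>: "\<zeta> i \<omega> = (\<xi>s i \<omega> - m (\<eta>s i \<omega>), \<eta>s i \<omega>)" for i \<omega> by (simp add: \<zeta>_def T_def)
  \<comment> \<open>The mean entropy becomes a difference of two integrals over labels and points,
    the first of which is finite for every n. Hence the assumption on n0 says that the second is
    finite there.\<close>
  have heq: "?h n = enn2ereal (\<integral>\<^sup>+ w. ennreal (- (scaled_dens n w * ln (scaled_dens n w))) \<partial>(P n \<Otimes>\<^sub>M lborel)) -
      enn2ereal (\<integral>\<^sup>+ w. ennreal (scaled_dens n w * ln (scaled_dens n w)) \<partial>(P n \<Otimes>\<^sub>M lborel))" if n: "n \<ge> 1" for n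
  proof -
    note [measurable] = measurable_scaled_dens[OF n]
    have "?h n = ereal_integral (P n) (\<lambda>y. ereal_integral lborel (\<lambda>x. ereal (- (scaled_dens n (y, x) * ln (scaled_dens n (y, x))))))"
      by (rule mean_cond_entropy_eq[OF m n _ \<zeta>]) (rule \<xi>sm)
    then show ?thesis
      using ereal_integral_iterated[OF prob_P _ pos_part_finite[OF n]] by simp
  qed
  have "(\<integral>\<^sup>+ w. ennreal (scaled_dens n0 w * ln (scaled_dens n0 w)) \<partial>(P n0 \<Otimes>\<^sub>M lborel)) < \<infinity>"
  proof (rule ccontr)
    assume "\<not> ?thesis"
    then have "(\<integral>\<^sup>+ w. ennreal (scaled_dens n0 w * ln (scaled_dens n0 w)) \<partial>(P n0 \<Otimes>\<^sub>M lborel)) = \<infinity>" by (simp add: less_top[symmetric])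
    moreover obtain a where "(\<integral>\<^sup>+ w. ennreal (- (scaled_dens n0 w * ln (scaled_dens n0 w))) \<partial>(P n0 \<Otimes>\<^sub>M lborel)) = ennreal a" "a \<ge> 0"
      using pos_part_finite[OF n0] by (cases "\<integral>\<^sup>+ w. ennreal (- (scaled_dens n0 w * ln (scaled_dens n0 w))) \<partial>(P n0 \<Otimes>\<^sub>M lborel)") auto
    ultimately have "?h n0 = -\<infinity>" using heq[OF n0] by (simp add: enn2ereal_ennreal)
    with h0 show False by simp
  qed
  note lim = entropy_dens_limit[OF n0 Psi_dens_finite[OF n0 this] CLT]
  let ?N = "2 * n0 + 1"
  have "?h (k + ?N) = ereal (- (LINT w|(P (k + ?N) \<Otimes>\<^sub>M lborel). scaled_dens (k + ?N) w * ln (scaled_dens (k + ?N) w)))" for k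
  proof -
    let ?g = "\<lambda>w. scaled_dens (k + ?N) w * ln (scaled_dens (k + ?N) w)" and ?\<mu> = "P (k + ?N) \<Otimes>\<^sub>M lborel"
    have i: "integrable ?\<mu> ?g" by (rule lim(1))
    then have fin: "(\<integral>\<^sup>+ w. ennreal (?g w) \<partial>?\<mu>) \<noteq> \<infinity>" "(\<integral>\<^sup>+ w. ennreal (- ?g w) \<partial>?\<mu>) \<noteq> \<infinity>"
      unfolding real_integrable_def by auto
    obtain a where a: "(\<integral>\<^sup>+ w. ennreal (?g w) \<partial>?\<mu>) = ennreal a" "a \<ge> 0"
      using fin(1) by (cases "\<integral>\<^sup>+ w. ennreal (?g w) \<partial>?\<mu>") auto
    obtain b where b: "(\<integral>\<^sup>+ w. ennreal (- ?g w) \<partial>?\<mu>) = ennreal b" "b \<ge> 0"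
      using fin(2) by (cases "\<integral>\<^sup>+ w. ennreal (- ?g w) \<partial>?\<mu>") auto
    have "(LINT w|?\<mu>. ?g w) = a - b" using real_lebesgue_integral_def[OF i] a b by simp
    moreover have "?h (k + ?N) = ereal (b - a)" using heq[of "k + ?N"] a b by (simp add: enn2ereal_ennreal)
    ultimately show ?thesis by simp
  qed
  moreover have "(\<lambda>k. ereal (- (LINT w|(P (k + ?N) \<Otimes>\<^sub>M lborel). scaled_dens (k + ?N) w * ln (scaled_dens (k + ?N) w))))
      \<longlonglongrightarrow> ereal (1 / 2 * ln (2 * pi * exp 1 * \<sigma>2))"
    using tendsto_minus[OF lim(2)] by (intro tendsto_ereal) (simp add: \<sigma>2)
  ultimately have "(\<lambda>k. ?h (k + ?N)) \<longlonglongrightarrow> ereal (1 / 2 * ln (2 * pi * exp 1 * \<sigma>2))" by simp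
  then show "?h \<longlonglongrightarrow> ereal (1 / 2 * ln (2 * pi * exp 1 * \<sigma>2))" by (rule LIMSEQ_offset)
qed

end
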